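(* Let $p\in(2,6)$ and $\mu>0$. For $\ell>0$ let $\mathcal G_\ell$ be the metric graph consisting of three halflines and one bounded terminal edge of length $\ell$, all emanating from a common vertex. Then there exists a critical length $\ell^*>0$ such that $\mathcal G_\ell$ has a ground state of mass $\mu$ if and only if $\ell\ge\ell^*$.
   Context: $H^1_\mu(\mathcal G)$: continuous functions on $\mathcal G$, $H^1$ on each edge, with $\int_{\mathcal G}|u|^2=\mu$. $E(u,\mathcal G)=\frac12\int_{\mathcal G}|u'|^2-\frac1p\int_{\mathcal G}|u|^p$; a ground state of mass $\mu$ is a minimizer of $E(\cdot,\mathcal G)$ on $H^1_\mu(\mathcal G)$. *)

theory Defs
  imports "HOL-Analysis.Analysis"
begin

definition test_fun_on :: "real set \<Rightarrow> (real \<Rightarrow> real) \<Rightarrow> (real \<Rightarrow> real) \<Rightarrow> bool" where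
  "test_fun_on I \<phi> \<phi>' \<longleftrightarrow>
     (\<forall>x. (\<phi> has_real_derivative \<phi>' x) (at x)) \<and> continuous_on UNIV \<phi>' \<and>
     (\<exists>K. compact K \<and> K \<subseteq> interior I \<and> (\<forall>x. x \<notin> K \<longrightarrow> \<phi> x = 0))"

definition has_weak_deriv_on :: "(real \<Rightarrow> real) \<Rightarrow> (real \<Rightarrow> real) \<Rightarrow> real set \<Rightarrow> bool" where
  "has_weak_deriv_on u g I \<longleftrightarrow>
     (\<forall>\<phi> \<phi>'. test_fun_on I \<phi> \<phi>' \<longrightarrow>
        (LINT x:I|lborel. u x * \<phi>' x) = - (LINT x:I|lborel. g x * \<phi> x))"

definition L2_on :: "real set \<Rightarrow> (real \<Rightarrow> real) \<Rightarrow> bool" where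
  "L2_on I f \<longleftrightarrow> set_borel_measurable lborel I f \<and> set_integrable lborel I (\<lambda>x. (f x)\<^sup>2)"

definition H1_on :: "real set \<Rightarrow> (real \<Rightarrow> real) \<Rightarrow> bool" where
  "H1_on I u \<longleftrightarrow> L2_on I u \<and> (\<exists>g. L2_on I g \<and> has_weak_deriv_on u g I)"

definition weak_deriv :: "real set \<Rightarrow> (real \<Rightarrow> real) \<Rightarrow> (real \<Rightarrow> real)" where
  "weak_deriv I u = (SOME g. L2_on I g \<and> has_weak_deriv_on u g I)"

text \<open>The metric graph G_l: edges 0,1,2 are halflines [0,\<infinity>), edge 3 is the terminal
edge [0,l]; all edges emanate from the common vertex at coordinate 0.
A function on G_l is represented by u :: nat \<Rightarrow> real \<Rightarrow> real, u i being its restriction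
to edge i (i < 4).\<close>
definition edge_dom :: "real \<Rightarrow> nat \<Rightarrow> real set" where
  "edge_dom l i = (if i < 3 then {0..} else {0..l})"

definition H1_mass :: "real \<Rightarrow> real \<Rightarrow> (nat \<Rightarrow> real \<Rightarrow> real) set" where
  "H1_mass l \<mu> = {u. (\<forall>i<4. continuous_on (edge_dom l i) (u i) \<and> H1_on (edge_dom l i) (u i)
                        \<and> u i 0 = u 0 0)
                  \<and> (\<Sum>i<4. LINT x:edge_dom l i|lborel. (u i x)\<^sup>2) = \<mu>}"

definition energy :: "real \<Rightarrow> real \<Rightarrow> (nat \<Rightarrow> real \<Rightarrow> real) \<Rightarrow> real" where
  "energy p l u =
     (1/2) * (\<Sum>i<4. LINT x:edge_dom l i|lborel. (weak_deriv (edge_dom l i) (u i) x)\<^sup>2)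
     - (1/p) * (\<Sum>i<4. LINT x:edge_dom l i|lborel. \<bar>u i x\<bar> powr p)"

definition ground_state :: "real \<Rightarrow> real \<Rightarrow> real \<Rightarrow> (nat \<Rightarrow> real \<Rightarrow> real) \<Rightarrow> bool" where
  "ground_state p l \<mu> u \<longleftrightarrow> u \<in> H1_mass l \<mu> \<and> (\<forall>v\<in>H1_mass l \<mu>. energy p l u \<le> energy p l v)"

end

theory Submission
  imports Defs "HOL-Probability.Helly_Selection"
begin

text \<open>
  A function on the graph is compared with its decreasing rearrangement \<open>f\<close> on \<open>[0,\<infinity>)\<close>. If
  almost every level in a band has at least \<open>n\<close> preimages, the kinetic energy carried by the band
  is at least \<open>n\<^sup>2\<close> times that of \<open>f\<close>. Levels below the vertex value have three preimages.
  If the maximum lies on a halfline, all levels have two, so the energy is at least the ground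
  state energy \<open>e\<close> of the line, strictly if the vertex value is positive; a ground state that
  vanishes at the vertex can be improved by stretching it next to a zero. If the maximum lies on the
  terminal edge, the energy is at least that of \<open>f\<close> for the halfline functional with weight 1 on
  \<open>[0,l]\<close> and 9 on \<open>[l,\<infinity>)\<close>, and conversely every decreasing \<open>f\<close> is realized on the graph by
  folding its tail onto the three halflines.

  Moving a line profile to infinity along a halfline shows that the infimum on the graph never
  exceeds \<open>e\<close>. Hence a ground state exists iff the minimum \<open>J(l)\<close> of the weighted functional is
  at most \<open>e\<close>. The function \<open>J\<close> is nonincreasing and continuous, exceeds \<open>e\<close> for small \<open>l\<close> and
  is below \<open>e\<close> for large \<open>l\<close>.
\<close>

section \<open>Square-integrable derivatives on intervals\<close>

text \<open>The weights are squares of preimage counts: 1 for the terminal edge, 9 = 3^2 for a tail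
  folded onto three halflines, 4 = 2^2 for the line, where \<open>f\<close> stands for the even
  profile f(2|x|). The core is a Polya-Szego inequality with multiplicities, obtained from finite
  differences instead of the coarea formula. Cauchy-Schwarz on \<open>n\<close> crossings of a level
  band of height D gives (n D)^2 \<le> length times energy of the band, and such bounds add over
  bands and edges. For the rearrangement they read n^2 (f x - f y)^2 \<le> (y - x)(\<kappa> y -
  \<kappa> x) with a bounded monotone \<kappa>, and a Riesz criterion turns this into a
  square-integrable derivative whose energy \<kappa> controls. Since the inequality survives
  pointwise limits, the same criterion yields lower semicontinuity along minimizing sequences. The
  range of p enters through scaling. The dilation sqrt r f(r x) keeps the mass, multiplies the
  kinetic part by r^2 and the potential part by r^(p/2 - 1), a lower power exactly when p < 6. For p
  > 2 the potential grows faster than the mass under multiplication by constants, and tails bounded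
  by x^(-1/2) have integrable p-th power.\<close>

lemma interval_sets_lborel:
  fixes I :: "real set"
  assumes "is_interval I"
  shows "I \<in> sets lborel"
  using assms by (simp add: is_interval_convex_1 real_interval_borel_measurable)

lemma L2_onD:
  assumes "L2_on I f"
  shows "set_borel_measurable lborel I f" "set_integrable lborel I (\<lambda>x. (f x)\<^sup>2)"
  using assms by (auto simp: L2_on_def)

lemma interval_Icc_subset:
  fixes I :: "real set"
  assumes "is_interval I" "x \<in> I" "y \<in> I"
  shows "{x..y} \<subseteq> I"
  using assms by (meson atLeastAtMost_iff is_interval_1 subsetI)

lemma emeasure_lborel_Icc_finite: "emeasure lborel {x..y::real} < \<infinity>"
  by (cases "x \<le> y") auto

lemma L2_on_subset:
  assumes "L2_on I f" "J \<in> sets lborel" "J \<subseteq> I"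
  shows "L2_on J f"
  using assms set_borel_measurable_subset[of lborel I f J]
  by (auto simp: L2_on_def intro: set_integrable_subset)

lemma set_integrable_const_fin:
  assumes "A \<in> sets lborel" "emeasure lborel A < \<infinity>"
  shows "set_integrable lborel A (\<lambda>x. c :: real)"
  using assms unfolding set_integrable_def
  by (intro integrable_scaleR_left integrable_real_indicator) (auto simp: less_top)

text \<open>On a set of finite measure \<open>1 + f^2\<close> is integrable, and it dominates
  |f|.\<close>

lemma L2_on_integrable:
  assumes "L2_on I f" "A \<in> sets lborel" "A \<subseteq> I" "emeasure lborel A < \<infinity>"
  shows "set_integrable lborel A f"
proof -
  note L = L2_on_subset[OF assms(1-3)]
  have "set_integrable lborel A (\<lambda>x. 1 + (f x)\<^sup>2)"
    using set_integral_add(1)[OF set_integrable_const_fin[OF assms(2,4)] L2_onD(2)[OF L]] .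
  then show ?thesis
  proof (rule set_integrable_bound)
    show "set_borel_measurable lborel A f" using L by (simp add: L2_on_def)
    show "AE x in lborel. x \<in> A \<longrightarrow> norm (f x) \<le> norm (1 + (f x)\<^sup>2)"
    proof (intro AE_I2 impI)
      fix x
      \<comment> \<open>Expanded, this is |f x| \<le> (f x)^2 + 1/4.\<close>
      have "0 \<le> (\<bar>f x\<bar> - 1/2)\<^sup>2" by simp
      then show "norm (f x) \<le> norm (1 + (f x)\<^sup>2)"
        by (simp add: power2_eq_square algebra_simps abs_if split: if_splits)
    qed
  qed
qed

lemma L2_on_integrable_Icc:
  assumes "L2_on I f" "is_interval I" "x \<in> I" "y \<in> I"
  shows "set_integrable lborel {x..y} f" "set_integrable lborel {x..y} (\<lambda>t. (f t)\<^sup>2)"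
proof -
  have sub: "{x..y} \<subseteq> I" using assms by (intro interval_Icc_subset)
  show "set_integrable lborel {x..y} f"
    by (rule L2_on_integrable[OF assms(1) _ sub emeasure_lborel_Icc_finite]) simp
  show "set_integrable lborel {x..y} (\<lambda>t. (f t)\<^sup>2)"
    by (rule set_integrable_subset[OF L2_onD(2)[OF assms(1)]]) (use sub in auto)
qed

text \<open>Cauchy-Schwarz against the constant 1, read off from the integral of (m g - G)^2 \<ge>
  0, where m is the measure of \<open>A\<close> and G the integral of \<open>g\<close>. Multiplying
  by m instead of dividing postpones the case of a null set to the end.\<close>

lemma set_integral_square_le:
  fixes g :: "real \<Rightarrow> real"
  assumes A: "A \<in> sets lborel" "emeasure lborel A < \<infinity>"
    and g: "set_integrable lborel A g" "set_integrable lborel A (\<lambda>t. (g t)\<^sup>2)"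
  shows "(LINT t:A|lborel. g t)\<^sup>2 \<le> measure lborel A * (LINT t:A|lborel. (g t)\<^sup>2)"
proof -
  let ?m = "measure lborel A" and ?G = "LINT t:A|lborel. g t" and ?S = "LINT t:A|lborel. (g t)\<^sup>2"
  have "0 \<le> (LINT t:A|lborel. (?m * g t - ?G)\<^sup>2)"
    unfolding set_lebesgue_integral_def by (intro integral_nonneg_AE) auto
  also have "(LINT t:A|lborel. (?m * g t - ?G)\<^sup>2)
      = (LINT t:A|lborel. ?m\<^sup>2 * (g t)\<^sup>2 - 2 * ?m * ?G * g t + ?G\<^sup>2)"
    by (intro set_lebesgue_integral_cong A(1)) (auto simp: power2_eq_square algebra_simps)
  also have "\<dots> = ?m\<^sup>2 * ?S - 2 * ?m * ?G * ?G + ?m * ?G\<^sup>2"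
  proof -
    have c: "set_integrable lborel A (\<lambda>t. ?G\<^sup>2)"
      by (rule set_integrable_const_fin[OF A])
    have 1: "set_integrable lborel A (\<lambda>t. ?m\<^sup>2 * (g t)\<^sup>2)" "set_integrable lborel A (\<lambda>t. 2 * ?m * ?G * g t)"
      using g by auto
    have 2: "set_integrable lborel A (\<lambda>t. ?m\<^sup>2 * (g t)\<^sup>2 - 2 * ?m * ?G * g t)"
      using 1 by (rule set_integral_diff)
    show ?thesis
      using A(2) by (simp add: set_integral_add(2)[OF 2 c] set_integral_diff(2)[OF 1]
          set_integral_const[OF A(1)])
  qed
  finally have *: "0 \<le> ?m * (?m * ?S - ?G\<^sup>2)"
    by (simp add: power2_eq_square algebra_simps)
  show ?thesis
  proof (cases "?m = 0")
    case True
    then have "emeasure lborel A = 0"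
      using A(2) emeasure_eq_ennreal_measure[of lborel A] by (auto simp: less_top)
    then have "A \<in> null_sets lborel" using A by auto
    then have "AE t in lborel. indicator A t *\<^sub>R g t = 0"
      by (intro AE_I'[of A]) (auto split: split_indicator)
    then have "?G = 0"
      unfolding set_lebesgue_integral_def by (rule integral_eq_zero_AE)
    with True show ?thesis by simp
  next
    case False
    then have "?m > 0" using measure_nonneg[of lborel A] by linarith
    with * show ?thesis by (simp add: zero_le_mult_iff)
  qed
qed

text \<open>Absolute continuity with square-integrable derivative, encoded by the fundamental
  theorem of calculus. In this form functions can be restricted, glued and rescaled without test
  functions; on the edges it is shown below to agree with continuous H1 functions.\<close>

definition ac_on :: "real set \<Rightarrow> (real \<Rightarrow> real) \<Rightarrow> (real \<Rightarrow> real) \<Rightarrow> bool" where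
  "ac_on I u g \<longleftrightarrow> L2_on I g \<and>
     (\<forall>x\<in>I. \<forall>y\<in>I. x \<le> y \<longrightarrow> u y - u x = (LINT t:{x..y}|lborel. g t))"

lemma ac_onD:
  assumes "ac_on I u g"
  shows "L2_on I g" "\<And>x y. x \<in> I \<Longrightarrow> y \<in> I \<Longrightarrow> x \<le> y \<Longrightarrow> u y - u x = (LINT t:{x..y}|lborel. g t)"
  using assms by (auto simp: ac_on_def)

lemma set_integral_square_nonneg [simp]: "0 \<le> (LINT t:A|lborel. ((g t :: real))\<^sup>2)"
  unfolding set_lebesgue_integral_def by (intro integral_nonneg_AE) auto

lemma set_integral_mono_set:
  fixes f :: "real \<Rightarrow> real"
  assumes "set_integrable lborel B f" "A \<in> sets lborel" "A \<subseteq> B" "\<And>x. x \<in> B \<Longrightarrow> 0 \<le> f x"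
  shows "(LINT x:A|lborel. f x) \<le> (LINT x:B|lborel. f x)"
  using assms set_integrable_subset[OF assms(1-3)]
  unfolding set_lebesgue_integral_def set_integrable_def
  by (intro integral_mono) (auto split: split_indicator)

lemma ac_on_hoelder:
  assumes "ac_on I u g" "is_interval I" "x \<in> I" "y \<in> I" "x \<le> y"
  shows "(u y - u x)\<^sup>2 \<le> (y - x) * (LINT t:{x..y}|lborel. (g t)\<^sup>2)"
  using set_integral_square_le[of "{x..y}" g] L2_on_integrable_Icc[OF ac_onD(1)[OF assms(1)] assms(2-4)]
    ac_onD(2)[OF assms(1,3-5)] assms(5) emeasure_lborel_Icc_finite
  by simp

lemma set_integral_Icc_combine:
  fixes f :: "real \<Rightarrow> real"
  assumes "set_integrable lborel {a..c} f" "a \<le> b" "b \<le> c"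
  shows "(LINT x:{a..c}|lborel. f x) = (LINT x:{a..b}|lborel. f x) + (LINT x:{b..c}|lborel. f x)"
proof -
  have "{a..c} = {a..b} \<union> {b<..c}" using assms by auto
  then have "(LINT x:{a..c}|lborel. f x) = (LINT x:{a..b}|lborel. f x) + (LINT x:{b<..c}|lborel. f x)"
    using set_integral_Un[of "{a..b}" "{b<..c}" lborel f]
      set_integrable_subset[OF assms(1), of "{a..b}"] set_integrable_subset[OF assms(1), of "{b<..c}"] assms
    by (simp add: subset_eq ivl_disj_int)
  moreover have "(LINT x:{b<..c}|lborel. f x) = (LINT x:{b..c}|lborel. f x)"
    unfolding set_lebesgue_integral_def
    by (rule integral_discrete_difference[of "{b}"]) (auto split: split_indicator)
  ultimately show ?thesis by simp
qed

lemma set_integral_Ici_split: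
  fixes f :: "real \<Rightarrow> real"
  assumes "set_integrable lborel {a..} f" "a \<le> b"
  shows "(LINT x:{a..}|lborel. f x) = (LINT x:{a..b}|lborel. f x) + (LINT x:{b..}|lborel. f x)"
proof -
  have "{a..} = {a..b} \<union> {b<..}" using assms by auto
  then have "(LINT x:{a..}|lborel. f x) = (LINT x:{a..b}|lborel. f x) + (LINT x:{b<..}|lborel. f x)"
    using set_integral_Un[of "{a..b}" "{b<..}" lborel f]
      set_integrable_subset[OF assms(1), of "{a..b}"] set_integrable_subset[OF assms(1), of "{b<..}"] assms
    by (simp add: subset_eq ivl_disj_int)
  moreover have "(LINT x:{b<..}|lborel. f x) = (LINT x:{b..}|lborel. f x)"
    unfolding set_lebesgue_integral_def
    by (rule integral_discrete_difference[of "{b}"]) (auto split: split_indicator)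
  ultimately show ?thesis by simp
qed

text \<open>Cauchy-Schwarz gives Hoelder continuity of exponent 1/2, with the full energy on
  \<open>I\<close> as constant.\<close>

lemma ac_on_continuous_on:
  assumes "ac_on I u g" "is_interval I"
  shows "continuous_on I u"
proof -
  let ?C = "LINT t:I|lborel. (g t)\<^sup>2"
  have half: "(u y - u x)\<^sup>2 \<le> \<bar>y - x\<bar> * ?C" if "x \<in> I" "y \<in> I" "x \<le> y" for x y
  proof -
    have "(LINT t:{x..y}|lborel. (g t)\<^sup>2) \<le> ?C"
      by (rule set_integral_mono_set[OF L2_onD(2)[OF ac_onD(1)[OF assms(1)]]])
        (use assms that interval_Icc_subset in auto)
    with that have "(y - x) * (LINT t:{x..y}|lborel. (g t)\<^sup>2) \<le> (y - x) * ?C"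
      by (intro mult_left_mono) auto
    with ac_on_hoelder[OF assms that] that show ?thesis by simp
  qed
  have all: "(u y - u x)\<^sup>2 \<le> \<bar>y - x\<bar> * ?C" if "x \<in> I" "y \<in> I" for x y
    using half[OF that] half[OF that(2,1)] by (cases "x \<le> y") (auto simp: power2_commute abs_minus_commute)
  show ?thesis
    unfolding continuous_on_def
  proof
    fix x assume "x \<in> I"
    have "((\<lambda>y. \<bar>y - x\<bar> * ?C) \<longlongrightarrow> \<bar>x - x\<bar> * ?C) (at x within I)"
      by (intro tendsto_intros)
    then have l: "((\<lambda>y. \<bar>y - x\<bar> * ?C) \<longlongrightarrow> 0) (at x within I)" by simp
    have "((\<lambda>y. (u y - u x)\<^sup>2) \<longlongrightarrow> 0) (at x within I)"
      using \<open>x \<in> I\<close> all by (intro tendsto_sandwich[OF _ _ tendsto_const l])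
        (auto simp: eventually_at_filter)
    then have "((\<lambda>y. sqrt ((u y - u x)\<^sup>2)) \<longlongrightarrow> sqrt 0) (at x within I)"
      by (intro tendsto_real_sqrt)
    then have "((\<lambda>y. \<bar>u y - u x\<bar>) \<longlongrightarrow> 0) (at x within I)" by simp
    then have "((\<lambda>y. u y - u x) \<longlongrightarrow> 0) (at x within I)" by (rule tendsto_rabs_zero_cancel)
    then show "(u \<longlongrightarrow> u x) (at x within I)" using LIM_zero_cancel by blast
  qed
qed

section \<open>Affine substitution and gluing\<close>

lemma set_integral_affine:
  fixes f :: "real \<Rightarrow> real"
  assumes "b \<noteq> 0"
  shows "(LINT x:{x. a + b * x \<in> A}|lborel. f (a + b * x)) = (LINT x:A|lborel. f x) / \<bar>b\<bar>"
    and "set_integrable lborel {x. a + b * x \<in> A} (\<lambda>x. f (a + b * x)) \<longleftrightarrow> set_integrable lborel A f"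
proof -
  have ind: "indicator {x. a + b * x \<in> A} x = (indicator A (a + b * x) :: real)" for x
    by (auto split: split_indicator)
  show "(LINT x:{x. a + b * x \<in> A}|lborel. f (a + b * x)) = (LINT x:A|lborel. f x) / \<bar>b\<bar>"
    using lborel_integral_real_affine[OF assms, of "\<lambda>x. indicator A x *\<^sub>R f x" a] assms
    by (simp add: set_lebesgue_integral_def ind)
  show "set_integrable lborel {x. a + b * x \<in> A} (\<lambda>x. f (a + b * x)) \<longleftrightarrow> set_integrable lborel A f"
    using lborel_integrable_real_affine_iff[OF assms, of "\<lambda>x. indicator A x *\<^sub>R f x" a]
    by (simp add: set_integrable_def ind)
qed

lemma L2_on_affine:
  assumes "L2_on A f" "b \<noteq> 0"
  shows "L2_on {x. a + b * x \<in> A} (\<lambda>x. c * f (a + b * x))"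
proof -
  have ind: "indicator {x. a + b * x \<in> A} x = (indicator A (a + b * x) :: real)" for x
    by (auto split: split_indicator)
  have [measurable]: "(\<lambda>x. indicator A x * f x) \<in> borel_measurable borel"
    using assms by (auto simp: L2_on_def set_borel_measurable_def)
  have "(\<lambda>x. c * (indicator A (a + b * x) * f (a + b * x))) \<in> borel_measurable borel"
    by measurable
  moreover have "set_integrable lborel {x. a + b * x \<in> A} (\<lambda>x. (f (a + b * x))\<^sup>2)"
    using set_integral_affine(2)[OF assms(2), of a A "\<lambda>x. (f x)\<^sup>2"] L2_onD(2)[OF assms(1)] by simp
  ultimately show ?thesis
    by (simp add: L2_on_def set_borel_measurable_def ind power_mult_distrib mult.left_commute)
qed

text \<open>The chain rule. Preimage sets let one statement cover both signs of \<open>b\<close>;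
  for negative \<open>b\<close> the reversed interval and the factor |b| contribute two signs that
  cancel.\<close>

lemma ac_on_affine:
  assumes "ac_on I u g" "b \<noteq> 0" "is_interval I"
  shows "ac_on {x. a + b * x \<in> I} (\<lambda>x. c * u (a + b * x)) (\<lambda>x. (c * b) * g (a + b * x))"
  unfolding ac_on_def
proof (intro conjI ballI impI)
  show "L2_on {x. a + b * x \<in> I} (\<lambda>x. (c * b) * g (a + b * x))"
    by (rule L2_on_affine[OF ac_onD(1)[OF assms(1)] assms(2)])
  fix x y assume xy: "x \<in> {x. a + b * x \<in> I}" "y \<in> {x. a + b * x \<in> I}" "x \<le> y"
  show "c * u (a + b * y) - c * u (a + b * x) = (LINT t:{x..y}|lborel. (c * b) * g (a + b * t))"
  proof (cases "b > 0")
    case True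
    then have "{x..y} = {t. a + b * t \<in> {a + b * x..a + b * y}}" by (auto)
    then have "(LINT t:{x..y}|lborel. g (a + b * t)) = (LINT t:{a + b * x..a + b * y}|lborel. g t) / b"
      using set_integral_affine(1)[OF assms(2), of a "{a + b * x..a + b * y}" g] True by simp
    moreover have "u (a + b * y) - u (a + b * x) = (LINT t:{a + b * x..a + b * y}|lborel. g t)"
      using xy True by (intro ac_onD(2)[OF assms(1)]) auto
    ultimately have "b * (LINT t:{x..y}|lborel. g (a + b * t)) = u (a + b * y) - u (a + b * x)"
      using True by simp
    then show ?thesis by (simp add: mult.assoc flip: right_diff_distrib)
  next
    case False
    with assms have b: "b < 0" by simp
    then have "{x..y} = {t. a + b * t \<in> {a + b * y..a + b * x}}" by (auto)
    then have "(LINT t:{x..y}|lborel. g (a + b * t)) = (LINT t:{a + b * y..a + b * x}|lborel. g t) / \<bar>b\<bar>"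
      using set_integral_affine(1)[OF assms(2), of a "{a + b * y..a + b * x}" g] by simp
    moreover have "u (a + b * x) - u (a + b * y) = (LINT t:{a + b * y..a + b * x}|lborel. g t)"
      using xy b by (intro ac_onD(2)[OF assms(1)]) auto
    ultimately have "b * (LINT t:{x..y}|lborel. g (a + b * t)) = u (a + b * y) - u (a + b * x)"
      using b by (simp add: field_simps)
    then show ?thesis by (simp add: mult.assoc flip: right_diff_distrib)
  qed
qed

lemma L2_on_cong:
  assumes "L2_on I f" "\<And>x. x \<in> I \<Longrightarrow> f x = h x"
  shows "L2_on I h"
proof -
  have "(\<lambda>x. indicator I x * h x) = (\<lambda>x. indicator I x * f x)"
    "(\<lambda>x. indicator I x * (h x)\<^sup>2) = (\<lambda>x. indicator I x * (f x)\<^sup>2)"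
    using assms(2) by (auto split: split_indicator)
  with assms(1) show ?thesis
    by (simp add: L2_on_def set_borel_measurable_def set_integrable_def)
qed

lemma L2_on_Un:
  assumes "L2_on A f" "L2_on B f" "A \<in> sets lborel" "B \<in> sets lborel"
  shows "L2_on (A \<union> B) f"
proof -
  have m [measurable]: "A \<in> sets borel" "B \<in> sets borel" using assms by auto
  have [measurable]: "(\<lambda>x. indicator A x * f x) \<in> borel_measurable borel"
    "(\<lambda>x. indicator B x * f x) \<in> borel_measurable borel"
    using assms by (auto simp: L2_on_def set_borel_measurable_def)
  have "(\<lambda>x. indicator A x * f x + indicator (-A) x * (indicator B x * f x)) \<in> borel_measurable borel"
    by measurable
  also have "(\<lambda>x. indicator A x * f x + indicator (-A) x * (indicator B x * f x))
     = (\<lambda>x. indicator (A \<union> B) x * f x)"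
    by (auto split: split_indicator)
  finally show ?thesis
    using assms set_integrable_Un[OF L2_onD(2)[OF assms(1)] L2_onD(2)[OF assms(2)]]
    by (simp add: L2_on_def set_borel_measurable_def)
qed

lemma ac_on_glue:
  assumes "ac_on A u g" "ac_on B u g" "is_interval A" "is_interval B"
    and "A \<subseteq> {..c}" "B \<subseteq> {c..}" "c \<in> A" "c \<in> B"
  shows "ac_on (A \<union> B) u g"
  unfolding ac_on_def
proof (intro conjI ballI impI)
  show L: "L2_on (A \<union> B) g"
    using assms by (intro L2_on_Un interval_sets_lborel) (auto simp: ac_on_def)
  have AB: "is_interval (A \<union> B)"
  proof -
    have "connected (A \<union> B)"
      using assms by (intro connected_Un) (auto simp: is_interval_connected_1)
    then show ?thesis by (simp add: is_interval_connected_1)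
  qed
  fix x y assume xy: "x \<in> A \<union> B" "y \<in> A \<union> B" "x \<le> y"
  consider "x \<in> A" "y \<in> A" | "x \<in> B" "y \<in> B" | "x \<in> A" "y \<in> B"
  proof -
    \<comment> \<open>Crossing from \<open>B\<close> back to \<open>A\<close> with x \<le> y is
      possible only at the common point \<open>c\<close>.\<close>
    have "x \<in> A" if "x \<in> B" "y \<in> A"
    proof -
      have "x = c" using that xy(3) assms(5,6) by (meson antisym atLeast_iff atMost_iff order_trans subsetD)
      with assms(7) show ?thesis by simp
    qed
    then show ?thesis using that xy by blast
  qed
  then show "u y - u x = (LINT t:{x..y}|lborel. g t)"
  proof cases
    case 3
    then have "x \<le> c" "c \<le> y" using assms(5,6) by auto
    then have "(LINT t:{x..y}|lborel. g t) = (LINT t:{x..c}|lborel. g t) + (LINT t:{c..y}|lborel. g t)"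
      using set_integral_Icc_combine[OF L2_on_integrable_Icc(1)[OF L AB xy(1,2)]] by simp
    also have "\<dots> = (u c - u x) + (u y - u c)"
      using ac_onD(2)[OF assms(1) 3(1) assms(7) \<open>x \<le> c\<close>] ac_onD(2)[OF assms(2) assms(8) 3(2) \<open>c \<le> y\<close>] by simp
    finally show ?thesis by simp
  qed (use xy assms(1,2) in \<open>auto simp: ac_on_def\<close>)
qed

lemma ac_on_cong:
  assumes "ac_on I u g" "\<And>x. x \<in> I \<Longrightarrow> u x = u' x" "\<And>x. x \<in> I \<Longrightarrow> g x = g' x" "is_interval I"
  shows "ac_on I u' g'"
  unfolding ac_on_def
proof (intro conjI ballI impI)
  show "L2_on I g'" using L2_on_cong[OF ac_onD(1)[OF assms(1)]] assms(3) by blast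
  fix x y assume xy: "x \<in> I" "y \<in> I" "x \<le> y"
  have "{x..y} \<subseteq> I" using assms(4) xy by (intro interval_Icc_subset)
  then have "(LINT t:{x..y}|lborel. g t) = (LINT t:{x..y}|lborel. g' t)"
    using assms(3) by (intro set_lebesgue_integral_cong) auto
  with ac_onD(2)[OF assms(1) xy] assms(2) xy show "u' y - u' x = (LINT t:{x..y}|lborel. g' t)" by simp
qed

lemma ac_on_subset:
  assumes "ac_on I u g" "J \<subseteq> I" "is_interval J"
  shows "ac_on J u g"
  using assms L2_on_subset[OF ac_onD(1)[OF assms(1)] interval_sets_lborel[OF assms(3)] assms(2)]
  by (auto simp: ac_on_def)

lemma ac_on_const_mult:
  assumes "ac_on I u g" "is_interval I"
  shows "ac_on I (\<lambda>x. c * u x) (\<lambda>x. c * g x)"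
  using ac_on_affine[OF assms(1) _ assms(2), of 1 0 c] by simp

section \<open>Weak derivatives\<close>

text \<open>The difference of the two functions integrates to zero over every right ray, so its
  positive and negative parts are densities of the same finite measure and therefore agree almost
  everywhere.\<close>

lemma AE_eq_of_interval_integrals:
  fixes g h :: "real \<Rightarrow> real"
  assumes g: "set_integrable lborel {a..b} g" and h: "set_integrable lborel {a..b} h"
    and eq: "\<And>x. a \<le> x \<Longrightarrow> x \<le> b \<Longrightarrow> (LINT t:{x..b}|lborel. g t) = (LINT t:{x..b}|lborel. h t)"
  shows "AE t in lborel. t \<in> {a..b} \<longrightarrow> g t = h t"
proof -
  define d where "d t = indicator {a..b} t * (g t - h t)" for t
  have int_d: "integrable lborel d"
    using set_integral_diff(1)[OF g h] by (simp add: d_def[abs_def] set_integrable_def)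
  then have [measurable]: "d \<in> borel_measurable borel" by auto
  \<comment> \<open>\<open>ennreal\<close> sends negative reals to 0, so \<open>M\<close> and
    \<open>N\<close> carry the positive and the negative part of \<open>d\<close>.\<close>
  define M where "M = density lborel (\<lambda>t. ennreal (d t))"
  define N where "N = density lborel (\<lambda>t. ennreal (- d t))"
  have zero: "(LINT t:{x<..}|lborel. d t) = 0" for x
  proof -
    have "(LINT t:{x<..}|lborel. d t) = (LINT t:{max a x..b}|lborel. g t - h t)"
      unfolding set_lebesgue_integral_def
      by (rule integral_discrete_difference[of "{x}"]) (auto simp: d_def split: split_indicator)
    also have "\<dots> = 0"
    proof (cases "max a x \<le> b")
      case True
      have "set_integrable lborel {max a x..b} g" "set_integrable lborel {max a x..b} h"
        by (rule set_integrable_subset[OF g] set_integrable_subset[OF h]; auto)+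
      then show ?thesis using eq[of "max a x"] True by simp
    next
      case False
      then have "{max a x..b} = {}" by auto
      then show ?thesis by (simp only: set_lebesgue_integral_def) simp
    qed
    finally show ?thesis .
  qed
  have parts: "emeasure M {x<..} = ennreal (LINT t:{x<..}|lborel. max 0 (d t))"
    "emeasure N {x<..} = ennreal (LINT t:{x<..}|lborel. max 0 (- d t))" for x
  proof -
    have i: "integrable lborel (\<lambda>t. indicator {x<..} t * max 0 (d t))"
      "integrable lborel (\<lambda>t. indicator {x<..} t * max 0 (- d t))"
      by (rule Bochner_Integration.integrable_bound[OF int_d]; auto split: split_indicator)+
    have "emeasure M {x<..} = (\<integral>\<^sup>+t. ennreal (indicator {x<..} t * max 0 (d t)) \<partial>lborel)"
      unfolding M_def by (subst emeasure_density)
        (auto intro!: nn_integral_cong simp: max_def ennreal_neg split: split_indicator)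
    then show "emeasure M {x<..} = ennreal (LINT t:{x<..}|lborel. max 0 (d t))"
      using i by (simp add: nn_integral_eq_integral set_lebesgue_integral_def)
    have "emeasure N {x<..} = (\<integral>\<^sup>+t. ennreal (indicator {x<..} t * max 0 (- d t)) \<partial>lborel)"
      unfolding N_def by (subst emeasure_density)
        (auto intro!: nn_integral_cong simp: max_def ennreal_neg split: split_indicator)
    then show "emeasure N {x<..} = ennreal (LINT t:{x<..}|lborel. max 0 (- d t))"
      using i by (simp add: nn_integral_eq_integral set_lebesgue_integral_def)
  qed
  have same: "(LINT t:{x<..}|lborel. max 0 (d t)) = (LINT t:{x<..}|lborel. max 0 (- d t))" for x
  proof -
    have i: "set_integrable lborel {x<..} (\<lambda>t. max 0 (d t))"
      "set_integrable lborel {x<..} (\<lambda>t. max 0 (- d t))"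
      unfolding set_integrable_def
      by (rule Bochner_Integration.integrable_bound[OF int_d]; auto split: split_indicator)+
    have "(LINT t:{x<..}|lborel. max 0 (d t)) - (LINT t:{x<..}|lborel. max 0 (- d t))
       = (LINT t:{x<..}|lborel. max 0 (d t) - max 0 (- d t))"
      using set_integral_diff(2)[OF i] by simp
    also have "(\<lambda>t. max 0 (d t) - max 0 (- d t)) = d" by (auto simp: max_def)
    finally show ?thesis using zero[of x] by simp
  qed
  have "M = N"
  proof (rule measure_eqI_lessThan)
    show "sets M = sets borel" "sets N = sets borel" by (auto simp: M_def N_def)
    show "emeasure M {x<..} < \<infinity>" for x by (simp add: parts)
    show "emeasure M {x<..} = emeasure N {x<..}" for x by (simp add: parts same)
  qed
  then have "AE t in lborel. ennreal (d t) = ennreal (- d t)"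
    unfolding M_def N_def by (intro sigma_finite_measure.density_unique[OF sigma_finite_lborel]) auto
  then show ?thesis
  proof eventually_elim
    case (elim t)
    then have "d t = 0" by (cases "d t" "0::real" rule: linorder_cases) (auto simp: ennreal_neg ennreal_eq_0_iff)
    then show ?case by (auto simp: d_def)
  qed
qed

lemma L2_on_indicator_measurable:
  assumes "L2_on I g"
  shows "(\<lambda>x. indicator I x * g x) \<in> borel_measurable borel"
    "(\<lambda>x. indicator I x * (g x)\<^sup>2) \<in> borel_measurable borel"
  using L2_onD[OF assms] by (auto simp: set_borel_measurable_def set_integrable_def)

text \<open>The energy is defined through the arbitrary choice \<open>weak_deriv\<close>; this makes
  it computable from any derivative at hand. On the halfline the exceptional sets of countably many
  bounded intervals are collected.\<close>

lemma ac_on_deriv_norm_unique: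
  assumes g: "ac_on I u g" and h: "ac_on I u h" and "I = {0..} \<or> I = {0..b}"
  shows "(LINT t:I|lborel. (g t)\<^sup>2) = (LINT t:I|lborel. (h t)\<^sup>2)"
proof -
  have I: "is_interval I" using assms(3) by auto
  have Icc: "AE t in lborel. t \<in> {x..y} \<longrightarrow> g t = h t" if "x \<in> I" "y \<in> I" for x y
  proof (rule AE_eq_of_interval_integrals)
    show "set_integrable lborel {x..y} g" "set_integrable lborel {x..y} h"
      using L2_on_integrable_Icc(1)[OF ac_onD(1)[OF g] I that] L2_on_integrable_Icc(1)[OF ac_onD(1)[OF h] I that] by auto
    fix z assume "x \<le> z" "z \<le> y"
    moreover then have "z \<in> I" using interval_Icc_subset[OF I that] by auto
    ultimately show "(LINT t:{z..y}|lborel. g t) = (LINT t:{z..y}|lborel. h t)"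
      using ac_onD(2)[OF g _ that(2)] ac_onD(2)[OF h _ that(2)] by metis
  qed
  have "AE t in lborel. t \<in> I \<longrightarrow> g t = h t"
  proof (cases "I = {0..}")
    case True
    then have "AE t in lborel. t \<in> {0..real n} \<longrightarrow> g t = h t" for n
      by (intro Icc) auto
    then have "AE t in lborel. \<forall>n. t \<in> {0..real n} \<longrightarrow> g t = h t"
      by (simp only: AE_all_countable) blast
    then show ?thesis
    proof eventually_elim
      case (elim t)
      obtain n where "t \<le> real n" using real_arch_simple by blast
      with elim True show ?case by auto
    qed
  next
    case False
    then have *: "I = {0..b}" using assms(3) by auto
    show ?thesis
    proof (cases "0 \<le> b")
      case True with Icc[of 0 b] * show ?thesis by auto
    next
      case False then show ?thesis using * by auto
    qed
  qed
  then show ?thesis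
    unfolding set_lebesgue_integral_def
    using L2_on_indicator_measurable[OF ac_onD(1)[OF g]] L2_on_indicator_measurable[OF ac_onD(1)[OF h]]
    by (intro integral_cong_AE) (auto split: split_indicator)
qed

lemma test_fun_deriv_zero:
  assumes "test_fun_on I \<phi> \<phi>'" "compact K" "\<And>x. x \<notin> K \<Longrightarrow> \<phi> x = 0" "x \<notin> K"
  shows "\<phi>' x = 0"
proof -
  have "open (- K)" using assms(2) by (simp add: compact_imp_closed open_Compl)
  have "((\<lambda>_. 0) has_real_derivative 0) (at x)" by simp
  then have "(\<phi> has_real_derivative 0) (at x)"
    using \<open>open (- K)\<close> assms(3,4)
    by (elim has_field_derivative_transform_within_open) auto
  moreover have "(\<phi> has_real_derivative \<phi>' x) (at x)"
    using assms(1) by (simp add: test_fun_on_def)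
  ultimately show ?thesis by (rule DERIV_unique[symmetric])
qed

text \<open>Integration by parts by Fubini for \<phi>'(x) g(t) on the triangle t \<le> x.
  Integrating in t first leaves \<phi>' (u - u a), integrating in x first leaves - g \<phi>. The
  constant \<open>u a\<close> drops out because \<phi> vanishes at both ends.\<close>

lemma weak_deriv_Icc_parts:
  fixes u g \<phi> \<phi>' :: "real \<Rightarrow> real"
  assumes ab: "a \<le> b" and ac: "ac_on {a..b} u g"
    and \<phi>: "\<And>x. (\<phi> has_real_derivative \<phi>' x) (at x)" "continuous_on UNIV \<phi>'" and "\<phi> a = 0" "\<phi> b = 0"
  shows "(LINT x:{a..b}|lborel. u x * \<phi>' x) = - (LINT x:{a..b}|lborel. g x * \<phi> x)"
proof -
  define G where "G x = indicator {a..b} x * g x" for x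
  have int_g: "set_integrable lborel {a..b} g"
    using L2_on_integrable_Icc(1)[OF ac_onD(1)[OF ac]] ab by auto
  then have int_G: "integrable lborel G"
    by (simp add: G_def[abs_def] set_integrable_def)
  then have [measurable]: "G \<in> borel_measurable borel" by auto
  have [measurable]: "\<phi>' \<in> borel_measurable borel"
    using \<phi>(2) borel_measurable_continuous_onI by blast
  have cont: "isCont \<phi>' x" for x using \<phi>(2) by (simp add: continuous_on_eq_continuous_at)
  have FTC: "(LINT x:{s..t}|lborel. \<phi>' x) = \<phi> t - \<phi> s" if "s \<le> t" for s t
    using integral_FTC_atLeastAtMost[OF that, of \<phi> \<phi>'] \<phi>
    by (simp add: set_lebesgue_integral_def has_real_derivative_iff_has_vector_derivative
        has_vector_derivative_at_within continuous_on_subset)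
  have int_\<phi>': "set_integrable lborel {a..b} \<phi>'"
    by (intro borel_integrable_atLeastAtMost') (auto intro: continuous_on_subset[OF \<phi>(2)])
  then have int_P: "integrable lborel (\<lambda>x. indicator {a..b} x * \<phi>' x)"
    by (simp add: set_integrable_def)
  define F where "F x t = (if t \<le> x then indicator {a..b} x * \<phi>' x * G t else 0)" for x t :: real
  have "integrable (lborel \<Otimes>\<^sub>M lborel) (\<lambda>(x,t). indicator {a..b} x * \<phi>' x * G t)"
    using lborel_pair.Fubini_integrable[of "\<lambda>(x,t). indicator {a..b} x * \<phi>' x * G t"]
      integrable_abs[OF int_P] int_G
    by (simp add: abs_mult)
  then have int_F: "integrable (lborel \<Otimes>\<^sub>M lborel) (case_prod F)"
    by (rule Bochner_Integration.integrable_bound) (auto simp: F_def[abs_def])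
  have inner1: "(\<integral>t. F x t \<partial>lborel) = indicator {a..b} x * (\<phi>' x * (u x - u a))" for x
  proof (cases "x \<in> {a..b}")
    case True
    have "(\<integral>t. F x t \<partial>lborel) = (\<integral>t. \<phi>' x * (indicator {a..x} t *\<^sub>R g t) \<partial>lborel)"
      using True by (intro Bochner_Integration.integral_cong) (auto simp: F_def G_def split: split_indicator)
    also have "\<dots> = \<phi>' x * (u x - u a)"
      using ac_onD(2)[OF ac, of a x] True by (simp add: set_lebesgue_integral_def)
    finally show ?thesis using True by simp
  next
    case False
    then have "F x = (\<lambda>t. 0)" by (auto simp: F_def)
    with False show ?thesis by simp
  qed
  have inner2: "(\<integral>x. F x t \<partial>lborel) = - (G t * \<phi> t)" for t
  proof (cases "t \<in> {a..b}")
    case True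
    have "(\<integral>x. F x t \<partial>lborel) = (\<integral>x. G t * (indicator {t..b} x *\<^sub>R \<phi>' x) \<partial>lborel)"
      using True by (intro Bochner_Integration.integral_cong) (auto simp: F_def split: split_indicator)
    also have "\<dots> = G t * (\<phi> b - \<phi> t)"
      using FTC[of t b] True by (simp add: set_lebesgue_integral_def)
    finally show ?thesis using assms by simp
  next
    case False
    then have "(\<lambda>x. F x t) = (\<lambda>x. 0)" "G t = 0" by (auto simp: F_def G_def)
    then show ?thesis by simp
  qed
  have "(\<integral>x. indicator {a..b} x * (\<phi>' x * (u x - u a)) \<partial>lborel) = (\<integral>t. - (G t * \<phi> t) \<partial>lborel)"
    using lborel_pair.Fubini_integral[OF int_F] by (simp add: inner1 inner2)
  also have "\<dots> = - (LINT x:{a..b}|lborel. g x * \<phi> x)"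
    by (simp add: set_lebesgue_integral_def G_def mult.assoc)
  finally have *: "(LINT x:{a..b}|lborel. \<phi>' x * (u x - u a)) = - (LINT x:{a..b}|lborel. g x * \<phi> x)"
    by (simp add: set_lebesgue_integral_def)
  have "continuous_on {a..b} u" using ac_on_continuous_on[OF ac] by simp
  then have int_u: "set_integrable lborel {a..b} (\<lambda>x. u x * \<phi>' x)"
    by (intro borel_integrable_atLeastAtMost' continuous_on_mult) (auto intro: continuous_on_subset[OF \<phi>(2)])
  have "(LINT x:{a..b}|lborel. \<phi>' x * (u x - u a)) = (LINT x:{a..b}|lborel. u x * \<phi>' x - u a * \<phi>' x)"
    by (intro set_lebesgue_integral_cong) (auto simp: algebra_simps)
  also have "\<dots> = (LINT x:{a..b}|lborel. u x * \<phi>' x) - u a * (LINT x:{a..b}|lborel. \<phi>' x)"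
    using set_integral_diff(2)[OF int_u, of "\<lambda>x. u a * \<phi>' x"] int_\<phi>' by simp
  also have "\<dots> = (LINT x:{a..b}|lborel. u x * \<phi>' x)"
    using FTC[OF ab] assms by simp
  finally show ?thesis using * by simp
qed

text \<open>A test function has compact support in the interior, so both integrals live on some
  bounded interval [0,c] at whose ends it vanishes, and integration by parts applies there.\<close>

lemma ac_on_imp_weak_deriv:
  assumes "ac_on I u g" "I = {0..} \<or> I = {0..b}"
  shows "has_weak_deriv_on u g I"
  unfolding has_weak_deriv_on_def
proof (intro allI impI)
  fix \<phi> \<phi>' assume t: "test_fun_on I \<phi> \<phi>'"
  then obtain K where K: "compact K" "K \<subseteq> interior I" "\<And>x. x \<notin> K \<Longrightarrow> \<phi> x = 0"
    unfolding test_fun_on_def by blast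
  have z': "\<phi>' x = 0" if "x \<notin> K" for x
    using test_fun_deriv_zero[OF t K(1) K(3) that] by blast
  have intI: "interior {0..b} = {0<..<b}" "interior {0..} = {(0::real)<..}" by auto
  \<comment> \<open>A negative \<open>c\<close> can only come from a negative \<open>b\<close>; then
    \<open>K\<close> is empty and both integrals vanish.\<close>
  obtain c where c: "{0..c} \<subseteq> I" "K \<subseteq> {0<..<c}"
  proof (cases "I = {0..}")
    case True
    obtain B where B: "\<And>x. x \<in> K \<Longrightarrow> \<bar>x\<bar> \<le> B"
      using compact_imp_bounded[OF K(1)] by (auto simp: bounded_iff)
    show ?thesis
      by (rule that[of "B + 1"]) (use True B K(2) intI in \<open>force simp: abs_le_iff\<close>)+
  next
    case False
    with assms(2) K(2) intI that[of b] show ?thesis by auto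
  qed
  have sub: "(LINT x:I|lborel. f x) = (LINT x:{0..c}|lborel. f x)" if "\<And>x. x \<notin> K \<Longrightarrow> f x = 0" for f :: "real \<Rightarrow> real"
    unfolding set_lebesgue_integral_def
  proof (intro Bochner_Integration.integral_cong refl)
    fix x
    show "indicator I x *\<^sub>R f x = indicator {0..c} x *\<^sub>R f x"
      using that[of x] c by (cases "x \<in> K") (auto simp: subset_eq)
  qed
  show "(LINT x:I|lborel. u x * \<phi>' x) = - (LINT x:I|lborel. g x * \<phi> x)"
  proof (cases "0 \<le> c")
    case True
    have "0 \<notin> K" "c \<notin> K" using c by auto
    then have "\<phi> 0 = 0" "\<phi> c = 0" using K(3) by auto
    then have "(LINT x:{0..c}|lborel. u x * \<phi>' x) = - (LINT x:{0..c}|lborel. g x * \<phi> x)"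
      using True c t
      by (intro weak_deriv_Icc_parts ac_on_subset[OF assms(1)]) (auto simp: test_fun_on_def)
    then show ?thesis using sub[of "\<lambda>x. u x * \<phi>' x"] sub[of "\<lambda>x. g x * \<phi> x"] z' K(3) by simp
  next
    case False
    then have "K = {}" using c by auto
    then have "\<phi>' = (\<lambda>_. 0)" "\<phi> = (\<lambda>_. 0)" using z' K(3) by auto
    then show ?thesis by simp
  qed
qed


section \<open>A smoothed step and its mollifying kernel\<close>

definition ramp :: "real \<Rightarrow> real" where "ramp s = max 0 s"

text \<open>The tent on [0,2] with height 1 and integral 1; \<open>smooth_step\<close> is its
  primitive. Test functions are only required to be C^1, so a piecewise quadratic primitive is
  smooth enough. The support lies on one side of 0, so mollifying at a point uses only values to its
  right.\<close>

definition hat :: "real \<Rightarrow> real" where "hat s = ramp s - 2 * ramp (s - 1) + ramp (s - 2)"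

definition smooth_step :: "real \<Rightarrow> real" where
  "smooth_step s = (ramp s)\<^sup>2 / 2 - (ramp (s - 1))\<^sup>2 + (ramp (s - 2))\<^sup>2 / 2"

lemma ramp_square_deriv: "((\<lambda>s. (ramp s)\<^sup>2) has_real_derivative 2 * ramp s) (at s)"
proof (cases s "0::real" rule: linorder_cases)
  case less
  have "((\<lambda>_. 0) has_real_derivative 2 * ramp s) (at s)" using less by (simp add: ramp_def)
  then show ?thesis
    by (rule has_field_derivative_transform_within_open[of _ _ _ "{..<0}"]) (use less in \<open>auto simp: ramp_def\<close>)
next
  case greater
  have "((\<lambda>s. s\<^sup>2) has_real_derivative 2 * ramp s) (at s)"
    using greater by (auto intro!: derivative_eq_intros simp: ramp_def)
  then show ?thesis
    by (rule has_field_derivative_transform_within_open[of _ _ _ "{0<..}"]) (use greater in \<open>auto simp: ramp_def\<close>)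
next
  case equal
  have "((\<lambda>h. ((ramp (0 + h))\<^sup>2 - (ramp 0)\<^sup>2) / h) \<longlongrightarrow> 0) (at 0)"
  proof (rule Lim_null_comparison)
    show "\<forall>\<^sub>F h in at 0. norm (((ramp (0 + h))\<^sup>2 - (ramp 0)\<^sup>2) / h) \<le> \<bar>h\<bar>"
      by (intro always_eventually) (auto simp: ramp_def max_def power2_eq_square)
    show "((\<lambda>h::real. \<bar>h\<bar>) \<longlongrightarrow> 0) (at 0)"
      using tendsto_rabs[OF tendsto_ident_at[of "0::real" UNIV]] by simp
  qed
  then show ?thesis using equal by (simp add: DERIV_def ramp_def)
qed

lemma smooth_step_deriv: "(smooth_step has_real_derivative hat s) (at s)"
proof -
  have sh: "((\<lambda>s. (ramp (s - c))\<^sup>2) has_real_derivative 2 * ramp (s - c)) (at s)" for c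
    using DERIV_shift[of "\<lambda>s. (ramp s)\<^sup>2" "2 * ramp (s - c)" s "- c"] ramp_square_deriv[of "s - c"] by simp
  have "(smooth_step has_real_derivative 2 * ramp s / 2 - 2 * ramp (s - 1) + 2 * ramp (s - 2) / 2) (at s)"
    unfolding smooth_step_def[abs_def]
    by (intro DERIV_add DERIV_diff DERIV_cdivide ramp_square_deriv sh)
  then show ?thesis by (simp add: hat_def)
qed

lemma continuous_on_hat [continuous_intros]: "continuous_on A hat"
  unfolding hat_def[abs_def] ramp_def by (intro continuous_intros)

lemma measurable_hat [measurable]: "hat \<in> borel_measurable borel"
  using borel_measurable_continuous_onI[OF continuous_on_hat] .

lemma hat_bounds: "0 \<le> hat s" "hat s \<le> 1" "s \<notin> {0..2} \<Longrightarrow> hat s = 0"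
  by (auto simp: hat_def ramp_def max_def)

lemma smooth_step_left: "s \<le> 0 \<Longrightarrow> smooth_step s = 0"
  by (simp add: smooth_step_def ramp_def)

lemma smooth_step_right: "s \<ge> 2 \<Longrightarrow> smooth_step s = 1"
  by (simp add: smooth_step_def ramp_def power2_eq_square field_simps)

lemma smooth_step_mono: "s \<le> t \<Longrightarrow> smooth_step s \<le> smooth_step t"
  by (rule DERIV_nonneg_imp_nondecreasing) (use smooth_step_deriv hat_bounds in blast)+

lemma smooth_step_bounds: "0 \<le> smooth_step s" "smooth_step s \<le> 1"
  using smooth_step_mono[of "min 0 s" s] smooth_step_left[of "min 0 s"]
    smooth_step_mono[of s "max 2 s"] smooth_step_right[of "max 2 s"] by auto

lemma measurable_smooth_step [measurable]: "smooth_step \<in> borel_measurable borel"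
  unfolding smooth_step_def[abs_def] ramp_def by measurable

lemma integral_hat: "integrable lborel hat" "(\<integral>s. hat s \<partial>lborel) = 1"
proof -
  have eq: "hat = (\<lambda>s. indicator {0..2} s *\<^sub>R hat s)"
  proof
    show "hat s = indicator {0..2} s *\<^sub>R hat s" for s
      using hat_bounds(3)[of s] by (cases "s \<in> {0..2}") auto
  qed
  have "set_integrable lborel {0..2} hat"
    by (intro borel_integrable_atLeastAtMost' continuous_on_hat)
  then show "integrable lborel hat" using eq by (simp add: set_integrable_def)
  have "(\<integral>s. indicator {0..2} s *\<^sub>R hat s \<partial>lborel) = smooth_step 2 - smooth_step 0"
    by (rule integral_FTC_atLeastAtMost)
      (auto simp flip: has_real_derivative_iff_has_vector_derivative
        intro: continuous_on_hat smooth_step_deriv has_field_derivative_at_within)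
  then show "(\<integral>s. hat s \<partial>lborel) = 1"
    using eq by (simp add: smooth_step_left smooth_step_right)
qed

text \<open>Substituting t = z + s/n turns the kernel into the fixed density \<open>hat\<close>;
  dominated convergence applies because \<open>u\<close> is bounded on the compact piece
  [z, z+d].\<close>

lemma hat_mollify:
  assumes u: "continuous_on I u" and I: "{z..z+d} \<subseteq> I" "d > 0" "I \<in> sets borel"
  shows "(\<lambda>n. LINT t:I|lborel. u t * (real n * hat (real n * (t - z)))) \<longlonglongrightarrow> u z"
    and "\<forall>\<^sub>F n in sequentially. set_integrable lborel I (\<lambda>t. u t * (real n * hat (real n * (t - z))))"
proof -
  define f where "f n s = indicator I (z + s / real n) * u (z + s / real n) * hat s" for n s
  have uI [measurable]: "(\<lambda>t. indicator I t * u t) \<in> borel_measurable borel"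
    using borel_measurable_continuous_on_indicator[OF I(3) u] by simp
  have fm [measurable]: "f n \<in> borel_measurable borel" for n
  proof -
    have "(\<lambda>s. (\<lambda>t. indicator I t * u t) (z + s / real n) * hat s) \<in> borel_measurable borel"
      by measurable
    then show ?thesis by (simp add: f_def[abs_def])
  qed
  have "continuous_on {z..z+d} u" using u I(1) continuous_on_subset by blast
  then have "compact (u ` {z..z+d})" by (intro compact_continuous_image) auto
  then obtain C where C: "\<And>t. t \<in> {z..z+d} \<Longrightarrow> \<bar>u t\<bar> \<le> C"
    using compact_imp_bounded by (fastforce simp: bounded_iff)
  have C0: "0 \<le> C" using C[of z] I(2) by auto
  \<comment> \<open>From this index on the support [z, z + 2/n] of the kernel fits into
    [z, z+d].\<close>
  obtain N :: nat where N: "2 / d < real N" using reals_Archimedean2 by blast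
  have big: "n > 0 \<and> 2 / real n \<le> d" if "n \<ge> N" for n
  proof -
    have "2 / d < real n" using N that by linarith
    moreover have "0 < 2 / d" using I(2) by simp
    ultimately have "0 < real n" "2 < real n * d" using I(2) by (linarith, simp add: field_simps)
    then show ?thesis by (simp add: field_simps)
  qed
  have bound: "\<bar>f n s\<bar> \<le> C * hat s" if "n \<ge> N" for n s
  proof (cases "s \<in> {0..2}")
    case True
    have "s / real n \<le> 2 / real n" using True by (intro divide_right_mono) auto
    then have "z + s / real n \<in> {z..z+d}" using big[OF that] True by auto
    then have "\<bar>u (z + s / real n)\<bar> \<le> C" by (rule C)
    then show ?thesis
      using hat_bounds(1)[of s] C0 by (auto simp: f_def abs_mult split: split_indicator intro!: mult_mono)
  qed (simp add: f_def hat_bounds(3))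
  have change: "(LINT t:I|lborel. u t * (real n * hat (real n * (t - z)))) = (\<integral>s. f n s \<partial>lborel)"
    "integrable lborel (f n) \<longleftrightarrow> set_integrable lborel I (\<lambda>t. u t * (real n * hat (real n * (t - z))))"
    if "n > 0" for n
  proof -
    have eq: "indicator I (z + 1 / real n * s) *\<^sub>R (u (z + 1 / real n * s) * (real n * hat (real n * (z + 1 / real n * s - z))))
        = real n * f n s" for s
      using that by (simp add: f_def)
    show "(LINT t:I|lborel. u t * (real n * hat (real n * (t - z)))) = (\<integral>s. f n s \<partial>lborel)"
      unfolding set_lebesgue_integral_def
      using lborel_integral_real_affine[of "1 / real n" "\<lambda>t. indicator I t *\<^sub>R (u t * (real n * hat (real n * (t - z))))" z] that
      by (simp only: eq) simp
    show "integrable lborel (f n) \<longleftrightarrow> set_integrable lborel I (\<lambda>t. u t * (real n * hat (real n * (t - z))))"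
      unfolding set_integrable_def
      using lborel_integrable_real_affine_iff[of "1 / real n" "\<lambda>t. indicator I t *\<^sub>R (u t * (real n * hat (real n * (t - z))))" z] that
      by (simp only: eq) simp
  qed
  have int_f: "integrable lborel (f n)" if "n \<ge> N" for n
    using bound[OF that] hat_bounds(1) C0
    by (intro Bochner_Integration.integrable_bound[OF integrable_mult_right[OF integral_hat(1), of C]])
      (auto simp: abs_mult)
  show "\<forall>\<^sub>F n in sequentially. set_integrable lborel I (\<lambda>t. u t * (real n * hat (real n * (t - z))))"
    using change(2) int_f big by (intro eventually_sequentiallyI[of N]) auto
  have "(\<lambda>n. \<integral>s. f (n + N) s \<partial>lborel) \<longlonglongrightarrow> (\<integral>s. u z * hat s \<partial>lborel)"
  proof (rule integral_dominated_convergence[where w="\<lambda>s. C * hat s"])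
    show "integrable lborel (\<lambda>s. C * hat s)" using integral_hat(1) by simp
    show "AE s in lborel. norm (f (n + N) s) \<le> C * hat s" for n using bound[of "n + N"] by auto
    show "AE s in lborel. (\<lambda>n. f (n + N) s) \<longlonglongrightarrow> u z * hat s"
    proof (rule AE_I2)
      fix s
      show "(\<lambda>n. f (n + N) s) \<longlonglongrightarrow> u z * hat s"
      proof (cases "s \<in> {0..2}")
        case True
        have mem: "z + s / real (n + N) \<in> I" for n
        proof -
          have "s / real (n + N) \<le> 2 / real (n + N)" using True by (intro divide_right_mono) auto
          then have "z + s / real (n + N) \<in> {z..z+d}" using big[of "n + N"] True by auto
          with I(1) show ?thesis by blast
        qed
        have lim: "(\<lambda>n. z + s / real n) \<longlonglongrightarrow> z"
        proof -
          have "(\<lambda>n. z + s / real n) \<longlonglongrightarrow> z + 0" by (intro tendsto_intros lim_const_over_n)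
          then show ?thesis by simp
        qed
        have "(\<lambda>n. u (z + s / real (n + N))) \<longlonglongrightarrow> u z"
          using I(1,2) mem by (intro continuous_on_tendsto_compose[OF u LIMSEQ_ignore_initial_segment[OF lim]]) auto
        then have "(\<lambda>n. u (z + s / real (n + N)) * hat s) \<longlonglongrightarrow> u z * hat s" by (intro tendsto_intros)
        moreover have "f (n + N) s = u (z + s / real (n + N)) * hat s" for n using mem[of n] by (simp add: f_def)
        ultimately show ?thesis by simp
      qed (simp add: f_def hat_bounds(3))
    qed
  qed auto
  moreover have "(\<integral>s. u z * hat s \<partial>lborel) = u z" by (simp add: integral_hat)
  ultimately have "(\<lambda>n. LINT t:I|lborel. u t * (real (n + N) * hat (real (n + N) * (t - z)))) \<longlonglongrightarrow> u z"
    using change(1) big by (simp only: le_add2)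
  then show "(\<lambda>n. LINT t:I|lborel. u t * (real n * hat (real n * (t - z)))) \<longlonglongrightarrow> u z"
    by (rule LIMSEQ_offset)
qed

text \<open>The test functions are differences of two smoothed steps. They tend to the indicator of
  (x,y], while their derivatives are differences of approximate point masses at \<open>x\<close> and
  \<open>y\<close>. The margin \<open>d\<close> beyond \<open>y\<close> holds the one-sided kernel
  placed there.\<close>

lemma weak_deriv_imp_increment:
  assumes u: "continuous_on I u" and g: "L2_on I g" and w: "has_weak_deriv_on u g I"
    and I: "is_interval I" and x: "x \<in> I" "x < y" "d > 0" "{x..y+d} \<subseteq> interior I"
  shows "u y - u x = (LINT t:{x..y}|lborel. g t)"
proof -
  define \<phi> where "\<phi> n t = smooth_step (real n * (t - x)) - smooth_step (real n * (t - y))" for n t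
  define \<phi>' where "\<phi>' n t = real n * hat (real n * (t - x)) - real n * hat (real n * (t - y))" for n t
  have Ib: "I \<in> sets borel" using interval_sets_lborel[OF I] by simp
  have sub: "{x..y+d} \<subseteq> I" using x(4) interior_subset by blast
  obtain N :: nat where N: "2 / d < real N" using reals_Archimedean2 by blast
  have big: "n > 0 \<and> 2 / real n \<le> d" if "n \<ge> N" for n
  proof -
    have "2 / d < real n" using N that by linarith
    moreover have "0 < 2 / d" using x(3) by simp
    ultimately have "0 < real n" "2 < real n * d" using x(3) by (linarith, simp add: field_simps)
    then show ?thesis by (simp add: field_simps)
  qed
  have zero: "\<phi> n t = 0" if n: "n \<ge> N" and t: "t \<notin> {x..y+d}" for n t
  proof (cases "t < x")
    case True
    then have "real n * (t - x) \<le> 0" "real n * (t - y) \<le> 0" using x(2) by (auto simp: mult_le_0_iff)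
    then show ?thesis by (simp add: \<phi>_def smooth_step_left)
  next
    case False
    then have t: "t > y + d" using t by auto
    have "2 / real n \<le> t - y" "2 / real n \<le> t - x" using big[OF n] t x(2) by linarith+
    then have "2 \<le> real n * (t - y)" "2 \<le> real n * (t - x)" using big[OF n] by (auto simp: field_simps)
    then show ?thesis by (simp add: \<phi>_def smooth_step_right)
  qed
  have der: "(\<phi> n has_real_derivative \<phi>' n t) (at t)" for n t
  proof -
    have "((\<lambda>t. smooth_step (real n * (t - z))) has_real_derivative hat (real n * (t - z)) * real n) (at t)" for z
      by (rule DERIV_chain2[OF smooth_step_deriv]) (auto intro!: derivative_eq_intros)
    then show ?thesis unfolding \<phi>_def[abs_def] \<phi>'_def by (auto intro!: derivative_eq_intros)
  qed
  have test: "test_fun_on I (\<phi> n) (\<phi>' n)" if "n \<ge> N" for n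
    unfolding test_fun_on_def
  proof (intro conjI allI)
    show "continuous_on UNIV (\<phi>' n)" unfolding \<phi>'_def[abs_def]
      by (intro continuous_intros continuous_on_compose2[OF continuous_on_hat[of UNIV]]) auto
    show "\<exists>K. compact K \<and> K \<subseteq> interior I \<and> (\<forall>x. x \<notin> K \<longrightarrow> \<phi> n x = 0)"
      using zero[OF that] x(4) by (intro exI[of _ "{x..y+d}"]) auto
  qed (rule der)
  have L: "(\<lambda>n. LINT t:I|lborel. u t * \<phi>' n t) \<longlonglongrightarrow> u x - u y"
  proof -
    have sx: "{x..x+d} \<subseteq> I" "{y..y+d} \<subseteq> I" using sub x(2) by auto
    note mx = hat_mollify[OF u sx(1) x(3) Ib] and my = hat_mollify[OF u sx(2) x(3) Ib]
    have "\<forall>\<^sub>F n in sequentially. (LINT t:I|lborel. u t * (real n * hat (real n * (t - x))))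
      - (LINT t:I|lborel. u t * (real n * hat (real n * (t - y)))) = (LINT t:I|lborel. u t * \<phi>' n t)"
      using mx(2) my(2)
    proof eventually_elim
      case (elim n)
      then show ?case
        using set_integral_diff(2)[OF elim] by (simp add: \<phi>'_def right_diff_distrib)
    qed
    with tendsto_diff[OF mx(1) my(1)] show ?thesis using filterlim_cong[OF refl refl] by force
  qed
  have R: "(\<lambda>n. LINT t:I|lborel. g t * \<phi> (n + N) t) \<longlonglongrightarrow> (LINT t:{x<..y}|lborel. g t)"
    unfolding set_lebesgue_integral_def
  proof (rule integral_dominated_convergence[where w="\<lambda>t. \<bar>indicator {x..y+d} t * g t\<bar>"])
    have ig: "set_integrable lborel {x..y+d} g"
      by (rule L2_on_integrable[OF g _ sub emeasure_lborel_Icc_finite]) auto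
    then show "integrable lborel (\<lambda>t. \<bar>indicator {x..y+d} t * g t\<bar>)"
      by (auto simp: set_integrable_def)
    have "set_integrable lborel {x<..y} g" by (rule set_integrable_subset[OF ig]) (use x(3) in auto)
    then show "(\<lambda>t. indicator {x<..y} t *\<^sub>R g t) \<in> borel_measurable lborel" by (auto simp: set_integrable_def)
    have [measurable]: "(\<lambda>t. indicator I t * g t) \<in> borel_measurable borel"
      using L2_on_indicator_measurable[OF g] by simp
    have "(\<lambda>t. (indicator I t * g t) * \<phi> (n + N) t) \<in> borel_measurable borel" for n
      unfolding \<phi>_def by measurable
    then show "(\<lambda>t. indicator I t *\<^sub>R (g t * \<phi> (n + N) t)) \<in> borel_measurable lborel" for n
      by (simp add: mult.assoc)
    show "AE t in lborel. norm (indicator I t *\<^sub>R (g t * \<phi> (n + N) t)) \<le> \<bar>indicator {x..y+d} t * g t\<bar>" for n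
    proof (rule AE_I2)
      fix t
      have "\<bar>\<phi> (n + N) t\<bar> \<le> 1"
        using smooth_step_bounds[of "real (n + N) * (t - x)"] smooth_step_bounds[of "real (n + N) * (t - y)"]
        by (simp add: \<phi>_def)
      then show "norm (indicator I t *\<^sub>R (g t * \<phi> (n + N) t)) \<le> \<bar>indicator {x..y+d} t * g t\<bar>"
        using zero[of "n + N" t] by (cases "t \<in> {x..y+d}") (auto simp: abs_mult indicator_def intro: mult_left_le)
    qed
    show "AE t in lborel. (\<lambda>n. indicator I t *\<^sub>R (g t * \<phi> (n + N) t)) \<longlonglongrightarrow> indicator {x<..y} t *\<^sub>R g t"
    proof (rule AE_I2)
      fix t
      \<comment> \<open>The smoothed step vanishes at t = z itself, so the limit exists at every
        point; this is why the limiting interval is half-open.\<close>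
      have step: "\<forall>\<^sub>F n in sequentially. smooth_step (real n * (t - z)) = (if z < t then 1 else 0)" for z
      proof (cases "z < t")
        case True
        obtain m :: nat where m: "2 / (t - z) < real m" using reals_Archimedean2 by blast
        have "2 \<le> real n * (t - z)" if "n \<ge> m" for n
        proof -
          have "2 / (t - z) \<le> real n" using m that by linarith
          then show ?thesis using True by (simp add: field_simps)
        qed
        then show ?thesis using True by (intro eventually_sequentiallyI[of m]) (simp add: smooth_step_right)
      next
        case False
        then show ?thesis
          by (intro always_eventually) (auto simp: smooth_step_left mult_nonneg_nonpos)
      qed
      have "\<forall>\<^sub>F n in sequentially. indicator I t *\<^sub>R (g t * \<phi> n t) = indicator {x<..y} t *\<^sub>R g t"
        using step[of x] step[of y]
      proof eventually_elim
        case (elim n)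
        have "t \<in> I" if "x < t" "t \<le> y" using that sub x(3) by auto
        with elim show ?case using x(2) by (auto simp: \<phi>_def indicator_def)
      qed
      then have "(\<lambda>n. indicator I t *\<^sub>R (g t * \<phi> n t)) \<longlonglongrightarrow> indicator {x<..y} t *\<^sub>R g t"
        by (rule tendsto_eventually)
      then show "(\<lambda>n. indicator I t *\<^sub>R (g t * \<phi> (n + N) t)) \<longlonglongrightarrow> indicator {x<..y} t *\<^sub>R g t"
        by (rule LIMSEQ_ignore_initial_segment)
    qed
  qed
  have "(LINT t:I|lborel. u t * \<phi>' (n + N) t) = - (LINT t:I|lborel. g t * \<phi> (n + N) t)" for n
    using w test[of "n + N"] by (auto simp: has_weak_deriv_on_def)
  then have "(\<lambda>n. - (LINT t:I|lborel. g t * \<phi> (n + N) t)) \<longlonglongrightarrow> u x - u y"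
    using LIMSEQ_ignore_initial_segment[OF L, of N] by simp
  moreover have "(\<lambda>n. - (LINT t:I|lborel. g t * \<phi> (n + N) t)) \<longlonglongrightarrow> - (LINT t:{x<..y}|lborel. g t)"
    using R by (rule tendsto_minus)
  ultimately have "u x - u y = - (LINT t:{x<..y}|lborel. g t)" by (rule LIMSEQ_unique)
  moreover have "(LINT t:{x<..y}|lborel. g t) = (LINT t:{x..y}|lborel. g t)"
    unfolding set_lebesgue_integral_def
    by (rule integral_discrete_difference[of "{x}"]) (use x in \<open>auto split: split_indicator\<close>)
  ultimately show ?thesis by simp
qed

text \<open>Test functions see only the interior of \<open>I\<close>, whereas the vertex is an
  endpoint of every edge. The interval is therefore shrunk at both ends by \<open>e n\<close>, and
  the increments pass to the limit by continuity of \<open>u\<close> and integrability of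
  \<open>g\<close>.\<close>

lemma weak_deriv_imp_ac_on:
  assumes u: "continuous_on I u" and g: "L2_on I g" and w: "has_weak_deriv_on u g I"
    and I: "I = {0..} \<or> I = {0..b}"
  shows "ac_on I u g"
  unfolding ac_on_def
proof (intro conjI ballI impI)
  show "L2_on I g" by fact
  have int: "is_interval I" using I by auto
  fix x y assume xy: "x \<in> I" "y \<in> I" "x \<le> y"
  show "u y - u x = (LINT t:{x..y}|lborel. g t)"
  proof (cases "x = y")
    case True
    have "(LINT t:{y..y}|lborel. g t) = (LINT t:{}|lborel. g t)"
      unfolding set_lebesgue_integral_def
      by (rule integral_discrete_difference[of "{y}"]) (auto split: split_indicator)
    then show ?thesis using True by (simp add: set_lebesgue_integral_def)
  next
    case False
    then have lt: "x < y" using xy by simp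
    \<comment> \<open>The offset 3 keeps the shrunken interval nondegenerate already for n =
      0.\<close>
    define e where "e n = (y - x) / real (n + 3)" for n
    have e: "0 < e n" "e n < (y - x) / 2" for n
    proof -
      show "0 < e n" using lt by (simp add: e_def)
      show "e n < (y - x) / 2" unfolding e_def using lt by (intro divide_strict_left_mono) auto
    qed
    have sub: "{x..y} \<subseteq> I" using interval_Icc_subset[OF int xy(1,2)] .
    have intr: "{x<..<y} \<subseteq> interior I" using sub by (intro interior_maximal) auto
    have e0: "e \<longlonglongrightarrow> 0"
      unfolding e_def[abs_def] using LIMSEQ_ignore_initial_segment[OF lim_const_over_n[of "y - x"], of 3] by simp
    have inc: "u (y - e n) - u (x + e n) = (LINT t:{x + e n..y - e n}|lborel. g t)" for n
    proof (rule weak_deriv_imp_increment[OF u g w int, where d="e n / 2"])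
      show "x + e n \<in> I" using sub e[of n] by auto
      show "x + e n < y - e n" using e(2)[of n] by (simp add: field_simps)
      show "0 < e n / 2" using e[of n] by simp
      show "{x + e n..y - e n + e n / 2} \<subseteq> interior I" using e[of n] by (intro subset_trans[OF _ intr]) auto
    qed
    have "(\<lambda>n. u (y - e n) - u (x + e n)) \<longlonglongrightarrow> u y - u x"
    proof (intro tendsto_diff)
      have "(\<lambda>n. y - e n) \<longlonglongrightarrow> y - 0" "(\<lambda>n. x + e n) \<longlonglongrightarrow> x + 0" using e0 by (intro tendsto_intros; simp)+
      moreover have "y - e n \<in> I" "x + e n \<in> I" for n using sub e[of n] by auto
      ultimately show "(\<lambda>n. u (y - e n)) \<longlonglongrightarrow> u y" "(\<lambda>n. u (x + e n)) \<longlonglongrightarrow> u x"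
        using xy by (auto intro!: continuous_on_tendsto_compose[OF u])
    qed
    moreover have "(\<lambda>n. LINT t:{x + e n..y - e n}|lborel. g t) \<longlonglongrightarrow> (LINT t:(\<Union>n. {x + e n..y - e n})|lborel. g t)"
    proof (rule set_integral_cont_up)
      have "e (Suc n) \<le> e n" for n unfolding e_def using lt by (intro divide_left_mono) auto
      then show "incseq (\<lambda>n. {x + e n..y - e n})"
        by (intro incseq_SucI) (simp add: atLeastatMost_subset_iff)
      have "(\<Union>n. {x + e n..y - e n}) \<subseteq> {x..y}"
      proof (rule UN_least)
        show "{x + e n..y - e n} \<subseteq> {x..y}" for n using e(1)[of n] by auto
      qed
      then show "set_integrable lborel (\<Union>n. {x + e n..y - e n}) g"
        by (intro set_integrable_subset[OF L2_on_integrable_Icc(1)[OF g int xy(1,2)]]) auto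
    qed auto
    moreover have "(\<Union>n. {x + e n..y - e n}) = {x<..<y}"
    proof
      show "(\<Union>n. {x + e n..y - e n}) \<subseteq> {x<..<y}"
      proof (rule UN_least)
        show "{x + e n..y - e n} \<subseteq> {x<..<y}" for n using e(1)[of n] by auto
      qed
      show "{x<..<y} \<subseteq> (\<Union>n. {x + e n..y - e n})"
      proof
        fix t assume t: "t \<in> {x<..<y}"
        then have "\<forall>\<^sub>F n in sequentially. e n < min (t - x) (y - t)"
          using e0 by (intro order_tendstoD(2)[of e 0]) auto
        then obtain n where "e n < min (t - x) (y - t)" by (auto simp: eventually_sequentially)
        then show "t \<in> (\<Union>n. {x + e n..y - e n})" by (intro UN_I[of n]) auto
      qed
    qed
    ultimately have "u y - u x = (LINT t:{x<..<y}|lborel. g t)"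
      using inc by (simp add: LIMSEQ_unique)
    also have "\<dots> = (LINT t:{x..y}|lborel. g t)"
      unfolding set_lebesgue_integral_def
      by (rule integral_discrete_difference[of "{x,y}"]) (auto split: split_indicator)
    finally show ?thesis .
  qed
qed

text \<open>This lemma and the next one translate between \<open>H1_on\<close> and
  \<open>ac_on\<close>; all later analysis takes place on the \<open>ac_on\<close> side.\<close>

lemma H1_on_weak_deriv:
  assumes "continuous_on I u" "H1_on I u" "I = {0..} \<or> I = {0..b}"
  shows "L2_on I u" "ac_on I u (weak_deriv I u)"
proof -
  show "L2_on I u" using assms(2) by (simp add: H1_on_def)
  have "\<exists>g. L2_on I g \<and> has_weak_deriv_on u g I" using assms(2) by (simp add: H1_on_def)
  then have "L2_on I (weak_deriv I u) \<and> has_weak_deriv_on u (weak_deriv I u) I"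
    unfolding weak_deriv_def by (rule someI_ex)
  then show "ac_on I u (weak_deriv I u)" using weak_deriv_imp_ac_on[OF assms(1) _ _ assms(3)] by blast
qed

lemma ac_on_imp_H1_on:
  assumes "L2_on I u" "ac_on I u g" "I = {0..} \<or> I = {0..b}"
  shows "continuous_on I u" "H1_on I u"
    "(LINT t:I|lborel. (weak_deriv I u t)\<^sup>2) = (LINT t:I|lborel. (g t)\<^sup>2)"
proof -
  show c: "continuous_on I u" using assms(3) by (intro ac_on_continuous_on[OF assms(2)]) auto
  show h: "H1_on I u"
    unfolding H1_on_def using assms(1) ac_onD(1)[OF assms(2)] ac_on_imp_weak_deriv[OF assms(2,3)] by blast
  show "(LINT t:I|lborel. (weak_deriv I u t)\<^sup>2) = (LINT t:I|lborel. (g t)\<^sup>2)"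
    by (rule ac_on_deriv_norm_unique[OF H1_on_weak_deriv(2)[OF c h assms(3)] assms(2,3)])
qed

section \<open>A Riesz criterion for square-integrable derivatives\<close>

lemma interval_measure_unique:
  assumes sets: "sets M = sets borel"
    and em: "\<And>a b. a \<le> b \<Longrightarrow> emeasure M {a<..b} = ennreal (F b - F a)"
    and F: "\<And>x y. x \<le> y \<Longrightarrow> F x \<le> F y" "\<And>a. continuous (at_right a) F"
  shows "M = interval_measure F"
proof (rule measure_eqI_generator_eq[where E="range (\<lambda>(a, b). {a <.. b::real})" and \<Omega>=UNIV
      and A="\<lambda>i. {- real i<..real i}"])
  show "Int_stable (range (\<lambda>(a, b). {a <.. b::real}))"
  proof (rule Int_stableI_image)
    show "\<exists>r\<in>UNIV. (case p of (a, b) \<Rightarrow> {a<..b}) \<inter> (case q of (a, b) \<Rightarrow> {a<..b})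
      = (case r of (a, b) \<Rightarrow> {a<..b})" for p q :: "real \<times> real"
      by (intro bexI[of _ "(max (fst p) (fst q), min (snd p) (snd q))"])
        (auto simp: Int_greaterThanAtMost split: prod.split)
  qed
  show "emeasure M X = emeasure (interval_measure F) X" if X_in: "X \<in> range (\<lambda>(a, b). {a <.. b::real})" for X
  proof -
    obtain q where q: "X = (\<lambda>(a, b). {a <.. b::real}) q" using X_in by (rule imageE)
    obtain a b where "q = (a, b)" by (rule prod.exhaust)
    with q have X: "X = {a<..b}" by (simp only: split)
    show ?thesis
    proof (cases "a \<le> b")
      case True
      show ?thesis unfolding X em[OF True] by (rule emeasure_interval_measure_Ioc[OF True F, symmetric])
    next
      case False with X show ?thesis by simp
    qed
  qed
  have borel_Ioc: "sets borel = sigma_sets UNIV (range (\<lambda>(a, b). {a <.. b::real}))"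
    by (subst borel_sigma_sets_Ioc) simp
  show "sets M = sigma_sets UNIV (range (\<lambda>(a, b). {a <.. b::real}))"
    "sets (interval_measure F) = sigma_sets UNIV (range (\<lambda>(a, b). {a <.. b::real}))"
    using sets borel_Ioc by simp_all
  show "(\<Union>i. {- real i<..real i}) = UNIV"
  proof -
    have "\<exists>i. x \<in> {- real i<..real i}" for x
    proof -
      obtain i where "\<bar>x\<bar> < real i" using reals_Archimedean2 by blast
      then show ?thesis by (intro exI[of _ i]) auto
    qed
    then show ?thesis by (simp add: set_eq_iff)
  qed
  show "emeasure M {- real i<..real i} \<noteq> \<infinity>" for i using em[of "- real i" "real i"] by simp
  show "range (\<lambda>i. {- real i<..real i}) \<subseteq> range (\<lambda>(a, b). {a <.. b::real})"
  proof (rule image_subsetI)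
    show "{- real i<..real i} \<in> range (\<lambda>(a, b). {a <.. b::real})" for i
      by (rule image_eqI[of _ _ "(- real i, real i)"]) simp_all
  qed
qed simp

text \<open>The sum of the two set functions is set up as a measure \<open>M\<close>, which is then
  recognised by its values on half-open intervals.\<close>

lemma emeasure_interval_measure_add:
  assumes F: "\<And>x y. x \<le> y \<Longrightarrow> F x \<le> F y" "\<And>a. continuous (at_right a) F"
    and G: "\<And>x y. x \<le> y \<Longrightarrow> G x \<le> G y" "\<And>a. continuous (at_right a) G"
    and A: "A \<in> sets borel"
  shows "emeasure (interval_measure (\<lambda>x. F x + G x)) A
    = emeasure (interval_measure F) A + emeasure (interval_measure G) A"
proof -
  define m where "m A = emeasure (interval_measure F) A + emeasure (interval_measure G) A" for A
  define M where "M = measure_of UNIV (sets borel) m"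
  have em: "emeasure M A = m A" if "A \<in> sets borel" for A
    unfolding M_def
  proof (rule emeasure_measure_of_sigma)
    show "sigma_algebra UNIV (sets (borel :: real measure))"
      using sets.sigma_algebra_axioms[of "borel :: real measure"] by simp
    show "positive (sets borel) m" by (simp add: positive_def m_def)
    show "countably_additive (sets borel) m"
    proof (rule countably_additiveI)
      fix A :: "nat \<Rightarrow> real set" assume *: "range A \<subseteq> sets borel" "disjoint_family A"
      have "(\<Sum>i. m (A i)) = (\<Sum>i. emeasure (interval_measure F) (A i)) + (\<Sum>i. emeasure (interval_measure G) (A i))"
        unfolding m_def by (rule suminf_add[symmetric]) (auto intro: summableI)
      also have "\<dots> = m (\<Union>i. A i)"
        unfolding m_def using * by (simp add: suminf_emeasure)
      finally show "(\<Sum>i. m (A i)) = m (\<Union>i. A i)" .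
    qed
  qed fact
  have "M = interval_measure (\<lambda>x. F x + G x)"
  proof (rule interval_measure_unique)
    have "sigma_algebra UNIV (sets (borel :: real measure))"
      using sets.sigma_algebra_axioms[of "borel :: real measure"] by simp
    then show "sets M = sets borel" unfolding M_def
      by (simp add: sigma_algebra.sets_measure_of_eq sigma_algebra.sigma_sets_eq)
    show "emeasure M {a<..b} = ennreal (F b + G b - (F a + G a))" if "a \<le> b" for a b
    proof -
      have "F a \<le> F b" "G a \<le> G b" using F(1) G(1) that by auto
      then have "ennreal (F b - F a) + ennreal (G b - G a) = ennreal (F b + G b - (F a + G a))"
        by (simp add: algebra_simps flip: ennreal_plus)
      then show ?thesis
        using that by (simp add: em m_def emeasure_interval_measure_Ioc F G)
    qed
    show "F x + G x \<le> F y + G y" if "x \<le> y" for x y using F(1)[OF that] G(1)[OF that] by linarith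
    show "continuous (at_right a) (\<lambda>x. F x + G x)" for a by (intro continuous_intros F G)
  qed
  then show ?thesis using em[OF A] by (simp add: m_def)
qed

lemma emeasure_interval_measure_cmult:
  assumes F: "\<And>x y. x \<le> y \<Longrightarrow> F x \<le> F y" "\<And>a. continuous (at_right a) F" and "0 \<le> c"
  shows "emeasure (interval_measure (\<lambda>x. c * F x)) A = ennreal c * emeasure (interval_measure F) A"
proof -
  have "scale_measure (ennreal c) (interval_measure F) = interval_measure (\<lambda>x. c * F x)"
  proof (rule interval_measure_unique)
    show "emeasure (scale_measure (ennreal c) (interval_measure F)) {a<..b} = ennreal (c * F b - c * F a)"
      if "a \<le> b" for a b
    proof -
      have "F a \<le> F b" using F(1) that by auto
      then have "ennreal c * ennreal (F b - F a) = ennreal (c * F b - c * F a)"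
        using assms(3) by (simp add: right_diff_distrib flip: ennreal_mult)
      with that show ?thesis by (simp add: emeasure_interval_measure_Ioc F)
    qed
    show "c * F x \<le> c * F y" if "x \<le> y" for x y using F(1)[OF that] assms(3) by (rule mult_left_mono)
    show "continuous (at_right a) (\<lambda>x. c * F x)" for a by (intro continuous_intros F)
  qed simp
  then show ?thesis by (metis emeasure_scale_measure)
qed

text \<open>The assumption \<open>energy\<close> for all t \<ge> 0 is the linearised form of (F y -
  F x)^2 \<le> (y - x)(k y - k x); optimizing over t recovers the product form. For fixed t it is
  linear in the increments and hence extends to measures of arbitrary Borel sets.\<close>

locale riesz_energy =
  fixes F k :: "real \<Rightarrow> real" and T :: real
  assumes F_mono: "\<And>x y. x \<le> y \<Longrightarrow> F x \<le> F y" and F_rc: "\<And>a. continuous (at_right a) F"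
    and k_mono: "\<And>x y. x \<le> y \<Longrightarrow> k x \<le> k y" and k_rc: "\<And>a. continuous (at_right a) k"
    and k_bound: "\<And>x. 0 \<le> k x" "\<And>x. k x \<le> T"
    and energy: "\<And>t x y. 0 \<le> t \<Longrightarrow> x \<le> y \<Longrightarrow> 2 * t * (F y - F x) \<le> t\<^sup>2 * (y - x) + (k y - k x)"
begin

abbreviation "\<nu> \<equiv> interval_measure F"
abbreviation "\<kappa> \<equiv> interval_measure k"

text \<open>By \<open>energy\<close> the function \<open>G\<close> below is nondecreasing, so it has
  a nonnegative Stieltjes measure; adding the measure of 2 t F gives that of t^2 x + k x.\<close>

lemma measure_ineq:
  assumes "0 \<le> t" and A: "A \<in> sets borel"
  shows "ennreal (2 * t) * emeasure \<nu> A \<le> ennreal (t\<^sup>2) * emeasure lborel A + emeasure \<kappa> A"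
proof -
  define G where "G x = t\<^sup>2 * x + k x - 2 * t * F x" for x
  have G: "G x \<le> G y" if "x \<le> y" for x y
    using energy[OF assms(1) that] by (simp add: G_def algebra_simps)
  have Gc: "continuous (at_right a) G" for a
    unfolding G_def by (intro continuous_intros F_rc k_rc)
  have tF: "2 * t * F x \<le> 2 * t * F y" if "x \<le> y" for x y using F_mono[OF that] assms by (intro mult_left_mono) auto
  have tFc: "continuous (at_right a) (\<lambda>x. 2 * t * F x)" for a by (intro continuous_intros F_rc)
  have tx: "t\<^sup>2 * x \<le> t\<^sup>2 * y" if "x \<le> y" for x y :: real using that by (intro mult_left_mono) auto
  have txc: "continuous (at_right a) (\<lambda>x. t\<^sup>2 * x)" for a :: real by (intro continuous_intros)
  have "ennreal (2 * t) * emeasure \<nu> A = emeasure (interval_measure (\<lambda>x. 2 * t * F x)) A"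
    using emeasure_interval_measure_cmult[of F "2 * t" A, OF F_mono F_rc] assms by simp
  also have "\<dots> \<le> emeasure (interval_measure G) A + emeasure (interval_measure (\<lambda>x. 2 * t * F x)) A"
    by simp
  also have "\<dots> = emeasure (interval_measure (\<lambda>x. G x + 2 * t * F x)) A"
    by (rule emeasure_interval_measure_add[symmetric, OF G Gc tF tFc A])
  also have "(\<lambda>x. G x + 2 * t * F x) = (\<lambda>x. t\<^sup>2 * x + k x)" by (auto simp: G_def)
  also have "emeasure (interval_measure (\<lambda>x. t\<^sup>2 * x + k x)) A = emeasure (interval_measure (\<lambda>x. t\<^sup>2 * x)) A + emeasure \<kappa> A"
    by (rule emeasure_interval_measure_add[OF tx txc k_mono k_rc A])
  also have "emeasure (interval_measure (\<lambda>x. t\<^sup>2 * x)) A = ennreal (t\<^sup>2) * emeasure lborel A"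
    using emeasure_interval_measure_cmult[of "\<lambda>x. x" "t\<^sup>2" A] by (simp add: lborel_eq_real)
  finally show ?thesis .
qed

lemma \<kappa>_finite: "emeasure \<kappa> A \<le> ennreal T"
proof -
  have "emeasure \<kappa> A \<le> emeasure \<kappa> (\<Union>i. {- real i<..real i})"
  proof (rule emeasure_mono)
    have "x \<in> (\<Union>i. {- real i<..real i})" for x
    proof -
      obtain i where "\<bar>x\<bar> < real i" using reals_Archimedean2 by blast
      then show ?thesis by (intro UN_I[of i]) auto
    qed
    then show "A \<subseteq> (\<Union>i. {- real i<..real i})" by blast
  qed auto
  also have "\<dots> = (SUP i. emeasure \<kappa> {- real i<..real i})"
    by (rule SUP_emeasure_incseq[symmetric]) (auto simp: incseq_def)
  also have "\<dots> \<le> ennreal T"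
  proof (rule SUP_least)
    fix i
    have "emeasure \<kappa> {- real i<..real i} = ennreal (k (real i) - k (- real i))"
      by (rule emeasure_interval_measure_Ioc[OF _ k_mono k_rc]) auto
    also have "\<dots> \<le> ennreal T"
      using k_bound(1)[of "- real i"] k_bound(2)[of "real i"] by (intro ennreal_leI) linarith
    finally show "emeasure \<kappa> {- real i<..real i} \<le> ennreal T" .
  qed
  finally show ?thesis .
qed

text \<open>On a Lebesgue null set \<open>measure_ineq\<close> reads 2 t \<nu>(A) \<le> \<kappa>(A)
  \<le> T, and t is arbitrarily large.\<close>

lemma absolutely_continuous_\<nu>: "absolutely_continuous lborel \<nu>"
  unfolding absolutely_continuous_def
proof
  fix A :: "real set" assume "A \<in> null_sets lborel"
  then have A: "A \<in> sets borel" "emeasure lborel A = 0" by auto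
  have T0: "0 \<le> T" using k_bound[of 0] by linarith
  have le: "ennreal (2 * real n) * emeasure \<nu> A \<le> ennreal T" for n
    using measure_ineq[of "real n" A] A \<kappa>_finite[of A] by (auto intro: order_trans)
  have "emeasure \<nu> A = 0"
  proof (rule ccontr)
    assume nz: "emeasure \<nu> A \<noteq> 0"
    have "emeasure \<nu> A \<noteq> \<infinity>" using le[of 1] by (auto simp: ennreal_mult_top top_unique)
    then obtain r where r: "emeasure \<nu> A = ennreal r" "0 \<le> r" by (cases "emeasure \<nu> A") auto
    with nz have "0 < r" by (cases "r = 0") auto
    obtain n where "T / r < real n" using reals_Archimedean2 by blast
    then have "T < real n * r" using \<open>0 < r\<close> by (simp add: field_simps)
    moreover have "2 * real n * r \<le> T"
      using le[of n] r T0 by (simp flip: ennreal_mult)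
    moreover have "0 \<le> real n * r" using r by simp
    ultimately show False by linarith
  qed
  then show "A \<in> null_sets \<nu>" using A by (auto simp: null_sets_def)
qed

text \<open>Where the density is at least y, the choice t = y in \<open>measure_ineq\<close> gives 2
  y \<nu>(E) \<le> y^2 |E| + \<kappa>(E), and \<nu>(E) \<ge> y |E| leaves y^2 |E| \<le> \<kappa>(E).
  Summing over the level sets of simple functions below the density and taking their limit gives the
  bound.\<close>

lemma density_square_bound:
  assumes \<phi> [measurable]: "\<phi> \<in> borel_measurable borel" and d: "density lborel \<phi> = \<nu>"
    and A [measurable]: "A \<in> sets borel" and fin: "emeasure lborel A < \<infinity>"
  shows "(\<integral>\<^sup>+x. (\<phi> x)\<^sup>2 * indicator A x \<partial>lborel) \<le> emeasure \<kappa> A"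
proof -
  have level: "y\<^sup>2 * emeasure lborel E \<le> emeasure \<kappa> E"
    if E [measurable]: "E \<in> sets borel" and "E \<subseteq> A" and y: "\<And>x. x \<in> E \<Longrightarrow> y \<le> \<phi> x" "y < top" for y E
  proof -
    obtain r where r: "y = ennreal r" "0 \<le> r" using y(2) by (cases y) auto
    have "emeasure lborel E \<le> emeasure lborel A" using that by (intro emeasure_mono) auto
    then have "emeasure lborel E \<noteq> \<infinity>" using fin by (auto simp: top_unique)
    then obtain l where l: "emeasure lborel E = ennreal l" "0 \<le> l" by (cases "emeasure lborel E") auto
    have "emeasure \<kappa> E \<noteq> \<infinity>" using \<kappa>_finite[of E] by (auto simp: top_unique)
    then obtain q where q: "emeasure \<kappa> E = ennreal q" "0 \<le> q" by (cases "emeasure \<kappa> E") auto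
    have "y * emeasure lborel E = (\<integral>\<^sup>+x. y * indicator E x \<partial>lborel)"
      by (simp add: nn_integral_cmult_indicator)
    also have "\<dots> \<le> (\<integral>\<^sup>+x. \<phi> x * indicator E x \<partial>lborel)"
      using y by (intro nn_integral_mono) (auto split: split_indicator)
    also have "\<dots> = emeasure \<nu> E" unfolding d[symmetric] by (simp add: emeasure_density)
    finally have 1: "ennreal r * ennreal l \<le> emeasure \<nu> E" by (simp add: r l)
    have "ennreal (2 * r) * (ennreal r * ennreal l) \<le> ennreal (2 * r) * emeasure \<nu> E"
      using 1 by (rule mult_left_mono) simp
    also have "\<dots> \<le> ennreal (r\<^sup>2) * ennreal l + ennreal q"
      using measure_ineq[of r E] r l q by simp
    finally have "2 * r * (r * l) \<le> r\<^sup>2 * l + q"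
      using r l q by (simp flip: ennreal_mult ennreal_plus)
    then have "r\<^sup>2 * l \<le> q" by (simp add: power2_eq_square algebra_simps)
    then show ?thesis using r l q by (simp add: ennreal_power flip: ennreal_mult)
  qed
  have "(\<lambda>x. \<phi> x * indicator A x) \<in> borel_measurable lborel" by measurable
  then obtain s where s': "incseq s" "\<forall>i. (\<forall>x. s i x < top) \<and> simple_function lborel (s i)"
      "(\<lambda>x. \<phi> x * indicator A x) = (SUP i. s i)"
    using borel_measurable_implies_simple_function_sequence by blast
  have s: "\<And>i. simple_function lborel (s i)" "incseq s" "\<And>i x. s i x < top"
      "\<And>x. (SUP i. s i x) = \<phi> x * indicator A x"
  proof -
    show "(SUP i. s i x) = \<phi> x * indicator A x" for x by (metis SUP_apply s'(3))
  qed (use s' in auto)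
  have [measurable]: "s i \<in> borel_measurable borel" for i
    using borel_measurable_simple_function[OF s(1)[of i]] by simp
  have le: "s i x \<le> \<phi> x * indicator A x" for i x unfolding s(4)[symmetric] by (rule SUP_upper) simp
  have simp_bound: "(\<integral>\<^sup>+x. (s i x)\<^sup>2 \<partial>lborel) \<le> emeasure \<kappa> A" for i
  proof -
    let ?R = "s i ` UNIV - {0}"
    have fin_R: "finite ?R" using simple_functionD(1)[OF s(1)[of i]] by simp
    define E where "E y = s i -` {y}" for y
    have Em [measurable]: "E y \<in> sets borel" for y
      using simple_functionD(2)[OF s(1)[of i], of "{y}"] by (simp add: E_def)
    have "(s i x)\<^sup>2 = (\<Sum>y\<in>?R. y\<^sup>2 * indicator (E y) x)" for x
    proof (cases "s i x = 0")
      case True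
      then have "y\<^sup>2 * indicator (E y) x = 0" if "y \<in> ?R" for y using that by (auto simp: E_def split: split_indicator)
      with True show ?thesis by simp
    next
      case False
      then have "(\<Sum>y\<in>?R. y\<^sup>2 * indicator (E y) x) = (\<Sum>y\<in>{s i x}. y\<^sup>2 * indicator (E y) x)"
        using fin_R by (intro sum.mono_neutral_right) (auto simp: E_def split: split_indicator)
      then show ?thesis by (simp add: E_def)
    qed
    then have "(\<integral>\<^sup>+x. (s i x)\<^sup>2 \<partial>lborel) = (\<Sum>y\<in>?R. y\<^sup>2 * emeasure lborel (E y))"
      by (simp add: nn_integral_sum nn_integral_cmult_indicator)
    also have "\<dots> \<le> (\<Sum>y\<in>?R. emeasure \<kappa> (E y))"
    proof (rule sum_mono)
      fix y assume "y \<in> ?R"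
      have inA: "x \<in> A \<and> y \<le> \<phi> x" if "x \<in> E y" for x
        using that le[of i x] \<open>y \<in> ?R\<close> by (cases "x \<in> A") (auto simp: E_def)
      show "y\<^sup>2 * emeasure lborel (E y) \<le> emeasure \<kappa> (E y)"
        using \<open>y \<in> ?R\<close> s(3) inA by (intro level) auto
    qed
    also have "\<dots> = emeasure \<kappa> (\<Union>y\<in>?R. E y)"
    proof (rule sum_emeasure)
      show "disjoint_family_on E ?R" by (auto simp: disjoint_family_on_def E_def)
      show "E ` ?R \<subseteq> sets \<kappa>" using Em by auto
    qed (rule fin_R)
    also have "\<dots> \<le> emeasure \<kappa> A"
    proof (rule emeasure_mono)
      show "(\<Union>y\<in>?R. E y) \<subseteq> A"
      proof
        fix x assume "x \<in> (\<Union>y\<in>?R. E y)"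
        then have "s i x \<noteq> 0" by (auto simp: E_def)
        with le[of i x] show "x \<in> A" by (cases "x \<in> A") auto
      qed
    qed simp
    finally show ?thesis .
  qed
  have lim: "(\<lambda>i. (s i x)\<^sup>2) \<longlonglongrightarrow> (\<phi> x)\<^sup>2 * indicator A x" for x
  proof -
    have "(\<lambda>i. s i x) \<longlonglongrightarrow> \<phi> x * indicator A x"
      using LIMSEQ_SUP[of "\<lambda>i. s i x"] s(2) unfolding s(4) by (auto simp: incseq_def le_fun_def)
    then have "(\<lambda>i. (s i x)\<^sup>2) \<longlonglongrightarrow> (\<phi> x * indicator A x)\<^sup>2"
      unfolding power2_eq_square by (intro tendsto_mult_ennreal) auto
    then show ?thesis by (cases "x \<in> A") (simp_all add: power2_eq_square)
  qed
  have "(\<lambda>i. \<integral>\<^sup>+x. (s i x)\<^sup>2 \<partial>lborel) \<longlonglongrightarrow> (\<integral>\<^sup>+x. (\<phi> x)\<^sup>2 * indicator A x \<partial>lborel)"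
    using s(2) lim by (intro nn_integral_LIMSEQ) (auto simp: incseq_def le_fun_def intro!: power_mono)
  then show ?thesis using simp_bound by (intro LIMSEQ_le_const2) auto
qed

text \<open>The Radon-Nikodym density is finite almost everywhere, because increments of
  \<open>F\<close> are finite, and can be replaced by a real function.\<close>

lemma density_real:
  obtains h where "h \<in> borel_measurable borel" "\<And>x. 0 \<le> h x"
    "\<And>x y. x \<le> y \<Longrightarrow> set_integrable lborel {x..y} h"
    "\<And>x y. x \<le> y \<Longrightarrow> (LINT t:{x..y}|lborel. h t) = F y - F x"
    "\<And>x y. x \<le> y \<Longrightarrow> set_integrable lborel {x..y} (\<lambda>t. (h t)\<^sup>2)"
    "\<And>x y. x \<le> y \<Longrightarrow> (LINT t:{x..y}|lborel. (h t)\<^sup>2) \<le> k y - k x"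
proof -
  obtain \<phi> where \<phi> [measurable]: "\<phi> \<in> borel_measurable borel" and d: "density lborel \<phi> = \<nu>"
    using sigma_finite_measure.Radon_Nikodym[OF sigma_finite_lborel absolutely_continuous_\<nu>] by auto
  have Ioc: "(\<integral>\<^sup>+t. \<phi> t * indicator {x<..y} t \<partial>lborel) = ennreal (F y - F x)" if "x \<le> y" for x y
  proof -
    have "emeasure \<nu> {x<..y} = ennreal (F y - F x)"
      by (rule emeasure_interval_measure_Ioc[OF that F_mono F_rc])
    then show ?thesis unfolding d[symmetric] by (simp add: emeasure_density)
  qed
  have "AE t in lborel. t \<in> {- real n<..real n} \<longrightarrow> \<phi> t \<noteq> \<infinity>" for n
  proof -
    have "AE t in lborel. \<phi> t * indicator {- real n<..real n} t \<noteq> \<infinity>"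
      by (rule nn_integral_PInf_AE) (use Ioc[of "- real n" "real n"] in auto)
    then show ?thesis by eventually_elim auto
  qed
  then have "AE t in lborel. \<forall>n. t \<in> {- real n<..real n} \<longrightarrow> \<phi> t \<noteq> \<infinity>"
    by (simp only: AE_all_countable) blast
  then have fin: "AE t in lborel. \<phi> t \<noteq> \<infinity>"
  proof eventually_elim
    case (elim t)
    obtain n where "\<bar>t\<bar> < real n" using reals_Archimedean2 by blast
    then have "t \<in> {- real n<..real n}" by auto
    with elim show ?case by blast
  qed
  define h where "h t = enn2real (\<phi> t)" for t
  have hm [measurable]: "h \<in> borel_measurable borel" unfolding h_def[abs_def] by measurable
  have h0: "0 \<le> h t" for t by (simp add: h_def)
  have h\<phi>: "AE t in lborel. \<phi> t = ennreal (h t)"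
    using fin by eventually_elim (simp add: h_def less_top)
  have null: "AE t in lborel. t \<noteq> x" for x :: real by (rule AE_lborel_singleton)
  have nn1: "(\<integral>\<^sup>+t. ennreal (indicator {x..y} t * h t) \<partial>lborel) = ennreal (F y - F x)" if "x \<le> y" for x y
  proof -
    have "(\<integral>\<^sup>+t. ennreal (indicator {x..y} t * h t) \<partial>lborel) = (\<integral>\<^sup>+t. \<phi> t * indicator {x<..y} t \<partial>lborel)"
      by (rule nn_integral_cong_AE) (use h\<phi> null[of x] in \<open>eventually_elim, auto split: split_indicator\<close>)
    with Ioc[OF that] show ?thesis by simp
  qed
  have nn2: "(\<integral>\<^sup>+t. ennreal (indicator {x..y} t * (h t)\<^sup>2) \<partial>lborel) \<le> ennreal (k y - k x)" if "x \<le> y" for x y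
  proof -
    have "(\<integral>\<^sup>+t. ennreal (indicator {x..y} t * (h t)\<^sup>2) \<partial>lborel) = (\<integral>\<^sup>+t. (\<phi> t)\<^sup>2 * indicator {x<..y} t \<partial>lborel)"
      by (rule nn_integral_cong_AE)
        (use h\<phi> null[of x] in \<open>eventually_elim, auto simp: ennreal_power h0 split: split_indicator\<close>)
    also have "\<dots> \<le> emeasure \<kappa> {x<..y}"
      using that by (intro density_square_bound[OF \<phi> d]) auto
    also have "\<dots> = ennreal (k y - k x)" by (rule emeasure_interval_measure_Ioc[OF that k_mono k_rc])
    finally show ?thesis .
  qed
  have i1: "set_integrable lborel {x..y} h" if "x \<le> y" for x y
    unfolding set_integrable_def using nn1[OF that] h0
    by (intro integrableI_bounded) (auto simp: abs_mult)
  have i2: "set_integrable lborel {x..y} (\<lambda>t. (h t)\<^sup>2)" if "x \<le> y" for x y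
    unfolding set_integrable_def using nn2[OF that]
    by (intro integrableI_bounded) (auto simp: abs_mult intro: le_less_trans)
  have e1: "(LINT t:{x..y}|lborel. h t) = F y - F x" if "x \<le> y" for x y
  proof -
    have "ennreal (LINT t:{x..y}|lborel. h t) = (\<integral>\<^sup>+t. ennreal (indicator {x..y} t * h t) \<partial>lborel)"
      using i1[OF that] h0 unfolding set_lebesgue_integral_def set_integrable_def
      by (simp add: nn_integral_eq_integral)
    then have "ennreal (LINT t:{x..y}|lborel. h t) = ennreal (F y - F x)" using nn1[OF that] by simp
    moreover have "0 \<le> (LINT t:{x..y}|lborel. h t)"
      unfolding set_lebesgue_integral_def using h0 by (intro integral_nonneg_AE) auto
    ultimately show ?thesis using F_mono[OF that] by simp
  qed
  have e2: "(LINT t:{x..y}|lborel. (h t)\<^sup>2) \<le> k y - k x" if "x \<le> y" for x y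
  proof -
    have "ennreal (LINT t:{x..y}|lborel. (h t)\<^sup>2) = (\<integral>\<^sup>+t. ennreal (indicator {x..y} t * (h t)\<^sup>2) \<partial>lborel)"
      using i2[OF that] unfolding set_lebesgue_integral_def set_integrable_def
      by (simp add: nn_integral_eq_integral)
    then have "ennreal (LINT t:{x..y}|lborel. (h t)\<^sup>2) \<le> ennreal (k y - k x)" using nn2[OF that] by simp
    then show ?thesis using k_mono[OF that] by (simp add: ennreal_le_iff)
  qed
  show thesis by (rule that[OF hm h0 i1 e1 i2 e2])
qed

end

text \<open>Root-free Cauchy-Schwarz for two summands, using 2 a b \<le> x1 k2 + x2 k1. It
  concatenates bounds across a jump of the weight, joins adjacent level bands and adds up
  edges.\<close>

lemma cauchy_schwarz_two:
  fixes a b :: real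
  assumes "a\<^sup>2 \<le> x1 * k1" "b\<^sup>2 \<le> x2 * k2" "0 \<le> x1" "0 \<le> x2" "0 \<le> k1" "0 \<le> k2"
  shows "(a + b)\<^sup>2 \<le> (x1 + x2) * (k1 + k2)"
proof -
  have "a\<^sup>2 * b\<^sup>2 \<le> (x1 * k1) * (x2 * k2)" by (rule mult_mono[OF assms(1,2)]) (use assms in simp_all)
  then have "(2 * (a * b))\<^sup>2 \<le> 4 * ((x1 * k1) * (x2 * k2))" by (simp add: power_mult_distrib)
  also have "\<dots> \<le> (x1 * k2 + x2 * k1)\<^sup>2"
    using zero_le_power2[of "x1 * k2 - x2 * k1"] by (simp add: power2_eq_square algebra_simps)
  finally have "2 * (a * b) \<le> x1 * k2 + x2 * k1"
    by (rule power2_le_imp_le) (use assms in simp)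
  then show ?thesis using assms(1,2) by (simp add: power2_eq_square algebra_simps)
qed

text \<open>The Riesz characterization of functions with square-integrable derivative, localized by
  \<kappa>. Since \<kappa> may jump, the Stieltjes argument runs with its right-continuous version
  \<open>k\<close>, and the bound by \<kappa> itself is recovered at the end.\<close>

lemma riesz_derivative:
  fixes f \<kappa> :: "real \<Rightarrow> real"
  assumes f: "\<And>x y. 0 \<le> x \<Longrightarrow> x \<le> y \<Longrightarrow> f y \<le> f x"
    and \<kappa>: "\<And>x y. 0 \<le> x \<Longrightarrow> x \<le> y \<Longrightarrow> \<kappa> x \<le> \<kappa> y" "\<And>x. 0 \<le> x \<Longrightarrow> 0 \<le> \<kappa> x" "\<And>x. 0 \<le> x \<Longrightarrow> \<kappa> x \<le> T"
    and H: "\<And>x y. 0 \<le> x \<Longrightarrow> x \<le> y \<Longrightarrow> (f x - f y)\<^sup>2 \<le> (y - x) * (\<kappa> y - \<kappa> x)"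
  obtains g where "ac_on {0..} f g" "\<And>x y. 0 \<le> x \<Longrightarrow> x \<le> y \<Longrightarrow> (LINT t:{x..y}|lborel. (g t)\<^sup>2) \<le> \<kappa> y - \<kappa> x"
proof -
  define F where "F x = - f (max 0 x)" for x
  \<comment> \<open>The right limit of \<kappa>, constant to the left of 0; it lies above \<kappa>
    at \<open>x\<close> and below \<kappa> at every later point.\<close>
  define k where "k x = Inf (\<kappa> ` {max 0 x<..})" for x
  have T0: "0 \<le> T" using \<kappa>(2)[of 0] \<kappa>(3)[of 0] by linarith
  have bdd: "bdd_below (\<kappa> ` {max 0 x<..})" for x
  proof (rule bdd_belowI2[of _ 0])
    fix y assume "y \<in> {max 0 x<..}"
    then have "0 \<le> y" by simp
    then show "0 \<le> \<kappa> y" by (rule \<kappa>(2))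
  qed
  have ne: "\<kappa> ` {max 0 x<..} \<noteq> {}" for x by simp
  have k_le: "k x \<le> \<kappa> y" if "max 0 x < y" for x y
    unfolding k_def by (rule cInf_lower[OF _ bdd]) (use that in simp)
  have k_ge: "\<kappa> (max 0 x) \<le> k x" for x
    unfolding k_def
  proof (rule cInf_greatest[OF ne])
    fix z assume "z \<in> \<kappa> ` {max 0 x<..}"
    then obtain y where y: "z = \<kappa> y" "max 0 x < y" by auto
    show "\<kappa> (max 0 x) \<le> z" unfolding y(1) by (rule \<kappa>(1)) (use y(2) in simp_all)
  qed
  have k_mono: "k x \<le> k y" if "x \<le> y" for x y
    unfolding k_def by (rule cInf_superset_mono[OF ne bdd image_mono]) (use that in auto)
  have k_approx: "\<exists>y > max 0 x. \<kappa> y < k x + e" if "e > 0" for x e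
  proof -
    have "Inf (\<kappa> ` {max 0 x<..}) < k x + e" using that by (simp add: k_def)
    then obtain z where "z \<in> \<kappa> ` {max 0 x<..}" "z < k x + e" using cInf_less_iff[OF ne bdd] by blast
    then show ?thesis by auto
  qed
  have F_mono: "F x \<le> F y" if "x \<le> y" for x y unfolding F_def using that by (simp add: f)
  have F_cont: "isCont F x" for x
  proof -
    have sq: "(F y - F x)\<^sup>2 \<le> \<bar>y - x\<bar> * T" for y
    proof -
      have *: "(F b - F a)\<^sup>2 \<le> (b - a) * T" if "a \<le> b" for a b
      proof -
        have "(F b - F a)\<^sup>2 \<le> (max 0 b - max 0 a) * (\<kappa> (max 0 b) - \<kappa> (max 0 a))"
          using H[of "max 0 a" "max 0 b"] that by (auto simp: F_def)
        also have "\<dots> \<le> (b - a) * T"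
        proof (intro mult_mono)
          show "\<kappa> (max 0 b) - \<kappa> (max 0 a) \<le> T" using \<kappa>(3)[of "max 0 b"] \<kappa>(2)[of "max 0 a"] by auto
          show "0 \<le> \<kappa> (max 0 b) - \<kappa> (max 0 a)" using \<kappa>(1)[of "max 0 a" "max 0 b"] that by auto
        qed (use that in auto)
        finally show ?thesis .
      qed
      show ?thesis
      proof (cases "x \<le> y")
        case True with *[of x y] show ?thesis by simp
      next
        case False with *[of y x] show ?thesis by (simp add: power2_commute[of "F y" "F x"])
      qed
    qed
    have le: "norm (F y - F x) \<le> sqrt (\<bar>y - x\<bar> * T)" for y
      using real_sqrt_le_mono[OF sq[of y]] by simp
    have "isCont (\<lambda>y. sqrt (\<bar>y - x\<bar> * T)) x" by (intro continuous_intros)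
    then have lim: "((\<lambda>y. sqrt (\<bar>y - x\<bar> * T)) \<longlongrightarrow> 0) (at x)" by (simp add: isCont_def)
    have "((\<lambda>y. F y - F x) \<longlongrightarrow> 0) (at x)"
      by (rule Lim_null_comparison[OF always_eventually lim]) (use le in blast)
    then show ?thesis unfolding isCont_def by (rule LIM_zero_cancel)
  qed
  interpret riesz_energy F k T
  proof
    show "continuous (at_right a) F" for a using F_cont continuous_at_imp_continuous_within by blast
    show "0 \<le> k x" for x using k_ge[of x] \<kappa>(2)[of "max 0 x"] by auto
    show "k x \<le> T" for x using k_le[of x "max 0 x + 1"] \<kappa>(3)[of "max 0 x + 1"] by auto
    show "continuous (at_right a) k" for a
      unfolding continuous_within
    proof (rule order_tendstoI)
      fix b assume "b < k a"
      then show "\<forall>\<^sub>F x in at_right a. b < k x"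
        using k_mono by (auto simp: eventually_at_filter intro!: always_eventually less_le_trans[of b "k a"])
    next
      fix b assume "k a < b"
      then obtain y where y: "y > max 0 a" "\<kappa> y < b" using k_approx[of "b - k a" a] by auto
      have "k x < b" if "x < y" for x using k_le[of x y] that y by auto
      then show "\<forall>\<^sub>F x in at_right a. k x < b"
        using y by (auto simp: eventually_at_right_field intro!: exI[of _ y])
    qed
    show "2 * t * (F y - F x) \<le> t\<^sup>2 * (y - x) + (k y - k x)" if t: "0 \<le> t" and xy: "x \<le> y" for t x y
    proof (rule field_le_epsilon)
      fix e :: real assume e: "e > 0"
      \<comment> \<open>Both endpoints are moved right by a small h, where \<kappa>(x + h) \<ge> k x
        and \<kappa>(y + h) \<le> \<kappa> z < k y + e/2. Continuity of \<open>F\<close> absorbs the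
        shift in the other half of e.\<close>
      let ?x = "max 0 x" and ?y = "max 0 y"
      obtain z where z: "z > ?y" "\<kappa> z < k y + e / 2" using k_approx[of "e / 2" y] e by auto
      have ev1: "\<forall>\<^sub>F h in at_right 0. h < z - ?y"
        unfolding eventually_at_right_field using z(1) by (intro exI[of _ "z - ?y"]) simp
      have "((\<lambda>h. 2 * t * (F (?y + h) - F (?x + h))) \<longlongrightarrow> 2 * t * (F ?y - F ?x)) (at_right 0)"
      proof -
        have "((\<lambda>h. F (c + h)) \<longlongrightarrow> F c) (at_right 0)" for c
        proof -
          have "((\<lambda>h. c + h) \<longlongrightarrow> c + 0) (at_right 0)" by (intro tendsto_intros)
          then show ?thesis using isCont_tendsto_compose[OF F_cont[of c]] by simp
        qed
        then show ?thesis by (intro tendsto_intros)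
      qed
      then have ev2: "\<forall>\<^sub>F h in at_right 0. 2 * t * (F ?y - F ?x) - e / 2 < 2 * t * (F (?y + h) - F (?x + h))"
        using e by (intro order_tendstoD(1)) auto
      have "\<forall>\<^sub>F h :: real in at_right 0. 0 < h" by (simp add: eventually_at_right_less)
      with ev1 ev2 have "\<forall>\<^sub>F h in at_right 0. h < z - ?y \<and> 0 < h \<and>
          2 * t * (F ?y - F ?x) - e / 2 < 2 * t * (F (?y + h) - F (?x + h))"
        by eventually_elim auto
      then obtain h where h: "h < z - ?y" "0 < h"
          "2 * t * (F ?y - F ?x) - e / 2 < 2 * t * (F (?y + h) - F (?x + h))"
        using eventually_happens[of _ "at_right (0::real)"] by force
      let ?K = "\<kappa> (?y + h) - \<kappa> (?x + h)" and ?D = "F (?y + h) - F (?x + h)"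
      have K0: "0 \<le> ?K" using \<kappa>(1)[of "?x + h" "?y + h"] h xy by auto
      have D: "?D\<^sup>2 \<le> (?y - ?x) * ?K" "0 \<le> ?D"
        using H[of "?x + h" "?y + h"] F_mono[of "?x + h" "?y + h"] h xy by (auto simp: F_def max_def)
      have "2 * t * ?D \<le> t\<^sup>2 * (?y - ?x) + ?K"
      proof (cases "?y = ?x")
        case True then show ?thesis using K0 by simp
      next
        case False
        then have p: "0 < ?y - ?x" using xy by auto
        \<comment> \<open>Completing the square linearises the product bound on the
          increment.\<close>
        have "0 \<le> (t * (?y - ?x) - ?D)\<^sup>2" by simp
        then have "2 * t * ?D * (?y - ?x) \<le> t\<^sup>2 * (?y - ?x) * (?y - ?x) + ?D\<^sup>2"
          by (simp add: power2_eq_square algebra_simps)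
        also have "\<dots> \<le> (t\<^sup>2 * (?y - ?x) + ?K) * (?y - ?x)" using D(1) by (simp add: algebra_simps)
        finally show ?thesis by (rule mult_right_le_imp_le) (rule p)
      qed
      moreover have "?K \<le> k y + e / 2 - k x"
        using \<kappa>(1)[of "?y + h" z] h z k_le[of x "?x + h"] by auto
      moreover have "t\<^sup>2 * (?y - ?x) \<le> t\<^sup>2 * (y - x)" using xy by (intro mult_left_mono) auto
      moreover have "F ?y = F y" "F ?x = F x" by (auto simp: F_def)
      ultimately show "2 * t * (F y - F x) \<le> t\<^sup>2 * (y - x) + (k y - k x) + e"
        using h(3) by auto
    qed
  qed (use F_mono k_mono in auto)
  obtain h where h: "h \<in> borel_measurable borel" "\<And>x. 0 \<le> h x"
    "\<And>x y. x \<le> y \<Longrightarrow> set_integrable lborel {x..y} h"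
    "\<And>x y. x \<le> y \<Longrightarrow> (LINT t:{x..y}|lborel. h t) = F y - F x"
    "\<And>x y. x \<le> y \<Longrightarrow> set_integrable lborel {x..y} (\<lambda>t. (h t)\<^sup>2)"
    "\<And>x y. x \<le> y \<Longrightarrow> (LINT t:{x..y}|lborel. (h t)\<^sup>2) \<le> k y - k x"
    using density_real by blast
  \<comment> \<open>For z < y the increment of \<open>k\<close> over [x,z] is at most that of
    \<kappa> over [x,y]; letting z increase to \<open>y\<close> returns to \<kappa> without
    right-continuity.\<close>
  have sq: "(LINT t:{x..y}|lborel. (h t)\<^sup>2) \<le> \<kappa> y - \<kappa> x" if "0 \<le> x" "x \<le> y" for x y
  proof (cases "x = y")
    case True
    then show ?thesis using h(6)[of x y] by simp
  next
    case False
    then have xy: "x < y" using that by simp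
    have lt: "(LINT t:{x..z}|lborel. (h t)\<^sup>2) \<le> \<kappa> y - \<kappa> x" if "z \<in> {x<..<y}" for z
      using h(6)[of x z] k_le[of z y] k_ge[of x] that \<open>0 \<le> x\<close> by auto
    define e where "e n = (y - x) / real (n + 2)" for n
    have e: "0 < e n" "e n < y - x" for n
    proof -
      show "0 < e n" using xy by (simp add: e_def)
      have "(y - x) / real (n + 2) < (y - x) / 1" using xy by (intro divide_strict_left_mono) auto
      then show "e n < y - x" by (simp add: e_def)
    qed
    have e0: "e \<longlonglongrightarrow> 0"
      unfolding e_def[abs_def] using LIMSEQ_ignore_initial_segment[OF lim_const_over_n[of "y - x"], of 2] by simp
    have "(\<lambda>n. LINT t:{x..y - e n}|lborel. (h t)\<^sup>2) \<longlonglongrightarrow> (LINT t:(\<Union>n. {x..y - e n})|lborel. (h t)\<^sup>2)"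
    proof (rule set_integral_cont_up)
      have "e (Suc n) \<le> e n" for n unfolding e_def using xy by (intro divide_left_mono) auto
      then show "incseq (\<lambda>n. {x..y - e n})" by (intro incseq_SucI) (simp add: atLeastatMost_subset_iff)
      have "(\<Union>n. {x..y - e n}) \<subseteq> {x..y}"
      proof (rule UN_least)
        show "{x..y - e n} \<subseteq> {x..y}" for n using e(1)[of n] by auto
      qed
      then show "set_integrable lborel (\<Union>n. {x..y - e n}) (\<lambda>t. (h t)\<^sup>2)"
        using that by (intro set_integrable_subset[OF h(5)[of x y]]) auto
    qed auto
    moreover have "(LINT t:{x..y - e n}|lborel. (h t)\<^sup>2) \<le> \<kappa> y - \<kappa> x" for n
      using e[of n] by (intro lt) auto
    ultimately have "(LINT t:(\<Union>n. {x..y - e n})|lborel. (h t)\<^sup>2) \<le> \<kappa> y - \<kappa> x"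
      by (intro LIMSEQ_le_const2) auto
    also have "(\<Union>n. {x..y - e n}) = {x..<y}"
    proof
      show "(\<Union>n. {x..y - e n}) \<subseteq> {x..<y}"
      proof (rule UN_least)
        show "{x..y - e n} \<subseteq> {x..<y}" for n using e(1)[of n] by auto
      qed
      show "{x..<y} \<subseteq> (\<Union>n. {x..y - e n})"
      proof
        fix t assume t: "t \<in> {x..<y}"
        then have "\<forall>\<^sub>F n in sequentially. e n < y - t"
          using e0 by (intro order_tendstoD(2)[of e 0]) auto
        then obtain n where "e n < y - t" by (auto simp: eventually_sequentially)
        then show "t \<in> (\<Union>n. {x..y - e n})" using t by (intro UN_I[of n]) auto
      qed
    qed
    also have "(LINT t:{x..<y}|lborel. (h t)\<^sup>2) = (LINT t:{x..y}|lborel. (h t)\<^sup>2)"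
      unfolding set_lebesgue_integral_def
      by (rule integral_discrete_difference[of "{y}"]) (auto split: split_indicator)
    finally show ?thesis .
  qed
  have "set_integrable lborel (\<Union>n. {0..real n}) (\<lambda>t. (h t)\<^sup>2)"
  proof -
    have mono: "incseq (\<lambda>n. LINT t:{0..real n}|lborel. (h t)\<^sup>2)"
    proof (rule incseq_SucI)
      show "(LINT t:{0..real n}|lborel. (h t)\<^sup>2) \<le> (LINT t:{0..real (Suc n)}|lborel. (h t)\<^sup>2)" for n
        by (rule set_integral_mono_set[OF h(5)]) auto
    qed
    moreover have "(LINT t:{0..real n}|lborel. (h t)\<^sup>2) \<le> T" for n
      using sq[of 0 "real n"] \<kappa>(2)[of 0] \<kappa>(3)[of "real n"] by auto
    ultimately obtain l where "(\<lambda>n. LINT t:{0..real n}|lborel. (h t)\<^sup>2) \<longlonglongrightarrow> l"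
      by (metis incseq_convergent)
    then show ?thesis by (intro pos_integrable_to_top) (auto intro!: h(5) simp: mono_def)
  qed
  also have "(\<Union>n. {0..real n}) = {0..}"
    using real_arch_simple by auto
  finally have "set_integrable lborel {0..} (\<lambda>t. (h t)\<^sup>2)" .
  then have "L2_on {0..} (\<lambda>t. - h t)"
    unfolding L2_on_def set_borel_measurable_def using h(1) by auto
  moreover have "f y - f x = (LINT t:{x..y}|lborel. - h t)" if "0 \<le> x" "x \<le> y" for x y
    using h(4)[OF that(2)] set_integral_uminus[OF h(3)[OF that(2)]] that by (simp add: F_def)
  ultimately have "ac_on {0..} f (\<lambda>t. - h t)" by (auto simp: ac_on_def)
  then show thesis using that[of "\<lambda>t. - h t"] sq by simp
qed

text \<open>Dividing the increments of \<kappa> by the local weight reduces to the unweighted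
  criterion; intervals straddling \<open>l\<close> are split there and recombined by
  \<open>cauchy_schwarz_two\<close>.\<close>

lemma weighted_riesz:
  fixes f \<kappa> :: "real \<Rightarrow> real"
  assumes f: "\<And>x y. 0 \<le> x \<Longrightarrow> x \<le> y \<Longrightarrow> f y \<le> f x"
    and \<kappa>: "\<And>x y. 0 \<le> x \<Longrightarrow> x \<le> y \<Longrightarrow> \<kappa> x \<le> \<kappa> y" "\<And>x. 0 \<le> x \<Longrightarrow> 0 \<le> \<kappa> x" "\<And>x. 0 \<le> x \<Longrightarrow> \<kappa> x \<le> T"
    and pos: "0 < \<alpha>" "0 < \<gamma>" "0 \<le> l"
    and H1: "\<And>x y. 0 \<le> x \<Longrightarrow> x \<le> y \<Longrightarrow> y \<le> l \<Longrightarrow> \<alpha> * (f x - f y)\<^sup>2 \<le> (y - x) * (\<kappa> y - \<kappa> x)"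
    and H2: "\<And>x y. l \<le> x \<Longrightarrow> x \<le> y \<Longrightarrow> \<gamma> * (f x - f y)\<^sup>2 \<le> (y - x) * (\<kappa> y - \<kappa> x)"
  obtains g where "ac_on {0..} f g"
    "\<alpha> * (LINT t:{0..l}|lborel. (g t)\<^sup>2) + \<gamma> * (LINT t:{l..}|lborel. (g t)\<^sup>2) \<le> T"
proof -
  define K where "K x = \<kappa> (min x l) / \<alpha> + (\<kappa> (max x l) - \<kappa> l) / \<gamma>" for x
  have K: "K x \<le> K y" if "0 \<le> x" "x \<le> y" for x y
    unfolding K_def using that pos by (intro add_mono divide_right_mono diff_mono \<kappa>) auto
  have K0: "0 \<le> K x" if "0 \<le> x" for x
    unfolding K_def using that pos \<kappa>(1)[of l "max x l"] by (intro add_nonneg_nonneg divide_nonneg_pos \<kappa>) auto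
  have KT: "K x \<le> T / \<alpha> + T / \<gamma>" if "0 \<le> x" for x
    unfolding K_def
  proof (intro add_mono divide_right_mono)
    have "0 \<le> max x l" using that by simp
    then show "\<kappa> (max x l) - \<kappa> l \<le> T" using \<kappa>(3)[of "max x l"] \<kappa>(2)[of l] pos by simp
  qed (use that pos \<kappa>(3) in auto)
  have left: "(f x - f y)\<^sup>2 \<le> (y - x) * ((\<kappa> y - \<kappa> x) / \<alpha>)" if "0 \<le> x" "x \<le> y" "y \<le> l" for x y
    using H1[OF that] pos by (simp add: field_simps)
  have right: "(f x - f y)\<^sup>2 \<le> (y - x) * ((\<kappa> y - \<kappa> x) / \<gamma>)" if "l \<le> x" "x \<le> y" for x y
    using H2[OF that] pos by (simp add: field_simps)
  have H: "(f x - f y)\<^sup>2 \<le> (y - x) * (K y - K x)" if xy: "0 \<le> x" "x \<le> y" for x y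
  proof -
    consider "y \<le> l" | "l \<le> x" | "x \<le> l" "l \<le> y" by linarith
    then show ?thesis
    proof cases
      case 1
      with left[OF xy 1] xy show ?thesis by (simp add: K_def diff_divide_distrib)
    next
      case 2
      with right[OF 2 xy(2)] xy show ?thesis by (simp add: K_def diff_divide_distrib)
    next
      case 3
      have "(f x - f l + (f l - f y))\<^sup>2 \<le> ((l - x) + (y - l)) * ((\<kappa> l - \<kappa> x) / \<alpha> + (\<kappa> y - \<kappa> l) / \<gamma>)"
        using left[of x l] right[of l y] 3 xy pos \<kappa>(1)[of x l] \<kappa>(1)[of l y]
        by (intro cauchy_schwarz_two) auto
      moreover have "K y - K x = (\<kappa> l - \<kappa> x) / \<alpha> + (\<kappa> y - \<kappa> l) / \<gamma>"
        using 3 by (simp add: K_def diff_divide_distrib)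
      ultimately show ?thesis by simp
    qed
  qed
  obtain g where g: "ac_on {0..} f g" "\<And>x y. 0 \<le> x \<Longrightarrow> x \<le> y \<Longrightarrow> (LINT t:{x..y}|lborel. (g t)\<^sup>2) \<le> K y - K x"
    using riesz_derivative[OF f K K0 KT H] by blast
  \<comment> \<open>The two sides of \<open>l\<close> are bounded by \<kappa> l - \<kappa> 0 and T -
    \<kappa> l, which telescope to at most T; the cruder bound \<open>KT\<close> on \<open>K\<close>
    would not.\<close>
  have 1: "\<alpha> * (LINT t:{0..l}|lborel. (g t)\<^sup>2) \<le> \<kappa> l - \<kappa> 0"
    using g(2)[of 0 l] pos by (simp add: K_def field_simps)
  have "\<gamma> * (LINT t:{l..l + real n}|lborel. (g t)\<^sup>2) \<le> T - \<kappa> l" for n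
  proof -
    have "(LINT t:{l..l + real n}|lborel. (g t)\<^sup>2) \<le> (\<kappa> (l + real n) - \<kappa> l) / \<gamma>"
      using g(2)[of l "l + real n"] pos by (simp add: K_def)
    then have "\<gamma> * (LINT t:{l..l + real n}|lborel. (g t)\<^sup>2) \<le> \<kappa> (l + real n) - \<kappa> l"
      using pos by (simp add: pos_le_divide_eq mult.commute)
    with \<kappa>(3)[of "l + real n"] pos show ?thesis by simp
  qed
  moreover have "(\<lambda>n. LINT t:{l..l + real n}|lborel. (g t)\<^sup>2) \<longlonglongrightarrow> (LINT t:(\<Union>n. {l..l + real n})|lborel. (g t)\<^sup>2)"
  proof (rule set_integral_cont_up)
    show "set_integrable lborel (\<Union>n. {l..l + real n}) (\<lambda>t. (g t)\<^sup>2)"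
      by (rule set_integrable_subset[OF L2_onD(2)[OF ac_onD(1)[OF g(1)]]]) (use pos in auto)
  qed (auto simp: incseq_def)
  moreover have "(\<Union>n. {l..l + real n}) = {l..}"
  proof -
    have "\<exists>n. x \<le> l + real n" for x using real_arch_simple[of "x - l"] by (auto simp: algebra_simps)
    then show ?thesis by auto
  qed
  ultimately have "\<gamma> * (LINT t:{l..}|lborel. (g t)\<^sup>2) \<le> T - \<kappa> l"
    by (intro LIMSEQ_le_const2[of "\<lambda>n. \<gamma> * (LINT t:{l..l + real n}|lborel. (g t)\<^sup>2)"] tendsto_mult_left) auto
  with 1 \<kappa>(2)[of 0] show thesis by (intro that[OF g(1)]) linarith
qed

section \<open>The weighted problem on the halfline\<close>

lemma powr_le_square:
  fixes y M p :: real
  assumes "0 \<le> y" "y \<le> M" "2 < p"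
  shows "y powr p \<le> M powr (p - 2) * y\<^sup>2"
proof (cases "y = 0")
  case False
  with assms have y: "0 < y" by simp
  have "y powr p = y powr (p - 2) * y powr 2" by (simp flip: powr_add)
  also have "\<dots> = y powr (p - 2) * y\<^sup>2" using y by simp
  also have "\<dots> \<le> M powr (p - 2) * y\<^sup>2"
    using assms by (intro mult_right_mono powr_mono2) auto
  finally show ?thesis .
qed simp

lemma L2_on_powr_integrable:
  fixes u :: "real \<Rightarrow> real"
  assumes u: "L2_on I u" and M: "\<And>x. x \<in> I \<Longrightarrow> \<bar>u x\<bar> \<le> M" and p: "2 < p" and I: "I \<in> sets lborel"
  shows "set_integrable lborel I (\<lambda>x. \<bar>u x\<bar> powr p)"
    and "(LINT x:I|lborel. \<bar>u x\<bar> powr p) \<le> M powr (p - 2) * (LINT x:I|lborel. (u x)\<^sup>2)"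
proof -
  have le: "\<bar>u x\<bar> powr p \<le> M powr (p - 2) * (u x)\<^sup>2" if "x \<in> I" for x
    using powr_le_square[of "\<bar>u x\<bar>" M p] M[OF that] p by simp
  have [measurable]: "(\<lambda>x. indicator I x * u x) \<in> borel_measurable borel"
    using L2_on_indicator_measurable[OF u] by simp
  have [measurable]: "I \<in> sets borel" using I by simp
  have "(\<lambda>x. indicator I x * \<bar>indicator I x * u x\<bar> powr p) \<in> borel_measurable borel" by measurable
  also have "(\<lambda>x. indicator I x * \<bar>indicator I x * u x\<bar> powr p) = (\<lambda>x. indicator I x * \<bar>u x\<bar> powr p)"
    by (auto split: split_indicator)
  finally have m: "set_borel_measurable lborel I (\<lambda>x. \<bar>u x\<bar> powr p)"
    by (simp add: set_borel_measurable_def)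
  have int: "set_integrable lborel I (\<lambda>x. M powr (p - 2) * (u x)\<^sup>2)"
    using L2_onD(2)[OF u] by simp
  show i: "set_integrable lborel I (\<lambda>x. \<bar>u x\<bar> powr p)"
    by (rule set_integrable_bound[OF int m]) (use le in \<open>auto intro!: AE_I2\<close>)
  have "(LINT x:I|lborel. \<bar>u x\<bar> powr p) \<le> (LINT x:I|lborel. M powr (p - 2) * (u x)\<^sup>2)"
    by (rule set_integral_mono[OF i int]) (rule le)
  then show "(LINT x:I|lborel. \<bar>u x\<bar> powr p) \<le> M powr (p - 2) * (LINT x:I|lborel. (u x)\<^sup>2)"
    by simp
qed

lemma set_integral_nonneg':
  fixes f :: "real \<Rightarrow> real"
  assumes "\<And>x. x \<in> A \<Longrightarrow> 0 \<le> f x"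
  shows "0 \<le> (LINT x:A|lborel. f x)"
  unfolding set_lebesgue_integral_def using assms
  by (intro integral_nonneg_AE AE_I2) (auto split: split_indicator)

text \<open>The derivative is carried along as a second component, so that energies are integrals of
  a named function rather than of a choice.\<close>

definition decr_pair :: "(real \<Rightarrow> real) \<Rightarrow> (real \<Rightarrow> real) \<Rightarrow> bool" where
  "decr_pair f g \<longleftrightarrow> (\<forall>x\<ge>0. 0 \<le> f x) \<and> (\<forall>x y. 0 \<le> x \<longrightarrow> x \<le> y \<longrightarrow> f y \<le> f x)
     \<and> L2_on {0..} f \<and> ac_on {0..} f g"

definition mass :: "(real \<Rightarrow> real) \<Rightarrow> real" where
  "mass f = (LINT x:{0..}|lborel. (f x)\<^sup>2)"

definition kin :: "real \<Rightarrow> real \<Rightarrow> real \<Rightarrow> (real \<Rightarrow> real) \<Rightarrow> real" where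
  "kin \<alpha> \<gamma> l g = \<alpha> * (LINT x:{0..l}|lborel. (g x)\<^sup>2) + \<gamma> * (LINT x:{l..}|lborel. (g x)\<^sup>2)"

definition pot :: "real \<Rightarrow> (real \<Rightarrow> real) \<Rightarrow> real" where
  "pot p f = (LINT x:{0..}|lborel. \<bar>f x\<bar> powr p)"

text \<open>With weights 4, 4 this is the energy on the line of f(2|x|), which has the same mass as
  \<open>f\<close>; with weights 1, 9 it is the energy on the graph of the profile folded at
  \<open>l\<close>.\<close>

definition wenergy :: "real \<Rightarrow> real \<Rightarrow> real \<Rightarrow> real \<Rightarrow> (real \<Rightarrow> real) \<Rightarrow> (real \<Rightarrow> real) \<Rightarrow> real" where
  "wenergy p \<alpha> \<gamma> l f g = kin \<alpha> \<gamma> l g / 2 - pot p f / p"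

lemma decr_pairD:
  assumes "decr_pair f g"
  shows "\<And>x. 0 \<le> x \<Longrightarrow> 0 \<le> f x" "\<And>x y. 0 \<le> x \<Longrightarrow> x \<le> y \<Longrightarrow> f y \<le> f x"
    "L2_on {0..} f" "ac_on {0..} f g"
  using assms by (auto simp: decr_pair_def)

lemma decr_pair_abs_le:
  assumes "decr_pair f g" "0 \<le> x"
  shows "\<bar>f x\<bar> \<le> f 0"
  using decr_pairD(1)[OF assms] decr_pairD(2)[OF assms(1), of 0 x] assms(2) by simp

lemma mass_nonneg [simp]: "0 \<le> mass f"
  by (simp add: mass_def)

lemma pot_nonneg [simp]: "0 \<le> pot p f"
  unfolding pot_def by (rule set_integral_nonneg') simp

lemma decr_pair_deriv_integrable:
  assumes "decr_pair f g" "0 \<le> l"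
  shows "set_integrable lborel {0..} (\<lambda>x. (g x)\<^sup>2)" "set_integrable lborel {0..l} (\<lambda>x. (g x)\<^sup>2)"
    "set_integrable lborel {l..} (\<lambda>x. (g x)\<^sup>2)"
proof -
  show i: "set_integrable lborel {0..} (\<lambda>x. (g x)\<^sup>2)"
    using decr_pairD(4)[OF assms(1)] by (auto dest!: ac_onD(1) L2_onD(2))
  show "set_integrable lborel {0..l} (\<lambda>x. (g x)\<^sup>2)" "set_integrable lborel {l..} (\<lambda>x. (g x)\<^sup>2)"
    using assms(2) by (auto intro!: set_integrable_subset[OF i])
qed

lemma kin_ge:
  assumes "decr_pair f g" "0 \<le> l" "c \<le> \<alpha>" "c \<le> \<gamma>"
  shows "c * (LINT x:{0..}|lborel. (g x)\<^sup>2) \<le> kin \<alpha> \<gamma> l g"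
proof -
  have "c * (LINT x:{0..}|lborel. (g x)\<^sup>2) = c * (LINT x:{0..l}|lborel. (g x)\<^sup>2) + c * (LINT x:{l..}|lborel. (g x)\<^sup>2)"
    using set_integral_Ici_split[OF decr_pair_deriv_integrable(1)[OF assms(1,2)] assms(2)]
    by (simp add: algebra_simps)
  also have "\<dots> \<le> kin \<alpha> \<gamma> l g"
    unfolding kin_def using assms(3,4) by (intro add_mono mult_right_mono) simp_all
  finally show ?thesis .
qed

lemma decr_pair_pot_le:
  assumes "decr_pair f g" "2 < p"
  shows "pot p f \<le> f 0 powr (p - 2) * mass f"
  unfolding pot_def mass_def
  by (rule L2_on_powr_integrable(2)[OF decr_pairD(3)[OF assms(1)] _ assms(2)])
    (use decr_pair_abs_le[OF assms(1)] in auto)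

text \<open>By monotonicity the interval [0,x] alone carries mass x (f x)^2. This pointwise decay is
  the source of compactness.\<close>

lemma decr_pair_tail:
  assumes "decr_pair f g" "0 \<le> x"
  shows "x * (f x)\<^sup>2 \<le> mass f"
proof -
  have "x * (f x)\<^sup>2 = (LINT t:{0..x}|lborel. (f x)\<^sup>2)"
    using assms(2) by (simp add: set_integral_const)
  also have "\<dots> \<le> (LINT t:{0..x}|lborel. (f t)\<^sup>2)"
  proof (rule set_integral_mono)
    show "set_integrable lborel {0..x} (\<lambda>t. (f x)\<^sup>2)"
      by (rule set_integrable_const_fin[OF _ emeasure_lborel_Icc_finite]) simp
    show "set_integrable lborel {0..x} (\<lambda>t. (f t)\<^sup>2)"
      using set_integrable_subset[OF L2_onD(2)[OF decr_pairD(3)[OF assms(1)]], of "{0..x}"] by auto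
    show "(f x)\<^sup>2 \<le> (f t)\<^sup>2" if "t \<in> {0..x}" for t
    proof (rule power_mono)
      show "f x \<le> f t" using that by (intro decr_pairD(2)[OF assms(1)]) auto
      show "0 \<le> f x" using decr_pairD(1)[OF assms] .
    qed
  qed
  also have "\<dots> \<le> mass f"
    unfolding mass_def by (rule set_integral_mono_set[OF L2_onD(2)[OF decr_pairD(3)[OF assms(1)]]]) auto
  finally show ?thesis .
qed

text \<open>A Gagliardo-Nirenberg bound on the maximum: mass limits how long the profile can stay
  high, and energy limits how fast it can drop.\<close>

lemma decr_pair_sup_bound:
  assumes "decr_pair f g"
  shows "(f 0)^4 \<le> 16 * mass f * (LINT x:{0..}|lborel. (g x)\<^sup>2)"
proof -
  let ?K = "LINT x:{0..}|lborel. (g x)\<^sup>2"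
  have f0: "0 \<le> f 0" using decr_pairD(1)[OF assms] by simp
  show ?thesis
  proof (cases "mass f = 0 \<or> f 0 = 0")
    case True
    have "f 0 = 0"
    proof (rule ccontr)
      assume nz: "f 0 \<noteq> 0"
      then have m: "mass f = 0" using True by simp
      have "f x = 0" if "0 < x" for x
        using decr_pair_tail[OF assms, of x] that m by (simp add: mult_le_0_iff)
      moreover have "continuous_on {0..} f" using ac_on_continuous_on[OF decr_pairD(4)[OF assms]] by simp
      then have "(f \<longlongrightarrow> f 0) (at 0 within {0..})" by (simp add: continuous_on_def)
      then have "(f \<longlongrightarrow> f 0) (at_right 0)" by (rule tendsto_within_subset) auto
      moreover have "\<forall>\<^sub>F x in at_right 0. f x = 0"
        using calculation(1) by (simp add: eventually_at_right_field) (meson zero_less_one)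
      ultimately have "f 0 = 0"
        using tendsto_unique[of "at_right (0::real)" f "f 0" 0] tendsto_eventually[of f 0 "at_right 0"] by simp
      with nz show False by simp
    qed
    then show ?thesis by (simp add: mass_nonneg)
  next
    case False
    then have M: "0 < f 0" and m: "0 < mass f" using f0 mass_nonneg[of f] by linarith+
    \<comment> \<open>By \<open>decr_pair_tail\<close> the profile has fallen to at most half its
      maximum at distance \<open>d\<close>.\<close>
    define d where "d = 4 * mass f / (f 0)\<^sup>2"
    have d: "0 < d" using M m by (simp add: d_def)
    have "d * (f d)\<^sup>2 \<le> mass f" using decr_pair_tail[OF assms, of d] d by simp
    then have fd: "(f d)\<^sup>2 \<le> (f 0)\<^sup>2 / 4" using M m by (simp add: d_def field_simps)
    have "(f d - f 0)\<^sup>2 \<le> d * (LINT t:{0..d}|lborel. (g t)\<^sup>2)"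
      using ac_on_hoelder[OF decr_pairD(4)[OF assms], of 0 d] d by simp
    also have "\<dots> \<le> d * ?K"
      using d by (intro mult_left_mono set_integral_mono_set[OF decr_pair_deriv_integrable(1)[OF assms order_refl]]) auto
    finally have h: "(f d - f 0)\<^sup>2 \<le> d * ?K" .
    have "(f 0)\<^sup>2 \<le> 2 * (f d)\<^sup>2 + 2 * (f d - f 0)\<^sup>2"
      using zero_le_power2[of "f 0 - 2 * f d"] by (simp add: power2_eq_square algebra_simps)
    with fd h have "(f 0)\<^sup>2 / 2 \<le> 2 * (d * ?K)" by linarith
    then have "(f 0)\<^sup>2 * ((f 0)\<^sup>2 / 2) \<le> (f 0)\<^sup>2 * (2 * (d * ?K))" by (intro mult_left_mono) auto
    also have "\<dots> = 8 * mass f * ?K" using M by (simp add: d_def)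
    finally show ?thesis by (simp add: power2_eq_square power4_eq_xxxx algebra_simps)
  qed
qed

text \<open>With M = f 0, nonpositive energy and \<open>decr_pair_sup_bound\<close> give c M^4 \<le>
  (32 m^2 / p) M^(p - 2); this is the largest M allowed.\<close>

definition sup_const :: "real \<Rightarrow> real \<Rightarrow> real \<Rightarrow> real" where
  "sup_const p c m = (32 * m\<^sup>2 / (p * c)) powr (1 / (6 - p))"

text \<open>Nonpositive energy bounds the kinetic part by the potential part, which is at most M^(p
  - 2) m. Since p - 2 < 4, the fourth power in \<open>decr_pair_sup_bound\<close> wins, so M is
  bounded, and with it everything else.\<close>

lemma wenergy_coercive:
  assumes f: "decr_pair f g" and m: "mass f = m" "0 < m" and p: "2 < p" "p < 6"
    and c: "0 < c" "c \<le> \<alpha>" "c \<le> \<gamma>" "0 \<le> l" and E: "wenergy p \<alpha> \<gamma> l f g \<le> 0"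
  shows "f 0 \<le> sup_const p c m" "kin \<alpha> \<gamma> l g \<le> 2 / p * (sup_const p c m powr (p - 2) * m)"
    "- (sup_const p c m powr (p - 2) * m) / p \<le> wenergy p \<alpha> \<gamma> l f g"
proof -
  let ?M = "f 0" and ?K = "LINT x:{0..}|lborel. (g x)\<^sup>2"
  have P: "pot p f \<le> ?M powr (p - 2) * m" using decr_pair_pot_le[OF f p(1)] m by simp
  have kE: "kin \<alpha> \<gamma> l g \<le> 2 / p * pot p f" using E by (simp add: wenergy_def mult.commute)
  have K0: "0 \<le> kin \<alpha> \<gamma> l g"
    using c by (auto simp: kin_def intro!: add_nonneg_nonneg mult_nonneg_nonneg)
  have M0: "0 \<le> ?M" using decr_pairD(1)[OF f] by simp
  show M: "?M \<le> sup_const p c m"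
  proof (cases "?M = 0")
    case True then show ?thesis by (simp add: sup_const_def)
  next
    case False
    then have Mp: "0 < ?M" using M0 by simp
    have "c * ?M^4 \<le> c * (16 * m * ?K)"
      using decr_pair_sup_bound[OF f] m c by (intro mult_left_mono) auto
    also have "\<dots> = 16 * m * (c * ?K)" by simp
    also have "\<dots> \<le> 16 * m * (2 / p * (?M powr (p - 2) * m))"
    proof (intro mult_left_mono)
      have "c * ?K \<le> kin \<alpha> \<gamma> l g" by (rule kin_ge[OF f c(4,2,3)])
      also have "\<dots> \<le> 2 / p * pot p f" by (rule kE)
      also have "\<dots> \<le> 2 / p * (?M powr (p - 2) * m)" using P p by (intro mult_left_mono) auto
      finally show "c * ?K \<le> 2 / p * (?M powr (p - 2) * m)" .
    qed (use m in simp)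
    finally have *: "c * ?M^4 \<le> 32 * m\<^sup>2 / p * ?M powr (p - 2)" by (simp add: power2_eq_square ac_simps)
    have "?M^4 = ?M powr (p - 2) * ?M powr (6 - p)"
    proof -
      have "?M^4 = ?M powr 4" using Mp by simp
      also have "\<dots> = ?M powr (p - 2 + (6 - p))" by simp
      finally show ?thesis by (simp only: powr_add)
    qed
    with * have "?M powr (p - 2) * (c * ?M powr (6 - p)) \<le> ?M powr (p - 2) * (32 * m\<^sup>2 / p)"
      by (simp add: ac_simps)
    then have "c * ?M powr (6 - p) \<le> 32 * m\<^sup>2 / p" by (rule mult_left_le_imp_le) (use Mp in simp)
    then have "?M powr (6 - p) * c \<le> 32 * m\<^sup>2 / p" by (subst mult.commute)
    then have "?M powr (6 - p) \<le> (32 * m\<^sup>2 / p) / c" by (rule mult_imp_le_div_pos[OF c(1)])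
    then have "?M powr (6 - p) \<le> 32 * m\<^sup>2 / (p * c)" by simp
    then have "(?M powr (6 - p)) powr (1 / (6 - p)) \<le> (32 * m\<^sup>2 / (p * c)) powr (1 / (6 - p))"
      using p by (intro powr_mono2) auto
    then show ?thesis using Mp p by (simp add: powr_powr sup_const_def)
  qed
  have "?M powr (p - 2) * m \<le> sup_const p c m powr (p - 2) * m"
    using M M0 m p by (intro mult_right_mono powr_mono2) auto
  with P have P': "pot p f \<le> sup_const p c m powr (p - 2) * m" by linarith
  then have "2 / p * pot p f \<le> 2 / p * (sup_const p c m powr (p - 2) * m)" using p by (intro mult_left_mono) auto
  with kE show "kin \<alpha> \<gamma> l g \<le> 2 / p * (sup_const p c m powr (p - 2) * m)" by linarith
  have "pot p f / p \<le> sup_const p c m powr (p - 2) * m / p" using P' p by (intro divide_right_mono) auto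
  with K0 show "- (sup_const p c m powr (p - 2) * m) / p \<le> wenergy p \<alpha> \<gamma> l f g"
    unfolding wenergy_def by linarith
qed

text \<open>Under the dilation the break point of the weight moves: break point \<open>l\<close>
  after dilation corresponds to \<open>r * l\<close> before.\<close>

lemma decr_pair_scale:
  assumes f: "decr_pair f g" and c: "0 \<le> c" "0 < r"
  shows "decr_pair (\<lambda>x. c * f (r * x)) (\<lambda>x. (c * r) * g (r * x))"
    and "mass (\<lambda>x. c * f (r * x)) = c\<^sup>2 * mass f / r"
    and "pot p (\<lambda>x. c * f (r * x)) = c powr p * pot p f / r"
    and "kin \<alpha> \<gamma> l (\<lambda>x. (c * r) * g (r * x)) = c\<^sup>2 * r * kin \<alpha> \<gamma> (r * l) g"
proof -
  have r: "r \<noteq> 0" using c by simp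
  have sets: "{x. 0 + r * x \<in> {0..}} = {0..}" "{x. 0 + r * x \<in> {0..r * l}} = {0..l}"
    "{x. 0 + r * x \<in> {r * l..}} = {l..}"
    using c by (auto simp: zero_le_mult_iff)
  note aff = set_integral_affine(1)[OF r, of 0]
  show "decr_pair (\<lambda>x. c * f (r * x)) (\<lambda>x. (c * r) * g (r * x))"
    unfolding decr_pair_def
  proof (intro conjI allI impI)
    show "0 \<le> c * f (r * x)" if "0 \<le> x" for x using that c decr_pairD(1)[OF f, of "r * x"] by simp
    show "c * f (r * y) \<le> c * f (r * x)" if "0 \<le> x" "x \<le> y" for x y
      using that c by (intro mult_left_mono decr_pairD(2)[OF f]) auto
    show "L2_on {0..} (\<lambda>x. c * f (r * x))"
      using L2_on_affine[OF decr_pairD(3)[OF f] r, of 0 c] sets by simp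
    show "ac_on {0..} (\<lambda>x. c * f (r * x)) (\<lambda>x. (c * r) * g (r * x))"
      using ac_on_affine[OF decr_pairD(4)[OF f] r, of 0 c] sets by simp
  qed
  show "mass (\<lambda>x. c * f (r * x)) = c\<^sup>2 * mass f / r"
    using aff[of "{0..}" "\<lambda>x. (f x)\<^sup>2"] c unfolding sets by (simp add: mass_def power_mult_distrib)
  have "pot p (\<lambda>x. c * f (r * x)) = (LINT x:{0..}|lborel. c powr p * \<bar>f (r * x)\<bar> powr p)"
    unfolding pot_def using c by (intro set_lebesgue_integral_cong) (auto simp: abs_mult powr_mult)
  then show "pot p (\<lambda>x. c * f (r * x)) = c powr p * pot p f / r"
    using aff[of "{0..}" "\<lambda>x. \<bar>f x\<bar> powr p"] c unfolding sets by (simp add: pot_def)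
  show "kin \<alpha> \<gamma> l (\<lambda>x. (c * r) * g (r * x)) = c\<^sup>2 * r * kin \<alpha> \<gamma> (r * l) g"
    using aff[of "{0..r * l}" "\<lambda>x. (g x)\<^sup>2"] aff[of "{r * l..}" "\<lambda>x. (g x)\<^sup>2"] c unfolding sets
    by (simp add: kin_def power_mult_distrib power2_eq_square field_simps)
qed

text \<open>The kinetic part scales by c^2, the potential part by c^p \<ge> c^2.\<close>

lemma wenergy_const_mult_le:
  assumes f: "decr_pair f g" and c: "1 \<le> c" and p: "2 < p"
  shows "wenergy p \<alpha> \<gamma> l (\<lambda>x. c * f x) (\<lambda>x. c * g x) \<le> c\<^sup>2 * wenergy p \<alpha> \<gamma> l f g"
proof -
  have "c powr 2 \<le> c powr p" using c p by (intro powr_mono) auto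
  then have "c\<^sup>2 * pot p f / p \<le> c powr p * pot p f / p"
    using c p by (intro divide_right_mono mult_right_mono) auto
  moreover have "pot p (\<lambda>x. c * f x) = c powr p * pot p f" "kin \<alpha> \<gamma> l (\<lambda>x. c * g x) = c\<^sup>2 * kin \<alpha> \<gamma> l g"
    using decr_pair_scale(3,4)[OF f, of c 1] c by simp_all
  ultimately show ?thesis
    by (simp add: wenergy_def right_diff_distrib)
qed

text \<open>The witness is the tent 1 - x cut off at 0; its derivative comes from
  \<open>riesz_derivative\<close> with \<kappa> x = min x 1.\<close>

lemma exists_decr_pair:
  obtains f g where "decr_pair f g" "0 < mass f" "\<And>p. 2 < p \<Longrightarrow> 0 < pot p f"
proof -
  define f :: "real \<Rightarrow> real" where "f x = max 0 (1 - x)" for x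
  define k :: "real \<Rightarrow> real" where "k x = min x 1" for x
  have inc: "(f x - f y)\<^sup>2 \<le> (y - x) * (k y - k x)" if "0 \<le> x" "x \<le> y" for x y
  proof -
    have "f x - f y = k y - k x" by (auto simp: f_def k_def)
    moreover have "0 \<le> k y - k x" "k y - k x \<le> y - x" using that by (auto simp: k_def)
    ultimately show ?thesis by (simp add: power2_eq_square mult_right_mono)
  qed
  obtain g where g: "ac_on {0..} f g"
    by (rule riesz_derivative[of f k 1, OF _ _ _ _ inc]) (auto simp: f_def k_def)
  have cont: "continuous_on A f" for A unfolding f_def by (intro continuous_intros)
  have int: "set_integrable lborel {0..1} (\<lambda>x. (f x)\<^sup>2)"
    by (intro borel_integrable_atLeastAtMost' continuous_intros cont)
  have eq: "indicator {0..} x * (f x)\<^sup>2 = indicator {0..1} x * (f x)\<^sup>2" for x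
    by (auto simp: f_def split: split_indicator)
  have L2: "L2_on {0..} f"
    unfolding L2_on_def
  proof
    show "set_borel_measurable lborel {0..} f"
      using set_measurable_continuous_on[OF _ cont, of "{0..}"] by (simp add: set_borel_measurable_def)
    show "set_integrable lborel {0..} (\<lambda>x. (f x)\<^sup>2)" 
      using int unfolding set_integrable_def real_scaleR_def eq .
  qed
  have dp: "decr_pair f g" using g L2 by (auto simp: decr_pair_def f_def)
  have "0 < (1/2) * (f (1/2))\<^sup>2" by (simp add: f_def)
  also have "\<dots> \<le> mass f" by (rule decr_pair_tail[OF dp]) simp
  finally have mp: "0 < mass f" .
  have "0 < pot p f" if p: "2 < p" for p
  proof -
    have i: "set_integrable lborel {0..} (\<lambda>x. \<bar>f x\<bar> powr p)"
      by (rule L2_on_powr_integrable(1)[OF L2 _ p, of 1]) (auto simp: f_def)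
    have "0 < (1/2) * (1/2) powr p" by simp
    also have "\<dots> = (LINT x:{0..1/2::real}|lborel. (1/2) powr p)" by (simp add: set_integral_const)
    also have "\<dots> \<le> (LINT x:{0..1/2}|lborel. \<bar>f x\<bar> powr p)"
    proof (rule set_integral_mono)
      show "set_integrable lborel {0..1/2::real} (\<lambda>x. (1/2) powr p)"
        by (rule set_integrable_const_fin[OF _ emeasure_lborel_Icc_finite]) simp
      show "set_integrable lborel {0..1/2} (\<lambda>x. \<bar>f x\<bar> powr p)" by (rule set_integrable_subset[OF i]) auto
      show "(1/2) powr p \<le> \<bar>f x\<bar> powr p" if "x \<in> {0..1/2}" for x
        using that p by (intro powr_mono2) (auto simp: f_def)
    qed
    also have "\<dots> \<le> pot p f" unfolding pot_def by (rule set_integral_mono_set[OF i]) auto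
    finally show ?thesis .
  qed
  with dp mp show thesis using that by blast
qed

text \<open>Normalized to mass \<mu> and dilated by \<open>r\<close>, a fixed profile has kinetic
  term at most A r^2 and potential term B r^(p/2 - 1). As p/2 - 1 < 2, the potential wins for small
  \<open>r\<close>.\<close>

lemma exists_negative_wenergy:
  assumes p: "2 < p" "p < 6" and \<mu>: "0 < \<mu>" and \<alpha>: "0 < \<alpha>" "0 < \<gamma>" "0 \<le> l"
  obtains f g where "decr_pair f g" "mass f = \<mu>" "wenergy p \<alpha> \<gamma> l f g < 0"
proof -
  obtain f g where f: "decr_pair f g" "0 < mass f" "0 < pot p f"
    using exists_decr_pair p(1) by metis
  \<comment> \<open>A bound uniform in the break point, which varies with \<open>r\<close>; the
    summand 1 secures positivity.\<close>
  define K where "K = (\<alpha> + \<gamma>) * (LINT x:{0..}|lborel. (g x)\<^sup>2) + 1"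
  have Kp: "0 < K" unfolding K_def
    by (rule add_nonneg_pos) (use \<alpha> in simp_all)
  have Kb: "kin \<alpha> \<gamma> l' g \<le> K" if "0 \<le> l'" for l'
  proof -
    have "kin \<alpha> \<gamma> l' g \<le> \<alpha> * (LINT x:{0..}|lborel. (g x)\<^sup>2) + \<gamma> * (LINT x:{0..}|lborel. (g x)\<^sup>2)"
      unfolding kin_def using \<alpha> that
      by (intro add_mono mult_left_mono set_integral_mono_set[OF decr_pair_deriv_integrable(1)[OF f(1) order_refl]]) auto
    then show ?thesis by (simp add: K_def algebra_simps)
  qed
  define A where "A = \<mu> / mass f * K / 2"
  define B where "B = (\<mu> / mass f) powr (p / 2) * pot p f / p"
  have AB: "0 < A" "0 < B" using f \<mu> Kp p by (auto simp: A_def B_def)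
  \<comment> \<open>Solves B r^(p/2 - 1) = 2 A r^2, so that the energy is at most - A r^2.\<close>
  define r where "r = (B / (2 * A)) powr (2 / (6 - p))"
  have r: "0 < r" using AB by (simp add: r_def)
  define c where "c = sqrt (\<mu> / mass f * r)"
  have c: "0 < c" "c\<^sup>2 = \<mu> / mass f * r" using f \<mu> r by (auto simp: c_def)
  have cp: "c powr p = (\<mu> / mass f) powr (p / 2) * r powr (p / 2)"
  proof -
    have "c powr p = (c powr 2) powr (p / 2)" by (simp add: powr_powr)
    also have "c powr 2 = \<mu> / mass f * r" using c by simp
    also have "(\<mu> / mass f * r) powr (p / 2) = (\<mu> / mass f) powr (p / 2) * r powr (p / 2)"
      by (rule powr_mult)
    finally show ?thesis .
  qed
  let ?f = "\<lambda>x. c * f (r * x)" and ?g = "\<lambda>x. (c * r) * g (r * x)"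
  note sc = decr_pair_scale[OF f(1) less_imp_le[OF c(1)] r]
  have m: "mass ?f = \<mu>" using sc(2) c(2) r f by simp
  have "wenergy p \<alpha> \<gamma> l ?f ?g = c\<^sup>2 * r * kin \<alpha> \<gamma> (r * l) g / 2 - c powr p * pot p f / r / p"
    unfolding wenergy_def sc(3,4) by simp
  also have "\<dots> \<le> c\<^sup>2 * r * K / 2 - c powr p * pot p f / r / p"
    using Kb[of "r * l"] r \<alpha> by (intro diff_right_mono divide_right_mono mult_left_mono) auto
  also have "c\<^sup>2 * r * K / 2 = A * r\<^sup>2" unfolding c(2) A_def by (simp add: power2_eq_square)
  also have "c powr p * pot p f / r / p = B * (r powr (p / 2) / r)"
  proof -
    have "(a * b) * q / r / p = (a * q / p) * (b / r)" for a b q :: real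
      unfolding divide_inverse by (simp only: ac_simps)
    then show ?thesis unfolding cp B_def .
  qed
  also have "r powr (p / 2) / r = r\<^sup>2 * r powr (- ((6 - p) / 2))"
  proof -
    have "r powr (-1) = 1 / r" using r by (subst powr_minus_divide) simp
    then have "r powr (p / 2) / r = r powr (p / 2) * r powr (-1)" by (simp only: times_divide_eq_right mult_1_right)
    also have "\<dots> = r powr (p / 2 + -1)" by (simp only: powr_add)
    also have "p / 2 + -1 = 2 + - ((6 - p) / 2)" by (simp add: field_simps)
    also have "r powr (2 + - ((6 - p) / 2)) = r powr 2 * r powr (- ((6 - p) / 2))" by (simp only: powr_add)
    finally show ?thesis using r by (simp only: powr_numeral)
  qed
  also have "r powr (- ((6 - p) / 2)) = 2 * A / B"
  proof -
    have "r powr (- ((6 - p) / 2)) = (B / (2 * A)) powr (-1)"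
    proof -
      have "2 / (6 - p) * - ((6 - p) / 2) = -1" using p by (simp add: field_simps)
      then show ?thesis unfolding r_def powr_powr by (simp only:)
    qed
    also have "\<dots> = 1 / (B / (2 * A))" using AB by (subst powr_minus_divide) simp
    finally show ?thesis by simp
  qed
  also have "A * r\<^sup>2 - B * (r\<^sup>2 * (2 * A / B)) = - (A * r\<^sup>2)" using AB by simp
  also have "\<dots> < 0" using AB r by simp
  finally show thesis using that[OF sc(1) m] by simp
qed

section \<open>Existence of minimizers\<close>

lemma isCont_set_integral_upper:
  fixes h :: "real \<Rightarrow> real"
  assumes h: "set_integrable lborel {a..} h"
  shows "isCont (\<lambda>x. LINT t:{a..x}|lborel. h t) x"
  unfolding isCont_def tendsto_at_iff_sequentially
proof (intro allI impI)
  fix X :: "nat \<Rightarrow> real" assume X: "X \<longlonglongrightarrow> x"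
  have hm [measurable]: "(\<lambda>t. indicator {a..} t * h t) \<in> borel_measurable borel"
    using h by (auto simp: set_integrable_def)
  have m: "(\<lambda>t. indicator {a..y} t *\<^sub>R h t) \<in> borel_measurable lborel" for y
  proof -
    have "(\<lambda>t. indicator {..y} t * (indicator {a..} t * h t)) \<in> borel_measurable lborel" by measurable
    also have "(\<lambda>t. indicator {..y} t * (indicator {a..} t * h t)) = (\<lambda>t. indicator {a..y} t *\<^sub>R h t)"
      by (auto split: split_indicator)
    finally show ?thesis .
  qed
  have "(\<lambda>n. \<integral>t. indicator {a..X n} t *\<^sub>R h t \<partial>lborel) \<longlonglongrightarrow> (\<integral>t. indicator {a..x} t *\<^sub>R h t \<partial>lborel)"
  proof (rule integral_dominated_convergence[where w="\<lambda>t. \<bar>indicator {a..} t * h t\<bar>"])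
    show "integrable lborel (\<lambda>t. \<bar>indicator {a..} t * h t\<bar>)"
      using h by (auto simp: set_integrable_def)
    show "AE t in lborel. norm (indicator {a..X n} t *\<^sub>R h t) \<le> \<bar>indicator {a..} t * h t\<bar>" for n
      by (intro AE_I2) (auto split: split_indicator)
    have ne: "AE t in lborel. t \<noteq> x" by (rule AE_lborel_singleton)
    show "AE t in lborel. (\<lambda>n. indicator {a..X n} t *\<^sub>R h t) \<longlonglongrightarrow> indicator {a..x} t *\<^sub>R h t"
      using ne
    proof eventually_elim
      case (elim t)
      have "\<forall>\<^sub>F n in sequentially. indicator {a..X n} t *\<^sub>R h t = indicator {a..x} t *\<^sub>R h t"
      proof (cases "t < x")
        case True
        have "\<forall>\<^sub>F n in sequentially. t < X n" by (rule order_tendstoD(1)[OF X True])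
        then show ?thesis by eventually_elim (use True in \<open>auto split: split_indicator\<close>)
      next
        case False
        then have "x < t" using elim by simp
        have "\<forall>\<^sub>F n in sequentially. X n < t" by (rule order_tendstoD(2)[OF X \<open>x < t\<close>])
        then show ?thesis by eventually_elim (use \<open>x < t\<close> in \<open>auto split: split_indicator\<close>)
      qed
      then show ?case by (rule tendsto_eventually)
    qed
  qed (rule m)+
  then show "((\<lambda>x. LINT t:{a..x}|lborel. h t) \<circ> X) \<longlonglongrightarrow> (LINT t:{a..x}|lborel. h t)"
    by (simp add: set_lebesgue_integral_def o_def)
qed

lemma helly_selection_pair:
  fixes F k :: "nat \<Rightarrow> real \<Rightarrow> real"
  assumes "\<And>n x. isCont (F n) x" "\<And>n. mono (F n)" "\<And>n x. \<bar>F n x\<bar> \<le> A"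
    and "\<And>n x. isCont (k n) x" "\<And>n. mono (k n)" "\<And>n x. \<bar>k n x\<bar> \<le> B"
  obtains s F' k' where "strict_mono (s :: nat \<Rightarrow> nat)" "mono F'" "mono k'"
    "\<And>x. continuous (at_right x) F'" "\<And>x. continuous (at_right x) k'"
    "\<And>x. isCont F' x \<Longrightarrow> (\<lambda>n. F (s n) x) \<longlonglongrightarrow> F' x"
    "\<And>x. isCont k' x \<Longrightarrow> (\<lambda>n. k (s n) x) \<longlonglongrightarrow> k' x"
proof -
  have c: "continuous (at_right x) (F n)" "continuous (at_right x) (k n)" for n x
    using assms(1,4) continuous_at_imp_continuous_within by blast+
  obtain s1 F' where s1: "strict_mono (s1 :: nat \<Rightarrow> nat)" "\<forall>x. continuous (at_right x) F'" "mono F'"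
      "\<forall>x. isCont F' x \<longrightarrow> (\<lambda>n. F (s1 n) x) \<longlonglongrightarrow> F' x"
    using Helly_selection[of F A, OF c(1) assms(2,3)] by blast
  obtain s2 k' where s2: "strict_mono (s2 :: nat \<Rightarrow> nat)" "\<forall>x. continuous (at_right x) k'" "mono k'"
      "\<forall>x. isCont k' x \<longrightarrow> (\<lambda>n. k (s1 (s2 n)) x) \<longlonglongrightarrow> k' x"
    using Helly_selection[of "\<lambda>n. k (s1 n)" B, OF c(2) assms(5,6)] by blast
  have "(\<lambda>n. F ((s1 \<circ> s2) n) x) \<longlonglongrightarrow> F' x" if "isCont F' x" for x
    using LIMSEQ_subseq_LIMSEQ[OF s1(4)[rule_format, OF that] s2(1)] by (simp add: o_def)
  then show thesis
    using that[of "s1 \<circ> s2" F' k'] s1 s2 strict_mono_o[OF s1(1) s2(1)] by auto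
qed

text \<open>An inequality known where two monotone limits are continuous reaches every pair of
  points by right-continuity, along shifts that avoid the countable set of discontinuities at both
  points at once.\<close>

lemma common_shift:
  fixes D :: "real set"
  assumes "countable D"
  obtains h :: "nat \<Rightarrow> real" where "\<And>i. 0 < h i" "h \<longlonglongrightarrow> 0" "\<And>i. x + h i \<notin> D" "\<And>i. y + h i \<notin> D"
proof -
  have "\<exists>h. 0 < h \<and> h < 1 / real (Suc i) \<and> x + h \<notin> D \<and> y + h \<notin> D" for i
  proof -
    let ?E = "(\<lambda>d. d - x) ` D \<union> (\<lambda>d. d - y) ` D"
    have "countable ?E" using assms by auto
    moreover have "uncountable {0<..<1 / real (Suc i)}" by (simp add: uncountable_open_interval)
    ultimately have "uncountable ({0<..<1 / real (Suc i)} - ?E)" by (intro uncountable_minus_countable)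
    then have "{0<..<1 / real (Suc i)} - ?E \<noteq> {}" by (metis countable_empty)
    then obtain h where h: "h \<in> {0<..<1 / real (Suc i)}" "h \<notin> ?E" by blast
    have "x + h \<notin> D"
    proof
      assume "x + h \<in> D" then have "h \<in> (\<lambda>d. d - x) ` D" by (intro image_eqI[of _ _ "x + h"]) auto
      with h show False by blast
    qed
    moreover have "y + h \<notin> D"
    proof
      assume "y + h \<in> D" then have "h \<in> (\<lambda>d. d - y) ` D" by (intro image_eqI[of _ _ "y + h"]) auto
      with h show False by blast
    qed
    ultimately show ?thesis using h by auto
  qed
  then obtain h where h: "\<And>i. 0 < h i \<and> h i < 1 / real (Suc i) \<and> x + h i \<notin> D \<and> y + h i \<notin> D"
    by metis
  have "h \<longlonglongrightarrow> 0"
  proof (rule tendsto_sandwich[OF _ _ tendsto_const LIMSEQ_inverse_real_of_nat])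
    show "\<forall>\<^sub>F i in sequentially. 0 \<le> h i" using h by (intro always_eventually allI) (simp add: less_imp_le)
    show "\<forall>\<^sub>F i in sequentially. h i \<le> inverse (real (Suc i))"
      using h by (intro always_eventually allI) (simp add: inverse_eq_divide less_imp_le)
  qed
  with h that show thesis by metis
qed

lemma right_continuous_shift:
  fixes F :: "real \<Rightarrow> real"
  assumes "continuous (at_right x) F" "\<And>i. 0 < h i" "h \<longlonglongrightarrow> 0"
  shows "(\<lambda>i. F (x + h i)) \<longlonglongrightarrow> F x"
proof -
  have "(\<lambda>i. x + h i) \<longlonglongrightarrow> x + 0" by (intro tendsto_add tendsto_const assms(3))
  moreover have "h i \<noteq> 0" for i using assms(2)[of i] by simp
  ultimately have "filterlim (\<lambda>i. x + h i) (at_right x) sequentially"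
    using assms(2) by (simp add: filterlim_at)
  then show ?thesis using assms(1) unfolding continuous_within by (rule filterlim_compose[rotated])
qed

text \<open>Helly's theorem is applied jointly to the profiles and to their accumulated weighted
  energies. The Cauchy-Schwarz relation between the two survives pointwise limits, and
  \<open>weighted_riesz\<close> turns it into a derivative of the limit; this is lower
  semicontinuity without weak convergence.\<close>

lemma decr_compact:
  fixes fn gn :: "nat \<Rightarrow> real \<Rightarrow> real"
  assumes dp: "\<And>n. decr_pair (fn n) (gn n)" and M: "\<And>n. fn n 0 \<le> M"
    and B: "\<And>n. kin \<alpha> \<gamma> l (gn n) \<le> B" and pos: "0 < \<alpha>" "0 < \<gamma>" "0 \<le> l"
  obtains s f where "strict_mono (s :: nat \<Rightarrow> nat)" "\<And>x. 0 \<le> x \<Longrightarrow> (\<lambda>n. fn (s n) x) \<longlonglongrightarrow> f x"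
    "\<And>T. (\<lambda>n. kin \<alpha> \<gamma> l (gn (s n))) \<longlonglongrightarrow> T \<Longrightarrow> \<exists>g. ac_on {0..} f g \<and> kin \<alpha> \<gamma> l g \<le> T"
proof -
  \<comment> \<open>Length with density 1/weight; measured this way, one inequality holds across the
    break point.\<close>
  define \<Lambda> where "\<Lambda> x = min x l / \<alpha> + (max x l - l) / \<gamma>" for x
  define F where "F n x = - fn n (max 0 x)" for n x
  define k where "k n x = \<alpha> * (LINT t:{0..min x l}|lborel. (gn n t)\<^sup>2) + \<gamma> * (LINT t:{l..max x l}|lborel. (gn n t)\<^sup>2)" for n x
  note int = decr_pair_deriv_integrable[OF dp pos(3)]
  have intI: "set_integrable lborel {a..b} (\<lambda>t. (gn n t)\<^sup>2)" if "0 \<le> a" for n a b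
    by (rule set_integrable_subset[OF int(1)]) (use that in auto)
  have F_mono: "mono (F n)" for n
  proof (rule monoI)
    fix x y :: real assume "x \<le> y"
    then have "fn n (max 0 y) \<le> fn n (max 0 x)" by (intro decr_pairD(2)[OF dp]) auto
    then show "F n x \<le> F n y" by (simp add: F_def)
  qed
  have F_bound: "\<bar>F n x\<bar> \<le> M" for n x
    using decr_pair_abs_le[OF dp, of "max 0 x" n] M[of n] by (simp add: F_def)
  have F_cont: "isCont (F n) x" for n x
  proof -
    have "continuous_on {0..} (fn n)" using ac_on_continuous_on[OF decr_pairD(4)[OF dp]] by simp
    then have "continuous_on UNIV (\<lambda>x. fn n (max 0 x))"
      by (rule continuous_on_compose2) (auto intro!: continuous_intros)
    then have "continuous_on UNIV (F n)" unfolding F_def by (intro continuous_on_minus)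
    then show ?thesis by (simp add: continuous_on_eq_continuous_at)
  qed
  have k_cont: "isCont (k n) x" for n x
  proof -
    have "isCont (\<lambda>x. LINT t:{0..min x l}|lborel. (gn n t)\<^sup>2) x"
      by (rule isCont_o2[OF _ isCont_set_integral_upper[OF int(1)]]) (intro continuous_intros)
    moreover have "isCont (\<lambda>x. LINT t:{l..max x l}|lborel. (gn n t)\<^sup>2) x"
      by (rule isCont_o2[OF _ isCont_set_integral_upper[OF int(3)]]) (intro continuous_intros)
    ultimately show ?thesis unfolding k_def by (intro continuous_intros)
  qed
  have k_mono: "mono (k n)" for n
  proof (rule monoI)
    fix x y :: real assume "x \<le> y"
    then show "k n x \<le> k n y"
      unfolding k_def using pos
      by (intro add_mono mult_left_mono set_integral_mono_set intI) auto
  qed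
  have k_nonneg: "0 \<le> k n x" for n x
    using pos by (auto simp: k_def intro!: add_nonneg_nonneg mult_nonneg_nonneg)
  have k_kin: "k n x \<le> kin \<alpha> \<gamma> l (gn n)" for n x
    unfolding k_def kin_def using pos
    by (intro add_mono mult_left_mono set_integral_mono_set intI int) auto
  have k_bound: "\<bar>k n x\<bar> \<le> B" for n x
    using k_nonneg[of n x] k_kin[of n x] B[of n] by simp
  have k_left: "k n y - k n x = \<alpha> * (LINT t:{x..y}|lborel. (gn n t)\<^sup>2)" if "0 \<le> x" "x \<le> y" "y \<le> l" for n x y
    using that set_integral_Icc_combine[OF intI[of 0 y n] that(1,2)] by (simp add: k_def algebra_simps)
  have k_right: "k n y - k n x = \<gamma> * (LINT t:{x..y}|lborel. (gn n t)\<^sup>2)" if "l \<le> x" "x \<le> y" for n x y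
    using that set_integral_Icc_combine[OF intI[of l y n] that] pos by (simp add: k_def algebra_simps)
  have hold: "(F n y - F n x)\<^sup>2 \<le> (y - x) * (LINT t:{x..y}|lborel. (gn n t)\<^sup>2)" if "0 \<le> x" "x \<le> y" for n x y
    using ac_on_hoelder[OF decr_pairD(4)[OF dp], of x y n] that by (simp add: F_def power2_commute)
  have left: "(F n y - F n x)\<^sup>2 \<le> ((y - x) / \<alpha>) * (k n y - k n x)" if "0 \<le> x" "x \<le> y" "y \<le> l" for n x y
    using hold[OF that(1,2), of n] k_left[OF that, of n] pos by simp
  have right: "(F n y - F n x)\<^sup>2 \<le> ((y - x) / \<gamma>) * (k n y - k n x)" if "l \<le> x" "x \<le> y" for n x y
    using hold[of x y n] k_right[OF that, of n] pos that by simp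
  have H0: "(F n y - F n x)\<^sup>2 \<le> (\<Lambda> y - \<Lambda> x) * (k n y - k n x)" if xy: "0 \<le> x" "x \<le> y" for n x y
  proof -
    consider "y \<le> l" | "l \<le> x" | "x \<le> l" "l \<le> y" by linarith
    then show ?thesis
    proof cases
      case 1
      with left[OF xy 1, of n] xy show ?thesis by (simp add: \<Lambda>_def diff_divide_distrib)
    next
      case 2
      with right[OF 2 xy(2), of n] xy show ?thesis by (simp add: \<Lambda>_def diff_divide_distrib)
    next
      case 3
      have "(F n l - F n x + (F n y - F n l))\<^sup>2
          \<le> ((l - x) / \<alpha> + (y - l) / \<gamma>) * ((k n l - k n x) + (k n y - k n l))"
        using left[of x l n] right[of l y n] 3 xy pos monoD[OF k_mono, of x l n] monoD[OF k_mono, of l y n]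
        by (intro cauchy_schwarz_two) auto
      moreover have "\<Lambda> y - \<Lambda> x = (l - x) / \<alpha> + (y - l) / \<gamma>"
        using 3 by (simp add: \<Lambda>_def diff_divide_distrib)
      ultimately show ?thesis by simp
    qed
  qed
  have \<Lambda>_mono: "\<Lambda> x \<le> \<Lambda> y" if "x \<le> y" for x y
    unfolding \<Lambda>_def using that pos by (intro add_mono divide_right_mono) auto
  \<comment> \<open>Left of 0 each \<open>F n\<close> is constant, so the bound extends to the whole
    line, where Helly selection takes place.\<close>
  have H: "(F n y - F n x)\<^sup>2 \<le> (\<Lambda> y - \<Lambda> x) * (k n y - k n x)" if xy: "x \<le> y" for n x y
  proof (cases "0 \<le> y")
    case True
    have "(F n y - F n x)\<^sup>2 = (F n y - F n (max 0 x))\<^sup>2" by (simp add: F_def)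
    also have "\<dots> \<le> (\<Lambda> y - \<Lambda> (max 0 x)) * (k n y - k n (max 0 x))" using True xy by (intro H0) auto
    also have "\<dots> \<le> (\<Lambda> y - \<Lambda> x) * (k n y - k n x)"
    proof (rule mult_mono)
      show "\<Lambda> y - \<Lambda> (max 0 x) \<le> \<Lambda> y - \<Lambda> x" using \<Lambda>_mono[of x "max 0 x"] by simp
      show "k n y - k n (max 0 x) \<le> k n y - k n x" using monoD[OF k_mono, of x "max 0 x" n] by simp
      show "0 \<le> \<Lambda> y - \<Lambda> x" using \<Lambda>_mono[OF xy] by simp
      show "0 \<le> k n y - k n (max 0 x)" using monoD[OF k_mono, of "max 0 x" y n] True xy by simp
    qed
    finally show ?thesis .
  next
    case False
    then have "F n y = F n x" using xy by (simp add: F_def)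
    then show ?thesis using \<Lambda>_mono[OF xy] monoD[OF k_mono xy, of n] by simp
  qed
  obtain s F' k' where s: "strict_mono (s :: nat \<Rightarrow> nat)" "mono F'" "mono k'"
    "\<And>x. continuous (at_right x) F'" "\<And>x. continuous (at_right x) k'"
    "\<And>x. isCont F' x \<Longrightarrow> (\<lambda>n. F (s n) x) \<longlonglongrightarrow> F' x"
    "\<And>x. isCont k' x \<Longrightarrow> (\<lambda>n. k (s n) x) \<longlonglongrightarrow> k' x"
    using helly_selection_pair[of F M k B, OF F_cont F_mono F_bound k_cont k_mono k_bound] by blast
  define D where "D = {x. \<not> isCont F' x} \<union> {x. \<not> isCont k' x}"
  have D: "countable D" unfolding D_def using mono_ctble_discont[OF s(2)] mono_ctble_discont[OF s(3)] by simp
  have \<Lambda>_cont: "isCont \<Lambda> x" for x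
    unfolding \<Lambda>_def using pos by (intro continuous_intros) auto
  have H': "(F' y - F' x)\<^sup>2 \<le> (\<Lambda> y - \<Lambda> x) * (k' y - k' x)" if xy: "x \<le> y" for x y
  proof -
    obtain h where h: "\<And>i. 0 < h i" "h \<longlonglongrightarrow> 0" "\<And>i. x + h i \<notin> D" "\<And>i. y + h i \<notin> D"
      using common_shift[OF D, of x y] by blast
    have good: "(F' (y + h i) - F' (x + h i))\<^sup>2 \<le> (\<Lambda> (y + h i) - \<Lambda> (x + h i)) * (k' (y + h i) - k' (x + h i))" for i
    proof (rule LIMSEQ_le)
      have c: "isCont F' (y + h i)" "isCont F' (x + h i)" "isCont k' (y + h i)" "isCont k' (x + h i)"
        using h(3,4)[of i] by (auto simp: D_def)
      show "(\<lambda>n. (F (s n) (y + h i) - F (s n) (x + h i))\<^sup>2) \<longlonglongrightarrow> (F' (y + h i) - F' (x + h i))\<^sup>2"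
        by (intro tendsto_power tendsto_diff s(6) c)
      show "(\<lambda>n. (\<Lambda> (y + h i) - \<Lambda> (x + h i)) * (k (s n) (y + h i) - k (s n) (x + h i)))
          \<longlonglongrightarrow> (\<Lambda> (y + h i) - \<Lambda> (x + h i)) * (k' (y + h i) - k' (x + h i))"
        by (intro tendsto_mult tendsto_const tendsto_diff s(7) c)
      show "\<exists>N. \<forall>n\<ge>N. (F (s n) (y + h i) - F (s n) (x + h i))\<^sup>2
          \<le> (\<Lambda> (y + h i) - \<Lambda> (x + h i)) * (k (s n) (y + h i) - k (s n) (x + h i))"
        using H[of "x + h i" "y + h i"] xy by auto
    qed
    have lF: "(\<lambda>i. F' (z + h i)) \<longlonglongrightarrow> F' z" "(\<lambda>i. k' (z + h i)) \<longlonglongrightarrow> k' z" "(\<lambda>i. \<Lambda> (z + h i)) \<longlonglongrightarrow> \<Lambda> z" for z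
      by (rule right_continuous_shift[OF _ h(1,2)], rule s(4) s(5) continuous_at_imp_continuous_within[OF \<Lambda>_cont])+
    show ?thesis
    proof (rule LIMSEQ_le)
      show "(\<lambda>i. (F' (y + h i) - F' (x + h i))\<^sup>2) \<longlonglongrightarrow> (F' y - F' x)\<^sup>2"
        by (intro tendsto_power tendsto_diff lF)
      show "(\<lambda>i. (\<Lambda> (y + h i) - \<Lambda> (x + h i)) * (k' (y + h i) - k' (x + h i))) \<longlonglongrightarrow> (\<Lambda> y - \<Lambda> x) * (k' y - k' x)"
        by (intro tendsto_mult tendsto_diff lF)
    qed (use good in blast)
  qed
  have exists_good: "\<exists>y > x. isCont k' y" for x
  proof -
    obtain h where h: "\<And>i. 0 < h i" "h \<longlonglongrightarrow> 0" "\<And>i. x + h i \<notin> D" "\<And>i. x + h i \<notin> D"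
      using common_shift[OF D, of x x] by blast
    show ?thesis using h(1,3)[of 0] by (intro exI[of _ "x + h 0"]) (simp add: D_def)
  qed
  have k'_nonneg: "0 \<le> k' x" for x
  proof -
    obtain h where h: "\<And>i. 0 < h i" "h \<longlonglongrightarrow> 0" "\<And>i. x + h i \<notin> D" "\<And>i. x + h i \<notin> D"
      using common_shift[OF D, of x x] by blast
    have "0 \<le> k' (x + h i)" for i
    proof (rule LIMSEQ_le_const[OF s(7)])
      show "isCont k' (x + h i)" using h(3)[of i] by (simp add: D_def)
    qed (use k_nonneg in blast)
    then show ?thesis by (intro LIMSEQ_le_const[OF right_continuous_shift[OF s(5) h(1,2), of x]]) blast
  qed
  define f where "f x = - F' x" for x
  \<comment> \<open>Helly gives convergence only at continuity points. By \<open>H'\<close> and the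
    Lipschitz bound for \<Lambda> the limit is locally Hoelder continuous, so convergence holds
    everywhere.\<close>
  have F'_cont: "isCont F' x" for x
  proof -
    define C where "C = k' (x + 1)"
    define b where "b = 1 / \<alpha> + 1 / \<gamma>"
    have b: "0 < b" using pos by (simp add: b_def add_pos_pos)
    have \<Lambda>_lip: "\<Lambda> z - \<Lambda> y \<le> b * (z - y)" if "y \<le> z" for y z
    proof -
      have "(min z l - min y l) / \<alpha> \<le> (z - y) / \<alpha>" "(max z l - max y l) / \<gamma> \<le> (z - y) / \<gamma>"
        using that pos by (intro divide_right_mono; auto)+
      then show ?thesis by (simp add: \<Lambda>_def b_def algebra_simps diff_divide_distrib)
    qed
    have bound: "\<bar>F' z - F' y\<bar> \<le> sqrt (b * C) * sqrt \<bar>z - y\<bar>" if yz: "y \<le> z" "z \<le> x + 1" for y z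
    proof -
      have "(F' z - F' y)\<^sup>2 \<le> (\<Lambda> z - \<Lambda> y) * (k' z - k' y)" by (rule H'[OF yz(1)])
      also have "\<dots> \<le> (b * (z - y)) * C"
      proof (rule mult_mono)
        show "k' z - k' y \<le> C" using monoD[OF s(3), of z "x + 1"] k'_nonneg[of y] yz by (simp add: C_def)
        show "0 \<le> k' z - k' y" using monoD[OF s(3) yz(1)] by simp
      qed (use \<Lambda>_lip[OF yz(1)] b yz in auto)
      finally have "sqrt ((F' z - F' y)\<^sup>2) \<le> sqrt ((b * C) * \<bar>z - y\<bar>)"
        using yz by (intro real_sqrt_le_mono) (simp add: ac_simps)
      then show ?thesis by (simp add: real_sqrt_mult)
    qed
    have ev: "\<forall>\<^sub>F y in at x. norm (F' y - F' x) \<le> sqrt (b * C) * sqrt \<bar>y - x\<bar>"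
    proof -
      have "\<forall>\<^sub>F y in at x. y \<in> {x-1<..<x+1}"
        by (rule eventually_at_in_open') auto
      then show ?thesis
      proof eventually_elim
        case (elim y)
        show ?case
        proof (cases "x \<le> y")
          case True then show ?thesis using bound[of x y] elim by simp
        next
          case False then show ?thesis using bound[of y x] by (simp add: abs_minus_commute)
        qed
      qed
    qed
    have "isCont (\<lambda>y. sqrt (b * C) * sqrt \<bar>y - x\<bar>) x" by (intro continuous_intros)
    then have "((\<lambda>y. sqrt (b * C) * sqrt \<bar>y - x\<bar>) \<longlongrightarrow> 0) (at x)" by (simp add: isCont_def)
    then have "((\<lambda>y. F' y - F' x) \<longlongrightarrow> 0) (at x)" by (rule Lim_null_comparison[OF ev])
    then show ?thesis unfolding isCont_def by (rule LIM_zero_cancel)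
  qed
  have conv: "(\<lambda>n. fn (s n) x) \<longlonglongrightarrow> f x" if "0 \<le> x" for x
    using tendsto_minus[OF s(6)[OF F'_cont[of x]]] that by (simp add: F_def f_def)
  have f_decr: "f y \<le> f x" if "x \<le> y" for x y using monoD[OF s(2) that] by (simp add: f_def)
  show thesis
  proof (rule that[OF s(1) conv])
    fix T assume T: "(\<lambda>n. kin \<alpha> \<gamma> l (gn (s n))) \<longlonglongrightarrow> T"
    \<comment> \<open>Every point lies below a continuity point of \<open>k'\<close>, and there
      \<open>k'\<close> is a limit of partial energies.\<close>
    have k'T: "k' x \<le> T" for x
    proof -
      obtain y where y: "x < y" "isCont k' y" using exists_good by blast
      have "k' x \<le> k' y" using monoD[OF s(3)] y by simp
      also have "\<dots> \<le> T" by (rule LIMSEQ_le[OF s(7)[OF y(2)] T]) (use k_kin in blast)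
      finally show ?thesis .
    qed
    have 1: "\<alpha> * (f x - f y)\<^sup>2 \<le> (y - x) * (k' y - k' x)" if "0 \<le> x" "x \<le> y" "y \<le> l" for x y
    proof -
      have "\<Lambda> y - \<Lambda> x = (y - x) / \<alpha>" using that by (simp add: \<Lambda>_def diff_divide_distrib)
      with H'[OF that(2)] pos show ?thesis by (simp add: f_def field_simps)
    qed
    have 2: "\<gamma> * (f x - f y)\<^sup>2 \<le> (y - x) * (k' y - k' x)" if "l \<le> x" "x \<le> y" for x y
    proof -
      have "\<Lambda> y - \<Lambda> x = (y - x) / \<gamma>" using that by (simp add: \<Lambda>_def diff_divide_distrib)
      with H'[of x y] that pos show ?thesis by (simp add: f_def field_simps)
    qed
    obtain g where "ac_on {0..} f g"
        "\<alpha> * (LINT t:{0..l}|lborel. (g t)\<^sup>2) + \<gamma> * (LINT t:{l..}|lborel. (g t)\<^sup>2) \<le> T"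
      by (rule weighted_riesz[of f k' T \<alpha> \<gamma> l, OF f_decr _ k'_nonneg k'T pos 1 2]) (use monoD[OF s(3)] in auto)
    then show "\<exists>g. ac_on {0..} f g \<and> kin \<alpha> \<gamma> l g \<le> T" by (auto simp: kin_def)
  qed
qed


lemma integrable_powr_tail:
  fixes e :: real
  assumes "e < -1"
  shows "set_integrable lborel {1..} (\<lambda>x. x powr e)"
proof -
  let ?F = "\<lambda>x. x powr (e + 1) / (e + 1)"
  have "(?F \<longlongrightarrow> 0 / (e + 1)) at_top"
    using assms by (intro tendsto_divide tendsto_const tendsto_neg_powr filterlim_ident) auto
  then have lim: "(?F \<longlongrightarrow> 0) at_top" by simp
  have "(\<integral>\<^sup>+x. ennreal (x powr e) * indicator {1..} x \<partial>lborel) = ennreal (0 - ?F 1)"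
  proof (rule nn_integral_FTC_atLeast[OF _ _ _ lim])
    show "(?F has_real_derivative x powr e) (at x)" if "1 \<le> x" for x
    proof -
      have "((\<lambda>x. x powr (e + 1)) has_real_derivative (e + 1) * x powr (e + 1 - 1)) (at x)"
        using that by (intro has_real_derivative_powr) auto
      then have "(?F has_real_derivative (e + 1) * x powr (e + 1 - 1) / (e + 1)) (at x)"
        by (rule DERIV_cdivide)
      then show ?thesis using assms by simp
    qed
  qed auto
  then have "(\<integral>\<^sup>+x. ennreal (norm (indicator {1..} x *\<^sub>R x powr e)) \<partial>lborel) < \<infinity>"
    by (simp add: ennreal_mult'' mult.commute ennreal_indicator)
  then show ?thesis unfolding set_integrable_def by (intro integrableI_bounded) auto
qed

text \<open>Mass is only lower semicontinuous, by Fatou, but the potential converges: the uniform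
  tail bound f(x)^2 \<le> \<mu>/x supplies an integrable majorant for the p-th power.\<close>

lemma decr_pair_limit:
  fixes fn gn :: "nat \<Rightarrow> real \<Rightarrow> real"
  assumes dp: "\<And>n. decr_pair (fn n) (gn n)" and m: "\<And>n. mass (fn n) = \<mu>" and M: "\<And>n. fn n 0 \<le> M"
    and conv: "\<And>x. 0 \<le> x \<Longrightarrow> (\<lambda>n. fn n x) \<longlonglongrightarrow> f x" and p: "2 < p"
  shows "L2_on {0..} f" "mass f \<le> \<mu>" "(\<lambda>n. pot p (fn n)) \<longlonglongrightarrow> pot p f"
    "\<And>x. 0 \<le> x \<Longrightarrow> 0 \<le> f x" "\<And>x y. 0 \<le> x \<Longrightarrow> x \<le> y \<Longrightarrow> f y \<le> f x"
proof -
  have fn0: "0 \<le> fn n x" if "0 \<le> x" for n x using decr_pairD(1)[OF dp that] .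
  have fnM: "fn n x \<le> M" if "0 \<le> x" for n x using decr_pairD(2)[OF dp order_refl that, of n] M[of n] by simp
  show nonneg: "0 \<le> f x" if "0 \<le> x" for x
    by (rule LIMSEQ_le_const[OF conv[OF that]]) (use fn0[OF that] in blast)
  show "f y \<le> f x" if "0 \<le> x" "x \<le> y" for x y
  proof (rule LIMSEQ_le[OF conv conv])
    show "\<exists>N. \<forall>n\<ge>N. fn n y \<le> fn n x" using decr_pairD(2)[OF dp that] by blast
  qed (use that in auto)
  have \<mu>0: "0 \<le> \<mu>" using m[of 0] mass_nonneg[of "fn 0"] by simp
  have fnm [measurable]: "(\<lambda>x. indicator {0..} x * fn n x) \<in> borel_measurable borel" for n
    using L2_on_indicator_measurable[OF decr_pairD(3)[OF dp]] by simp
  have ind_conv: "(\<lambda>n. indicator {0..} x * fn n x) \<longlonglongrightarrow> indicator {0..} x * f x" for x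
  proof (cases "0 \<le> x")
    case True then show ?thesis using conv[OF True] by simp
  qed simp
  have fm [measurable]: "(\<lambda>x. indicator {0..} x * f x) \<in> borel_measurable borel"
    by (rule borel_measurable_LIMSEQ_real[OF ind_conv fnm])
  have sq: "indicator {0..} x * (h x)\<^sup>2 = (indicator {0..} x * h x)\<^sup>2" for x and h :: "real \<Rightarrow> real"
    by (auto split: split_indicator)
  have nn: "(\<integral>\<^sup>+x. ennreal (indicator {0..} x * (f x)\<^sup>2) \<partial>lborel) \<le> ennreal \<mu>"
  proof -
    have "(\<integral>\<^sup>+x. ennreal (indicator {0..} x * (f x)\<^sup>2) \<partial>lborel)
        = (\<integral>\<^sup>+x. liminf (\<lambda>n. ennreal (indicator {0..} x * (fn n x)\<^sup>2)) \<partial>lborel)"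
    proof (rule nn_integral_cong)
      fix x
      have "(\<lambda>n. ennreal ((indicator {0..} x * fn n x)\<^sup>2)) \<longlonglongrightarrow> ennreal ((indicator {0..} x * f x)\<^sup>2)"
        by (intro tendsto_ennrealI tendsto_power ind_conv)
      from lim_imp_Liminf[OF _ this]
      show "ennreal (indicator {0..} x * (f x)\<^sup>2) = liminf (\<lambda>n. ennreal (indicator {0..} x * (fn n x)\<^sup>2))"
        unfolding sq by simp
    qed
    also have "\<dots> \<le> liminf (\<lambda>n. \<integral>\<^sup>+x. ennreal (indicator {0..} x * (fn n x)\<^sup>2) \<partial>lborel)"
      unfolding sq by (rule nn_integral_liminf) measurable
    also have "(\<lambda>n. \<integral>\<^sup>+x. ennreal (indicator {0..} x * (fn n x)\<^sup>2) \<partial>lborel) = (\<lambda>n. ennreal \<mu>)"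
    proof
      fix n
      have "integrable lborel (\<lambda>x. indicator {0..} x * (fn n x)\<^sup>2)"
        using L2_onD(2)[OF decr_pairD(3)[OF dp[of n]]] by (simp add: set_integrable_def)
      then show "(\<integral>\<^sup>+x. ennreal (indicator {0..} x * (fn n x)\<^sup>2) \<partial>lborel) = ennreal \<mu>"
        using m[of n] by (simp add: nn_integral_eq_integral mass_def set_lebesgue_integral_def)
    qed
    finally show ?thesis by (simp add: Liminf_const)
  qed
  have int: "set_integrable lborel {0..} (\<lambda>x. (f x)\<^sup>2)"
    unfolding set_integrable_def
  proof (rule integrableI_bounded)
    show "(\<lambda>x. indicator {0..} x *\<^sub>R (f x)\<^sup>2) \<in> borel_measurable lborel"
      unfolding real_scaleR_def sq by measurable
    have "(\<integral>\<^sup>+x. ennreal (norm (indicator {0..} x *\<^sub>R (f x)\<^sup>2)) \<partial>lborel)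
        = (\<integral>\<^sup>+x. ennreal (indicator {0..} x * (f x)\<^sup>2) \<partial>lborel)"
      by (intro nn_integral_cong) (simp add: abs_mult)
    also have "\<dots> < \<infinity>" using nn by (auto intro: le_less_trans)
    finally show "(\<integral>\<^sup>+x. ennreal (norm (indicator {0..} x *\<^sub>R (f x)\<^sup>2)) \<partial>lborel) < \<infinity>" .
  qed
  then show L2: "L2_on {0..} f" by (simp add: L2_on_def set_borel_measurable_def)
  have "ennreal (mass f) = (\<integral>\<^sup>+x. ennreal (indicator {0..} x * (f x)\<^sup>2) \<partial>lborel)"
    using int by (simp add: nn_integral_eq_integral mass_def set_lebesgue_integral_def set_integrable_def)
  with nn have "ennreal (mass f) \<le> ennreal \<mu>" by simp
  then show "mass f \<le> \<mu>" using \<mu>0 by simp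
  \<comment> \<open>The uniform bound M near 0 and the decay (\<mu>/x)^(p/2) beyond 1, integrable
    because p/2 > 1.\<close>
  define w where "w x = indicator {0..1} x * M powr p + indicator {1..} x * (\<mu> powr (p / 2) * x powr (- (p / 2)))" for x :: real
  have iw: "integrable lborel w"
  proof -
    have "set_integrable lborel {1..} (\<lambda>x. \<mu> powr (p / 2) * x powr (- (p / 2)))"
      using integrable_powr_tail[of "- (p / 2)"] p by simp
    moreover have "set_integrable lborel {0..1::real} (\<lambda>x. M powr p)"
      by (rule set_integrable_const_fin[OF _ emeasure_lborel_Icc_finite]) simp
    ultimately show ?thesis unfolding w_def set_integrable_def real_scaleR_def
      by (intro Bochner_Integration.integrable_add)
  qed
  have bound: "indicator {0..} x * \<bar>fn n x\<bar> powr p \<le> w x" for n x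
  proof (cases "0 \<le> x")
    case True
    have w0: "0 \<le> indicator {0..1} x * M powr p" "0 \<le> indicator {1..} x * (\<mu> powr (p / 2) * x powr (- (p / 2)))"
      by simp_all
    show ?thesis
    proof (cases "x \<le> 1")
      case x1: True
      have "\<bar>fn n x\<bar> powr p \<le> M powr p" using fn0[OF True, of n] fnM[OF True, of n] p by (intro powr_mono2) auto
      moreover have "w x = M powr p + indicator {1..} x * (\<mu> powr (p / 2) * x powr (- (p / 2)))"
        using True x1 by (simp add: w_def)
      moreover have "indicator {0..} x * \<bar>fn n x\<bar> powr p = \<bar>fn n x\<bar> powr p" using True by simp
      ultimately show ?thesis using w0(2) by linarith
    next
      case False
      have "x * (fn n x)\<^sup>2 \<le> \<mu>" using decr_pair_tail[OF dp True, of n] m[of n] by simp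
      then have le: "(fn n x)\<^sup>2 \<le> \<mu> / x" using False by (simp add: field_simps)
      have "\<bar>fn n x\<bar> powr p = (\<bar>fn n x\<bar> powr 2) powr (p / 2)" by (subst powr_powr) simp
      also have "\<bar>fn n x\<bar> powr 2 = (fn n x)\<^sup>2" using fn0[OF True, of n] by (cases "fn n x = 0") auto
      also have "((fn n x)\<^sup>2) powr (p / 2) \<le> (\<mu> / x) powr (p / 2)" using le p by (intro powr_mono2) auto
      also have "(\<mu> / x) powr (p / 2) = \<mu> powr (p / 2) * x powr (- (p / 2))"
        using False \<mu>0 by (simp add: powr_divide powr_minus_divide)
      finally show ?thesis using False True by (simp add: w_def)
    qed
  next
    case False then show ?thesis by (simp add: w_def)
  qed
  have pw: "indicator {0..} x * \<bar>h x\<bar> powr p = \<bar>indicator {0..} x * h x\<bar> powr p" for x and h :: "real \<Rightarrow> real"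
    by (auto split: split_indicator)
  show "(\<lambda>n. pot p (fn n)) \<longlonglongrightarrow> pot p f"
    unfolding pot_def set_lebesgue_integral_def real_scaleR_def
  proof (rule integral_dominated_convergence[OF _ _ iw])
    show "(\<lambda>x. indicator {0..} x * \<bar>f x\<bar> powr p) \<in> borel_measurable lborel"
      "(\<lambda>x. indicator {0..} x * \<bar>fn n x\<bar> powr p) \<in> borel_measurable lborel" for n
      unfolding pw by measurable
    show "AE x in lborel. norm (indicator {0..} x * \<bar>fn n x\<bar> powr p) \<le> w x" for n
      using bound by (intro AE_I2) (simp add: abs_mult)
    show "AE x in lborel. (\<lambda>n. indicator {0..} x * \<bar>fn n x\<bar> powr p) \<longlonglongrightarrow> indicator {0..} x * \<bar>f x\<bar> powr p"
    proof (rule AE_I2)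
      fix x
      have "(\<lambda>n. \<bar>indicator {0..} x * fn n x\<bar> powr p) \<longlonglongrightarrow> \<bar>indicator {0..} x * f x\<bar> powr p"
        using p by (intro tendsto_powr' tendsto_rabs ind_conv tendsto_const) auto
      then show "(\<lambda>n. indicator {0..} x * \<bar>fn n x\<bar> powr p) \<longlonglongrightarrow> indicator {0..} x * \<bar>f x\<bar> powr p"
        unfolding pw .
    qed
  qed
qed

text \<open>Monotone profiles have uniformly small tails, so a minimizing sequence can only lose mass;
  as the infimum is negative, multiplying the limit by a constant restores it at no cost.\<close>

lemma exists_minimizer:
  assumes p: "2 < p" "p < 6" and \<mu>: "0 < \<mu>" and \<alpha>: "0 < \<alpha>" "0 < \<gamma>" "0 \<le> l"
  obtains f g where "decr_pair f g" "mass f = \<mu>" "wenergy p \<alpha> \<gamma> l f g < 0"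
    "\<And>f' g'. decr_pair f' g' \<Longrightarrow> mass f' = \<mu> \<Longrightarrow> wenergy p \<alpha> \<gamma> l f g \<le> wenergy p \<alpha> \<gamma> l f' g'"
proof -
  define S where "S = {wenergy p \<alpha> \<gamma> l f g | f g. decr_pair f g \<and> mass f = \<mu>}"
  define c where "c = min \<alpha> \<gamma>"
  have c: "0 < c" "c \<le> \<alpha>" "c \<le> \<gamma>" using \<alpha> by (auto simp: c_def)
  note coerc = wenergy_coercive[OF _ _ \<mu> p c \<alpha>(3)]
  define M where "M = sup_const p c \<mu>"
  have low: "- (M powr (p - 2) * \<mu>) / p \<le> E" if "E \<in> S" for E
  proof (cases "E \<le> 0")
    case True
    from \<open>E \<in> S\<close> obtain f g where fg: "E = wenergy p \<alpha> \<gamma> l f g" "decr_pair f g" "mass f = \<mu>"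
      by (auto simp: S_def)
    show ?thesis using coerc(3)[OF fg(2,3)] True fg(1) by (simp add: M_def)
  next
    case False
    have "- (M powr (p - 2) * \<mu>) / p \<le> 0" using \<mu> p by simp
    with False show ?thesis by linarith
  qed
  then have bdd: "bdd_below S" by (rule bdd_belowI)
  obtain f0 g0 where f0: "decr_pair f0 g0" "mass f0 = \<mu>" "wenergy p \<alpha> \<gamma> l f0 g0 < 0"
    using exists_negative_wenergy[OF p \<mu> \<alpha>] by blast
  then have in_S: "wenergy p \<alpha> \<gamma> l f0 g0 \<in> S" by (auto simp: S_def)
  define j where "j = Inf S"
  have j_le: "j \<le> wenergy p \<alpha> \<gamma> l f g" if "decr_pair f g" "mass f = \<mu>" for f g
    unfolding j_def by (rule cInf_lower[OF _ bdd]) (use that in \<open>auto simp: S_def\<close>)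
  have j_neg: "j < 0" using j_le[OF f0(1,2)] f0(3) by simp
  \<comment> \<open>The minimum with 0 keeps all energies of the sequence nonpositive, as the
    coercivity bounds require.\<close>
  have "\<exists>f g. decr_pair f g \<and> mass f = \<mu> \<and> wenergy p \<alpha> \<gamma> l f g < min 0 (j + 1 / real (Suc n))" for n
  proof -
    have "Inf S < min 0 (j + 1 / real (Suc n))" using j_neg by (simp add: j_def)
    then obtain E where E: "E \<in> S" "E < min 0 (j + 1 / real (Suc n))"
      using cInf_less_iff[OF _ bdd] in_S by blast
    then show ?thesis by (auto simp: S_def)
  qed
  then obtain fn gn where seq: "\<And>n. decr_pair (fn n) (gn n)" "\<And>n. mass (fn n) = \<mu>"
      "\<And>n. wenergy p \<alpha> \<gamma> l (fn n) (gn n) < min 0 (j + 1 / real (Suc n))"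
    by metis
  have neg: "wenergy p \<alpha> \<gamma> l (fn n) (gn n) \<le> 0" for n using seq(3)[of n] by simp
  have Mn: "fn n 0 \<le> M" for n unfolding M_def by (rule coerc(1)[OF seq(1,2) neg])
  have Bn: "kin \<alpha> \<gamma> l (gn n) \<le> 2 / p * (M powr (p - 2) * \<mu>)" for n
    unfolding M_def by (rule coerc(2)[OF seq(1,2) neg])
  have E_lim: "(\<lambda>n. wenergy p \<alpha> \<gamma> l (fn n) (gn n)) \<longlonglongrightarrow> j"
  proof (rule tendsto_sandwich)
    show "\<forall>\<^sub>F n in sequentially. j \<le> wenergy p \<alpha> \<gamma> l (fn n) (gn n)"
      using j_le[OF seq(1,2)] by (intro always_eventually allI)
    show "\<forall>\<^sub>F n in sequentially. wenergy p \<alpha> \<gamma> l (fn n) (gn n) \<le> j + inverse (real (Suc n))"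
      using seq(3) by (intro always_eventually allI) (simp add: inverse_eq_divide less_imp_le)
    show "(\<lambda>n. j + inverse (real (Suc n))) \<longlonglongrightarrow> j"
      using tendsto_add[OF tendsto_const[of j] LIMSEQ_inverse_real_of_nat] by simp
  qed (rule tendsto_const)
  obtain s f where s: "strict_mono (s :: nat \<Rightarrow> nat)" "\<And>x. 0 \<le> x \<Longrightarrow> (\<lambda>n. fn (s n) x) \<longlonglongrightarrow> f x"
    "\<And>T. (\<lambda>n. kin \<alpha> \<gamma> l (gn (s n))) \<longlonglongrightarrow> T \<Longrightarrow> \<exists>g. ac_on {0..} f g \<and> kin \<alpha> \<gamma> l g \<le> T"
    using decr_compact[of fn gn, OF seq(1) Mn Bn \<alpha>] by blast
  note lim = decr_pair_limit[of "\<lambda>n. fn (s n)" "\<lambda>n. gn (s n)", OF seq(1,2) Mn s(2) p(1)]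
  have "(\<lambda>n. 2 * (wenergy p \<alpha> \<gamma> l (fn (s n)) (gn (s n)) + pot p (fn (s n)) / p)) \<longlonglongrightarrow> 2 * (j + pot p f / p)"
    using p LIMSEQ_subseq_LIMSEQ[OF E_lim s(1)]
    by (intro tendsto_mult tendsto_add tendsto_divide tendsto_const lim(3)) (auto simp: o_def)
  then have "(\<lambda>n. kin \<alpha> \<gamma> l (gn (s n))) \<longlonglongrightarrow> 2 * (j + pot p f / p)"
    by (simp add: wenergy_def)
  then obtain g where g: "ac_on {0..} f g" "kin \<alpha> \<gamma> l g \<le> 2 * (j + pot p f / p)"
    using s(3) by blast
  have dp: "decr_pair f g" using lim g by (auto simp: decr_pair_def)
  have Ej: "wenergy p \<alpha> \<gamma> l f g \<le> j" using g(2) by (simp add: wenergy_def)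
  \<comment> \<open>A limit without mass has no potential energy, so its energy could not lie below
    the negative infimum.\<close>
  have m0: "0 < mass f"
  proof (rule ccontr)
    assume "\<not> 0 < mass f"
    then have "mass f = 0" using mass_nonneg[of f] by simp
    then have "pot p f \<le> 0" using decr_pair_pot_le[OF dp p(1)] by simp
    then have "pot p f = 0" using pot_nonneg[of p f] by simp
    moreover have "0 \<le> kin \<alpha> \<gamma> l g" using \<alpha> by (auto simp: kin_def intro!: add_nonneg_nonneg mult_nonneg_nonneg)
    ultimately show False using Ej j_neg by (simp add: wenergy_def)
  qed
  define b where "b = sqrt (\<mu> / mass f)"
  have b1: "1 \<le> b" using lim(2) m0 by (simp add: b_def)
  have b2: "b\<^sup>2 = \<mu> / mass f" using m0 \<mu> by (simp add: b_def)
  have dpb: "decr_pair (\<lambda>x. b * f x) (\<lambda>x. b * g x)" "mass (\<lambda>x. b * f x) = \<mu>"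
    using decr_pair_scale(1,2)[OF dp, of b 1] b1 b2 m0 by simp_all
  have "wenergy p \<alpha> \<gamma> l (\<lambda>x. b * f x) (\<lambda>x. b * g x) \<le> b\<^sup>2 * wenergy p \<alpha> \<gamma> l f g"
    by (rule wenergy_const_mult_le[OF dp b1 p(1)])
  also have "\<dots> \<le> 1 * wenergy p \<alpha> \<gamma> l f g"
    using Ej j_neg b1 by (intro mult_right_mono_neg) (auto simp: one_le_power)
  also have "\<dots> \<le> j" using Ej by simp
  finally have le: "wenergy p \<alpha> \<gamma> l (\<lambda>x. b * f x) (\<lambda>x. b * g x) \<le> j" .
  show thesis
  proof (rule that[OF dpb])
    show "wenergy p \<alpha> \<gamma> l (\<lambda>x. b * f x) (\<lambda>x. b * g x) < 0" using le j_neg by simp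
    show "wenergy p \<alpha> \<gamma> l (\<lambda>x. b * f x) (\<lambda>x. b * g x) \<le> wenergy p \<alpha> \<gamma> l f' g'"
      if "decr_pair f' g'" "mass f' = \<mu>" for f' g' using le j_le[OF that] by simp
  qed
qed

section \<open>The critical length\<close>

lemma set_integral_tail_tendsto:
  fixes h :: "real \<Rightarrow> real"
  assumes h: "set_integrable lborel {0..} h"
  shows "(\<lambda>n. LINT x:{real n..}|lborel. h x) \<longlonglongrightarrow> 0"
proof -
  have U: "(\<Union>n. {0..real n}) = {0..}" using real_arch_simple by auto
  have "(\<lambda>n. LINT x:{0..real n}|lborel. h x) \<longlonglongrightarrow> (LINT x:(\<Union>n. {0..real n})|lborel. h x)"
    by (rule set_integral_cont_up) (auto simp: incseq_def U h)
  then have "(\<lambda>n. (LINT x:{0..}|lborel. h x) - (LINT x:{0..real n}|lborel. h x))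
      \<longlonglongrightarrow> (LINT x:{0..}|lborel. h x) - (LINT x:{0..}|lborel. h x)"
    unfolding U by (intro tendsto_diff tendsto_const)
  moreover have "(LINT x:{0..}|lborel. h x) - (LINT x:{0..real n}|lborel. h x) = (LINT x:{real n..}|lborel. h x)" for n
    using set_integral_Ici_split[OF h, of "real n"] by simp
  ultimately show ?thesis by simp
qed

lemma kin_same:
  assumes "decr_pair f g" "0 \<le> l"
  shows "kin c c l g = c * (LINT x:{0..}|lborel. (g x)\<^sup>2)"
  using set_integral_Ici_split[OF decr_pair_deriv_integrable(1)[OF assms] assms(2)]
  by (simp add: kin_def algebra_simps)

text \<open>The exponent 2/(6 - p) makes r^2 exactly q times r^(p/2 - 1). The mass-preserving
  dilation thus trades the weight a q for a, up to an overall factor r^(p/2 - 1).\<close>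

lemma decr_pair_dilate:
  assumes f: "decr_pair f g" and p: "p < 6" and q: "0 < q"
  defines "r \<equiv> q powr (2 / (6 - p))"
  shows "decr_pair (\<lambda>x. sqrt r * f (r * x)) (\<lambda>x. (sqrt r * r) * g (r * x))"
    "mass (\<lambda>x. sqrt r * f (r * x)) = mass f"
    "wenergy p a a 0 (\<lambda>x. sqrt r * f (r * x)) (\<lambda>x. (sqrt r * r) * g (r * x))
      = r powr (p / 2 - 1) * wenergy p (a * q) (a * q) 0 f g"
proof -
  have r: "0 < r" using q by (simp add: r_def)
  have s0: "0 \<le> sqrt r" using r by simp
  note sc = decr_pair_scale[OF f s0 r]
  show "decr_pair (\<lambda>x. sqrt r * f (r * x)) (\<lambda>x. (sqrt r * r) * g (r * x))" by (rule sc(1))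
  show "mass (\<lambda>x. sqrt r * f (r * x)) = mass f" unfolding sc(2) using r by simp
  have rp: "sqrt r powr p / r = r powr (p / 2 - 1)"
  proof -
    have "sqrt r powr p = r powr (p / 2)" using r by (simp add: powr_half_sqrt[symmetric] powr_powr)
    moreover have "r powr (p / 2 - 1) = r powr (p / 2) / r powr 1" by (rule powr_diff)
    ultimately show ?thesis using r by simp
  qed
  have rq: "r\<^sup>2 = r powr (p / 2 - 1) * q"
  proof -
    have "r powr ((6 - p) / 2) = q powr (2 / (6 - p) * ((6 - p) / 2))" unfolding r_def by (rule powr_powr)
    also have "2 / (6 - p) * ((6 - p) / 2) = 1" using p by simp
    finally have "r powr ((6 - p) / 2) = q" using q by simp
    moreover have "r powr (p / 2 - 1) * r powr ((6 - p) / 2) = r powr 2"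
    proof -
      have "p / 2 - 1 + (6 - p) / 2 = 2" by (simp add: field_simps)
      then show ?thesis by (simp only: powr_add[symmetric])
    qed
    ultimately show ?thesis using r by simp
  qed
  have "kin a a 0 (\<lambda>x. (sqrt r * r) * g (r * x)) = r powr (p / 2 - 1) * kin (a * q) (a * q) 0 g"
  proof -
    have "kin a a 0 (\<lambda>x. (sqrt r * r) * g (r * x)) = r\<^sup>2 * kin a a 0 g"
      unfolding sc(4) using r by (simp add: power2_eq_square)
    also have "\<dots> = r powr (p / 2 - 1) * kin (a * q) (a * q) 0 g"
      unfolding rq kin_def by (simp add: algebra_simps)
    finally show ?thesis .
  qed
  moreover have "pot p (\<lambda>x. sqrt r * f (r * x)) = r powr (p / 2 - 1) * pot p f"
    unfolding sc(3) rp[symmetric] by simp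
  ultimately show "wenergy p a a 0 (\<lambda>x. sqrt r * f (r * x)) (\<lambda>x. (sqrt r * r) * g (r * x))
      = r powr (p / 2 - 1) * wenergy p (a * q) (a * q) 0 f g"
    by (simp add: wenergy_def right_diff_distrib)
qed

lemma decr_pair_shift:
  assumes f: "decr_pair f g" and l: "0 \<le> l"
  shows "decr_pair (\<lambda>x. f (l + x)) (\<lambda>x. g (l + x))"
    "mass (\<lambda>x. f (l + x)) = (LINT x:{l..}|lborel. (f x)\<^sup>2)"
    "pot p (\<lambda>x. f (l + x)) = (LINT x:{l..}|lborel. \<bar>f x\<bar> powr p)"
    "(LINT x:{0..}|lborel. (g (l + x))\<^sup>2) = (LINT x:{l..}|lborel. (g x)\<^sup>2)"
proof -
  have sets: "{x. l + 1 * x \<in> {l..}} = {0..}" by auto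
  note aff = set_integral_affine(1)[of 1 l "{l..}", unfolded sets, simplified]
  show "decr_pair (\<lambda>x. f (l + x)) (\<lambda>x. g (l + x))"
    unfolding decr_pair_def
  proof (intro conjI allI impI)
    show "0 \<le> f (l + x)" if "0 \<le> x" for x using that l by (intro decr_pairD(1)[OF f]) auto
    show "f (l + y) \<le> f (l + x)" if "0 \<le> x" "x \<le> y" for x y using that l by (intro decr_pairD(2)[OF f]) auto
    have "L2_on {l..} f" by (rule L2_on_subset[OF decr_pairD(3)[OF f]]) (use l in auto)
    from L2_on_affine[OF this, of 1 l 1] show "L2_on {0..} (\<lambda>x. f (l + x))" unfolding sets by simp
    have "ac_on {l..} f g" by (rule ac_on_subset[OF decr_pairD(4)[OF f]]) (use l in auto)
    from ac_on_affine[OF this, of 1 l 1] show "ac_on {0..} (\<lambda>x. f (l + x)) (\<lambda>x. g (l + x))" unfolding sets by simp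
  qed
  show "mass (\<lambda>x. f (l + x)) = (LINT x:{l..}|lborel. (f x)\<^sup>2)" unfolding mass_def by (rule aff)
  show "pot p (\<lambda>x. f (l + x)) = (LINT x:{l..}|lborel. \<bar>f x\<bar> powr p)" unfolding pot_def by (rule aff)
  show "(LINT x:{0..}|lborel. (g (l + x))\<^sup>2) = (LINT x:{l..}|lborel. (g x)\<^sup>2)" by (rule aff)
qed

text \<open>Moving the break point right replaces weight 9 by weight 1 on [l,l'].\<close>

lemma kin_antimono_length:
  assumes f: "decr_pair f g" and l: "0 \<le> l" "l \<le> l'"
  shows "kin 1 9 l' g \<le> kin 1 9 l g"
proof -
  have i: "set_integrable lborel {0..l'} (\<lambda>x. (g x)\<^sup>2)" "set_integrable lborel {l..} (\<lambda>x. (g x)\<^sup>2)"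
    using decr_pair_deriv_integrable[OF f] l by auto
  have "(LINT x:{0..l'}|lborel. (g x)\<^sup>2) = (LINT x:{0..l}|lborel. (g x)\<^sup>2) + (LINT x:{l..l'}|lborel. (g x)\<^sup>2)"
    by (rule set_integral_Icc_combine[OF i(1) l])
  moreover have "(LINT x:{l..}|lborel. (g x)\<^sup>2) = (LINT x:{l..l'}|lborel. (g x)\<^sup>2) + (LINT x:{l'..}|lborel. (g x)\<^sup>2)"
    by (rule set_integral_Ici_split[OF i(2) l(2)])
  moreover have "0 \<le> (LINT x:{l..l'}|lborel. (g x)\<^sup>2)" by simp
  ultimately show ?thesis by (simp add: kin_def)
qed

text \<open>The comparison level \<open>e\<close> below is the ground state energy of the line. A profile for the
  problem with weight 9 is rescaled to one for the line with strictly better energy, which bounds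
  the admissible lengths away from zero; in the other direction, concentrating the line profile on
  the terminal edge beats the line for large lengths.\<close>

lemma critical_length:
  assumes p: "2 < p" "p < 6" and \<mu>: "0 < \<mu>"
    and R: "decr_pair fR gR" "mass fR = \<mu>" "wenergy p 4 4 0 fR gR = e" "e < 0"
    and min: "\<And>f g. decr_pair f g \<Longrightarrow> mass f = \<mu> \<Longrightarrow> e \<le> wenergy p 4 4 0 f g"
  shows "\<exists>ls>0. \<forall>l>0. (\<exists>f g. decr_pair f g \<and> mass f = \<mu> \<and> wenergy p 1 9 l f g \<le> e) \<longleftrightarrow> ls \<le> l"
proof -
  define S where "S = {l. 0 < l \<and> (\<exists>f g. decr_pair f g \<and> mass f = \<mu> \<and> wenergy p 1 9 l f g \<le> e)}"
  have up: "l' \<in> S" if "l \<in> S" "l \<le> l'" for l l'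
  proof -
    from \<open>l \<in> S\<close> obtain f g where fg: "0 < l" "decr_pair f g" "mass f = \<mu>" "wenergy p 1 9 l f g \<le> e"
      by (auto simp: S_def)
    have "kin 1 9 l' g \<le> kin 1 9 l g" using kin_antimono_length[OF fg(2) _ that(2)] fg(1) by simp
    then have "wenergy p 1 9 l' f g \<le> e" using fg(4) by (simp add: wenergy_def)
    with fg that(2) show ?thesis by (auto simp: S_def)
  qed
  have nonempty: "S \<noteq> {}"
  proof -
    \<comment> \<open>Ratio 4 turns the line weight 4 into weight 1; the energy becomes
      \<open>e\<close> times a factor above 1, which lies below the negative
      \<open>e\<close>.\<close>
    define r where "r = (4::real) powr (2 / (6 - p))"
    define f where "f x = sqrt r * fR (r * x)" for x
    define g where "g x = (sqrt r * r) * gR (r * x)" for x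
    have f: "decr_pair f g" "mass f = \<mu>" "wenergy p 1 1 0 f g = r powr (p / 2 - 1) * e"
      using decr_pair_dilate(1,2)[OF R(1) p(2), of 4] decr_pair_dilate(3)[OF R(1) p(2), of 4 1] R(2,3) unfolding f_def[abs_def] g_def[abs_def] r_def by simp_all
    have "1 < r" unfolding r_def using p by (intro gr_one_powr) auto
    then have "1 < r powr (p / 2 - 1)" using p by (intro gr_one_powr) auto
    then have lt: "wenergy p 1 1 0 f g < e" unfolding f(3) using R(4) by (simp add: mult_less_cancel_right2)
    have "(\<lambda>n. LINT x:{real n..}|lborel. (g x)\<^sup>2) \<longlonglongrightarrow> 0"
      by (rule set_integral_tail_tendsto[OF decr_pair_deriv_integrable(1)[OF f(1) order_refl]])
    then have "\<forall>\<^sub>F n in sequentially. (LINT x:{real n..}|lborel. (g x)\<^sup>2) < (e - wenergy p 1 1 0 f g) / 4"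
      using lt by (intro order_tendstoD(2)[of _ 0]) auto
    then obtain N where N: "\<And>n. N \<le> n \<Longrightarrow> (LINT x:{real n..}|lborel. (g x)\<^sup>2) < (e - wenergy p 1 1 0 f g) / 4"
      by (auto simp: eventually_sequentially)
    define l where "l = real (Suc N)"
    \<comment> \<open>Weight 9 instead of 1 on the tail adds 8/2 = 4 times its energy, hence the
      quarter of the gap in the choice of \<open>N\<close>.\<close>
    have "kin 1 9 l g = (LINT x:{0..}|lborel. (g x)\<^sup>2) + 8 * (LINT x:{l..}|lborel. (g x)\<^sup>2)"
      using set_integral_Ici_split[OF decr_pair_deriv_integrable(1)[OF f(1) order_refl], of l]
      by (simp add: kin_def l_def)
    then have "wenergy p 1 9 l f g = wenergy p 1 1 0 f g + 4 * (LINT x:{l..}|lborel. (g x)\<^sup>2)"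
      using kin_same[OF f(1) order_refl, of 1] by (simp add: wenergy_def)
    also have "\<dots> < e" using N[of "Suc N"] by (simp add: l_def field_simps)
    finally have "wenergy p 1 9 l f g \<le> e" by simp
    moreover have "0 < l" by (simp add: l_def)
    ultimately have "l \<in> S" using f(1,2) unfolding S_def by blast
    then show ?thesis by blast
  qed
  have "\<exists>l0>0. \<forall>l\<in>S. l0 \<le> l"
  proof -
    \<comment> \<open>The ratio of the tail weight 9 to the line weight 4.\<close>
    define r where "r = (9 / 4 :: real) powr (2 / (6 - p))"
    define \<tau> where "\<tau> = r powr (p / 2 - 1)"
    have "1 < r" unfolding r_def using p by (intro gr_one_powr) auto
    then have \<tau>: "1 < \<tau>" unfolding \<tau>_def using p by (intro gr_one_powr) auto
    define M where "M = sup_const p 1 \<mu>"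
    have M: "0 < M" unfolding M_def sup_const_def using p \<mu> by simp
    \<comment> \<open>Since \<open>e\<close> is negative and \<tau> > 1, this lower bound is
      strictly above \<open>e\<close>. Masses below \<mu> are included because scaling a profile of
      negative energy up to mass \<mu> lowers the energy further.\<close>
    have nine: "e / \<tau> \<le> wenergy p 9 9 0 h k" if h: "decr_pair h k" and hm: "mass h \<le> \<mu>" for h k
    proof -
      define f where "f x = sqrt r * h (r * x)" for x
      define g where "g x = (sqrt r * r) * k (r * x)" for x
      have f: "decr_pair f g" "mass f = mass h" "wenergy p 4 4 0 f g = \<tau> * wenergy p 9 9 0 h k"
        using decr_pair_dilate(1,2)[OF h p(2), of "9/4"] decr_pair_dilate(3)[OF h p(2), of "9/4" 4] unfolding f_def[abs_def] g_def[abs_def] r_def \<tau>_def by simp_all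
      have "e \<le> wenergy p 4 4 0 f g"
      proof (cases "0 \<le> wenergy p 4 4 0 f g")
        case True then show ?thesis using R(4) by simp
      next
        case False
        have m0: "0 < mass f"
        proof (rule ccontr)
          assume "\<not> 0 < mass f"
          then have "mass f = 0" using mass_nonneg[of f] by simp
          then have "pot p f \<le> 0" using decr_pair_pot_le[OF f(1) p(1)] by simp
          then have "pot p f = 0" using pot_nonneg[of p f] by simp
          then show False using False by (simp add: wenergy_def kin_def)
        qed
        define b where "b = sqrt (\<mu> / mass f)"
        have b1: "1 \<le> b" using hm f(2) m0 by (simp add: b_def)
        have b2: "b\<^sup>2 = \<mu> / mass f" using m0 \<mu> by (simp add: b_def)
        have "decr_pair (\<lambda>x. b * f x) (\<lambda>x. b * g x)" "mass (\<lambda>x. b * f x) = \<mu>"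
          using decr_pair_scale(1,2)[OF f(1), of b 1] b1 b2 m0 by simp_all
        then have "e \<le> wenergy p 4 4 0 (\<lambda>x. b * f x) (\<lambda>x. b * g x)" by (rule min)
        also have "\<dots> \<le> b\<^sup>2 * wenergy p 4 4 0 f g" by (rule wenergy_const_mult_le[OF f(1) b1 p(1)])
        also have "\<dots> \<le> 1 * wenergy p 4 4 0 f g"
          using False b1 by (intro mult_right_mono_neg) (auto simp: one_le_power)
        finally show ?thesis by simp
      qed
      then show ?thesis using \<tau> f(3) by (simp add: field_simps)
    qed
    \<comment> \<open>Beyond \<open>l\<close> the energy is at least \<open>e / \<tau>\<close>, and
      [0,l] can lower it by at most l M^p / p; reaching \<open>e\<close> forces l \<ge>
      \<open>l0\<close>.\<close>
    define l0 where "l0 = (e / \<tau> - e) * p / M powr p"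
    have "0 < e / \<tau> - e" using \<tau> R(4) by (simp add: field_simps)
    then have l0: "0 < l0" unfolding l0_def using M p by simp
    have "l0 \<le> l" if lS: "l \<in> S" for l
    proof -
      from lS obtain f g where f: "0 < l" "decr_pair f g" "mass f = \<mu>" "wenergy p 1 9 l f g \<le> e"
        by (auto simp: S_def)
      have fM: "f 0 \<le> M"
        unfolding M_def using wenergy_coercive(1)[OF f(2,3) \<mu> p, of 1 1 9 l] f(1,4) R(4) by simp
      have l: "0 \<le> l" using f(1) by simp
      note sh = decr_pair_shift[OF f(2) l]
      have i2: "set_integrable lborel {0..} (\<lambda>x. (f x)\<^sup>2)" using L2_onD(2)[OF decr_pairD(3)[OF f(2)]] .
      have ip: "set_integrable lborel {0..} (\<lambda>x. \<bar>f x\<bar> powr p)"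
        by (rule L2_on_powr_integrable(1)[OF decr_pairD(3)[OF f(2)] _ p(1)]) (use decr_pair_abs_le[OF f(2)] in auto)
      have "mass (\<lambda>x. f (l + x)) \<le> \<mu>"
        unfolding sh(2) f(3)[symmetric] mass_def by (rule set_integral_mono_set[OF i2]) (use l in auto)
      then have "e / \<tau> \<le> wenergy p 9 9 0 (\<lambda>x. f (l + x)) (\<lambda>x. g (l + x))" by (rule nine[OF sh(1)])
      also have "\<dots> = 9 * (LINT x:{l..}|lborel. (g x)\<^sup>2) / 2 - (LINT x:{l..}|lborel. \<bar>f x\<bar> powr p) / p"
        unfolding wenergy_def kin_same[OF sh(1) order_refl] sh(3,4) ..
      finally have A: "e / \<tau> \<le> 9 * (LINT x:{l..}|lborel. (g x)\<^sup>2) / 2 - (LINT x:{l..}|lborel. \<bar>f x\<bar> powr p) / p" .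
      have "(LINT x:{0..l}|lborel. \<bar>f x\<bar> powr p) \<le> (LINT x:{0..l}|lborel. M powr p)"
      proof (rule set_integral_mono)
        show "set_integrable lborel {0..l} (\<lambda>x. \<bar>f x\<bar> powr p)" by (rule set_integrable_subset[OF ip]) auto
        show "set_integrable lborel {0..l} (\<lambda>x. M powr p)"
          by (rule set_integrable_const_fin[OF _ emeasure_lborel_Icc_finite]) simp
        show "\<bar>f x\<bar> powr p \<le> M powr p" if "x \<in> {0..l}" for x
          using decr_pair_abs_le[OF f(2), of x] fM that p by (intro powr_mono2) auto
      qed
      also have "\<dots> = l * M powr p" using l by (simp add: set_integral_const)
      finally have B: "(LINT x:{0..l}|lborel. \<bar>f x\<bar> powr p) / p \<le> l * M powr p / p"
        using p by (intro divide_right_mono) auto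
      have "pot p f = (LINT x:{0..l}|lborel. \<bar>f x\<bar> powr p) + (LINT x:{l..}|lborel. \<bar>f x\<bar> powr p)"
        unfolding pot_def by (rule set_integral_Ici_split[OF ip l])
      then have "wenergy p 1 9 l f g = (LINT x:{0..l}|lborel. (g x)\<^sup>2) / 2 + 9 * (LINT x:{l..}|lborel. (g x)\<^sup>2) / 2
         - (LINT x:{0..l}|lborel. \<bar>f x\<bar> powr p) / p - (LINT x:{l..}|lborel. \<bar>f x\<bar> powr p) / p"
        by (simp add: wenergy_def kin_def add_divide_distrib)
      moreover have "0 \<le> (LINT x:{0..l}|lborel. (g x)\<^sup>2) / 2" by simp
      ultimately have "e / \<tau> - l * M powr p / p \<le> e" using A B f(4) by linarith
      then have "e / \<tau> - e \<le> l * M powr p / p" by linarith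
      then have "(e / \<tau> - e) * p \<le> l * M powr p" using p by (simp add: pos_le_divide_eq)
      then show ?thesis unfolding l0_def using M by (simp add: pos_divide_le_eq)
    qed
    with l0 show ?thesis by blast
  qed
  then obtain l0 where l0: "0 < l0" "\<And>l. l \<in> S \<Longrightarrow> l0 \<le> l" by blast
  have bdd: "bdd_below S" using l0(2) by (rule bdd_belowI)
  define ls where "ls = Inf S"
  have ls_pos: "0 < ls" using cInf_greatest[OF nonempty l0(2)] l0(1) unfolding ls_def by linarith
  obtain f1 g1 where f1: "decr_pair f1 g1" "mass f1 = \<mu>"
      "\<And>f g. decr_pair f g \<Longrightarrow> mass f = \<mu> \<Longrightarrow> wenergy p 1 9 ls f1 g1 \<le> wenergy p 1 9 ls f g"
    using exists_minimizer[OF p \<mu>, of 1 9 ls] ls_pos by (metis less_imp_le zero_less_numeral zero_less_one)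
  \<comment> \<open>The infimum is attained: a profile admissible for \<open>l\<close> slightly
    above \<open>ls\<close>, dilated so that its break point moves to \<open>ls\<close>, would
    otherwise beat the minimizer there.\<close>
  have "wenergy p 1 9 ls f1 g1 \<le> e"
  proof (rule ccontr)
    assume "\<not> wenergy p 1 9 ls f1 g1 \<le> e"
    define \<eta> where "\<eta> = wenergy p 1 9 ls f1 g1 - e"
    have \<eta>: "0 < \<eta>" using \<open>\<not> wenergy p 1 9 ls f1 g1 \<le> e\<close> by (simp add: \<eta>_def)
    define B where "B = 2 / p * (sup_const p 1 \<mu> powr (p - 2) * \<mu>)"
    have B0: "0 \<le> B" using p \<mu> by (simp add: B_def)
    \<comment> \<open>For d \<le> 1 one has (1 + d)^2 - 1 \<le> 3 d, so the relative growth of the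
      kinetic term costs at most 3 d B < \<eta>.\<close>
    define d where "d = min 1 (\<eta> / (3 * (B + 1)))"
    have d: "0 < d" "d \<le> 1" "d * (3 * (B + 1)) \<le> \<eta>"
    proof -
      show "0 < d" using \<eta> B0 by (simp add: d_def)
      show "d \<le> 1" by (simp add: d_def)
      have "d * (3 * (B + 1)) \<le> \<eta> / (3 * (B + 1)) * (3 * (B + 1))"
        using B0 by (intro mult_right_mono) (auto simp: d_def)
      then show "d * (3 * (B + 1)) \<le> \<eta>" using B0 by simp
    qed
    have "Inf S < ls * (1 + d)" using ls_pos d by (simp add: ls_def[symmetric])
    then obtain l where l: "l \<in> S" "l < ls * (1 + d)" using cInf_less_iff[OF nonempty bdd] by blast
    have ll: "ls \<le> l" unfolding ls_def by (rule cInf_lower[OF l(1) bdd])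
    from l(1) obtain f g where f: "0 < l" "decr_pair f g" "mass f = \<mu>" "wenergy p 1 9 l f g \<le> e"
      by (auto simp: S_def)
    have kB: "kin 1 9 l g \<le> B"
      unfolding B_def using wenergy_coercive(2)[OF f(2,3) \<mu> p, of 1 1 9 l] f(1,4) R(4) by simp
    have k0: "0 \<le> kin 1 9 l g" by (simp add: kin_def)
    \<comment> \<open>Carries the break point from \<open>l\<close> to \<open>ls\<close>; as r \<ge>
      1, the potential term does not decrease.\<close>
    define r where "r = l / ls"
    have r: "1 \<le> r" "r \<le> 1 + d" "r * ls = l" using ll l(2) ls_pos by (auto simp: r_def field_simps)
    have r0: "0 < r" "0 \<le> sqrt r" using r by auto
    note sc = decr_pair_scale[OF f(2) r0(2,1)]
    have mk: "mass (\<lambda>x. sqrt r * f (r * x)) = \<mu>" unfolding sc(2) using r0 f(3) by simp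
    have "pot p f \<le> pot p (\<lambda>x. sqrt r * f (r * x))"
    proof -
      have "sqrt r powr p = r powr (p / 2)" using r0 by (simp add: powr_half_sqrt[symmetric] powr_powr)
      moreover have "r powr 1 \<le> r powr (p / 2)" using r p by (intro powr_mono) auto
      ultimately have "1 \<le> sqrt r powr p / r" using r0 by simp
      then have "1 * pot p f \<le> (sqrt r powr p / r) * pot p f" by (rule mult_right_mono) simp
      then show ?thesis unfolding sc(3) by simp
    qed
    then have pp: "pot p f / p \<le> pot p (\<lambda>x. sqrt r * f (r * x)) / p" using p by (intro divide_right_mono) auto
    have kk: "kin 1 9 ls (\<lambda>x. (sqrt r * r) * g (r * x)) = r\<^sup>2 * kin 1 9 l g"
      unfolding sc(4) r(3) using r0 by (simp add: power2_eq_square)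
    have "r\<^sup>2 - 1 \<le> 3 * d"
    proof -
      have "r\<^sup>2 \<le> (1 + d)\<^sup>2" using r r0 by (intro power_mono) auto
      also have "\<dots> = 1 + 2 * d + d * d" by (simp add: power2_eq_square algebra_simps)
      also have "d * d \<le> 1 * d" using d by (intro mult_right_mono) auto
      finally show ?thesis by simp
    qed
    then have "(r\<^sup>2 - 1) * kin 1 9 l g \<le> (3 * d) * B"
      using kB k0 d by (intro mult_mono) auto
    also have "\<dots> < d * (3 * (B + 1))" using d by (simp add: algebra_simps)
    also have "\<dots> \<le> \<eta>" by (rule d(3))
    finally have small: "(r\<^sup>2 - 1) * kin 1 9 l g < \<eta>" .
    have "wenergy p 1 9 ls f1 g1 \<le> wenergy p 1 9 ls (\<lambda>x. sqrt r * f (r * x)) (\<lambda>x. (sqrt r * r) * g (r * x))"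
      by (rule f1(3)[OF sc(1) mk])
    also have "\<dots> \<le> r\<^sup>2 * kin 1 9 l g / 2 - pot p f / p"
      unfolding wenergy_def kk using pp by linarith
    also have "\<dots> = wenergy p 1 9 l f g + (r\<^sup>2 - 1) * kin 1 9 l g / 2"
      by (simp add: wenergy_def algebra_simps diff_divide_distrib)
    also have "\<dots> < e + \<eta>" using f(4) small \<eta> by (simp add: field_simps)
    finally show False by (simp add: \<eta>_def)
  qed
  then have ls_S: "ls \<in> S" using f1 ls_pos by (auto simp: S_def)
  have "(l \<in> S) \<longleftrightarrow> ls \<le> l" for l
    using up[OF ls_S] cInf_lower[OF _ bdd] unfolding ls_def by blast
  then show ?thesis using ls_pos unfolding S_def by (intro exI[of _ ls]) auto
qed

section \<open>Level sets on the graph\<close>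

text \<open>\<open>d\<close> is the first point where |u| reaches \<open>t2\<close>, and
  \<open>c\<close> the last point before it where |u| is at most \<open>t1\<close>. Between them |u|
  stays strictly inside the band and changes by at least t2 - t1.\<close>

lemma ac_on_crossing_up:
  assumes ac: "ac_on I u g" "is_interval I" and ab: "a \<in> I" "b \<in> I" "a \<le> b"
    and t: "\<bar>u a\<bar> \<le> t1" "t1 < t2" "t2 \<le> \<bar>u b\<bar>"
  shows "\<exists>c d. a \<le> c \<and> c < d \<and> d \<le> b \<and> (\<forall>x\<in>{c<..<d}. t1 < \<bar>u x\<bar> \<and> \<bar>u x\<bar> < t2) \<and>
    (t2 - t1)\<^sup>2 \<le> (d - c) * (LINT x:{c..d}|lborel. (g x)\<^sup>2)"
proof -
  have sub: "{a..b} \<subseteq> I" using interval_Icc_subset[OF ac(2) ab(1,2)] .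
  have cont: "continuous_on {a..b} (\<lambda>x. \<bar>u x\<bar>)"
    by (intro continuous_on_rabs continuous_on_subset[OF ac_on_continuous_on[OF ac] sub])
  define D where "D = {x \<in> {a..b}. t2 \<le> \<bar>u x\<bar>}"
  have "closed D" unfolding D_def
    using continuous_closed_preimage[OF cont, of "{t2..}"] by (simp add: vimage_def Int_def conj_commute)
  moreover have "bounded D" by (rule bounded_subset[of "{a..b}"]) (auto simp: D_def)
  ultimately have "compact D" by (simp add: compact_eq_bounded_closed)
  moreover have "D \<noteq> {}" using ab t by (auto simp: D_def)
  ultimately obtain d where d: "d \<in> D" "\<And>x. x \<in> D \<Longrightarrow> d \<le> x" using compact_attains_inf by metis
  define C where "C = {x \<in> {a..d}. \<bar>u x\<bar> \<le> t1}"
  have cont': "continuous_on {a..d} (\<lambda>x. \<bar>u x\<bar>)"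
    by (rule continuous_on_subset[OF cont]) (use d(1) in \<open>auto simp: D_def\<close>)
  have "closed C" unfolding C_def
    using continuous_closed_preimage[OF cont', of "{..t1}"] by (simp add: vimage_def Int_def conj_commute)
  moreover have "bounded C" by (rule bounded_subset[of "{a..d}"]) (auto simp: C_def)
  ultimately have "compact C" by (simp add: compact_eq_bounded_closed)
  moreover have "C \<noteq> {}" using d(1) t by (auto simp: D_def C_def)
  ultimately obtain c where c: "c \<in> C" "\<And>x. x \<in> C \<Longrightarrow> x \<le> c" using compact_attains_sup by metis
  have cd: "a \<le> c" "c \<le> d" "d \<le> b" "t2 \<le> \<bar>u d\<bar>" "\<bar>u c\<bar> \<le> t1" using c(1) d(1) by (auto simp: C_def D_def)
  then have "c \<noteq> d" using t(2) by auto
  with cd have lt: "c < d" by simp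
  have between: "t1 < \<bar>u x\<bar> \<and> \<bar>u x\<bar> < t2" if x: "x \<in> {c<..<d}" for x
  proof
    show "t1 < \<bar>u x\<bar>"
    proof (rule ccontr)
      assume "\<not> t1 < \<bar>u x\<bar>"
      then have "x \<in> C" using x cd by (auto simp: C_def)
      then show False using c(2)[of x] x by simp
    qed
    show "\<bar>u x\<bar> < t2"
    proof (rule ccontr)
      assume "\<not> \<bar>u x\<bar> < t2"
      then have "x \<in> D" using x cd by (auto simp: D_def)
      then show False using d(2)[of x] x by simp
    qed
  qed
  have "\<bar>t2 - t1\<bar> \<le> \<bar>u d - u c\<bar>" using cd t(2) by linarith
  then have "(t2 - t1)\<^sup>2 \<le> (u d - u c)\<^sup>2" by (simp add: abs_le_square_iff)
  also have "\<dots> \<le> (d - c) * (LINT x:{c..d}|lborel. (g x)\<^sup>2)"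
    by (rule ac_on_hoelder[OF ac]) (use sub cd lt in auto)
  finally have "(t2 - t1)\<^sup>2 \<le> (d - c) * (LINT x:{c..d}|lborel. (g x)\<^sup>2)" .
  then show ?thesis
    by (intro exI[of _ c] exI[of _ d] conjI ballI between cd(1,3) lt)
qed

text \<open>The reflection x \<mapsto> -x reduces this to an upward crossing.\<close>

lemma ac_on_crossing_down:
  assumes ac: "ac_on I u g" "is_interval I" and ab: "a \<in> I" "b \<in> I" "a \<le> b"
    and t: "\<bar>u b\<bar> \<le> t1" "t1 < t2" "t2 \<le> \<bar>u a\<bar>"
  shows "\<exists>c d. a \<le> c \<and> c < d \<and> d \<le> b \<and> (\<forall>x\<in>{c<..<d}. t1 < \<bar>u x\<bar> \<and> \<bar>u x\<bar> < t2) \<and>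
    (t2 - t1)\<^sup>2 \<le> (d - c) * (LINT x:{c..d}|lborel. (g x)\<^sup>2)"
proof -
  have I': "{x. 0 + (-1) * x \<in> I} = uminus ` I" by (force simp: image_iff)
  have ac': "ac_on (uminus ` I) (\<lambda>x. u (- x)) (\<lambda>x. - g (- x))"
    using ac_on_affine[OF ac(1) _ ac(2), of "-1" 0 1] unfolding I' by simp
  have int': "is_interval (uminus ` I)" using ac(2) by (simp add: is_interval_uminus)
  have "\<exists>c d. - b \<le> c \<and> c < d \<and> d \<le> - a \<and> (\<forall>x\<in>{c<..<d}. t1 < \<bar>u (- x)\<bar> \<and> \<bar>u (- x)\<bar> < t2) \<and>
    (t2 - t1)\<^sup>2 \<le> (d - c) * (LINT x:{c..d}|lborel. (- g (- x))\<^sup>2)"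
    by (rule ac_on_crossing_up[OF ac' int']) (use ab t in auto)
  then obtain c d where cd: "- b \<le> c" "c < d" "d \<le> - a" "\<And>x. x \<in> {c<..<d} \<Longrightarrow> t1 < \<bar>u (- x)\<bar> \<and> \<bar>u (- x)\<bar> < t2"
    "(t2 - t1)\<^sup>2 \<le> (d - c) * (LINT x:{c..d}|lborel. (g (- x))\<^sup>2)"
    by auto
  have "{x. 0 + (-1) * x \<in> {- d..- c}} = {c..d}" by auto
  then have "(LINT x:{c..d}|lborel. (g (- x))\<^sup>2) = (LINT x:{- d..- c}|lborel. (g x)\<^sup>2)"
    using set_integral_affine(1)[of "-1" 0 "{- d..- c}" "\<lambda>x. (g x)\<^sup>2"] by simp
  then have "(t2 - t1)\<^sup>2 \<le> (- c - - d) * (LINT x:{- d..- c}|lborel. (g x)\<^sup>2)" using cd(5) by simp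
  moreover have "t1 < \<bar>u x\<bar> \<and> \<bar>u x\<bar> < t2" if "x \<in> {- d<..<- c}" for x
    using cd(4)[of "- x"] that by auto
  ultimately show ?thesis using cd(1-3) by (intro exI[of _ "- d"] exI[of _ "- c"]) auto
qed

text \<open>A value of size t persists at size t/2 over a fixed length \<open>d\<close> by Hoelder
  continuity, and so needs a fixed amount of mass; far out less than that is left.\<close>

lemma H1_halfline_decay:
  assumes u: "L2_on {0..} u" "ac_on {0..} u g" and t: "0 < t"
  shows "\<exists>N\<ge>0. \<forall>x\<ge>N. \<bar>u x\<bar> < t"
proof -
  define K where "K = (LINT x:{0..}|lborel. (g x)\<^sup>2) + 1"
  have K: "0 < K" unfolding K_def by (rule add_nonneg_pos) simp_all
  define d where "d = (t / 2)\<^sup>2 / K"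
  have d: "0 < d" using t K by (simp add: d_def)
  have "(\<lambda>n. LINT x:{real n..}|lborel. (u x)\<^sup>2) \<longlonglongrightarrow> 0"
    by (rule set_integral_tail_tendsto[OF L2_onD(2)[OF u(1)]])
  then have "\<forall>\<^sub>F n in sequentially. (LINT x:{real n..}|lborel. (u x)\<^sup>2) < d * (t / 2)\<^sup>2"
    using d t by (intro order_tendstoD(2)[of _ 0]) auto
  then obtain N where N: "(LINT x:{real N..}|lborel. (u x)\<^sup>2) < d * (t / 2)\<^sup>2"
    by (auto simp: eventually_sequentially)
  have "\<bar>u x\<bar> < t" if x: "real N \<le> x" for x
  proof (rule ccontr)
    assume "\<not> \<bar>u x\<bar> < t"
    then have ux: "t \<le> \<bar>u x\<bar>" by simp
    have x0: "0 \<le> x" using x by (simp add: order_trans[OF of_nat_0_le_iff])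
    have low: "(t / 2)\<^sup>2 \<le> (u y)\<^sup>2" if y: "y \<in> {x..x + d}" for y
    proof -
      have "(u y - u x)\<^sup>2 \<le> (y - x) * (LINT s:{x..y}|lborel. (g s)\<^sup>2)"
        by (rule ac_on_hoelder[OF u(2)]) (use y x0 in auto)
      also have "\<dots> \<le> d * K"
      proof (rule mult_mono)
        have "(LINT s:{x..y}|lborel. (g s)\<^sup>2) \<le> (LINT s:{0..}|lborel. (g s)\<^sup>2)"
          by (rule set_integral_mono_set[OF L2_onD(2)[OF ac_onD(1)[OF u(2)]]]) (use x0 in auto)
        then show "(LINT s:{x..y}|lborel. (g s)\<^sup>2) \<le> K" by (simp add: K_def)
      qed (use y d in auto)
      also have "d * K = (t / 2)\<^sup>2" using K by (simp add: d_def)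
      finally have "\<bar>u y - u x\<bar> \<le> \<bar>t / 2\<bar>" by (simp only: abs_le_square_iff)
      then have "\<bar>t / 2\<bar> \<le> \<bar>u y\<bar>" using ux t by linarith
      then show ?thesis by (simp only: abs_le_square_iff)
    qed
    have sub: "{x..x + d} \<subseteq> {0..}" using x0 by auto
    have "d * (t / 2)\<^sup>2 = (LINT y:{x..x + d}|lborel. (t / 2)\<^sup>2)" using d by (simp add: set_integral_const)
    also have "\<dots> \<le> (LINT y:{x..x + d}|lborel. (u y)\<^sup>2)"
    proof (rule set_integral_mono[OF _ _ low])
      show "set_integrable lborel {x..x + d} (\<lambda>y. (t / 2)\<^sup>2)"
        by (rule set_integrable_const_fin[OF _ emeasure_lborel_Icc_finite]) simp
      show "set_integrable lborel {x..x + d} (\<lambda>y. (u y)\<^sup>2)"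
        by (rule set_integrable_subset[OF L2_onD(2)[OF u(1)] _ sub]) simp
    qed
    also have "\<dots> \<le> (LINT y:{real N..}|lborel. (u y)\<^sup>2)"
    proof (rule set_integral_mono_set)
      show "set_integrable lborel {real N..} (\<lambda>y. (u y)\<^sup>2)"
        by (rule set_integrable_subset[OF L2_onD(2)[OF u(1)]]) auto
    qed (use x in auto)
    finally show False using N by simp
  qed
  then show ?thesis by (intro exI[of _ "real N"]) auto
qed

lemma H1_halfline_attains_max:
  assumes u: "L2_on {0..} u" "ac_on {0..} u g"
  shows "\<exists>xm\<ge>0. \<forall>x\<ge>0. \<bar>u x\<bar> \<le> \<bar>u xm\<bar>"
proof (cases "\<forall>x\<ge>0. u x = 0")
  case True then show ?thesis by (intro exI[of _ 0]) auto
next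
  case False
  then obtain x0 where x0: "0 \<le> x0" "u x0 \<noteq> 0" by blast
  obtain N where N: "0 \<le> N" "\<And>x. N \<le> x \<Longrightarrow> \<bar>u x\<bar> < \<bar>u x0\<bar>"
    using H1_halfline_decay[OF u, of "\<bar>u x0\<bar>"] x0(2) by auto
  have "continuous_on {0..max N x0} (\<lambda>x. \<bar>u x\<bar>)"
    by (intro continuous_on_rabs continuous_on_subset[OF ac_on_continuous_on[OF u(2)]]) auto
  moreover have "{0..max N x0} \<noteq> {}" using N(1) by (simp add: le_max_iff_disj)
  ultimately obtain xm where xm: "xm \<in> {0..max N x0}" "\<And>x. x \<in> {0..max N x0} \<Longrightarrow> \<bar>u x\<bar> \<le> \<bar>u xm\<bar>"
    using continuous_attains_sup[OF compact_Icc] by metis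
  have "\<bar>u x\<bar> \<le> \<bar>u xm\<bar>" if "0 \<le> x" for x
  proof (cases "x \<le> max N x0")
    case True with xm(2) that show ?thesis by auto
  next
    case False
    then have "\<bar>u x\<bar> < \<bar>u x0\<bar>" by (intro N(2)) simp
    also have "\<dots> \<le> \<bar>u xm\<bar>" using x0 by (intro xm(2)) auto
    finally show ?thesis by simp
  qed
  with xm(1) show ?thesis by auto
qed

lemma set_integral_Icc_eq_Ioo:
  fixes f :: "real \<Rightarrow> real"
  shows "(LINT x:{c..d}|lborel. f x) = (LINT x:{c<..<d}|lborel. f x)"
  unfolding set_lebesgue_integral_def
  by (rule integral_discrete_difference[of "{c, d}"]) (auto split: split_indicator)

section \<open>Level bands of a function on the graph\<close>

locale graph_fun =
  fixes l :: real and u g :: "nat \<Rightarrow> real \<Rightarrow> real"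
  assumes l_pos: "0 < l"
    and u_L2: "\<And>i. i < 4 \<Longrightarrow> L2_on (edge_dom l i) (u i)"
    and u_ac: "\<And>i. i < 4 \<Longrightarrow> ac_on (edge_dom l i) (u i) (g i)"
    and u_vertex: "\<And>i. i < 4 \<Longrightarrow> u i 0 = u 0 0"
begin

abbreviation I :: "nat \<Rightarrow> real set" where "I \<equiv> edge_dom l"

definition lev :: "nat \<Rightarrow> real set \<Rightarrow> real set" where "lev i A = {x \<in> I i. \<bar>u i x\<bar> \<in> A}"
text \<open>The energies \<open>kk\<close>, \<open>KK\<close> and lengths \<open>ll\<close>,
  \<open>LL\<close> of level sets are the two factors in Cauchy-Schwarz, per edge and for the whole
  graph.\<close>

definition kk :: "nat \<Rightarrow> real set \<Rightarrow> real" where "kk i A = (LINT x:lev i A|lborel. (g i x)\<^sup>2)"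
definition ll :: "nat \<Rightarrow> real set \<Rightarrow> real" where "ll i A = measure lborel (lev i A)"
definition KK :: "real set \<Rightarrow> real" where "KK A = (\<Sum>i<4. kk i A)"
definition LL :: "real set \<Rightarrow> real" where "LL A = (\<Sum>i<4. ll i A)"
definition v0 :: real where "v0 = \<bar>u 0 0\<bar>"

lemma I_halfline: "i < 3 \<Longrightarrow> I i = {0..}" and I_edge: "I 3 = {0..l}"
  by (auto simp: edge_dom_def)

lemma I_interval: "is_interval (I i)" by (simp add: edge_dom_def)

lemma I_sets [measurable]: "I i \<in> sets borel" by (simp add: edge_dom_def)

lemma u_abs_measurable:
  assumes "i < 4"
  shows "(\<lambda>x. indicator (I i) x * \<bar>u i x\<bar>) \<in> borel_measurable borel"
proof -
  have [measurable]: "(\<lambda>x. indicator (I i) x * u i x) \<in> borel_measurable borel"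
    using L2_on_indicator_measurable[OF u_L2[OF assms]] by simp
  have "(\<lambda>x. \<bar>indicator (I i) x * u i x\<bar>) \<in> borel_measurable borel" by measurable
  then show ?thesis by (simp add: abs_mult)
qed

lemma lev_sets:
  assumes "i < 4" "A \<in> sets borel"
  shows "lev i A \<in> sets lborel"
proof -
  note [measurable] = u_abs_measurable[OF assms(1)] assms(2)
  have "{x \<in> space borel. x \<in> I i \<and> indicator (I i) x * \<bar>u i x\<bar> \<in> A} \<in> sets borel" by measurable
  also have "{x \<in> space borel. x \<in> I i \<and> indicator (I i) x * \<bar>u i x\<bar> \<in> A} = lev i A"
    by (auto simp: lev_def)
  finally show ?thesis by simp
qed

text \<open>Chebyshev's inequality. Because \<open>measure\<close> is 0 on sets of infinite length,
  lengths of level sets are reliable only for levels bounded away from 0.\<close>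

lemma lev_finite:
  assumes i: "i < 4" and A: "A \<in> sets borel" "A \<subseteq> {t<..}" "0 < t"
  shows "emeasure lborel (lev i A) < \<infinity>"
proof -
  note [measurable] = lev_sets[OF i A(1)]
  have "ennreal (t\<^sup>2) * emeasure lborel (lev i A) = (\<integral>\<^sup>+x. ennreal (t\<^sup>2) * indicator (lev i A) x \<partial>lborel)"
    by (rule nn_integral_cmult_indicator[symmetric, OF lev_sets[OF i A(1)]])
  also have "\<dots> \<le> (\<integral>\<^sup>+x. ennreal (indicator (I i) x * (u i x)\<^sup>2) \<partial>lborel)"
  proof (intro nn_integral_mono)
    fix x
    show "ennreal (t\<^sup>2) * indicator (lev i A) x \<le> ennreal (indicator (I i) x * (u i x)\<^sup>2)"
    proof (cases "x \<in> lev i A")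
      case True
      then have "x \<in> I i" "t < \<bar>u i x\<bar>" using A(2) by (auto simp: lev_def)
      moreover then have "t\<^sup>2 \<le> (u i x)\<^sup>2" using A(3) by (simp add: abs_le_square_iff[symmetric])
      ultimately show ?thesis using True by (simp add: ennreal_leI)
    qed simp
  qed
  also have "\<dots> = ennreal (\<integral>x. indicator (I i) x * (u i x)\<^sup>2 \<partial>lborel)"
    using L2_onD(2)[OF u_L2[OF i]] by (intro nn_integral_eq_integral) (auto simp: set_integrable_def)
  also have "\<dots> < \<infinity>" by simp
  finally show ?thesis using A(3) by (auto simp: ennreal_mult_less_top)
qed

lemma g_sq_integrable:
  assumes "i < 4" "A \<in> sets borel"
  shows "set_integrable lborel (lev i A) (\<lambda>x. (g i x)\<^sup>2)"
  by (rule set_integrable_subset[OF L2_onD(2)[OF ac_onD(1)[OF u_ac[OF assms(1)]]] lev_sets[OF assms]])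
    (auto simp: lev_def)

lemma kk_nonneg [simp]: "0 \<le> kk i A" by (simp add: kk_def)
lemma ll_nonneg [simp]: "0 \<le> ll i A" by (simp add: ll_def)
lemma KK_nonneg [simp]: "0 \<le> KK A" by (simp add: KK_def sum_nonneg)
lemma LL_nonneg [simp]: "0 \<le> LL A" by (simp add: LL_def sum_nonneg)

lemma lev_mono: "A \<subseteq> B \<Longrightarrow> lev i A \<subseteq> lev i B" by (auto simp: lev_def)

lemma KK_le_total:
  assumes "A \<in> sets borel"
  shows "KK A \<le> (\<Sum>i<4. LINT x:I i|lborel. (g i x)\<^sup>2)"
  unfolding KK_def
proof (rule sum_mono)
  fix i :: nat assume "i \<in> {..<4}"
  then have i: "i < 4" by simp
  show "kk i A \<le> (LINT x:I i|lborel. (g i x)\<^sup>2)"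
    unfolding kk_def
    by (rule set_integral_mono_set[OF L2_onD(2)[OF ac_onD(1)[OF u_ac[OF i]]] lev_sets[OF i assms]])
      (auto simp: lev_def)
qed

text \<open>Superadditivity suffices for lower bounds on products and allows adjacent open bands to
  omit their common level.\<close>

lemma KK_superadd:
  assumes "A \<in> sets borel" "B \<in> sets borel" "C \<in> sets borel" "A \<inter> B = {}" "A \<union> B \<subseteq> C"
  shows "KK A + KK B \<le> KK C"
  unfolding KK_def sum.distrib[symmetric]
proof (rule sum_mono)
  fix i :: nat assume "i \<in> {..<4}"
  then have i: "i < 4" by simp
  have "kk i A + kk i B = (LINT x:lev i A \<union> lev i B|lborel. (g i x)\<^sup>2)"
    unfolding kk_def using assms(4)
    by (intro set_integral_Un[symmetric] g_sq_integrable i assms) (auto simp: lev_def)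
  also have "\<dots> \<le> kk i C"
    unfolding kk_def
    using assms(5) lev_sets[OF i assms(1)] lev_sets[OF i assms(2)]
    by (intro set_integral_mono_set g_sq_integrable i assms(3)) (auto simp: lev_def)
  finally show "kk i A + kk i B \<le> kk i C" .
qed

lemma LL_superadd:
  assumes "A \<in> sets borel" "B \<in> sets borel" "C \<in> sets borel" "A \<inter> B = {}" "A \<union> B \<subseteq> C"
    and C: "C \<subseteq> {t<..}" "0 < t"
  shows "LL A + LL B \<le> LL C"
  unfolding LL_def sum.distrib[symmetric]
proof (rule sum_mono)
  fix i :: nat assume "i \<in> {..<4}"
  then have i: "i < 4" by simp
  have fin: "lev i A \<in> fmeasurable lborel" "lev i B \<in> fmeasurable lborel" "lev i C \<in> fmeasurable lborel"
    using assms lev_sets[OF i] lev_finite[OF i, of _ t] by (auto intro!: fmeasurableI)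
  have "ll i A + ll i B = measure lborel (lev i A \<union> lev i B)"
    unfolding ll_def using assms(4) fin
    by (intro measure_Union[symmetric]) (auto simp: lev_def fmeasurable_def)
  also have "\<dots> \<le> ll i C"
    unfolding ll_def
  proof (rule measure_mono_fmeasurable[OF _ _ fin(3)])
    show "lev i A \<union> lev i B \<subseteq> lev i C" using assms(5) by (auto simp: lev_def)
    show "lev i A \<union> lev i B \<in> sets lborel" by (intro sets.Un lev_sets i assms(1,2))
  qed
  finally show "ll i A + ll i B \<le> ll i C" .
qed

text \<open>\<open>Q n t1 t2\<close> is what the Cauchy-Schwarz inequality yields when the level band
  between \<open>t1\<close> and \<open>t2\<close> is crossed at least \<open>n\<close> times.\<close>

definition Q :: "real \<Rightarrow> real \<Rightarrow> real \<Rightarrow> bool" where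
  "Q n t1 t2 \<longleftrightarrow> (n * (t2 - t1))\<^sup>2 \<le> LL {t1<..<t2} * KK {t1<..<t2}"

text \<open>Adjacent bands with the same count combine by \<open>cauchy_schwarz_two\<close>, so a
  band may be cut at the vertex value.\<close>

lemma Q_trans:
  assumes "Q n t1 t2" "Q n t2 t3" "0 < t1" "t1 \<le> t2" "t2 \<le> t3"
  shows "Q n t1 t3"
proof -
  have L: "LL {t1<..<t2} + LL {t2<..<t3} \<le> LL {t1<..<t3}"
    by (rule LL_superadd[where t="t1"]) (use assms in auto)
  have K: "KK {t1<..<t2} + KK {t2<..<t3} \<le> KK {t1<..<t3}"
    by (rule KK_superadd) (use assms in auto)
  have "(n * (t2 - t1) + n * (t3 - t2))\<^sup>2 \<le> (LL {t1<..<t2} + LL {t2<..<t3}) * (KK {t1<..<t2} + KK {t2<..<t3})"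
    by (rule cauchy_schwarz_two) (use assms in \<open>auto simp: Q_def\<close>)
  also have "\<dots> \<le> LL {t1<..<t3} * KK {t1<..<t3}"
    by (rule mult_mono[OF L K]) (simp_all add: add_nonneg_nonneg)
  finally show ?thesis unfolding Q_def by (simp add: algebra_simps)
qed

lemma Q_mono:
  assumes "Q n t1 t2" "0 \<le> m" "m \<le> n" "t1 \<le> t2"
  shows "Q m t1 t2"
proof -
  have "(m * (t2 - t1))\<^sup>2 \<le> (n * (t2 - t1))\<^sup>2"
    using assms by (intro power_mono mult_right_mono) auto
  with assms(1) show ?thesis unfolding Q_def by linarith
qed

text \<open>Crossing counts add over the edges, by Cauchy-Schwarz over the four of them; edges that
  need not cross the band enter with count 0.\<close>

lemma Q_sum:
  assumes "\<And>i. i < 4 \<Longrightarrow> (n i * (t2 - t1))\<^sup>2 \<le> ll i {t1<..<t2} * kk i {t1<..<t2}"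
  shows "Q (n 0 + n 1 + n 2 + n 3) t1 t2"
proof -
  let ?A = "{t1<..<t2}" and ?d = "t2 - t1"
  have 1: "(n 0 * ?d + n 1 * ?d)\<^sup>2 \<le> (ll 0 ?A + ll 1 ?A) * (kk 0 ?A + kk 1 ?A)"
    by (rule cauchy_schwarz_two) (simp_all add: assms)
  have 2: "(n 0 * ?d + n 1 * ?d + n 2 * ?d)\<^sup>2 \<le> (ll 0 ?A + ll 1 ?A + ll 2 ?A) * (kk 0 ?A + kk 1 ?A + kk 2 ?A)"
    by (rule cauchy_schwarz_two[OF 1]) (simp_all add: assms add_nonneg_nonneg)
  have 3: "(n 0 * ?d + n 1 * ?d + n 2 * ?d + n 3 * ?d)\<^sup>2
      \<le> (ll 0 ?A + ll 1 ?A + ll 2 ?A + ll 3 ?A) * (kk 0 ?A + kk 1 ?A + kk 2 ?A + kk 3 ?A)"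
    by (rule cauchy_schwarz_two[OF 2]) (simp_all add: assms add_nonneg_nonneg)
  have "{..<4::nat} = {0, 1, 2, 3}" by auto
  then show ?thesis using 3 by (simp add: Q_def LL_def KK_def algebra_simps)
qed

lemma edge_crossing_one:
  assumes i: "i < 4" and t: "0 < t1" "t1 < t2" and ab: "a \<in> I i" "b \<in> I i" "a \<le> b"
    and cr: "\<bar>u i a\<bar> \<le> t1 \<and> t2 \<le> \<bar>u i b\<bar> \<or> \<bar>u i b\<bar> \<le> t1 \<and> t2 \<le> \<bar>u i a\<bar>"
  shows "\<exists>c d. a \<le> c \<and> c < d \<and> d \<le> b \<and> {c<..<d} \<subseteq> lev i {t1<..<t2} \<and>
    (1 * (t2 - t1))\<^sup>2 \<le> (d - c) * (LINT x:{c<..<d}|lborel. (g i x)\<^sup>2)"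
proof -
  have "\<exists>c d. a \<le> c \<and> c < d \<and> d \<le> b \<and> (\<forall>x\<in>{c<..<d}. t1 < \<bar>u i x\<bar> \<and> \<bar>u i x\<bar> < t2) \<and>
    (t2 - t1)\<^sup>2 \<le> (d - c) * (LINT x:{c..d}|lborel. (g i x)\<^sup>2)"
    using cr
  proof
    assume "\<bar>u i a\<bar> \<le> t1 \<and> t2 \<le> \<bar>u i b\<bar>"
    then show ?thesis by (intro ac_on_crossing_up[OF u_ac[OF i] I_interval ab]) (use t in auto)
  next
    assume "\<bar>u i b\<bar> \<le> t1 \<and> t2 \<le> \<bar>u i a\<bar>"
    then show ?thesis by (intro ac_on_crossing_down[OF u_ac[OF i] I_interval ab]) (use t in auto)
  qed
  then obtain c d where cd: "a \<le> c" "c < d" "d \<le> b" "\<And>x. x \<in> {c<..<d} \<Longrightarrow> t1 < \<bar>u i x\<bar> \<and> \<bar>u i x\<bar> < t2"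
      "(t2 - t1)\<^sup>2 \<le> (d - c) * (LINT x:{c..d}|lborel. (g i x)\<^sup>2)"
    by blast
  have "{a..b} \<subseteq> I i" by (rule interval_Icc_subset[OF I_interval ab(1,2)])
  then have sub: "{c<..<d} \<subseteq> lev i {t1<..<t2}" using cd(1,3,4) by (auto simp: lev_def)
  have "(LINT x:{c..d}|lborel. (g i x)\<^sup>2) = (LINT x:{c<..<d}|lborel. (g i x)\<^sup>2)"
    by (rule set_integral_Icc_eq_Ioo)
  with cd(5) have "(1 * (t2 - t1))\<^sup>2 \<le> (d - c) * (LINT x:{c<..<d}|lborel. (g i x)\<^sup>2)" by simp
  with cd(1-3) sub show ?thesis by blast
qed

lemma edge_cover:
  assumes i: "i < 4" and t: "0 < t1" and B: "B \<in> sets borel" "B \<subseteq> lev i {t1<..<t2}"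
  shows "measure lborel B \<le> ll i {t1<..<t2}" "(LINT x:B|lborel. (g i x)\<^sup>2) \<le> kk i {t1<..<t2}"
proof -
  have "emeasure lborel (lev i {t1<..<t2}) < \<infinity>" by (rule lev_finite[OF i _ _ t]) auto
  then have fm: "lev i {t1<..<t2} \<in> fmeasurable lborel" by (intro fmeasurableI lev_sets[OF i]) simp_all
  show "measure lborel B \<le> ll i {t1<..<t2}"
    unfolding ll_def by (rule measure_mono_fmeasurable[OF B(2) _ fm]) (use B(1) in simp)
  show "(LINT x:B|lborel. (g i x)\<^sup>2) \<le> kk i {t1<..<t2}"
    unfolding kk_def by (rule set_integral_mono_set[OF g_sq_integrable[OF i] _ B(2)]) (use B(1) in simp_all)
qed

lemma edge_once:
  assumes "i < 4" "0 < t1" "t1 < t2" "a \<in> I i" "b \<in> I i" "a \<le> b"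
    and "\<bar>u i a\<bar> \<le> t1 \<and> t2 \<le> \<bar>u i b\<bar> \<or> \<bar>u i b\<bar> \<le> t1 \<and> t2 \<le> \<bar>u i a\<bar>"
  shows "(1 * (t2 - t1))\<^sup>2 \<le> ll i {t1<..<t2} * kk i {t1<..<t2}"
proof -
  obtain c d where cd: "c < d" "{c<..<d} \<subseteq> lev i {t1<..<t2}"
      "(1 * (t2 - t1))\<^sup>2 \<le> (d - c) * (LINT x:{c<..<d}|lborel. (g i x)\<^sup>2)"
    using edge_crossing_one[OF assms] by blast
  note cov = edge_cover[OF assms(1,2) _ cd(2)]
  have "(d - c) * (LINT x:{c<..<d}|lborel. (g i x)\<^sup>2) \<le> ll i {t1<..<t2} * kk i {t1<..<t2}"
    using cov cd(1) by (intro mult_mono) auto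
  with cd(3) show ?thesis by linarith
qed

lemma halfline_exit:
  assumes "i < 3" "0 < t"
  shows "\<exists>b\<ge>a. 0 \<le> b \<and> \<bar>u i b\<bar> \<le> t"
proof -
  have "L2_on {0..} (u i)" "ac_on {0..} (u i) (g i)"
    using u_L2[of i] u_ac[of i] assms(1) I_halfline[of i] by auto
  then obtain N where "0 \<le> N" "\<And>x. N \<le> x \<Longrightarrow> \<bar>u i x\<bar> < t" using H1_halfline_decay assms(2) by blast
  then show ?thesis by (intro exI[of _ "max a N"]) (auto intro: less_imp_le)
qed

lemma halfline_once:
  assumes i: "i < 3" and t: "0 < t1" "t1 < t2" "t2 \<le> v0"
  shows "(1 * (t2 - t1))\<^sup>2 \<le> ll i {t1<..<t2} * kk i {t1<..<t2}"
proof -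
  obtain b where "0 \<le> b" "\<bar>u i b\<bar> \<le> t1" using halfline_exit[OF i t(1), of 0] by blast
  moreover have "\<bar>u i 0\<bar> = v0" using u_vertex[of i] i by (simp add: v0_def)
  ultimately show ?thesis
    using i t I_halfline[OF i] by (intro edge_once[of i t1 t2 0 b]) auto
qed

text \<open>Above the vertex value the function climbs from the vertex to \<open>xm\<close> and
  descends again to 0 at infinity; the two crossings use disjoint intervals.\<close>

lemma halfline_twice:
  assumes i: "i < 3" and t: "0 < t1" "t1 < t2" "v0 \<le> t1" "t2 \<le> \<bar>u i xm\<bar>" "0 \<le> xm"
  shows "(2 * (t2 - t1))\<^sup>2 \<le> ll i {t1<..<t2} * kk i {t1<..<t2}"
proof -
  have i4: "i < 4" using i by simp
  obtain b where b: "xm \<le> b" "0 \<le> b" "\<bar>u i b\<bar> \<le> t1" using halfline_exit[OF i t(1), of xm] by blast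
  have v: "\<bar>u i 0\<bar> = v0" using u_vertex[OF i4] by (simp add: v0_def)
  have "\<exists>c d. 0 \<le> c \<and> c < d \<and> d \<le> xm \<and> {c<..<d} \<subseteq> lev i {t1<..<t2} \<and>
    (1 * (t2 - t1))\<^sup>2 \<le> (d - c) * (LINT x:{c<..<d}|lborel. (g i x)\<^sup>2)"
    by (rule edge_crossing_one[OF i4 t(1,2)]) (use v t I_halfline[OF i] in auto)
  then obtain c d where cd: "c < d" "d \<le> xm" "{c<..<d} \<subseteq> lev i {t1<..<t2}"
    "(1 * (t2 - t1))\<^sup>2 \<le> (d - c) * (LINT x:{c<..<d}|lborel. (g i x)\<^sup>2)" by blast
  have "\<exists>c d. xm \<le> c \<and> c < d \<and> d \<le> b \<and> {c<..<d} \<subseteq> lev i {t1<..<t2} \<and>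
    (1 * (t2 - t1))\<^sup>2 \<le> (d - c) * (LINT x:{c<..<d}|lborel. (g i x)\<^sup>2)"
    by (rule edge_crossing_one[OF i4 t(1,2)]) (use b t I_halfline[OF i] in auto)
  then obtain c' d' where cd': "xm \<le> c'" "c' < d'" "{c'<..<d'} \<subseteq> lev i {t1<..<t2}"
    "(1 * (t2 - t1))\<^sup>2 \<le> (d' - c') * (LINT x:{c'<..<d'}|lborel. (g i x)\<^sup>2)" by blast
  let ?B = "{c<..<d} \<union> {c'<..<d'}"
  have disj: "{c<..<d} \<inter> {c'<..<d'} = {}" using cd(2) cd'(1) by auto
  have int: "set_integrable lborel {c<..<d} (\<lambda>x. (g i x)\<^sup>2)" "set_integrable lborel {c'<..<d'} (\<lambda>x. (g i x)\<^sup>2)"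
    using cd(3) cd'(3) by (auto intro!: set_integrable_subset[OF g_sq_integrable[OF i4, of "{t1<..<t2}"]])
  have mB: "measure lborel ?B = (d - c) + (d' - c')"
    using disj cd(1) cd'(2) by (subst measure_Union) auto
  have kB: "(LINT x:?B|lborel. (g i x)\<^sup>2) = (LINT x:{c<..<d}|lborel. (g i x)\<^sup>2) + (LINT x:{c'<..<d'}|lborel. (g i x)\<^sup>2)"
    by (rule set_integral_Un[OF disj int])
  have "(1 * (t2 - t1) + 1 * (t2 - t1))\<^sup>2 \<le> measure lborel ?B * (LINT x:?B|lborel. (g i x)\<^sup>2)"
    unfolding mB kB using cd cd' by (intro cauchy_schwarz_two) auto
  also have "\<dots> \<le> ll i {t1<..<t2} * kk i {t1<..<t2}"
    using cd(3) cd'(3) by (intro mult_mono edge_cover[OF i4 t(1)]) auto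
  finally show ?thesis by (simp add: algebra_simps)
qed

text \<open>On each of the three halflines the function descends from the vertex value to 0.\<close>

lemma Q_below_vertex:
  assumes "0 < t1" "t1 < t2" "t2 \<le> v0"
  shows "Q 3 t1 t2"
proof -
  have "Q (1 + 1 + 1 + 0) t1 t2"
    using Q_sum[of "\<lambda>i. if i < 3 then 1 else 0" t2 t1] halfline_once[OF _ assms] by simp
  then show ?thesis by simp
qed

lemma Q_halfline_max:
  assumes j: "j < 3" and t: "0 < t1" "t1 < t2" "v0 \<le> t1" "t2 \<le> \<bar>u j xm\<bar>" "0 \<le> xm"
  shows "Q 2 t1 t2"
proof -
  have "Q ((if 0 = j then 2 else 0) + (if 1 = j then 2 else 0) + (if 2 = j then 2 else 0) + (if 3 = j then 2 else 0)) t1 t2"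
    by (rule Q_sum[of "\<lambda>i. if i = j then 2 else 0"]) (use halfline_twice[OF j t] in auto)
  moreover have "j = 0 \<or> j = 1 \<or> j = 2" using j by auto
  ultimately show ?thesis by auto
qed

text \<open>Two crossings on the halfline with the larger maximum and one on the terminal edge: the
  same count 3 as below the vertex value.\<close>

lemma Q_both_max:
  assumes j: "j < 3" and t: "0 < t1" "t1 < t2" "v0 \<le> t1" "t2 \<le> \<bar>u j xm\<bar>" "0 \<le> xm"
    and M: "t2 \<le> \<bar>u 3 xM\<bar>" "xM \<in> {0..l}"
  shows "Q 3 t1 t2"
proof -
  have e3: "(1 * (t2 - t1))\<^sup>2 \<le> ll 3 {t1<..<t2} * kk 3 {t1<..<t2}"
    by (rule edge_once[of 3 t1 t2 0 xM]) (use t M I_edge u_vertex[of 3] l_pos in \<open>auto simp: v0_def\<close>)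
  have "Q ((if 0 = j then 2 else if (0::nat) = 3 then 1 else 0) + (if 1 = j then 2 else if (1::nat) = 3 then 1 else 0)
      + (if 2 = j then 2 else if (2::nat) = 3 then 1 else 0) + (if 3 = j then 2 else if (3::nat) = 3 then 1 else 0)) t1 t2"
    by (rule Q_sum[of "\<lambda>i. if i = j then 2 else if i = 3 then 1 else 0"]) (use halfline_twice[OF j t] e3 in auto)
  moreover have "j = 0 \<or> j = 1 \<or> j = 2" using j by auto
  ultimately show ?thesis by auto
qed

lemma Q_edge_max:
  assumes t: "0 < t1" "t1 < t2" "v0 \<le> t1" and M: "t2 \<le> \<bar>u 3 xM\<bar>" "xM \<in> {0..l}"
  shows "Q 1 t1 t2"
proof -
  have e3: "(1 * (t2 - t1))\<^sup>2 \<le> ll 3 {t1<..<t2} * kk 3 {t1<..<t2}"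
    by (rule edge_once[of 3 t1 t2 0 xM]) (use t M I_edge u_vertex[of 3] l_pos in \<open>auto simp: v0_def\<close>)
  have "Q (0 + 0 + 0 + 1) t1 t2"
    using Q_sum[of "\<lambda>i. if i = 3 then 1 else 0" t2 t1] e3 by simp
  then show ?thesis by simp
qed

text \<open>The arguments differ below and above the vertex value, which plays the role of
  \<open>s\<close>; a band containing it is cut there.\<close>

lemma Q_glue:
  assumes low: "\<And>t1 t2. 0 < t1 \<Longrightarrow> t1 < t2 \<Longrightarrow> t2 \<le> s \<Longrightarrow> Q n t1 t2"
    and high: "\<And>t1 t2. 0 < t1 \<Longrightarrow> t1 < t2 \<Longrightarrow> s \<le> t1 \<Longrightarrow> t2 \<le> m \<Longrightarrow> Q n t1 t2"
    and t: "0 < t1" "t1 < t2" "t2 \<le> m"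
  shows "Q n t1 t2"
proof -
  consider "t2 \<le> s" | "s \<le> t1" | "t1 < s" "s < t2" by linarith
  then show ?thesis
  proof cases
    case 3
    have "Q n t1 s" by (rule low) (use 3 t in auto)
    moreover have "Q n s t2" by (rule high) (use 3 t in auto)
    ultimately show ?thesis by (rule Q_trans) (use 3 t in auto)
  qed (use low high t in blast)+
qed

end

section \<open>Decreasing rearrangement\<close>

text \<open>Fubini for the region 0 < s < H x; negative values of \<open>H\<close> drop out on both
  sides because \<open>ennreal\<close> truncates them.\<close>

lemma layer_cake:
  fixes H :: "real \<Rightarrow> real"
  assumes [measurable]: "H \<in> borel_measurable borel"
  shows "(\<integral>\<^sup>+x. ennreal (H x) \<partial>lborel) = (\<integral>\<^sup>+s. indicator {0<..} s * emeasure lborel {x. s < H x} \<partial>lborel)"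
proof -
  define G where "G x s = (if 0 < s \<and> s < H x then 1 else 0 :: ennreal)" for x s
  have [measurable]: "case_prod G \<in> borel_measurable (lborel \<Otimes>\<^sub>M lborel)"
    unfolding G_def[abs_def] by measurable
  have 1: "(\<integral>\<^sup>+s. G x s \<partial>lborel) = ennreal (H x)" for x
  proof -
    have "(\<integral>\<^sup>+s. G x s \<partial>lborel) = (\<integral>\<^sup>+s. indicator {0<..<H x} s \<partial>lborel)"
      by (intro nn_integral_cong) (auto simp: G_def split: split_indicator)
    also have "\<dots> = emeasure lborel {0<..<H x}" by simp
    also have "\<dots> = ennreal (H x)" by (cases "0 \<le> H x") (auto simp: ennreal_neg)
    finally show ?thesis .
  qed
  have 2: "(\<integral>\<^sup>+x. G x s \<partial>lborel) = indicator {0<..} s * emeasure lborel {x. s < H x}" for s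
  proof -
    have [measurable]: "{x. s < H x} \<in> sets lborel" by measurable
    have "(\<integral>\<^sup>+x. G x s \<partial>lborel) = (\<integral>\<^sup>+x. indicator {0<..} s * indicator {x. s < H x} x \<partial>lborel)"
      by (intro nn_integral_cong) (auto simp: G_def split: split_indicator)
    then show ?thesis by (simp add: nn_integral_cmult_indicator)
  qed
  have "(\<integral>\<^sup>+x. (\<integral>\<^sup>+s. G x s \<partial>lborel) \<partial>lborel) = (\<integral>\<^sup>+s. (\<integral>\<^sup>+x. G x s \<partial>lborel) \<partial>lborel)"
    by (rule lborel_pair.Fubini'[symmetric]) measurable
  then show ?thesis unfolding 1 2 .
qed

lemma powr_level:
  fixes s y q :: real
  assumes "0 < s" "0 \<le> y" "0 < q"
  shows "s < y powr q \<longleftrightarrow> s powr (1 / q) < y"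
proof -
  have "s = (s powr (1 / q)) powr q" using assms by (simp add: powr_powr)
  moreover have "(s powr (1 / q)) powr q < y powr q \<longleftrightarrow> s powr (1 / q) < y"
  proof
    assume *: "(s powr (1 / q)) powr q < y powr q"
    show "s powr (1 / q) < y"
    proof (rule ccontr)
      assume "\<not> s powr (1 / q) < y"
      then have "y powr q \<le> (s powr (1 / q)) powr q" using assms by (intro powr_mono2) auto
      with * show False by simp
    qed
  next
    assume "s powr (1 / q) < y"
    then show "(s powr (1 / q)) powr q < y powr q" using assms by (intro powr_less_mono2) auto
  qed
  ultimately show ?thesis by simp
qed

context graph_fun
begin

definition \<rho> :: "real \<Rightarrow> real" where "\<rho> t = LL {t<..}"
text \<open>The decreasing rearrangement, as generalized inverse of the distribution function
  \<rho>. The restriction to positive levels excludes those where the level set may have infinite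
  length and \<open>measure\<close> returns 0.\<close>

definition rr :: "real \<Rightarrow> real" where "rr x = Inf {t. 0 < t \<and> \<rho> t \<le> x}"

lemma u_bounded: "\<exists>M>0. \<forall>i<4. \<forall>x\<in>I i. \<bar>u i x\<bar> \<le> M"
proof -
  have "\<exists>m. \<forall>x\<in>I i. \<bar>u i x\<bar> \<le> m" if i: "i < 4" for i
  proof (cases "i < 3")
    case True
    have "L2_on {0..} (u i)" "ac_on {0..} (u i) (g i)" using u_L2[OF i] u_ac[OF i] I_halfline[OF True] by simp_all
    then obtain xm where "\<forall>x\<ge>0. \<bar>u i x\<bar> \<le> \<bar>u i xm\<bar>" using H1_halfline_attains_max by metis
    then show ?thesis using I_halfline[OF True] by (intro exI[of _ "\<bar>u i xm\<bar>"]) simp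
  next
    case False
    then have i3: "i = 3" using i by simp
    have "continuous_on {0..l} (\<lambda>x. \<bar>u i x\<bar>)"
      using ac_on_continuous_on[OF u_ac[OF i] I_interval] i3 I_edge by (intro continuous_on_rabs) simp
    then obtain xm where "\<forall>x\<in>{0..l}. \<bar>u i x\<bar> \<le> \<bar>u i xm\<bar>"
      using continuous_attains_sup[OF compact_Icc, of 0 l] l_pos by (metis atLeastatMost_empty_iff less_imp_le)
    then show ?thesis using i3 I_edge by (intro exI[of _ "\<bar>u i xm\<bar>"]) simp
  qed
  then obtain m where m: "\<And>i x. i < 4 \<Longrightarrow> x \<in> I i \<Longrightarrow> \<bar>u i x\<bar> \<le> m i" by metis
  define M where "M = 1 + (\<Sum>i<4. \<bar>m i\<bar>)"
  have s0: "0 \<le> (\<Sum>i<4. \<bar>m i\<bar>)" by (rule sum_nonneg) simp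
  have "\<bar>u i x\<bar> \<le> M" if "i < 4" "x \<in> I i" for i x
  proof -
    have "\<bar>m i\<bar> \<le> (\<Sum>i<4. \<bar>m i\<bar>)" using that(1) by (intro member_le_sum) auto
    then show ?thesis using m[OF that] by (simp add: M_def)
  qed
  moreover have "0 < M" unfolding M_def using s0 by linarith
  ultimately show ?thesis by blast
qed

lemma \<rho>_nonneg [simp]: "0 \<le> \<rho> t" by (simp add: \<rho>_def)

lemma \<rho>_eq_0:
  assumes "\<And>i x. i < 4 \<Longrightarrow> x \<in> I i \<Longrightarrow> \<bar>u i x\<bar> \<le> t"
  shows "\<rho> t = 0"
proof -
  have "lev i {t<..} = {}" if "i < 4" for i using assms[OF that] by (force simp: lev_def)
  then show ?thesis by (simp add: \<rho>_def LL_def ll_def)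
qed

lemma \<rho>_antimono:
  assumes "0 < s" "s \<le> t"
  shows "\<rho> t \<le> \<rho> s"
proof -
  have "LL {t<..} + LL {} \<le> LL {s<..}" by (rule LL_superadd[of _ _ _ s]) (use assms in auto)
  then show ?thesis unfolding \<rho>_def using LL_nonneg[of "{}"] by linarith
qed

text \<open>Sets above levels decreasing to \<open>t\<close> exhaust the set above \<open>t\<close>.
  This one-sided continuity is what makes the equivalence \<open>less_rr_iff\<close> strict on both
  sides.\<close>

lemma \<rho>_right_continuous:
  assumes t: "0 < t" and x: "x < \<rho> t"
  shows "\<exists>t'>t. x < \<rho> t'"
proof -
  have "(\<lambda>n. ll i {t + 1 / real (Suc n)<..}) \<longlonglongrightarrow> ll i {t<..}" if i: "i < 4" for i
  proof -
    have U: "(\<Union>n. lev i {t + 1 / real (Suc n)<..}) = lev i {t<..}"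
    proof
      show "(\<Union>n. lev i {t + 1 / real (Suc n)<..}) \<subseteq> lev i {t<..}"
      proof (rule UN_least)
        fix n
        have "0 < 1 / real (Suc n)" by simp
        then show "lev i {t + 1 / real (Suc n)<..} \<subseteq> lev i {t<..}" by (intro lev_mono) auto
      qed
      show "lev i {t<..} \<subseteq> (\<Union>n. lev i {t + 1 / real (Suc n)<..})"
      proof
        fix y assume y: "y \<in> lev i {t<..}"
        then have "0 < \<bar>u i y\<bar> - t" by (simp add: lev_def)
        then obtain n where "inverse (real (Suc n)) < \<bar>u i y\<bar> - t" using reals_Archimedean by blast
        then have "t + 1 / real (Suc n) < \<bar>u i y\<bar>" by (simp add: inverse_eq_divide)
        then show "y \<in> (\<Union>n. lev i {t + 1 / real (Suc n)<..})" using y by (intro UN_I[of n]) (auto simp: lev_def)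
      qed
    qed
    have "(\<lambda>n. measure lborel (lev i {t + 1 / real (Suc n)<..})) \<longlonglongrightarrow> measure lborel (\<Union>n. lev i {t + 1 / real (Suc n)<..})"
    proof (rule Lim_measure_incseq)
      show "range (\<lambda>n. lev i {t + 1 / real (Suc n)<..}) \<subseteq> sets lborel"
        using lev_sets[OF i] by (intro image_subsetI) simp
      show "incseq (\<lambda>n. lev i {t + 1 / real (Suc n)<..})"
      proof (rule incseq_SucI)
        fix n
        have "1 / real (Suc (Suc n)) \<le> 1 / real (Suc n)" by (simp add: frac_le)
        then show "lev i {t + 1 / real (Suc n)<..} \<subseteq> lev i {t + 1 / real (Suc (Suc n))<..}"
          by (intro lev_mono) auto
      qed
      have "emeasure lborel (lev i {t<..}) < \<infinity>" by (rule lev_finite[OF i _ _ t]) auto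
      then show "emeasure lborel (\<Union>n. lev i {t + 1 / real (Suc n)<..}) \<noteq> \<infinity>" unfolding U by simp
    qed
    then show ?thesis unfolding U ll_def .
  qed
  then have "(\<lambda>n. \<rho> (t + 1 / real (Suc n))) \<longlonglongrightarrow> \<rho> t"
    unfolding \<rho>_def LL_def by (intro tendsto_sum) simp
  then have "\<forall>\<^sub>F n in sequentially. x < \<rho> (t + 1 / real (Suc n))" by (rule order_tendstoD(1)[OF _ x])
  then obtain n where "x < \<rho> (t + 1 / real (Suc n))" by (auto simp: eventually_sequentially)
  then show ?thesis by (intro exI[of _ "t + 1 / real (Suc n)"]) simp
qed

lemma rr_set_nonempty: "0 \<le> x \<Longrightarrow> {t. 0 < t \<and> \<rho> t \<le> x} \<noteq> {}"
proof -
  assume x: "0 \<le> x"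
  obtain M where M: "0 < M" "\<And>i x. i < 4 \<Longrightarrow> x \<in> I i \<Longrightarrow> \<bar>u i x\<bar> \<le> M" using u_bounded by metis
  have "\<rho> M = 0" by (rule \<rho>_eq_0[OF M(2)])
  then have "M \<in> {t. 0 < t \<and> \<rho> t \<le> x}" using M(1) x by simp
  then show ?thesis by blast
qed

lemma rr_set_bdd: "bdd_below {t. 0 < t \<and> \<rho> t \<le> x}"
  by (intro bdd_belowI[of _ 0]) auto

lemma rr_nonneg:
  assumes "0 \<le> x" shows "0 \<le> rr x"
  unfolding rr_def by (rule cInf_greatest[OF rr_set_nonempty[OF assms]]) auto

lemma rr_antimono:
  assumes "0 \<le> x" "x \<le> y" shows "rr y \<le> rr x"
  unfolding rr_def by (rule cInf_superset_mono[OF rr_set_nonempty[OF assms(1)] rr_set_bdd]) (use assms in auto)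

text \<open>It says that {rr > t} is the interval [0, \<rho> t), so that \<open>rr\<close> is
  equimeasurable with the function on the graph.\<close>

lemma less_rr_iff:
  assumes t: "0 < t" and x: "0 \<le> x"
  shows "t < rr x \<longleftrightarrow> x < \<rho> t"
proof
  assume "t < rr x"
  show "x < \<rho> t"
  proof (rule ccontr)
    assume "\<not> x < \<rho> t"
    then have "rr x \<le> t" unfolding rr_def using t by (intro cInf_lower rr_set_bdd) auto
    with \<open>t < rr x\<close> show False by simp
  qed
next
  assume "x < \<rho> t"
  then obtain t' where t': "t < t'" "x < \<rho> t'" using \<rho>_right_continuous[OF t] by blast
  have "t' \<le> rr x" unfolding rr_def
  proof (rule cInf_greatest[OF rr_set_nonempty[OF x]])
    fix s assume "s \<in> {t. 0 < t \<and> \<rho> t \<le> x}"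
    then have s: "0 < s" "\<rho> s \<le> x" by auto
    show "t' \<le> s"
    proof (rule ccontr)
      assume "\<not> t' \<le> s"
      then have "\<rho> t' \<le> \<rho> s" using \<rho>_antimono[OF s(1), of t'] by simp
      with s t' show False by simp
    qed
  qed
  with t'(1) show "t < rr x" by simp
qed

lemma rr_measurable: "(\<lambda>x. indicator {0..} x * rr x) \<in> borel_measurable borel"
proof -
  have "mono (\<lambda>x. - rr (max 0 x))" by (intro monoI) (simp add: rr_antimono)
  then have m: "(\<lambda>x. - rr (max 0 x)) \<in> borel_measurable borel" by (rule borel_measurable_mono)
  have "(\<lambda>x. indicator {0..} x * - (- rr (max 0 x))) \<in> borel_measurable borel"
    using m by measurable
  also have "(\<lambda>x. indicator {0..} x * - (- rr (max 0 x))) = (\<lambda>x. indicator {0..} x * rr x)"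
    by (auto split: split_indicator)
  finally show ?thesis .
qed

text \<open>Layer cake on both sides: by \<open>less_rr_iff\<close> every level set of
  \<open>rr\<close> has the total length of the corresponding level sets on the edges.\<close>

lemma rr_powr:
  assumes q: "0 < q" and int: "\<And>i. i < 4 \<Longrightarrow> set_integrable lborel (I i) (\<lambda>x. \<bar>u i x\<bar> powr q)"
  shows "set_integrable lborel {0..} (\<lambda>x. \<bar>rr x\<bar> powr q)"
    "(LINT x:{0..}|lborel. \<bar>rr x\<bar> powr q) = (\<Sum>i<4. LINT x:I i|lborel. \<bar>u i x\<bar> powr q)"
proof -
  define H where "H x = indicator {0..} x * \<bar>rr x\<bar> powr q" for x
  define Hi where "Hi i x = indicator (I i) x * \<bar>u i x\<bar> powr q" for i x
  note [measurable] = rr_measurable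
  have H_eq: "H x = \<bar>indicator {0..} x * rr x\<bar> powr q" for x using q by (auto simp: H_def split: split_indicator)
  have Hm [measurable]: "H \<in> borel_measurable borel" unfolding H_eq[abs_def] by measurable
  have inti: "integrable lborel (Hi i)" if "i < 4" for i
    using int[OF that] by (simp add: set_integrable_def Hi_def[abs_def])
  then have Him: "Hi i \<in> borel_measurable borel" if "i < 4" for i using that by force
  have levels: "emeasure lborel {x. s < Hi i x} = ennreal (ll i {s powr (1 / q)<..})" if "i < 4" "0 < s" for i s
  proof -
    have "{x. s < Hi i x} = lev i {s powr (1 / q)<..}"
      using that powr_level[OF that(2) abs_ge_zero q] by (auto simp: Hi_def lev_def split: split_indicator)
    moreover have "emeasure lborel (lev i {s powr (1 / q)<..}) < \<infinity>"
      by (rule lev_finite[OF that(1), of _ "s powr (1 / q)"]) (use that in auto)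
    ultimately show ?thesis by (simp add: ll_def emeasure_eq_ennreal_measure less_top)
  qed
  have level: "emeasure lborel {x. s < H x} = ennreal (\<rho> (s powr (1 / q)))" if "0 < s" for s
  proof -
    have "x \<in> {x. s < H x} \<longleftrightarrow> x \<in> {0..<\<rho> (s powr (1 / q))}" for x
    proof (cases "0 \<le> x")
      case True
      have "s < H x \<longleftrightarrow> s powr (1 / q) < \<bar>rr x\<bar>"
        using powr_level[OF that abs_ge_zero q] True by (simp add: H_def)
      also have "\<dots> \<longleftrightarrow> x < \<rho> (s powr (1 / q))"
        using less_rr_iff[of "s powr (1 / q)" x] rr_nonneg[OF True] that True by simp
      finally show ?thesis using True by simp
    next
      case False then show ?thesis using that by (simp add: H_def)
    qed
    then have "{x. s < H x} = {0..<\<rho> (s powr (1 / q))}" by blast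
    then show ?thesis by simp
  qed
  have "(\<integral>\<^sup>+x. ennreal (H x) \<partial>lborel) = (\<integral>\<^sup>+s. indicator {0<..} s * emeasure lborel {x. s < H x} \<partial>lborel)"
    by (rule layer_cake[OF Hm])
  also have "\<dots> = (\<integral>\<^sup>+s. (\<Sum>i<4. indicator {0<..} s * emeasure lborel {x. s < Hi i x}) \<partial>lborel)"
  proof (rule nn_integral_cong)
    fix s :: real
    show "indicator {0<..} s * emeasure lborel {x. s < H x} = (\<Sum>i<4. indicator {0<..} s * emeasure lborel {x. s < Hi i x})"
    proof (cases "0 < s")
      case True
      have "ennreal (\<rho> (s powr (1 / q))) = (\<Sum>i<4. ennreal (ll i {s powr (1 / q)<..}))"
        unfolding \<rho>_def LL_def by (simp add: sum_ennreal)
      then show ?thesis using True level levels by simp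
    qed simp
  qed
  also have "\<dots> = (\<Sum>i<4. \<integral>\<^sup>+s. indicator {0<..} s * emeasure lborel {x. s < Hi i x} \<partial>lborel)"
  proof (rule nn_integral_sum)
    fix i :: nat assume "i \<in> {..<4}"
    then have i: "i < 4" by simp
    note [measurable] = Him[OF i]
    show "(\<lambda>s. indicator {0<..} s * emeasure lborel {x. s < Hi i x}) \<in> borel_measurable lborel" by measurable
  qed
  also have "\<dots> = (\<Sum>i<4. \<integral>\<^sup>+x. ennreal (Hi i x) \<partial>lborel)"
    by (intro sum.cong refl layer_cake[symmetric] Him) simp
  also have "\<dots> = (\<Sum>i<4. ennreal (\<integral>x. Hi i x \<partial>lborel))"
    by (intro sum.cong refl nn_integral_eq_integral inti) (auto simp: Hi_def)
  also have "\<dots> = ennreal (\<Sum>i<4. \<integral>x. Hi i x \<partial>lborel)"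
    by (intro sum_ennreal integral_nonneg_AE) (auto simp: Hi_def)
  finally have nn: "(\<integral>\<^sup>+x. ennreal (H x) \<partial>lborel) = ennreal (\<Sum>i<4. \<integral>x. Hi i x \<partial>lborel)" .
  have H0: "0 \<le> H x" for x by (simp add: H_def)
  have intH: "integrable lborel H" by (rule integrableI_nonneg) (use nn H0 in auto)
  then show "set_integrable lborel {0..} (\<lambda>x. \<bar>rr x\<bar> powr q)" by (simp add: set_integrable_def H_def[abs_def])
  have s0: "0 \<le> (\<Sum>i<4. \<integral>x. Hi i x \<partial>lborel)" by (intro sum_nonneg integral_nonneg_AE) (auto simp: Hi_def)
  have "ennreal (\<integral>x. H x \<partial>lborel) = ennreal (\<Sum>i<4. \<integral>x. Hi i x \<partial>lborel)"
    using nn nn_integral_eq_integral[OF intH] H0 by simp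
  then have "(\<integral>x. H x \<partial>lborel) = (\<Sum>i<4. \<integral>x. Hi i x \<partial>lborel)"
    using s0 integral_nonneg_AE[of H lborel] H0 by simp
  then show "(LINT x:{0..}|lborel. \<bar>rr x\<bar> powr q) = (\<Sum>i<4. LINT x:I i|lborel. \<bar>u i x\<bar> powr q)"
    by (simp add: set_lebesgue_integral_def H_def Hi_def)
qed

lemma abs_powr_two: "\<bar>x\<bar> powr 2 = (x::real)\<^sup>2"
  by (cases "x = 0") simp_all

lemma rr_mass: "L2_on {0..} rr" "mass rr = (\<Sum>i<4. LINT x:I i|lborel. (u i x)\<^sup>2)"
proof -
  have int: "set_integrable lborel (I i) (\<lambda>x. \<bar>u i x\<bar> powr 2)" if "i < 4" for i
    unfolding abs_powr_two using L2_onD(2)[OF u_L2[OF that]] .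
  note r = rr_powr[OF zero_less_numeral int, unfolded abs_powr_two]
  show "L2_on {0..} rr" using r(1) rr_measurable by (simp add: L2_on_def set_borel_measurable_def)
  show "mass rr = (\<Sum>i<4. LINT x:I i|lborel. (u i x)\<^sup>2)" unfolding mass_def by (rule r(2))
qed

lemma u_powr_integrable:
  assumes "2 < p" "i < 4"
  shows "set_integrable lborel (I i) (\<lambda>x. \<bar>u i x\<bar> powr p)"
proof -
  obtain M where M: "0 < M" "\<And>i x. i < 4 \<Longrightarrow> x \<in> I i \<Longrightarrow> \<bar>u i x\<bar> \<le> M" using u_bounded by metis
  show ?thesis by (rule L2_on_powr_integrable(1)[OF u_L2[OF assms(2)] M(2)[OF assms(2)] assms(1)]) simp_all
qed

lemma rr_pot:
  assumes "2 < p"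
  shows "pot p rr = (\<Sum>i<4. LINT x:I i|lborel. \<bar>u i x\<bar> powr p)"
  unfolding pot_def using rr_powr(2)[of p, OF _ u_powr_integrable[OF assms]] assms by simp

text \<open>The graph energy at levels above \<open>rr x\<close>: the budget for the first
  \<open>x\<close> units of length of the rearrangement, in the role of \<kappa> in the Riesz
  criterion.\<close>

definition \<kappa> :: "real \<Rightarrow> real" where "\<kappa> x = KK {rr x<..}"

text \<open>The levels strictly between \<open>rr b\<close> and \<open>rr a\<close> occupy length at
  most b - a on the graph and energy at most \<kappa> b - \<kappa> a, so \<open>Q\<close> bounds the
  squared drop. \<open>less_rr_iff\<close> needs strict inequalities, hence the slightly smaller
  bands and the limit.\<close>

lemma rr_increment:
  assumes ab: "0 \<le> a" "a \<le> b"
    and Qn: "\<And>t1 t2. rr b < t1 \<Longrightarrow> t1 < t2 \<Longrightarrow> t2 < rr a \<Longrightarrow> Q n t1 t2"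
  shows "n\<^sup>2 * (rr a - rr b)\<^sup>2 \<le> (b - a) * (\<kappa> b - \<kappa> a)"
proof (cases "rr a = rr b")
  case True then show ?thesis by (simp add: \<kappa>_def)
next
  case False
  define D where "D = rr a - rr b"
  have D: "0 < D" using rr_antimono[OF ab] False by (simp add: D_def)
  have b0: "0 \<le> rr b" using ab by (intro rr_nonneg) simp
  \<comment> \<open>The offset 3 keeps 2 \<open>e k\<close> below \<open>D\<close> already for k =
    0.\<close>
  define e where "e k = D / real (k + 3)" for k
  have e: "0 < e k" "2 * e k < D" for k
  proof -
    show "0 < e k" using D by (simp add: e_def)
    have "D / real (k + 3) < D / 2" using D by (intro divide_strict_left_mono) auto
    then show "2 * e k < D" unfolding e_def by linarith
  qed
  have step: "(n * (D - 2 * e k))\<^sup>2 \<le> (b - a) * (\<kappa> b - \<kappa> a)" for k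
  proof -
    define t1 where "t1 = rr b + e k"
    define t2 where "t2 = rr a - e k"
    have t: "rr b < t1" "t1 < t2" "t2 < rr a" "0 < t1" "t2 - t1 = D - 2 * e k"
      using e[of k] b0 by (auto simp: t1_def t2_def D_def)
    have t2p: "0 < t2" using t by simp
    have "LL {t1<..<t2} + \<rho> t2 \<le> \<rho> t1"
      unfolding \<rho>_def by (rule LL_superadd[of _ _ _ t1]) (use t in auto)
    moreover have "\<rho> t1 \<le> b" using less_rr_iff[OF t(4), of b] t(1) ab by simp
    moreover have "a < \<rho> t2" using less_rr_iff[OF t2p ab(1)] t(3) by simp
    ultimately have L: "LL {t1<..<t2} \<le> b - a" by linarith
    have "KK {t1<..<t2} + KK {rr a<..} \<le> KK {rr b<..}"
      by (rule KK_superadd) (use t in auto)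
    then have K: "KK {t1<..<t2} \<le> \<kappa> b - \<kappa> a" by (simp add: \<kappa>_def)
    have "(n * (t2 - t1))\<^sup>2 \<le> LL {t1<..<t2} * KK {t1<..<t2}" using Qn[OF t(1-3)] by (simp add: Q_def)
    also have "\<dots> \<le> (b - a) * (\<kappa> b - \<kappa> a)" by (rule mult_mono[OF L K]) (use ab in simp_all)
    finally show ?thesis by (simp add: t(5))
  qed
  have "e \<longlonglongrightarrow> 0"
    unfolding e_def[abs_def] using LIMSEQ_ignore_initial_segment[OF lim_const_over_n[of D], of 3] by simp
  then have "(\<lambda>k. (n * (D - 2 * e k))\<^sup>2) \<longlonglongrightarrow> (n * (D - 2 * 0))\<^sup>2"
    by (intro tendsto_power tendsto_mult tendsto_diff tendsto_const)
  then have "(n * D)\<^sup>2 \<le> (b - a) * (\<kappa> b - \<kappa> a)"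
    using step by (intro LIMSEQ_le_const2[of "\<lambda>k. (n * (D - 2 * e k))\<^sup>2"]) auto
  then show ?thesis by (simp add: D_def power_mult_distrib)
qed

text \<open>The Polya-Szego inequality with multiplicities: levels above \<open>rr y\<close> sit on
  [0,y] and are crossed \<open>n1\<close> times, lower levels sit on [y,\<infinity>) and are crossed
  \<open>n2\<close> times.\<close>

lemma rearrangement:
  assumes y: "0 \<le> y" and n: "0 < n1" "0 < n2"
    and Q1: "\<And>t1 t2. 0 < t1 \<Longrightarrow> rr y < t1 \<Longrightarrow> t1 < t2 \<Longrightarrow> t2 < rr 0 \<Longrightarrow> Q n1 t1 t2"
    and Q2: "\<And>t1 t2. 0 < t1 \<Longrightarrow> t1 < t2 \<Longrightarrow> t2 < rr y \<Longrightarrow> Q n2 t1 t2"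
  shows "\<exists>h. decr_pair rr h \<and> kin (n1\<^sup>2) (n2\<^sup>2) y h \<le> (\<Sum>i<4. LINT x:I i|lborel. (g i x)\<^sup>2)"
proof -
  have \<kappa>_mono: "\<kappa> x \<le> \<kappa> z" if "0 \<le> x" "x \<le> z" for x z
  proof -
    have "KK {rr x<..} + KK {} \<le> KK {rr z<..}"
      by (rule KK_superadd) (use rr_antimono[OF that] in auto)
    then show ?thesis using KK_nonneg[of "{}"] unfolding \<kappa>_def by linarith
  qed
  have 1: "n1\<^sup>2 * (rr a - rr b)\<^sup>2 \<le> (b - a) * (\<kappa> b - \<kappa> a)" if "0 \<le> a" "a \<le> b" "b \<le> y" for a b
  proof (rule rr_increment[OF that(1,2)])
    fix t1 t2 assume t: "rr b < t1" "t1 < t2" "t2 < rr a"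
    have "0 \<le> b" using that by simp
    then have "rr y \<le> rr b" "rr a \<le> rr 0" "0 \<le> rr b" using that by (auto intro: rr_antimono rr_nonneg)
    then show "Q n1 t1 t2" using t by (intro Q1) auto
  qed
  have 2: "n2\<^sup>2 * (rr a - rr b)\<^sup>2 \<le> (b - a) * (\<kappa> b - \<kappa> a)" if "y \<le> a" "a \<le> b" for a b
  proof (rule rr_increment)
    show a0: "0 \<le> a" using y that by simp
    show "a \<le> b" by fact
    fix t1 t2 assume t: "rr b < t1" "t1 < t2" "t2 < rr a"
    have "rr a \<le> rr y" "0 \<le> rr b" using that y a0 by (auto intro: rr_antimono rr_nonneg)
    then show "Q n2 t1 t2" using t by (intro Q2) auto
  qed
  obtain h where h: "ac_on {0..} rr h"
      "n1\<^sup>2 * (LINT t:{0..y}|lborel. (h t)\<^sup>2) + n2\<^sup>2 * (LINT t:{y..}|lborel. (h t)\<^sup>2) \<le> (\<Sum>i<4. LINT x:I i|lborel. (g i x)\<^sup>2)"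
    by (rule weighted_riesz[of rr \<kappa> _ "n1\<^sup>2" "n2\<^sup>2" y, OF rr_antimono \<kappa>_mono _ _ _ _ y 1 2])
      (use n KK_le_total in \<open>auto simp: \<kappa>_def\<close>)
  have "decr_pair rr h" using rr_nonneg rr_antimono rr_mass(1) h(1) by (auto simp: decr_pair_def)
  then show ?thesis using h(2) by (intro exI[of _ h]) (simp add: kin_def)
qed

lemma rr_zero_le:
  assumes "\<And>i x. i < 4 \<Longrightarrow> x \<in> I i \<Longrightarrow> \<bar>u i x\<bar> \<le> m" "0 \<le> m"
  shows "rr 0 \<le> m"
proof (rule ccontr)
  assume "\<not> rr 0 \<le> m"
  then obtain t where t: "m < t" "t < rr 0" using dense[of m "rr 0"] by auto
  have "0 < \<rho> t" using less_rr_iff[of t 0] t assms(2) by simp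
  moreover have "\<rho> t = 0" by (rule \<rho>_eq_0) (use assms(1) t in force)
  ultimately show False by simp
qed

section \<open>Comparison of the graph energy with the weighted functionals\<close>

definition genergy :: "real \<Rightarrow> real" where
  "genergy p = (\<Sum>i<4. LINT x:I i|lborel. (g i x)\<^sup>2) / 2 - (\<Sum>i<4. LINT x:I i|lborel. \<bar>u i x\<bar> powr p) / p"

definition gmass :: real where "gmass = (\<Sum>i<4. LINT x:I i|lborel. (u i x)\<^sup>2)"

text \<open>The largest value on the halflines separates the counts. Below it every band has three
  crossings; above it only the terminal edge contributes, at least one crossing and total length at
  most \<open>l\<close>. So the break point of the weights is \<open>l\<close>.\<close>

lemma max_on_edge:
  assumes p: "2 < p" and j: "j < 3" "0 \<le> xm" "\<And>i x. i < 3 \<Longrightarrow> 0 \<le> x \<Longrightarrow> \<bar>u i x\<bar> \<le> \<bar>u j xm\<bar>"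
    and M: "xM \<in> {0..l}" "\<And>x. x \<in> {0..l} \<Longrightarrow> \<bar>u 3 x\<bar> \<le> \<bar>u 3 xM\<bar>" "\<bar>u j xm\<bar> \<le> \<bar>u 3 xM\<bar>"
  shows "\<exists>f h. decr_pair f h \<and> mass f = gmass \<and> wenergy p 1 9 l f h \<le> genergy p"
proof -
  let ?m = "\<bar>u j xm\<bar>" and ?M = "\<bar>u 3 xM\<bar>"
  have split: "i < 3 \<or> i = 3" if "i < 4" for i :: nat using that by linarith
  have r0: "rr 0 \<le> ?M"
  proof (rule rr_zero_le)
    fix i :: nat and x assume ix: "i < 4" "x \<in> I i"
    show "\<bar>u i x\<bar> \<le> ?M"
      using split[OF ix(1)]
    proof
      assume "i < 3"
      then show ?thesis using j(3)[of i x] ix(2) I_halfline[of i] M(3) by simp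
    next
      assume "i = 3"
      then show ?thesis using M(2)[of x] ix(2) I_edge by simp
    qed
  qed simp
  \<comment> \<open>Levels above \<open>?m\<close> occur only on the terminal edge, where they
    occupy length at most \<open>l\<close>.\<close>
  have rl: "rr l \<le> ?m"
  proof (rule ccontr)
    assume "\<not> rr l \<le> ?m"
    then have "?m < rr l" by simp
    then obtain t where t: "?m < t" "t < rr l" using dense by blast
    have t0: "0 < t" using t(1) by linarith
    have "l < \<rho> t" using less_rr_iff[OF t0, of l] t(2) l_pos by simp
    moreover have "\<rho> t \<le> l"
    proof -
      have "lev i {t<..} = {}" if "i < 3" for i
        using j(3)[OF that] t(1) I_halfline[OF that] by (force simp: lev_def)
      then have z: "ll i {t<..} = 0" if "i < 3" for i using that by (simp add: ll_def)
      have "ll 3 {t<..} \<le> measure lborel {0..l}"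
        unfolding ll_def
      proof (rule measure_mono_fmeasurable)
        show "lev 3 {t<..} \<subseteq> {0..l}" unfolding lev_def I_edge by blast
        show "lev 3 {t<..} \<in> sets lborel" by (rule lev_sets) simp_all
        show "{0..l} \<in> fmeasurable lborel" by (rule fmeasurableI[OF _ emeasure_lborel_Icc_finite]) simp
      qed
      then have "ll 3 {t<..} \<le> l" using l_pos by simp
      moreover have "{..<4::nat} = {0, 1, 2, 3}" by auto
      ultimately show ?thesis unfolding \<rho>_def LL_def by (simp add: z)
    qed
    ultimately show False by simp
  qed
  have v0m: "v0 \<le> ?m" using j(3)[of 0 0] by (simp add: v0_def)
  have Q3: "Q 3 t1 t2" if "0 < t1" "t1 < t2" "t2 \<le> ?m" for t1 t2
  proof (rule Q_glue[of v0 3 ?m])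
    show "Q 3 s1 s2" if "0 < s1" "s1 < s2" "s2 \<le> v0" for s1 s2 using that by (rule Q_below_vertex)
    show "Q 3 s1 s2" if "0 < s1" "s1 < s2" "v0 \<le> s1" "s2 \<le> ?m" for s1 s2
      by (rule Q_both_max[OF j(1) that j(2) _ M(1)]) (use that M(3) in linarith)
  qed (use that in simp_all)
  have Q1: "Q 1 t1 t2" if "0 < t1" "t1 < t2" "t2 \<le> ?M" for t1 t2
  proof (rule Q_glue[of v0 1 ?M])
    show "Q 1 s1 s2" if "0 < s1" "s1 < s2" "s2 \<le> v0" for s1 s2
      by (rule Q_mono[OF Q_below_vertex[OF that]]) (use that in simp_all)
    show "Q 1 s1 s2" if "0 < s1" "s1 < s2" "v0 \<le> s1" "s2 \<le> ?M" for s1 s2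
      by (rule Q_edge_max[OF that M(1)])
  qed (use that in simp_all)
  have R1: "Q 1 t1 t2" if "0 < t1" "rr l < t1" "t1 < t2" "t2 < rr 0" for t1 t2
    by (rule Q1) (use that r0 in linarith)+
  have R3: "Q 3 t1 t2" if "0 < t1" "t1 < t2" "t2 < rr l" for t1 t2
    by (rule Q3) (use that rl in linarith)+
  have "\<exists>h. decr_pair rr h \<and> kin (1\<^sup>2) (3\<^sup>2) l h \<le> (\<Sum>i<4. LINT x:I i|lborel. (g i x)\<^sup>2)"
  proof (rule rearrangement)
    show "Q 1 t1 t2" if "0 < t1" "rr l < t1" "t1 < t2" "t2 < rr 0" for t1 t2 by (rule R1[OF that])
    show "Q 3 t1 t2" if "0 < t1" "t1 < t2" "t2 < rr l" for t1 t2 by (rule R3[OF that])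
  qed (use l_pos in simp_all)
  then obtain h where h: "decr_pair rr h" "kin (1\<^sup>2) (3\<^sup>2) l h \<le> (\<Sum>i<4. LINT x:I i|lborel. (g i x)\<^sup>2)"
    by blast
  have "wenergy p 1 9 l rr h \<le> genergy p"
    using h(2) by (simp add: wenergy_def genergy_def rr_pot[OF p])
  with h(1) rr_mass(2) show ?thesis
    by (intro exI[of _ rr] exI[of _ h] conjI) (simp_all add: gmass_def)
qed

text \<open>All bands have two crossings, which gives the line energy. Strictness comes from the
  third crossing below a positive vertex value: the tail of the rearrangement then carries weight 9
  instead of 4, and its kinetic energy cannot vanish.\<close>

lemma max_on_halfline:
  assumes p: "2 < p" and j: "j < 3" "0 \<le> xm" and m: "\<And>i x. i < 4 \<Longrightarrow> x \<in> I i \<Longrightarrow> \<bar>u i x\<bar> \<le> \<bar>u j xm\<bar>"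
  shows "\<exists>f h. decr_pair f h \<and> mass f = gmass \<and> wenergy p 4 4 0 f h \<le> genergy p"
    and "0 < v0 \<Longrightarrow> \<exists>f h. decr_pair f h \<and> mass f = gmass \<and> wenergy p 4 4 0 f h < genergy p"
proof -
  let ?m = "\<bar>u j xm\<bar>"
  have r0: "rr 0 \<le> ?m" by (rule rr_zero_le[OF m]) auto
  have Q2: "Q 2 t1 t2" if "0 < t1" "t1 < t2" "t2 \<le> ?m" for t1 t2
  proof (rule Q_glue[of v0 2 ?m])
    show "Q 2 s1 s2" if "0 < s1" "s1 < s2" "s2 \<le> v0" for s1 s2
      by (rule Q_mono[OF Q_below_vertex[OF that]]) (use that in auto)
    show "Q 2 s1 s2" if "0 < s1" "s1 < s2" "v0 \<le> s1" "s2 \<le> ?m" for s1 s2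
      by (rule Q_halfline_max[OF j(1) that j(2)])
  qed (use that in auto)
  have R2: "Q 2 t1 t2" if "0 < t1" "rr y < t1" "t1 < t2" "t2 < rr 0" for t1 t2 y
    by (rule Q2) (use that r0 in linarith)+
  have R2': "Q 2 t1 t2" if "0 < t1" "t1 < t2" "t2 < rr 0" for t1 t2
    by (rule Q2) (use that r0 in linarith)+
  have "\<exists>h. decr_pair rr h \<and> kin (2\<^sup>2) (2\<^sup>2) 0 h \<le> (\<Sum>i<4. LINT x:I i|lborel. (g i x)\<^sup>2)"
  proof (rule rearrangement)
    show "Q 2 t1 t2" if "0 < t1" "rr 0 < t1" "t1 < t2" "t2 < rr 0" for t1 t2 by (rule R2[OF that])
    show "Q 2 t1 t2" if "0 < t1" "t1 < t2" "t2 < rr 0" for t1 t2 by (rule R2'[OF that])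
  qed (use l_pos in simp_all)
  then obtain h where h: "decr_pair rr h" "kin (2\<^sup>2) (2\<^sup>2) 0 h \<le> (\<Sum>i<4. LINT x:I i|lborel. (g i x)\<^sup>2)"
    by blast
  have "wenergy p 4 4 0 rr h \<le> genergy p"
    using h(2) by (simp add: wenergy_def genergy_def rr_pot[OF p])
  with h(1) rr_mass(2) show "\<exists>f h. decr_pair f h \<and> mass f = gmass \<and> wenergy p 4 4 0 f h \<le> genergy p"
    by (intro exI[of _ rr] exI[of _ h] conjI) (simp_all add: gmass_def)
  assume v0: "0 < v0"
  have cont: "continuous_on {0..} rr" using ac_on_continuous_on[OF decr_pairD(4)[OF h(1)]] by simp
  \<comment> \<open>A point beyond which the rearrangement is positive at first and takes only
    values up to the vertex value.\<close>
  have "\<exists>y\<ge>0. 0 < rr y \<and> rr y \<le> v0"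
  proof (cases "rr 0 \<le> v0")
    case True
    have "0 < rr 0"
    proof (rule ccontr)
      \<comment> \<open>Then the levels between v0/2 and v0 would have length 0, although a halfline
        has to cross them.\<close>
      assume "\<not> 0 < rr 0"
      then have z: "rr x = 0" if "0 \<le> x" for x using rr_antimono[OF order_refl that] rr_nonneg[OF that] by simp
      have "\<rho> (v0 / 2) \<le> 0" using less_rr_iff[of "v0 / 2" 0] z[of 0] v0 by simp
      then have r: "\<rho> (v0 / 2) = 0" using \<rho>_nonneg[of "v0 / 2"] by linarith
      have "(1 * (v0 - v0 / 2))\<^sup>2 \<le> ll 0 {v0 / 2<..<v0} * kk 0 {v0 / 2<..<v0}"
        by (rule halfline_once) (use v0 in auto)
      moreover have "ll 0 {v0 / 2<..<v0} \<le> LL {v0 / 2<..<v0}"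
        unfolding LL_def by (rule member_le_sum) auto
      moreover have "LL {v0 / 2<..<v0} + LL {} \<le> LL {v0 / 2<..}"
        by (rule LL_superadd[of _ _ _ "v0 / 2"]) (use v0 in auto)
      moreover have "0 \<le> LL {}" "0 \<le> ll 0 {v0 / 2<..<v0}" by simp_all
      ultimately have "ll 0 {v0 / 2<..<v0} = 0" using r unfolding \<rho>_def by linarith
      with \<open>(1 * (v0 - v0 / 2))\<^sup>2 \<le> _\<close> v0 show False by simp
    qed
    with True show ?thesis by (intro exI[of _ 0]) simp
  next
    case False
    have "\<not> v0 < rr (\<rho> v0)" using less_rr_iff[OF v0, of "\<rho> v0"] by simp
    then have "\<exists>y. 0 \<le> y \<and> y \<le> \<rho> v0 \<and> rr y = v0"
      using False by (intro IVT2' continuous_on_subset[OF cont]) auto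
    then show ?thesis using v0 by auto
  qed
  then obtain y where y: "0 \<le> y" "0 < rr y" "rr y \<le> v0" by blast
  have R3: "Q 3 t1 t2" if "0 < t1" "t1 < t2" "t2 < rr y" for t1 t2
    by (rule Q_below_vertex) (use that y in linarith)+
  have "\<exists>h. decr_pair rr h \<and> kin (2\<^sup>2) (3\<^sup>2) y h \<le> (\<Sum>i<4. LINT x:I i|lborel. (g i x)\<^sup>2)"
  proof (rule rearrangement)
    show "Q 2 t1 t2" if "0 < t1" "rr y < t1" "t1 < t2" "t2 < rr 0" for t1 t2 by (rule R2[OF that])
    show "Q 3 t1 t2" if "0 < t1" "t1 < t2" "t2 < rr y" for t1 t2 by (rule R3[OF that])
  qed (use y(1) in simp_all)
  then obtain k where k: "decr_pair rr k" "kin (2\<^sup>2) (3\<^sup>2) y k \<le> (\<Sum>i<4. LINT x:I i|lborel. (g i x)\<^sup>2)"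
    by blast
  \<comment> \<open>Without kinetic energy beyond \<open>y\<close> the profile would be a positive
    constant there, with infinite mass.\<close>
  have pos: "0 < (LINT x:{y..}|lborel. (k x)\<^sup>2)"
  proof (rule ccontr)
    assume "\<not> 0 < (LINT x:{y..}|lborel. (k x)\<^sup>2)"
    moreover have "0 \<le> (LINT x:{y..}|lborel. (k x)\<^sup>2)" by simp
    ultimately have z: "(LINT x:{y..}|lborel. (k x)\<^sup>2) = 0" by linarith
    have const: "rr x = rr y" if "y \<le> x" for x
    proof -
      have "(LINT t:{y..x}|lborel. (k t)\<^sup>2) \<le> (LINT t:{y..}|lborel. (k t)\<^sup>2)"
        by (rule set_integral_mono_set[OF decr_pair_deriv_integrable(3)[OF k(1) y(1)]]) auto
      with z have "(LINT t:{y..x}|lborel. (k t)\<^sup>2) \<le> 0" by simp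
      then have "(x - y) * (LINT t:{y..x}|lborel. (k t)\<^sup>2) \<le> 0" using that by (simp add: mult_nonneg_nonpos)
      moreover have "(rr x - rr y)\<^sup>2 \<le> (x - y) * (LINT t:{y..x}|lborel. (k t)\<^sup>2)"
        by (rule ac_on_hoelder[OF decr_pairD(4)[OF k(1)]]) (use that y in simp_all)
      ultimately have "(rr x - rr y)\<^sup>2 \<le> 0" by linarith
      then show ?thesis by simp
    qed
    \<comment> \<open>So far out that x (rr y)^2 \<ge> mass + 1, contradicting
      \<open>decr_pair_tail\<close>.\<close>
    define x where "x = max y ((mass rr + 1) / (rr y)\<^sup>2)"
    have "x * (rr x)\<^sup>2 \<le> mass rr" using decr_pair_tail[OF k(1), of x] y by (simp add: x_def)
    moreover have "rr x = rr y" by (rule const) (simp add: x_def)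
    moreover have "(mass rr + 1) / (rr y)\<^sup>2 * (rr y)\<^sup>2 \<le> x * (rr y)\<^sup>2" by (intro mult_right_mono) (simp_all add: x_def)
    moreover have "(mass rr + 1) / (rr y)\<^sup>2 * (rr y)\<^sup>2 = mass rr + 1" using y by simp
    ultimately show False by simp
  qed
  have "kin 4 9 y k = kin 4 4 0 k + 5 * (LINT x:{y..}|lborel. (k x)\<^sup>2)"
    using kin_same[OF k(1) y(1), of 4] kin_same[OF k(1) order_refl, of 4] by (simp add: kin_def)
  with k(2) pos have "wenergy p 4 4 0 rr k < genergy p"
    by (simp add: wenergy_def genergy_def rr_pot[OF p])
  with k(1) rr_mass(2) show "\<exists>f h. decr_pair f h \<and> mass f = gmass \<and> wenergy p 4 4 0 f h < genergy p"
    by (intro exI[of _ rr] exI[of _ k] conjI) (simp_all add: gmass_def)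
qed

end

section \<open>Competitors on the graph\<close>

lemma set_integral_cong_except_point:
  fixes f h :: "real \<Rightarrow> real"
  assumes "\<And>x. x \<in> A \<Longrightarrow> x \<noteq> c \<Longrightarrow> f x = h x"
  shows "(LINT x:A|lborel. f x) = (LINT x:A|lborel. h x)"
    and "set_integrable lborel A f \<longleftrightarrow> set_integrable lborel A h"
proof -
  have eq: "indicator A x *\<^sub>R f x = indicator A x *\<^sub>R h x" if "x \<notin> {c}" for x
    using assms[of x] that by (auto split: split_indicator)
  show "(LINT x:A|lborel. f x) = (LINT x:A|lborel. h x)"
    unfolding set_lebesgue_integral_def
    by (rule integral_discrete_difference[of "{c}"]) (use eq in auto)
  show "set_integrable lborel A f \<longleftrightarrow> set_integrable lborel A h"
    unfolding set_integrable_def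
    by (rule integrable_discrete_difference[of "{c}"]) (use eq in auto)
qed

text \<open>In a glued function the branch x \<le> c assigns the derivative at \<open>c\<close> to
  the left piece; for the right piece this changes it on a null set only.\<close>

lemma ac_on_cong_except_point:
  assumes ac: "ac_on I u g" "is_interval I" and eq: "\<And>x. x \<in> I \<Longrightarrow> x \<noteq> c \<Longrightarrow> g x = g' x"
  shows "ac_on I u g'"
  unfolding ac_on_def
proof (intro conjI ballI impI)
  have Ib: "I \<in> sets borel" using interval_sets_lborel[OF ac(2)] by simp
  note [measurable] = Ib
  have [measurable]: "(\<lambda>x. indicator I x * g x) \<in> borel_measurable borel"
    using L2_on_indicator_measurable[OF ac_onD(1)[OF ac(1)]] by simp
  have "(\<lambda>x. if x = c then indicator I c * g' c else indicator I x * g x) \<in> borel_measurable borel" by measurable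
  also have "(\<lambda>x. if x = c then indicator I c * g' c else indicator I x * g x) = (\<lambda>x. indicator I x * g' x)"
    using eq by (auto split: split_indicator)
  finally have "set_borel_measurable lborel I g'" by (simp add: set_borel_measurable_def)
  moreover have "set_integrable lborel I (\<lambda>x. (g' x)\<^sup>2)"
    using L2_onD(2)[OF ac_onD(1)[OF ac(1)]] set_integral_cong_except_point(2)[of I c "\<lambda>x. (g x)\<^sup>2" "\<lambda>x. (g' x)\<^sup>2"] eq by simp
  ultimately show "L2_on I g'" by (simp add: L2_on_def)
  fix x y assume xy: "x \<in> I" "y \<in> I" "x \<le> y"
  have sub: "{x..y} \<subseteq> I" by (rule interval_Icc_subset[OF ac(2) xy(1,2)])
  have "(LINT t:{x..y}|lborel. g t) = (LINT t:{x..y}|lborel. g' t)"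
    by (rule set_integral_cong_except_point(1)[of _ c]) (use eq sub in auto)
  then show "u y - u x = (LINT t:{x..y}|lborel. g' t)" using ac_onD(2)[OF ac(1) xy] by simp
qed

lemma ac_on_glue_if:
  assumes "ac_on A u g" "ac_on B v h" "is_interval A" "is_interval B"
    and "A \<subseteq> {..c}" "B \<subseteq> {c..}" "c \<in> A" "c \<in> B" "u c = v c"
  shows "ac_on (A \<union> B) (\<lambda>x. if x \<le> c then u x else v x) (\<lambda>x. if x \<le> c then g x else h x)"
proof (rule ac_on_glue[OF _ _ assms(3-8)])
  show "ac_on A (\<lambda>x. if x \<le> c then u x else v x) (\<lambda>x. if x \<le> c then g x else h x)"
    by (rule ac_on_cong[OF assms(1) _ _ assms(3)]) (use assms(5) in auto)
  have "ac_on B (\<lambda>x. if x \<le> c then u x else v x) h"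
  proof (rule ac_on_cong[OF assms(2) _ refl assms(4)])
    fix x assume "x \<in> B"
    then have "c \<le> x" using assms(6) by auto
    then show "v x = (if x \<le> c then u x else v x)" using assms(9) by (cases "x = c") auto
  qed
  then show "ac_on B (\<lambda>x. if x \<le> c then u x else v x) (\<lambda>x. if x \<le> c then g x else h x)"
    by (rule ac_on_cong_except_point[of _ _ _ c, OF _ assms(4)]) (use assms(6) in force)
qed

lemma L2_on_continuous_square_integrable:
  assumes "continuous_on I u" "I \<in> sets borel" "set_integrable lborel I (\<lambda>x. (u x)\<^sup>2)"
  shows "L2_on I u"
  using set_measurable_continuous_on[OF assms(2,1)] assms(3) by (simp add: L2_on_def set_borel_measurable_def)

lemma sum_lessThan_four: "(\<Sum>i<(4::nat). F i) = F 0 + F 1 + F 2 + (F 3 :: real)"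
proof -
  have "{..<4::nat} = {0, 1, 2, 3}" by auto
  then show ?thesis by simp
qed

lemma graph_funI_H1_mass:
  assumes "0 < l" "u \<in> H1_mass l \<mu>"
  shows "graph_fun l u (\<lambda>i. weak_deriv (edge_dom l i) (u i))"
    "graph_fun.gmass l u = \<mu>" "graph_fun.genergy l u (\<lambda>i. weak_deriv (edge_dom l i) (u i)) p = energy p l u"
proof -
  have e: "edge_dom l i = {0..} \<or> edge_dom l i = {0..l}" for i by (simp add: edge_dom_def)
  have u: "continuous_on (edge_dom l i) (u i)" "H1_on (edge_dom l i) (u i)" "u i 0 = u 0 0" if "i < 4" for i
    using assms(2) that unfolding H1_mass_def by blast+
  show gf: "graph_fun l u (\<lambda>i. weak_deriv (edge_dom l i) (u i))"
  proof
    fix i :: nat assume i: "i < 4"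
    show "L2_on (edge_dom l i) (u i)" by (rule H1_on_weak_deriv(1)[OF u(1,2)[OF i] e])
    show "ac_on (edge_dom l i) (u i) (weak_deriv (edge_dom l i) (u i))"
      by (rule H1_on_weak_deriv(2)[OF u(1,2)[OF i] e])
    show "u i 0 = u 0 0" by (rule u(3)[OF i])
  qed (rule assms(1))
  show "graph_fun.gmass l u = \<mu>"
    using assms(2) by (simp add: graph_fun.gmass_def[OF gf] H1_mass_def)
  show "graph_fun.genergy l u (\<lambda>i. weak_deriv (edge_dom l i) (u i)) p = energy p l u"
    by (simp add: graph_fun.genergy_def[OF gf] energy_def)
qed

text \<open>The converse translation: competitors are constructed with explicit derivatives, and
  their \<open>energy\<close> is independent of the choice hidden in
  \<open>weak_deriv\<close>.\<close>

lemma (in graph_fun) in_H1_mass: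
  shows "u \<in> H1_mass l gmass" "energy p l u = genergy p"
proof -
  have e: "I i = {0..} \<or> I i = {0..l}" for i by (simp add: edge_dom_def)
  note h = ac_on_imp_H1_on[OF u_L2 u_ac e]
  show "u \<in> H1_mass l gmass"
    unfolding H1_mass_def
  proof (intro CollectI conjI allI impI)
    show "u i 0 = u 0 0" if "i < 4" for i by (rule u_vertex[OF that])
    show "(\<Sum>i<4. LINT x:I i|lborel. (u i x)\<^sup>2) = gmass" by (simp only: gmass_def)
  qed (rule h(1,2); assumption)+
  have "(\<Sum>i<4. LINT x:I i|lborel. (weak_deriv (I i) (u i) x)\<^sup>2) = (\<Sum>i<4. LINT x:I i|lborel. (g i x)\<^sup>2)"
    by (intro sum.cong refl h(3)) auto
  then show "energy p l u = genergy p" by (simp add: energy_def genergy_def)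
qed

text \<open>Used to restore the prescribed mass of a competitor after a modification has changed
  it.\<close>

lemma (in graph_fun) scaled_energy:
  assumes "0 < c"
  shows "(\<lambda>i x. c * u i x) \<in> H1_mass l (c\<^sup>2 * gmass)"
    "energy p l (\<lambda>i x. c * u i x) = c\<^sup>2 * (\<Sum>i<4. LINT x:I i|lborel. (g i x)\<^sup>2) / 2
      - c powr p * (\<Sum>i<4. LINT x:I i|lborel. \<bar>u i x\<bar> powr p) / p"
proof -
  interpret s: graph_fun l "\<lambda>i x. c * u i x" "\<lambda>i x. c * g i x"
  proof
    fix i :: nat assume i: "i < 4"
    show "L2_on (I i) (\<lambda>x. c * u i x)" using L2_on_affine[OF u_L2[OF i], of 1 0 c] by simp
    show "ac_on (I i) (\<lambda>x. c * u i x) (\<lambda>x. c * g i x)" by (rule ac_on_const_mult[OF u_ac[OF i] I_interval])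
    show "c * u i 0 = c * u 0 0" using u_vertex[OF i] by simp
  qed (rule l_pos)
  have "s.gmass = c\<^sup>2 * gmass"
    unfolding s.gmass_def gmass_def by (simp add: power_mult_distrib sum_distrib_left)
  then show "(\<lambda>i x. c * u i x) \<in> H1_mass l (c\<^sup>2 * gmass)" using s.in_H1_mass(1) by simp
  have "(\<Sum>i<4. LINT x:I i|lborel. \<bar>c * u i x\<bar> powr p) = c powr p * (\<Sum>i<4. LINT x:I i|lborel. \<bar>u i x\<bar> powr p)"
  proof -
    have "(LINT x:I i|lborel. \<bar>c * u i x\<bar> powr p) = (LINT x:I i|lborel. c powr p * \<bar>u i x\<bar> powr p)" for i
      by (rule set_lebesgue_integral_cong) (use assms in \<open>simp_all add: abs_mult powr_mult\<close>)
    then show ?thesis by (simp add: sum_distrib_left)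
  qed
  then show "energy p l (\<lambda>i x. c * u i x) = c\<^sup>2 * (\<Sum>i<4. LINT x:I i|lborel. (g i x)\<^sup>2) / 2
      - c powr p * (\<Sum>i<4. LINT x:I i|lborel. \<bar>u i x\<bar> powr p) / p"
    unfolding s.in_H1_mass(2) s.genergy_def by (simp add: power_mult_distrib sum_distrib_left)
qed

lemma edge_dom_simps: "edge_dom l 0 = {0..}" "edge_dom l 1 = {0..}" "edge_dom l (Suc 0) = {0..}"
  "edge_dom l 2 = {0..}" "edge_dom l 3 = {0..l}"
  by (auto simp: edge_dom_def)

text \<open>The part of \<open>f\<close> on [0,l] goes to the terminal edge, reversed so that the
  maximum sits at the tip. The rest is run through at triple speed on each halfline: three copies
  with Jacobian 1/3 preserve mass and potential, and the squared speed gives the weight 9.\<close>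

lemma profile_on_graph:
  assumes f: "decr_pair f h" and l: "0 < l" and p: "2 < p"
  shows "\<exists>u\<in>H1_mass l (mass f). energy p l u = wenergy p 1 9 l f h"
proof -
  define u where "u i x = (if i < 3 then 1 * f (l + 3 * x) else 1 * f (l + (-1) * x))" for i :: nat and x
  define g where "g i x = (if i < 3 then 1 * 3 * h (l + 3 * x) else 1 * (-1) * h (l + (-1) * x))" for i :: nat and x
  have sets: "{x. l + 3 * x \<in> {l..}} = {0..}" "{x. l + (-1) * x \<in> {0..l}} = {0..l}" by auto
  have ac: "ac_on {l..} f h" "ac_on {0..l} f h"
    by (rule ac_on_subset[OF decr_pairD(4)[OF f]]; use l in auto)+
  have L2: "L2_on {l..} f" "L2_on {0..l} f"
    by (rule L2_on_subset[OF decr_pairD(3)[OF f]]; use l in auto)+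
  have three: "(3::real) \<noteq> 0" "(-1::real) \<noteq> 0" by auto
  have i: "i < 3 \<or> i = 3" if "i < 4" for i :: nat using that by linarith
  interpret graph_fun l u g
  proof
    fix i :: nat assume "i < 4"
    with i have ii: "i < 3 \<or> i = 3" by blast
    show "L2_on (edge_dom l i) (u i)"
      using ii L2_on_affine[OF L2(1) three(1), of l 1] L2_on_affine[OF L2(2) three(2), of l 1]
      unfolding sets u_def[abs_def] edge_dom_def by auto
    show "ac_on (edge_dom l i) (u i) (g i)"
      using ii ac_on_affine[OF ac(1) three(1), of l 1] ac_on_affine[OF ac(2) three(2), of l 1]
      unfolding sets u_def[abs_def] g_def[abs_def] edge_dom_def by auto
    show "u i 0 = u 0 0" by (simp add: u_def)
  qed (rule l)
  have half: "(LINT x:{0..}|lborel. \<phi> (l + 3 * x)) = (LINT x:{l..}|lborel. \<phi> x) / 3" for \<phi> :: "real \<Rightarrow> real"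
    using set_integral_affine(1)[OF three(1), of l "{l..}" \<phi>] unfolding sets by simp
  have edge: "(LINT x:{0..l}|lborel. \<phi> (l - x)) = (LINT x:{0..l}|lborel. \<phi> x)" for \<phi> :: "real \<Rightarrow> real"
    using set_integral_affine(1)[OF three(2), of l "{0..l}" \<phi>] unfolding sets by simp
  have split: "(LINT x:{0..}|lborel. \<phi> x) = (LINT x:{0..l}|lborel. \<phi> x) + (LINT x:{l..}|lborel. \<phi> x)"
    if "set_integrable lborel {0..} \<phi>" for \<phi> :: "real \<Rightarrow> real"
    using set_integral_Ici_split[OF that] l by simp
  have ip: "set_integrable lborel {0..} (\<lambda>x. \<bar>f x\<bar> powr p)"
    by (rule L2_on_powr_integrable(1)[OF decr_pairD(3)[OF f] _ p]) (use decr_pair_abs_le[OF f] in auto)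
  have "gmass = mass f"
    unfolding gmass_def sum_lessThan_four edge_dom_simps mass_def
    by (simp add: u_def half[of "\<lambda>x. (f x)\<^sup>2"] edge[of "\<lambda>x. (f x)\<^sup>2"]
        split[OF L2_onD(2)[OF decr_pairD(3)[OF f]]])
  moreover have "genergy p = wenergy p 1 9 l f h"
    unfolding genergy_def sum_lessThan_four edge_dom_simps wenergy_def pot_def kin_def
    by (simp add: u_def g_def power_mult_distrib split[OF ip] half[of "\<lambda>x. \<bar>f x\<bar> powr p"]
        edge[of "\<lambda>x. \<bar>f x\<bar> powr p"] half[of "\<lambda>x. (h x)\<^sup>2"] edge[of "\<lambda>x. (h x)\<^sup>2"] add.commute)
  ultimately show ?thesis using in_H1_mass by metis
qed

text \<open>The map x \<mapsto> 2|x - n| on the halfline covers [0,2n] twice and the rest once, each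
  time with Jacobian 1/2.\<close>

lemma fold_integral:
  fixes \<phi> :: "real \<Rightarrow> real"
  assumes \<phi>: "set_integrable lborel {0..} \<phi>" and n: "0 \<le> n"
  shows "set_integrable lborel {0..} (\<lambda>x. \<phi> (2 * \<bar>x - n\<bar>))"
    "(LINT x:{0..}|lborel. \<phi> (2 * \<bar>x - n\<bar>)) = (LINT x:{0..}|lborel. \<phi> x) - (LINT x:{2 * n..}|lborel. \<phi> x) / 2"
proof -
  have two: "(2::real) \<noteq> 0" "(-2::real) \<noteq> 0" by auto
  have sets: "{x. 2 * n + (-2) * x \<in> {0..2 * n}} = {0..n}" "{x. - 2 * n + 2 * x \<in> {0..}} = {n..}" by auto
  have "set_integrable lborel {0..2 * n} \<phi>" by (rule set_integrable_subset[OF \<phi>]) auto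
  then have "set_integrable lborel {0..n} (\<lambda>x. \<phi> (2 * n + (-2) * x))"
    using set_integral_affine(2)[OF two(2), of "2 * n" "{0..2 * n}" \<phi>] unfolding sets by simp
  also have "set_integrable lborel {0..n} (\<lambda>x. \<phi> (2 * n + (-2) * x)) \<longleftrightarrow> set_integrable lborel {0..n} (\<lambda>x. \<phi> (2 * \<bar>x - n\<bar>))"
    by (rule set_integrable_cong) (auto simp: algebra_simps)
  finally have i1: "set_integrable lborel {0..n} (\<lambda>x. \<phi> (2 * \<bar>x - n\<bar>))" .
  have "set_integrable lborel {n..} (\<lambda>x. \<phi> (- 2 * n + 2 * x))"
    using set_integral_affine(2)[OF two(1), of "- 2 * n" "{0..}" \<phi>] \<phi> unfolding sets by simp
  also have "set_integrable lborel {n..} (\<lambda>x. \<phi> (- 2 * n + 2 * x)) \<longleftrightarrow> set_integrable lborel {n..} (\<lambda>x. \<phi> (2 * \<bar>x - n\<bar>))"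
    by (rule set_integrable_cong) (auto simp: algebra_simps)
  finally have i2: "set_integrable lborel {n..} (\<lambda>x. \<phi> (2 * \<bar>x - n\<bar>))" .
  have un: "{0..} = {0..n} \<union> {n..}" using n by auto
  show i: "set_integrable lborel {0..} (\<lambda>x. \<phi> (2 * \<bar>x - n\<bar>))"
    unfolding un by (rule set_integrable_Un[OF i1 i2]) auto
  have "(LINT x:{0..n}|lborel. \<phi> (2 * \<bar>x - n\<bar>)) = (LINT x:{0..n}|lborel. \<phi> (2 * n + (-2) * x))"
    by (rule set_lebesgue_integral_cong) (auto simp: algebra_simps)
  also have "\<dots> = (LINT x:{0..2 * n}|lborel. \<phi> x) / 2"
    using set_integral_affine(1)[OF two(2), of "2 * n" "{0..2 * n}" \<phi>] unfolding sets by simp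
  finally have 1: "(LINT x:{0..n}|lborel. \<phi> (2 * \<bar>x - n\<bar>)) = (LINT x:{0..2 * n}|lborel. \<phi> x) / 2" .
  have "(LINT x:{n..}|lborel. \<phi> (2 * \<bar>x - n\<bar>)) = (LINT x:{n..}|lborel. \<phi> (- 2 * n + 2 * x))"
    by (rule set_lebesgue_integral_cong) (auto simp: algebra_simps)
  also have "\<dots> = (LINT x:{0..}|lborel. \<phi> x) / 2"
    using set_integral_affine(1)[OF two(1), of "- 2 * n" "{0..}" \<phi>] unfolding sets by simp
  finally have 2: "(LINT x:{n..}|lborel. \<phi> (2 * \<bar>x - n\<bar>)) = (LINT x:{0..}|lborel. \<phi> x) / 2" .
  have "(LINT x:{0..}|lborel. \<phi> x) = (LINT x:{0..2 * n}|lborel. \<phi> x) + (LINT x:{2 * n..}|lborel. \<phi> x)"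
    by (rule set_integral_Ici_split[OF \<phi>]) (use n in simp)
  then show "(LINT x:{0..}|lborel. \<phi> (2 * \<bar>x - n\<bar>)) = (LINT x:{0..}|lborel. \<phi> x) - (LINT x:{2 * n..}|lborel. \<phi> x) / 2"
    using set_integral_Ici_split[OF i n] 1 2 by linarith
qed

text \<open>A line profile centred at distance \<open>n\<close> from the vertex; its tail is copied on the two
  remaining halflines and continued by a constant on the terminal edge.\<close>

lemma translated_profile:
  assumes f: "decr_pair f h" and l: "0 < l" and p: "2 < p" and n: "0 \<le> n" and m: "0 < mass f"
  defines "\<nu> \<equiv> mass f + (LINT x:{2 * n..}|lborel. (f x)\<^sup>2) / 2 + l * (f (2 * n))\<^sup>2"
  shows "\<exists>u\<in>H1_mass l (mass f). energy p l u \<le>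
    (4 * (LINT x:{0..}|lborel. (h x)\<^sup>2) + 2 * (LINT x:{2 * n..}|lborel. (h x)\<^sup>2)) / 2
    - (sqrt (mass f / \<nu>)) powr p * pot p f / p"
proof -
  define u where "u i x = (if i = 0 then if x \<le> n then 1 * f (2 * n + (-2) * x) else 1 * f (- 2 * n + 2 * x)
    else if i < 3 then 1 * f (2 * n + 2 * x) else f (2 * n))" for i :: nat and x
  define g where "g i x = (if i = 0 then if x \<le> n then 1 * (-2) * h (2 * n + (-2) * x) else 1 * 2 * h (- 2 * n + 2 * x)
    else if i < 3 then 1 * 2 * h (2 * n + 2 * x) else 0)" for i :: nat and x
  have two: "(2::real) \<noteq> 0" "(-2::real) \<noteq> 0" by auto
  have sets: "{x. 2 * n + (-2) * x \<in> {0..2 * n}} = {0..n}" "{x. - 2 * n + 2 * x \<in> {0..}} = {n..}"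
    "{x. 2 * n + 2 * x \<in> {2 * n..}} = {0..}" by auto
  have un: "{0..n} \<union> {n..} = {0..}" using n by auto
  have ac: "ac_on {2 * n..} f h" "ac_on {0..2 * n} f h" "ac_on {0..} f h"
    by (rule ac_on_subset[OF decr_pairD(4)[OF f]]; use n in auto)+
  have u0: "u 0 x = f (2 * \<bar>x - n\<bar>)" "(g 0 x)\<^sup>2 = 4 * (h (2 * \<bar>x - n\<bar>))\<^sup>2" for x
    by (auto simp: u_def g_def algebra_simps power2_eq_square)
  have ac0: "ac_on {0..} (u 0) (g 0)"
  proof -
    have "ac_on ({0..n} \<union> {n..}) (\<lambda>x. if x \<le> n then 1 * f (2 * n + (-2) * x) else 1 * f (- 2 * n + 2 * x))
        (\<lambda>x. if x \<le> n then 1 * (-2) * h (2 * n + (-2) * x) else 1 * 2 * h (- 2 * n + 2 * x))"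
    proof (rule ac_on_glue_if)
      show "ac_on {0..n} (\<lambda>x. 1 * f (2 * n + (-2) * x)) (\<lambda>x. 1 * (-2) * h (2 * n + (-2) * x))"
        using ac_on_affine[OF ac(2) two(2), of "2 * n" 1] unfolding sets by simp
      show "ac_on {n..} (\<lambda>x. 1 * f (- 2 * n + 2 * x)) (\<lambda>x. 1 * 2 * h (- 2 * n + 2 * x))"
        using ac_on_affine[OF ac(3) two(1), of "- 2 * n" 1] unfolding sets by simp
    qed (use n in auto)
    then show ?thesis unfolding un u_def[abs_def] g_def[abs_def] by simp
  qed
  have i2: "set_integrable lborel {0..} (\<lambda>x. (f x)\<^sup>2)" using L2_onD(2)[OF decr_pairD(3)[OF f]] .
  have ip: "set_integrable lborel {0..} (\<lambda>x. \<bar>f x\<bar> powr p)"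
    by (rule L2_on_powr_integrable(1)[OF decr_pairD(3)[OF f] _ p]) (use decr_pair_abs_le[OF f] in auto)
  have ih: "set_integrable lborel {0..} (\<lambda>x. (h x)\<^sup>2)" by (rule decr_pair_deriv_integrable(1)[OF f order_refl])
  note fold2 = fold_integral[OF i2 n] and foldp = fold_integral[OF ip n] and foldh = fold_integral[OF ih n]
  have L20: "L2_on {0..} (u 0)"
    by (rule L2_on_continuous_square_integrable) (use ac_on_continuous_on[OF ac0] fold2(1) u0(1) in simp_all)
  have ac1: "ac_on {0..} (\<lambda>x. 1 * f (2 * n + 2 * x)) (\<lambda>x. 1 * 2 * h (2 * n + 2 * x))"
    using ac_on_affine[OF ac(1) two(1), of "2 * n" 1] unfolding sets by simp
  have L21: "L2_on {0..} (\<lambda>x. 1 * f (2 * n + 2 * x))"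
  proof -
    have "L2_on {2 * n..} f" by (rule L2_on_subset[OF decr_pairD(3)[OF f]]) (use n in auto)
    from L2_on_affine[OF this two(1), of "2 * n" 1] show ?thesis unfolding sets .
  qed
  have ac3: "ac_on {0..l} (\<lambda>x. f (2 * n)) (\<lambda>x. 0)"
    by (simp add: ac_on_def L2_on_def set_borel_measurable_def set_integrable_def)
  have L23: "L2_on {0..l} (\<lambda>x. f (2 * n))"
    using set_integrable_const_fin[OF _ emeasure_lborel_Icc_finite, of 0 l "(f (2 * n))\<^sup>2"]
    by (simp add: L2_on_def set_borel_measurable_def)
  interpret graph_fun l u g
  proof
    fix i :: nat assume "i < 4"
    then have i: "i = 0 \<or> (0 < i \<and> i < 3) \<or> i = 3" by linarith
    then show "L2_on (edge_dom l i) (u i)"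
    proof (elim disjE conjE)
      assume "i = 0" then show ?thesis using L20 by (simp add: edge_dom_def)
    next
      assume "0 < i" "i < 3" then show ?thesis using L21 by (simp add: edge_dom_def u_def[abs_def])
    next
      assume "i = 3" then show ?thesis using L23 by (simp add: edge_dom_def u_def[abs_def])
    qed
    from i show "ac_on (edge_dom l i) (u i) (g i)"
    proof (elim disjE conjE)
      assume "i = 0" then show ?thesis using ac0 by (simp add: edge_dom_def)
    next
      assume "0 < i" "i < 3" then show ?thesis using ac1 by (simp add: edge_dom_def u_def[abs_def] g_def[abs_def])
    next
      assume "i = 3" then show ?thesis using ac3 by (simp add: edge_dom_def u_def[abs_def] g_def[abs_def])
    qed
    show "u i 0 = u 0 0" using n by (simp add: u_def)
  qed (rule l)
  have tail: "(LINT x:{0..}|lborel. \<phi> (2 * n + 2 * x)) = (LINT x:{2 * n..}|lborel. \<phi> x) / 2" for \<phi> :: "real \<Rightarrow> real"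
    using set_integral_affine(1)[OF two(1), of "2 * n" "{2 * n..}" \<phi>] unfolding sets by simp
  have gm: "gmass = \<nu>"
  proof -
    have "(LINT x:{0..l}|lborel. (f (2 * n))\<^sup>2) = l * (f (2 * n))\<^sup>2" using l by (simp add: set_integral_const)
    moreover have "(LINT x:{0..}|lborel. (u 1 x)\<^sup>2) = (LINT x:{2 * n..}|lborel. (f x)\<^sup>2) / 2"
      "(LINT x:{0..}|lborel. (u 2 x)\<^sup>2) = (LINT x:{2 * n..}|lborel. (f x)\<^sup>2) / 2"
      using tail[of "\<lambda>x. (f x)\<^sup>2"] by (simp_all add: u_def)
    moreover have "u 3 x = f (2 * n)" for x by (simp add: u_def)
    ultimately show ?thesis
      unfolding gmass_def sum_lessThan_four edge_dom_simps u0 \<nu>_def fold2(2) mass_def by simp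
  qed
  have gk: "(\<Sum>i<4. LINT x:I i|lborel. (g i x)\<^sup>2) = 4 * (LINT x:{0..}|lborel. (h x)\<^sup>2) + 2 * (LINT x:{2 * n..}|lborel. (h x)\<^sup>2)"
  proof -
    have "(LINT x:{0..}|lborel. (g 1 x)\<^sup>2) = 2 * (LINT x:{2 * n..}|lborel. (h x)\<^sup>2)"
      "(LINT x:{0..}|lborel. (g 2 x)\<^sup>2) = 2 * (LINT x:{2 * n..}|lborel. (h x)\<^sup>2)"
      by (simp_all add: g_def power_mult_distrib tail[of "\<lambda>x. (h x)\<^sup>2"])
    moreover have "g 3 x = 0" for x by (simp add: g_def)
    moreover have "(LINT x:{0..}|lborel. (g 0 x)\<^sup>2) = 4 * (LINT x:{0..}|lborel. (h (2 * \<bar>x - n\<bar>))\<^sup>2)"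
      unfolding u0 by simp
    ultimately show ?thesis unfolding sum_lessThan_four edge_dom_simps foldh(2) by simp
  qed
  \<comment> \<open>Folding loses half of the tail, and each of the two copies on the other
    halflines brings that half back.\<close>
  have gp: "pot p f \<le> (\<Sum>i<4. LINT x:I i|lborel. \<bar>u i x\<bar> powr p)"
  proof -
    have "(LINT x:{0..}|lborel. \<bar>u 1 x\<bar> powr p) = (LINT x:{2 * n..}|lborel. \<bar>f x\<bar> powr p) / 2"
      "(LINT x:{0..}|lborel. \<bar>u 2 x\<bar> powr p) = (LINT x:{2 * n..}|lborel. \<bar>f x\<bar> powr p) / 2"
      using tail[of "\<lambda>x. \<bar>f x\<bar> powr p"] by (simp_all add: u_def)
    moreover have "(LINT x:{0..}|lborel. \<bar>u 0 x\<bar> powr p) = pot p f - (LINT x:{2 * n..}|lborel. \<bar>f x\<bar> powr p) / 2"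
      unfolding u0 foldp(2) pot_def ..
    moreover have "0 \<le> (LINT x:{2 * n..}|lborel. \<bar>f x\<bar> powr p)" "0 \<le> (LINT x:{0..l}|lborel. \<bar>u 3 x\<bar> powr p)"
      by (rule set_integral_nonneg'; simp)+
    ultimately show ?thesis unfolding sum_lessThan_four edge_dom_simps by linarith
  qed
  have "0 \<le> (LINT x:{2 * n..}|lborel. (f x)\<^sup>2) / 2" "0 \<le> l * (f (2 * n))\<^sup>2" using l by simp_all
  then have \<nu>: "mass f \<le> \<nu>" unfolding \<nu>_def by linarith
  \<comment> \<open>The copies and the constant on the edge only add mass, so restoring the mass
    needs a factor at most 1, which cannot raise the kinetic term.\<close>
  define c where "c = sqrt (mass f / \<nu>)"
  have c: "0 < c" "c \<le> 1" "c\<^sup>2 = mass f / \<nu>" using m \<nu> by (auto simp: c_def)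
  have "(\<lambda>i x. c * u i x) \<in> H1_mass l (mass f)"
    using scaled_energy(1)[OF c(1)] gm c(3) m \<nu> by simp
  moreover have "energy p l (\<lambda>i x. c * u i x) \<le>
    (4 * (LINT x:{0..}|lborel. (h x)\<^sup>2) + 2 * (LINT x:{2 * n..}|lborel. (h x)\<^sup>2)) / 2 - c powr p * pot p f / p"
  proof -
    let ?K = "4 * (LINT x:{0..}|lborel. (h x)\<^sup>2) + 2 * (LINT x:{2 * n..}|lborel. (h x)\<^sup>2)"
    have "c\<^sup>2 \<le> 1" using c(1,2) by (simp add: power_le_one)
    then have "c\<^sup>2 * ?K \<le> 1 * ?K" by (rule mult_right_mono) simp
    moreover have "c powr p * pot p f / p \<le> c powr p * (\<Sum>i<4. LINT x:I i|lborel. \<bar>u i x\<bar> powr p) / p"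
      using gp p by (intro divide_right_mono mult_left_mono) auto
    ultimately show ?thesis unfolding scaled_energy(2)[OF c(1)] gk by linarith
  qed
  ultimately show ?thesis unfolding c_def by blast
qed

text \<open>As the centre moves to infinity, the copied tails and the constant on the terminal edge
  vanish, and the competitors approach the energy on the line.\<close>

lemma energy_le_line:
  assumes f: "decr_pair f h" and l: "0 < l" and p: "2 < p" and m: "0 < mass f"
    and low: "\<And>v. v \<in> H1_mass l (mass f) \<Longrightarrow> c \<le> energy p l v"
  shows "c \<le> wenergy p 4 4 0 f h"
proof -
  let ?K = "LINT x:{0..}|lborel. (h x)\<^sup>2"
  define \<nu> where "\<nu> n = mass f + (LINT x:{2 * real n..}|lborel. (f x)\<^sup>2) / 2 + l * (f (2 * real n))\<^sup>2" for n
  have le: "c \<le> (4 * ?K + 2 * (LINT x:{2 * real n..}|lborel. (h x)\<^sup>2)) / 2 - (sqrt (mass f / \<nu> n)) powr p * pot p f / p" for n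
  proof -
    obtain u where "u \<in> H1_mass l (mass f)" "energy p l u \<le>
        (4 * ?K + 2 * (LINT x:{2 * real n..}|lborel. (h x)\<^sup>2)) / 2 - (sqrt (mass f / \<nu> n)) powr p * pot p f / p"
      using translated_profile[OF f l p _ m, of "real n"] unfolding \<nu>_def by auto
    with low[of u] show ?thesis by linarith
  qed
  have tail: "(\<lambda>n. LINT x:{2 * real n..}|lborel. \<phi> x) \<longlonglongrightarrow> 0" if "set_integrable lborel {0..} \<phi>" for \<phi> :: "real \<Rightarrow> real"
  proof -
    have "(\<lambda>n. LINT x:{real (2 * n)..}|lborel. \<phi> x) \<longlonglongrightarrow> 0"
      using LIMSEQ_subseq_LIMSEQ[OF set_integral_tail_tendsto[OF that], of "\<lambda>n. 2 * n"]
      by (simp add: strict_mono_def o_def)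
    then show ?thesis by simp
  qed
  have t2: "(\<lambda>n. LINT x:{2 * real n..}|lborel. (f x)\<^sup>2) \<longlonglongrightarrow> 0" by (rule tail[OF L2_onD(2)[OF decr_pairD(3)[OF f]]])
  have th: "(\<lambda>n. LINT x:{2 * real n..}|lborel. (h x)\<^sup>2) \<longlonglongrightarrow> 0" by (rule tail[OF decr_pair_deriv_integrable(1)[OF f order_refl]])
  have f0: "(\<lambda>n. (f (2 * real n))\<^sup>2) \<longlonglongrightarrow> 0"
  proof (rule tendsto_sandwich[OF _ _ tendsto_const lim_const_over_n[of "mass f"]])
    show "\<forall>\<^sub>F n in sequentially. (f (2 * real n))\<^sup>2 \<le> mass f / real n"
    proof (rule eventually_sequentiallyI[of 1])
      fix n :: nat assume n: "1 \<le> n"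
      have "real n * (f (2 * real n))\<^sup>2 \<le> 2 * real n * (f (2 * real n))\<^sup>2" by (intro mult_right_mono) auto
      also have "\<dots> \<le> mass f" by (rule decr_pair_tail[OF f]) simp
      finally show "(f (2 * real n))\<^sup>2 \<le> mass f / real n" using n by (simp add: field_simps)
    qed
  qed simp
  have "\<nu> \<longlonglongrightarrow> mass f + 0 / 2 + l * 0"
    unfolding \<nu>_def[abs_def] by (intro tendsto_add tendsto_mult tendsto_divide tendsto_const t2 f0) auto
  then have "(\<lambda>n. sqrt (mass f / \<nu> n)) \<longlonglongrightarrow> sqrt (mass f / mass f)"
    using m by (intro tendsto_real_sqrt tendsto_divide tendsto_const) auto
  then have "(\<lambda>n. (sqrt (mass f / \<nu> n)) powr p) \<longlonglongrightarrow> 1 powr p"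
    using m by (intro tendsto_powr tendsto_const) auto
  then have "(\<lambda>n. (4 * ?K + 2 * (LINT x:{2 * real n..}|lborel. (h x)\<^sup>2)) / 2 - (sqrt (mass f / \<nu> n)) powr p * pot p f / p)
      \<longlonglongrightarrow> (4 * ?K + 2 * 0) / 2 - 1 powr p * pot p f / p"
    using p by (intro tendsto_diff tendsto_divide tendsto_mult tendsto_add tendsto_const th) auto
  then have "c \<le> (4 * ?K + 2 * 0) / 2 - 1 powr p * pot p f / p"
    by (rule LIMSEQ_le_const) (use le in blast)
  then show ?thesis unfolding wenergy_def kin_same[OF f order_refl] by simp
qed

section \<open>Ground states\<close>

text \<open>The piece [x1, x1 + a] is stretched to double length. The parameter \<open>s\<close> is
  the factor acquired by the integrand there: 1 for mass and potential, 1/4 for the squared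
  derivative. The net change is 2 s - 1 times the integral over the piece.\<close>

lemma stretch_integral:
  fixes \<phi> :: "real \<Rightarrow> real" and s :: real
  assumes \<phi>: "set_integrable lborel {0..} \<phi>" and x1: "0 \<le> x1" "0 < a"
  defines "F \<equiv> (\<lambda>x. if x \<le> x1 + 2 * a then (if x \<le> x1 then \<phi> x else s * \<phi> (x1 / 2 + 1 / 2 * x)) else \<phi> (- a + 1 * x))"
  shows "set_integrable lborel {0..} F"
    "(LINT x:{0..}|lborel. F x) = (LINT x:{0..}|lborel. \<phi> x) + (2 * s - 1) * (LINT x:{x1..x1 + a}|lborel. \<phi> x)"
proof -
  have nz: "(1 / 2 :: real) \<noteq> 0" "(1::real) \<noteq> 0" by auto
  have sets: "{x. x1 / 2 + 1 / 2 * x \<in> {x1..x1 + a}} = {x1..x1 + 2 * a}" "{x. - a + 1 * x \<in> {x1 + a..}} = {x1 + 2 * a..}"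
    by auto
  have sub: "set_integrable lborel {0..x1} \<phi>" "set_integrable lborel {x1..x1 + a} \<phi>" "set_integrable lborel {x1 + a..} \<phi>"
    "set_integrable lborel {x1..} \<phi>"
    by (rule set_integrable_subset[OF \<phi>]; use x1 in auto)+
  have i1: "set_integrable lborel {0..x1} F" and e1: "(LINT x:{0..x1}|lborel. F x) = (LINT x:{0..x1}|lborel. \<phi> x)"
  proof -
    have "\<phi> x = F x" if "x \<in> {0..x1}" for x using that x1 by (simp add: F_def)
    then show "set_integrable lborel {0..x1} F" "(LINT x:{0..x1}|lborel. F x) = (LINT x:{0..x1}|lborel. \<phi> x)"
      using sub(1) set_integral_cong_except_point[of "{0..x1}" 0 \<phi> F] by auto
  qed
  have i2: "set_integrable lborel {x1..x1 + 2 * a} F"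
    and e2: "(LINT x:{x1..x1 + 2 * a}|lborel. F x) = 2 * s * (LINT x:{x1..x1 + a}|lborel. \<phi> x)"
  proof -
    have eq: "s * \<phi> (x1 / 2 + 1 / 2 * x) = F x" if "x \<in> {x1..x1 + 2 * a}" "x \<noteq> x1" for x using that by (simp add: F_def)
    have "set_integrable lborel {x1..x1 + 2 * a} (\<lambda>x. s * \<phi> (x1 / 2 + 1 / 2 * x))"
      using set_integral_affine(2)[OF nz(1), of "x1 / 2" "{x1..x1 + a}" \<phi>] sub(2) unfolding sets by simp
    then show "set_integrable lborel {x1..x1 + 2 * a} F"
      using set_integral_cong_except_point(2)[of "{x1..x1 + 2 * a}" x1 _ F, OF eq] by blast
    have "(LINT x:{x1..x1 + 2 * a}|lborel. F x) = (LINT x:{x1..x1 + 2 * a}|lborel. s * \<phi> (x1 / 2 + 1 / 2 * x))"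
      by (rule set_integral_cong_except_point(1)[symmetric, of _ x1]) (rule eq)
    also have "\<dots> = s * ((LINT x:{x1..x1 + a}|lborel. \<phi> x) / \<bar>1 / 2\<bar>)"
      using set_integral_affine(1)[OF nz(1), of "x1 / 2" "{x1..x1 + a}" \<phi>] unfolding sets by simp
    finally show "(LINT x:{x1..x1 + 2 * a}|lborel. F x) = 2 * s * (LINT x:{x1..x1 + a}|lborel. \<phi> x)" by simp
  qed
  have i3: "set_integrable lborel {x1 + 2 * a..} F"
    and e3: "(LINT x:{x1 + 2 * a..}|lborel. F x) = (LINT x:{x1 + a..}|lborel. \<phi> x)"
  proof -
    have eq: "\<phi> (- a + 1 * x) = F x" if "x \<in> {x1 + 2 * a..}" "x \<noteq> x1 + 2 * a" for x using that by (simp add: F_def)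
    have "set_integrable lborel {x1 + 2 * a..} (\<lambda>x. \<phi> (- a + 1 * x))"
      using set_integral_affine(2)[OF nz(2), of "- a" "{x1 + a..}" \<phi>] sub(3) unfolding sets by simp
    then show "set_integrable lborel {x1 + 2 * a..} F"
      using set_integral_cong_except_point(2)[of "{x1 + 2 * a..}" "x1 + 2 * a" _ F, OF eq] by blast
    have "(LINT x:{x1 + 2 * a..}|lborel. F x) = (LINT x:{x1 + 2 * a..}|lborel. \<phi> (- a + 1 * x))"
      by (rule set_integral_cong_except_point(1)[symmetric, of _ "x1 + 2 * a"]) (rule eq)
    also have "\<dots> = (LINT x:{x1 + a..}|lborel. \<phi> x)"
      using set_integral_affine(1)[OF nz(2), of "- a" "{x1 + a..}" \<phi>] unfolding sets by simp
    finally show "(LINT x:{x1 + 2 * a..}|lborel. F x) = (LINT x:{x1 + a..}|lborel. \<phi> x)" .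
  qed
  have "{0..} = {0..x1} \<union> ({x1..x1 + 2 * a} \<union> {x1 + 2 * a..})" using x1 by auto
  then show i: "set_integrable lborel {0..} F"
    using set_integrable_Un[OF i1 set_integrable_Un[OF i2 i3]] by simp
  have iF: "set_integrable lborel {x1..} F" by (rule set_integrable_subset[OF i]) (use x1 in auto)
  have "(LINT x:{0..}|lborel. F x) = (LINT x:{0..x1}|lborel. F x) + (LINT x:{x1..}|lborel. F x)"
    by (rule set_integral_Ici_split[OF i x1(1)])
  moreover have "(LINT x:{x1..}|lborel. F x) = (LINT x:{x1..x1 + 2 * a}|lborel. F x) + (LINT x:{x1 + 2 * a..}|lborel. F x)"
    by (rule set_integral_Ici_split[OF iF]) (use x1 in simp)
  moreover have "(LINT x:{0..}|lborel. \<phi> x) = (LINT x:{0..x1}|lborel. \<phi> x) + (LINT x:{x1..}|lborel. \<phi> x)"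
    by (rule set_integral_Ici_split[OF \<phi> x1(1)])
  moreover have "(LINT x:{x1..}|lborel. \<phi> x) = (LINT x:{x1..x1 + a}|lborel. \<phi> x) + (LINT x:{x1 + a..}|lborel. \<phi> x)"
    by (rule set_integral_Ici_split[OF sub(4)]) (use x1 in simp)
  ultimately show "(LINT x:{0..}|lborel. F x) = (LINT x:{0..}|lborel. \<phi> x) + (2 * s - 1) * (LINT x:{x1..x1 + a}|lborel. \<phi> x)"
    unfolding e1 e2 e3 by (simp add: algebra_simps)
qed

lemma ac_on_stretch:
  assumes ac: "ac_on {0..} w k" and x1: "0 \<le> x1" "0 < a"
  shows "ac_on {0..} (\<lambda>x. if x \<le> x1 + 2 * a then (if x \<le> x1 then w x else 1 * w (x1 / 2 + 1 / 2 * x)) else 1 * w (- a + 1 * x))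
    (\<lambda>x. if x \<le> x1 + 2 * a then (if x \<le> x1 then k x else 1 * (1 / 2) * k (x1 / 2 + 1 / 2 * x)) else 1 * 1 * k (- a + 1 * x))"
proof -
  have nz: "(1 / 2 :: real) \<noteq> 0" "(1::real) \<noteq> 0" by auto
  have sets: "{x. x1 / 2 + 1 / 2 * x \<in> {x1..x1 + a}} = {x1..x1 + 2 * a}" "{x. - a + 1 * x \<in> {x1 + a..}} = {x1 + 2 * a..}"
    by auto
  have sub: "ac_on {0..x1} w k" "ac_on {x1..x1 + a} w k" "ac_on {x1 + a..} w k"
    by (rule ac_on_subset[OF ac]; use x1 in auto)+
  have in2: "ac_on {x1..x1 + 2 * a} (\<lambda>x. 1 * w (x1 / 2 + 1 / 2 * x)) (\<lambda>x. 1 * (1 / 2) * k (x1 / 2 + 1 / 2 * x))"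
    using ac_on_affine[OF sub(2) nz(1), of "x1 / 2" 1] unfolding sets by simp
  have in3: "ac_on {x1 + 2 * a..} (\<lambda>x. 1 * w (- a + 1 * x)) (\<lambda>x. 1 * 1 * k (- a + 1 * x))"
    using ac_on_affine[OF sub(3) nz(2), of "- a" 1] unfolding sets by simp
  have "ac_on ({0..x1} \<union> {x1..x1 + 2 * a}) (\<lambda>x. if x \<le> x1 then w x else 1 * w (x1 / 2 + 1 / 2 * x))
      (\<lambda>x. if x \<le> x1 then k x else 1 * (1 / 2) * k (x1 / 2 + 1 / 2 * x))"
    by (rule ac_on_glue_if[OF sub(1) in2]) (use x1 in auto)
  moreover have "{0..x1} \<union> {x1..x1 + 2 * a} = {0..x1 + 2 * a}" using x1 by auto
  ultimately have in12: "ac_on {0..x1 + 2 * a} (\<lambda>x. if x \<le> x1 then w x else 1 * w (x1 / 2 + 1 / 2 * x))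
      (\<lambda>x. if x \<le> x1 then k x else 1 * (1 / 2) * k (x1 / 2 + 1 / 2 * x))" by simp
  have pt: "x1 / 2 + 1 / 2 * (x1 + 2 * a) = - a + 1 * (x1 + 2 * a)" by (simp add: field_simps)
  have "ac_on ({0..x1 + 2 * a} \<union> {x1 + 2 * a..})
     (\<lambda>x. if x \<le> x1 + 2 * a then (if x \<le> x1 then w x else 1 * w (x1 / 2 + 1 / 2 * x)) else 1 * w (- a + 1 * x))
     (\<lambda>x. if x \<le> x1 + 2 * a then (if x \<le> x1 then k x else 1 * (1 / 2) * k (x1 / 2 + 1 / 2 * x)) else 1 * 1 * k (- a + 1 * x))"
  proof (rule ac_on_glue_if[OF in12 in3])
    show "(if x1 + 2 * a \<le> x1 then w (x1 + 2 * a) else 1 * w (x1 / 2 + 1 / 2 * (x1 + 2 * a))) = 1 * w (- a + 1 * (x1 + 2 * a))"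
      unfolding pt using x1 by simp
  qed (use x1 in auto)
  moreover have "{0..x1 + 2 * a} \<union> {x1 + 2 * a..} = {0..}" using x1 by auto
  ultimately show ?thesis by simp
qed

context graph_fun
begin

text \<open>Stretching a short piece adjacent to a zero by a factor two lowers the kinetic energy by a
  fixed fraction, while by the Poincare inequality the added mass is of second order in the length
  of the piece.\<close>

lemma not_optimal_if_vertex_zero:
  assumes p: "2 < p" "p < 6" and j: "j < 3" "0 \<le> xm" "u j xm \<noteq> 0" and v: "u 0 0 = 0" and m: "0 < gmass"
  shows "\<exists>w\<in>H1_mass l gmass. energy p l w < genergy p"
proof -
  define K where "K = (\<Sum>i<4. LINT x:I i|lborel. (g i x)\<^sup>2)"
  define P where "P = (\<Sum>i<4. LINT x:I i|lborel. \<bar>u i x\<bar> powr p)"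
  have j4: "j < 4" using j by simp
  have Ij: "I j = {0..}" by (rule I_halfline[OF j(1)])
  have acj: "ac_on {0..} (u j) (g j)" using u_ac[OF j4] unfolding Ij .
  have L2j: "L2_on {0..} (u j)" using u_L2[OF j4] unfolding Ij .
  have K0: "0 \<le> K" unfolding K_def by (rule sum_nonneg) simp
  have P0: "0 \<le> P" unfolding P_def by (rule sum_nonneg) (rule set_integral_nonneg', simp)
  have cont: "continuous_on {0..xm} (u j)" by (rule continuous_on_subset[OF ac_on_continuous_on[OF acj]]) auto
  define Z where "Z = {x \<in> {0..xm}. u j x = 0}"
  have "closed Z" unfolding Z_def
    using continuous_closed_preimage[OF cont, of "{0}"] by (simp add: vimage_def Int_def conj_commute)
  moreover have "bounded Z" by (rule bounded_subset[of "{0..xm}"]) (auto simp: Z_def)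
  ultimately have "compact Z" by (simp add: compact_eq_bounded_closed)
  moreover have "0 \<in> Z" using j(2) u_vertex[OF j4] v by (simp add: Z_def)
  then have "Z \<noteq> {}" by blast
  \<comment> \<open>The last zero before \<open>xm\<close>: next to it the function is small but not
    constant.\<close>
  ultimately obtain x1 where x1Z: "x1 \<in> Z" "\<And>x. x \<in> Z \<Longrightarrow> x \<le> x1" using compact_attains_sup by metis
  have x1: "0 \<le> x1" "x1 \<le> xm" "u j x1 = 0" using x1Z(1) by (auto simp: Z_def)
  then have x1m: "x1 < xm" using j(3) by (cases "x1 = xm") auto
  \<comment> \<open>With a^2 \<le> b, the term 24 P makes the loss of potential after
    renormalization smaller than the kinetic gain, the term K keeps the added mass below
    \<open>gmass\<close>, and the 1 keeps the denominator positive.\<close>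
  define b where "b = gmass / (24 * P + K + 1)"
  have den: "0 < 24 * P + K + 1" using P0 K0 by linarith
  have b: "0 < b" using m den by (simp add: b_def)
  \<comment> \<open>The bounds 1 and b give a^2 \<le> b; the bound xm - x1 keeps the piece in the
    range without further zeros.\<close>
  define a where "a = min (xm - x1) (min 1 b)"
  have a: "0 < a" "a \<le> 1" "a \<le> b" "x1 + a \<le> xm" using x1m b by (auto simp: a_def)
  have bP: "b * (24 * P + K + 1) = gmass" using den by (simp add: b_def)
  have a2: "a\<^sup>2 \<le> b" using mult_mono[of a 1 a b] a b by (simp add: power2_eq_square)
  define Ka where "Ka = (LINT x:{x1..x1 + a}|lborel. (g j x)\<^sup>2)"
  define ma where "ma = (LINT x:{x1..x1 + a}|lborel. (u j x)\<^sup>2)"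
  define Pa where "Pa = (LINT x:{x1..x1 + a}|lborel. \<bar>u j x\<bar> powr p)"
  have Pa0: "0 \<le> Pa" unfolding Pa_def by (rule set_integral_nonneg') simp
  have ma0: "0 \<le> ma" by (simp add: ma_def)
  have ig: "set_integrable lborel {0..} (\<lambda>x. (g j x)\<^sup>2)" using L2_onD(2)[OF ac_onD(1)[OF acj]] .
  have iu: "set_integrable lborel {0..} (\<lambda>x. (u j x)\<^sup>2)" using L2_onD(2)[OF L2j] .
  have ip: "set_integrable lborel {0..} (\<lambda>x. \<bar>u j x\<bar> powr p)" using u_powr_integrable[OF p(1) j4] unfolding Ij .
  have point: "(u j x)\<^sup>2 \<le> a * Ka" if x: "x \<in> {x1..x1 + a}" for x
  proof -
    have "(u j x - u j x1)\<^sup>2 \<le> (x - x1) * (LINT t:{x1..x}|lborel. (g j t)\<^sup>2)"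
      by (rule ac_on_hoelder[OF acj]) (use x x1 in auto)
    also have "\<dots> \<le> a * Ka"
    proof (rule mult_mono)
      show "(LINT t:{x1..x}|lborel. (g j t)\<^sup>2) \<le> Ka" unfolding Ka_def
        by (rule set_integral_mono_set[OF set_integrable_subset[OF ig]]) (use x x1 in auto)
    qed (use x a in auto)
    finally show ?thesis using x1(3) by simp
  qed
  have ma_le: "ma \<le> a\<^sup>2 * Ka"
  proof -
    have "ma \<le> (LINT x:{x1..x1 + a}|lborel. a * Ka)"
      unfolding ma_def
    proof (rule set_integral_mono[OF _ _ point])
      show "set_integrable lborel {x1..x1 + a} (\<lambda>x. (u j x)\<^sup>2)"
        by (rule set_integrable_subset[OF iu]) (use x1 in auto)
      show "set_integrable lborel {x1..x1 + a} (\<lambda>x. a * Ka)"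
        by (rule set_integrable_const_fin[OF _ emeasure_lborel_Icc_finite]) simp
    qed
    also have "\<dots> = a\<^sup>2 * Ka" using a by (simp add: set_integral_const power2_eq_square)
    finally show ?thesis .
  qed
  \<comment> \<open>Zero energy on the piece would make x1 + a another zero, contradicting the
    choice of \<open>x1\<close>.\<close>
  have Ka: "0 < Ka"
  proof (rule ccontr)
    assume "\<not> 0 < Ka"
    moreover have "0 \<le> Ka" by (simp add: Ka_def)
    ultimately have "Ka = 0" by linarith
    then have "u j (x1 + a) = 0" using point[of "x1 + a"] a by simp
    then have "x1 + a \<in> Z" using a x1 by (simp add: Z_def)
    then show False using x1Z(2)[of "x1 + a"] a by simp
  qed
  have KaK: "Ka \<le> K"
  proof -
    have "Ka \<le> (LINT x:{0..}|lborel. (g j x)\<^sup>2)" unfolding Ka_def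
      by (rule set_integral_mono_set[OF ig]) (use x1 in auto)
    also have "\<dots> = (LINT x:I j|lborel. (g j x)\<^sup>2)" unfolding Ij ..
    also have "\<dots> \<le> K" unfolding K_def
      by (rule member_le_sum[of j "{..<4}" "\<lambda>i. LINT x:I i|lborel. (g i x)\<^sup>2"]) (use j4 in auto)
    finally show ?thesis .
  qed
  define w where "w x = (if x \<le> x1 + 2 * a then (if x \<le> x1 then u j x else 1 * u j (x1 / 2 + 1 / 2 * x)) else 1 * u j (- a + 1 * x))" for x
  define k where "k x = (if x \<le> x1 + 2 * a then (if x \<le> x1 then g j x else 1 * (1 / 2) * g j (x1 / 2 + 1 / 2 * x)) else 1 * 1 * g j (- a + 1 * x))" for x
  have acw: "ac_on {0..} w k" unfolding w_def[abs_def] k_def[abs_def] by (rule ac_on_stretch[OF acj x1(1) a(1)])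
  have w2: "(\<lambda>x. (w x)\<^sup>2) = (\<lambda>x. if x \<le> x1 + 2 * a then (if x \<le> x1 then (u j x)\<^sup>2 else 1 * (u j (x1 / 2 + 1 / 2 * x))\<^sup>2) else (u j (- a + 1 * x))\<^sup>2)"
    by (auto simp: w_def)
  have wp: "(\<lambda>x. \<bar>w x\<bar> powr p) = (\<lambda>x. if x \<le> x1 + 2 * a then (if x \<le> x1 then \<bar>u j x\<bar> powr p else 1 * \<bar>u j (x1 / 2 + 1 / 2 * x)\<bar> powr p) else \<bar>u j (- a + 1 * x)\<bar> powr p)"
    by (auto simp: w_def)
  have k2: "(\<lambda>x. (k x)\<^sup>2) = (\<lambda>x. if x \<le> x1 + 2 * a then (if x \<le> x1 then (g j x)\<^sup>2 else (1 / 4) * (g j (x1 / 2 + 1 / 2 * x))\<^sup>2) else (g j (- a + 1 * x))\<^sup>2)"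
    by (auto simp: k_def power2_eq_square)
  note sw2 = stretch_integral[OF iu x1(1) a(1), of 1, folded w2]
  note swp = stretch_integral[OF ip x1(1) a(1), of 1, folded wp]
  note sk2 = stretch_integral[OF ig x1(1) a(1), of "1 / 4", folded k2]
  have L2w: "L2_on {0..} w"
    by (rule L2_on_continuous_square_integrable[OF _ _ sw2(1)]) (use ac_on_continuous_on[OF acw] in simp_all)
  have w0: "w 0 = u j 0" using x1 a by (simp add: w_def)
  interpret s: graph_fun l "\<lambda>i. if i = j then w else u i" "\<lambda>i. if i = j then k else g i"
  proof
    fix i :: nat assume i: "i < 4"
    show "L2_on (I i) (if i = j then w else u i)" using u_L2[OF i] L2w Ij by (cases "i = j") auto
    show "ac_on (I i) (if i = j then w else u i) (if i = j then k else g i)"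
      using u_ac[OF i] acw Ij by (cases "i = j") auto
    have "u i 0 = 0" "u j 0 = 0" using u_vertex[OF i] u_vertex[OF j4] v by simp_all
    then show "(if i = j then w else u i) 0 = (if 0 = j then w else u 0) 0" using w0 v by simp
  qed (rule l_pos)
  have upd: "(\<Sum>i<4. F i + (if i = j then d else 0)) = (\<Sum>i<4. F i) + d" for F :: "nat \<Rightarrow> real" and d
    using j4 by (simp add: sum.distrib)
  have sm: "s.gmass = gmass + ma"
  proof -
    have "s.gmass = (\<Sum>i<4. (LINT x:I i|lborel. (u i x)\<^sup>2) + (if i = j then ma else 0))"
      unfolding s.gmass_def by (intro sum.cong refl) (auto simp: sw2(2) Ij ma_def)
    then show ?thesis unfolding upd gmass_def .
  qed
  have sk: "(\<Sum>i<4. LINT x:I i|lborel. ((if i = j then k else g i) x)\<^sup>2) = K - Ka / 2"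
  proof -
    have "(\<Sum>i<4. LINT x:I i|lborel. ((if i = j then k else g i) x)\<^sup>2)
        = (\<Sum>i<4. (LINT x:I i|lborel. (g i x)\<^sup>2) + (if i = j then - Ka / 2 else 0))"
      by (intro sum.cong refl) (auto simp: sk2(2) Ij Ka_def)
    then show ?thesis unfolding upd K_def by simp
  qed
  have sp: "(\<Sum>i<4. LINT x:I i|lborel. \<bar>(if i = j then w else u i) x\<bar> powr p) = P + Pa"
  proof -
    have "(\<Sum>i<4. LINT x:I i|lborel. \<bar>(if i = j then w else u i) x\<bar> powr p)
        = (\<Sum>i<4. (LINT x:I i|lborel. \<bar>u i x\<bar> powr p) + (if i = j then Pa else 0))"
      by (intro sum.cong refl) (auto simp: swp(2) Ij Pa_def)
    then show ?thesis unfolding upd P_def .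
  qed
  define c where "c = sqrt (gmass / (gmass + ma))"
  have mm: "0 < gmass + ma" using m ma0 by linarith
  have c: "0 < c" "c\<^sup>2 = gmass / (gmass + ma)" using m mm by (auto simp: c_def)
  \<comment> \<open>The share of the mass that renormalization removes. By the Poincare bound
    \<open>ma_le\<close> it is of order a^2 Ka, while the stretching saves Ka/2 of kinetic
    energy.\<close>
  define y where "y = ma / (gmass + ma)"
  have cy: "c\<^sup>2 = 1 - y" using mm by (simp add: c(2) y_def field_simps)
  have a2K: "a\<^sup>2 * Ka \<le> gmass"
  proof -
    have "a\<^sup>2 * Ka \<le> b * (24 * P + K + 1)" using a2 KaK P0 K0 Ka b by (intro mult_mono) auto
    then show ?thesis using bP by simp
  qed
  have y: "0 \<le> y" "y \<le> 1 / 2" "gmass * y \<le> a\<^sup>2 * Ka"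
  proof -
    show "0 \<le> y" using ma0 mm by (simp add: y_def)
    show "y \<le> 1 / 2" using ma_le a2K mm by (simp add: y_def field_simps)
    have "gmass * y \<le> (gmass + ma) * y" using ma0 \<open>0 \<le> y\<close> by (intro mult_right_mono) auto
    also have "\<dots> = ma" using mm by (simp add: y_def)
    finally show "gmass * y \<le> a\<^sup>2 * Ka" using ma_le by linarith
  qed
  have c1: "c \<le> 1" using m ma0 by (simp add: c_def)
  \<comment> \<open>For c \<le> 1 and p < 6 the power c^p is at least c^6 = (1 - y)^3.\<close>
  have cp: "1 - 3 * y \<le> c powr p"
  proof -
    have "1 - 3 * y \<le> (1 - y)^3"
    proof -
      have "(1 - y)^3 - (1 - 3 * y) = y\<^sup>2 * (3 - y)" by (simp add: power3_eq_cube power2_eq_square algebra_simps)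
      moreover have "0 \<le> y\<^sup>2 * (3 - y)" using y by simp
      ultimately show ?thesis by linarith
    qed
    also have "(1 - y)^3 = c^6" unfolding cy[symmetric] by (simp flip: power_mult)
    also have "c^6 = c powr 6" using c(1) by simp
    also have "c powr 6 \<le> c powr p" using c c1 p by (intro powr_mono') auto
    finally show ?thesis .
  qed
  \<comment> \<open>The potential lost by renormalization is less than the kinetic gain that is
    left.\<close>
  have small: "3 * y * P / p < (1 - y) * Ka / 4"
  proof -
    have "gmass * (24 * (y * P)) = (gmass * y) * (24 * P)" by simp
    also have "\<dots> \<le> (a\<^sup>2 * Ka) * (24 * P)" using y(3) P0 by (intro mult_right_mono) auto
    also have "\<dots> \<le> (b * Ka) * (24 * P)" using a2 Ka P0 by (intro mult_right_mono) auto
    also have "\<dots> = Ka * (b * (24 * P))" by simp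
    also have "\<dots> < Ka * gmass"
    proof (rule mult_strict_left_mono[OF _ Ka])
      have "0 < b * (K + 1)" using b K0 by simp
      then show "b * (24 * P) < gmass" unfolding bP[symmetric] by (simp add: algebra_simps)
    qed
    finally have "gmass * (24 * (y * P)) < gmass * Ka" by (simp add: mult.commute)
    then have "24 * (y * P) < Ka" using m by simp
    then have "3 * (y * P) < Ka / 8" by simp
    moreover have "3 * y * P / p \<le> 3 * (y * P)"
    proof -
      have "3 * (y * P) / p \<le> 3 * (y * P) / 1" using p y P0 by (intro divide_left_mono) auto
      then show ?thesis by (simp add: mult.assoc)
    qed
    moreover have "Ka / 8 \<le> (1 - y) * Ka / 4"
    proof -
      have "1 / 2 * Ka \<le> (1 - y) * Ka" using y Ka by (intro mult_right_mono) auto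
      then show ?thesis by simp
    qed
    ultimately show ?thesis by linarith
  qed
  have mem: "(\<lambda>i x. c * (if i = j then w else u i) x) \<in> H1_mass l gmass"
    using s.scaled_energy(1)[OF c(1)] mm unfolding sm c(2) by simp
  have "energy p l (\<lambda>i x. c * (if i = j then w else u i) x) = c\<^sup>2 * (K - Ka / 2) / 2 - c powr p * (P + Pa) / p"
    unfolding s.scaled_energy(2)[OF c(1)] sk sp ..
  also have "\<dots> \<le> c\<^sup>2 * (K - Ka / 2) / 2 - (1 - 3 * y) * P / p"
  proof -
    have "(1 - 3 * y) * P \<le> c powr p * P" using cp P0 by (rule mult_right_mono)
    also have "\<dots> \<le> c powr p * (P + Pa)" using Pa0 by (intro mult_left_mono) auto
    finally have "(1 - 3 * y) * P / p \<le> c powr p * (P + Pa) / p" using p by (intro divide_right_mono) auto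
    then show ?thesis by linarith
  qed
  also have "\<dots> = (1 - y) * K / 2 - (1 - y) * Ka / 4 - P / p + 3 * y * P / p"
    unfolding cy by (simp add: algebra_simps diff_divide_distrib add_divide_distrib)
  also have "\<dots> < (1 - y) * K / 2 - P / p" using small by linarith
  also have "\<dots> \<le> K / 2 - P / p"
  proof -
    have "(1 - y) * K \<le> 1 * K" using y K0 by (intro mult_right_mono) auto
    then show ?thesis by simp
  qed
  also have "\<dots> = genergy p" unfolding genergy_def K_def P_def ..
  finally show ?thesis using mem by blast
qed

lemma halfline_max: "\<exists>j<3. \<exists>xm\<ge>0. \<forall>i<3. \<forall>x\<ge>0. \<bar>u i x\<bar> \<le> \<bar>u j xm\<bar>"
proof -
  have "\<exists>xm\<ge>0. \<forall>x\<ge>0. \<bar>u i x\<bar> \<le> \<bar>u i xm\<bar>" if "i < 3" for i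
    by (rule H1_halfline_attains_max) (use u_L2[of i] u_ac[of i] I_halfline[OF that] that in auto)
  then obtain X where X: "\<And>i. i < 3 \<Longrightarrow> 0 \<le> X i" "\<And>i x. i < 3 \<Longrightarrow> 0 \<le> x \<Longrightarrow> \<bar>u i x\<bar> \<le> \<bar>u i (X i)\<bar>"
    by metis
  let ?F = "(\<lambda>i. \<bar>u i (X i)\<bar>) ` {..<3}"
  have fin: "finite ?F" "?F \<noteq> {}" by (simp_all add: lessThan_empty_iff)
  obtain j where j: "j < 3" "Max ?F = \<bar>u j (X j)\<bar>" using Max_in[OF fin] by auto
  have "\<bar>u i x\<bar> \<le> \<bar>u j (X j)\<bar>" if "i < 3" "0 \<le> x" for i x
  proof -
    have "\<bar>u i (X i)\<bar> \<le> Max ?F" using that by (intro Max_ge fin) auto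
    with X(2)[OF that] j(2) show ?thesis by linarith
  qed
  with j(1) X(1)[OF j(1)] show ?thesis by blast
qed

text \<open>Ties are assigned to the terminal edge, so in the halfline case the maximum is strictly
  larger than on the edge and in particular nonzero, as the stretching argument requires.\<close>

lemma max_cases:
  obtains
    (edge) j xm xM where "j < 3" "0 \<le> xm" "\<And>i x. i < 3 \<Longrightarrow> 0 \<le> x \<Longrightarrow> \<bar>u i x\<bar> \<le> \<bar>u j xm\<bar>"
      "xM \<in> {0..l}" "\<And>x. x \<in> {0..l} \<Longrightarrow> \<bar>u 3 x\<bar> \<le> \<bar>u 3 xM\<bar>" "\<bar>u j xm\<bar> \<le> \<bar>u 3 xM\<bar>"
  | (halfline) j xm where "j < 3" "0 \<le> xm" "\<And>i x. i < 4 \<Longrightarrow> x \<in> I i \<Longrightarrow> \<bar>u i x\<bar> \<le> \<bar>u j xm\<bar>" "u j xm \<noteq> 0"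
proof -
  obtain j xm where j: "j < 3" "0 \<le> xm" "\<And>i x. i < 3 \<Longrightarrow> 0 \<le> x \<Longrightarrow> \<bar>u i x\<bar> \<le> \<bar>u j xm\<bar>"
    using halfline_max by blast
  have "continuous_on {0..l} (\<lambda>x. \<bar>u 3 x\<bar>)"
    using ac_on_continuous_on[OF u_ac[of 3] I_interval] I_edge by (intro continuous_on_rabs) simp
  moreover have "{0..l} \<noteq> {}" using l_pos by simp
  ultimately obtain xM where M: "xM \<in> {0..l}" "\<And>x. x \<in> {0..l} \<Longrightarrow> \<bar>u 3 x\<bar> \<le> \<bar>u 3 xM\<bar>"
    using continuous_attains_sup[OF compact_Icc] by metis
  show thesis
  proof (cases "\<bar>u j xm\<bar> \<le> \<bar>u 3 xM\<bar>")
    case True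
    show thesis by (rule edge[OF j M True])
  next
    case False
    have "\<bar>u i x\<bar> \<le> \<bar>u j xm\<bar>" if "i < 4" "x \<in> I i" for i x
    proof (cases "i < 3")
      case True
      then show ?thesis using j(3)[of i x] that I_halfline[of i] by simp
    next
      case i: False
      then have "i = 3" using that by linarith
      then show ?thesis using M(2)[of x] that I_edge False by simp
    qed
    moreover have "u j xm \<noteq> 0" using False by auto
    ultimately show thesis by (rule halfline[OF j(1,2)])
  qed
qed

end

theorem theorem6p5:
  fixes p \<mu> :: real
  assumes "2 < p" and "p < 6" and "\<mu> > 0"
  shows "\<exists>l_star > 0. \<forall>l > 0. (\<exists>u. ground_state p l \<mu> u) \<longleftrightarrow> l \<ge> l_star"
proof -
  have four: "(0::real) < 4" "(0::real) < 9" "(0::real) < 1" by simp_all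
  obtain fR gR where R: "decr_pair fR gR" "mass fR = \<mu>" "wenergy p 4 4 0 fR gR < 0"
      "\<And>f g. decr_pair f g \<Longrightarrow> mass f = \<mu> \<Longrightarrow> wenergy p 4 4 0 fR gR \<le> wenergy p 4 4 0 f g"
    using exists_minimizer[OF assms four(1) four(1) order_refl] by metis
  define e where "e = wenergy p 4 4 0 fR gR"
  obtain ls where ls: "0 < ls"
      "\<And>l. 0 < l \<Longrightarrow> (\<exists>f g. decr_pair f g \<and> mass f = \<mu> \<and> wenergy p 1 9 l f g \<le> e) \<longleftrightarrow> ls \<le> l"
    using critical_length[OF assms R(1,2) refl R(3) R(4)] unfolding e_def by blast
  have "(\<exists>u. ground_state p l \<mu> u) \<longleftrightarrow> (\<exists>f g. decr_pair f g \<and> mass f = \<mu> \<and> wenergy p 1 9 l f g \<le> e)"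
    if l: "0 < l" for l
  proof
    assume "\<exists>u. ground_state p l \<mu> u"
    then obtain u where u: "u \<in> H1_mass l \<mu>" "\<And>v. v \<in> H1_mass l \<mu> \<Longrightarrow> energy p l u \<le> energy p l v"
      unfolding ground_state_def by blast
    note gf = graph_funI_H1_mass[OF l u(1)]
    interpret graph_fun l u "\<lambda>i. weak_deriv (edge_dom l i) (u i)" by (rule gf(1))
    have gm: "gmass = \<mu>" and ge: "genergy p = energy p l u" by (rule gf(2), rule gf(3))
    \<comment> \<open>A minimizer lies below all translated copies of the line profile.\<close>
    have le: "energy p l u \<le> e"
      unfolding e_def
    proof (rule energy_le_line[OF R(1) l assms(1)])
      show "0 < mass fR" using R(2) assms(3) by simp
      show "energy p l u \<le> energy p l v" if "v \<in> H1_mass l (mass fR)" for v using u(2) that R(2) by simp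
    qed
    show "\<exists>f g. decr_pair f g \<and> mass f = \<mu> \<and> wenergy p 1 9 l f g \<le> e"
    proof (cases rule: max_cases)
      case (edge j xm xM)
      obtain f h where f: "decr_pair f h" "mass f = gmass" "wenergy p 1 9 l f h \<le> genergy p"
        using max_on_edge[OF assms(1) edge] by blast
      have "wenergy p 1 9 l f h \<le> e" using f(3) le unfolding ge by linarith
      with f(1,2) show ?thesis unfolding gm by blast
    next
      \<comment> \<open>This case cannot occur for a minimizer: with zero vertex value it can be
        improved by stretching, with nonzero vertex value its energy would strictly exceed
        \<open>e\<close>.\<close>
      case (halfline j xm)
      show ?thesis
      proof (cases "u 0 0 = 0")
        case True
        have "0 < gmass" using gm assms(3) by simp
        then obtain w where "w \<in> H1_mass l gmass" "energy p l w < genergy p"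
          using not_optimal_if_vertex_zero[OF assms(1,2) halfline(1,2,4) True] by blast
        with u(2)[of w] show ?thesis unfolding gm ge by simp
      next
        case False
        then have "0 < v0" by (simp add: v0_def)
        then obtain f h where "decr_pair f h" "mass f = gmass" "wenergy p 4 4 0 f h < genergy p"
          using max_on_halfline(2)[OF assms(1) halfline(1,2,3)] by blast
        with R(4)[of f h] le show ?thesis unfolding gm ge e_def by simp
      qed
    qed
  next
    assume ex: "\<exists>f g. decr_pair f g \<and> mass f = \<mu> \<and> wenergy p 1 9 l f g \<le> e"
    obtain f h where f: "decr_pair f h" "mass f = \<mu>"
        "\<And>f' h'. decr_pair f' h' \<Longrightarrow> mass f' = \<mu> \<Longrightarrow> wenergy p 1 9 l f h \<le> wenergy p 1 9 l f' h'"
      using exists_minimizer[OF assms four(3) four(2) less_imp_le[OF l]] by metis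
    have fe: "wenergy p 1 9 l f h \<le> e"
    proof -
      obtain f' h' where "decr_pair f' h'" "mass f' = \<mu>" "wenergy p 1 9 l f' h' \<le> e" using ex by blast
      with f(3)[of f' h'] show ?thesis by simp
    qed
    obtain u where u: "u \<in> H1_mass l \<mu>" "energy p l u = wenergy p 1 9 l f h"
      using profile_on_graph[OF f(1) l assms(1)] f(2) by auto
    have "energy p l u \<le> energy p l v" if v: "v \<in> H1_mass l \<mu>" for v
    proof -
      note gf = graph_funI_H1_mass[OF l v]
      interpret graph_fun l v "\<lambda>i. weak_deriv (edge_dom l i) (v i)" by (rule gf(1))
      have gm: "gmass = \<mu>" and ge: "genergy p = energy p l v" by (rule gf(2), rule gf(3))
      show ?thesis
      proof (cases rule: max_cases)
        case (edge j xm xM)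
        obtain f' h' where f': "decr_pair f' h'" "mass f' = gmass" "wenergy p 1 9 l f' h' \<le> genergy p"
          using max_on_edge[OF assms(1) edge] by blast
        show ?thesis using f(3)[OF f'(1)] f'(2,3) u(2) unfolding gm ge by simp
      next
        \<comment> \<open>Here \<open>v\<close> is an arbitrary competitor, and the non-strict
          comparison with the line suffices.\<close>
        case (halfline j xm)
        obtain f' h' where f': "decr_pair f' h'" "mass f' = gmass" "wenergy p 4 4 0 f' h' \<le> genergy p"
          using max_on_halfline(1)[OF assms(1) halfline(1,2,3)] by blast
        then have "e \<le> energy p l v" using R(4)[OF f'(1)] unfolding gm ge e_def by simp
        then show ?thesis using u(2) fe by simp
      qed
    qed
    then show "\<exists>u. ground_state p l \<mu> u" using u(1) unfolding ground_state_def by blast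
  qed
  then show ?thesis using ls by (intro exI[of _ ls]) simp
qed

end
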